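(* Let $\mathcal{E}$ be a connected locally connected topos with structure morphism $\gamma : \mathcal{E}\to\mathcal{S}$. a) For any Galois object $A$, the functor $p_A^* : \mathcal{D}_A \to \mathcal{S}$, $p_A^*(X,S,\sigma) = S$, determines a point of the site $\mathcal{D}_A$. This point is naturally isomorphic to the representable functor $[A,-] : \mathcal{C}_A \to \mathcal{S}$ under the equivalence $q_A : \mathcal{D}_A \to \mathcal{C}_A$, $(X,S,\sigma)\mapsto X$; that is, $p_A^* \cong [A,-]\circ q_A$. b) A morphism between Galois objects $u : A \to B$ determines a morphism of sites $u^* : \mathcal{D}_B \to \mathcal{D}_A$ commuting with the points: $p_A^*\circ u^* = p_B^*$. c) Given any two morphisms between Galois objects $u,v : A \to B$, there is a canonical natural transformation $\theta_{vu} : u^* \Rightarrow v^*$ between functors $\mathcal{D}_B \to \mathcal{D}_A$, and these satisfy the equations $$\theta_{uu} = id,\qquad \theta_{wv}\circ\theta_{vu} = \theta_{wu}\quad(\text{thus } \theta_{uv}=\theta_{vu}^{-1}),\qquad \theta_{vu}\,\theta_{sr} = \theta_{sv\; ru}$$ for all morphisms $u,v,w : A\to B$ and $r,s : B \to C$ of Galois objects, where $\theta_{vu}\,\theta_{sr}$ denotes the horizontal composite $u^* r^* \Rightarrow v^* s^*$. d) For any $u,v : A \to B$ as in c), the diagram formed by $u^*, v^* : \mathcal{D}_B \to \mathcal{D}_A$, the 2-cell $\theta_{vu}$, the equivalences $q_B : \mathcal{D}_B \to \mathcal{C}_B$ and $q_A : \mathcal{D}_A \to \mathcal{C}_A$,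 and the inclusion $\iota: \mathcal{C}_B \hookrightarrow \mathcal{C}_A$ commutes: $q_A\circ u^* = \iota\circ q_B = q_A \circ v^*$, and $q_A\,\theta_{vu}$ is the identity.
   Context: All topoi are Grothendieck topoi over the topos $\mathcal{S}$ of sets. $[A,X]$ denotes the set of morphisms $A \to X$. Connected objects are by convention not initial. A Galois object in $\mathcal{E}$ is an object $A$ such that: (i) the canonical map $A \times \gamma^* Aut(A) \to A \times A$, $(a,h)\mapsto (a,h(a))$, is an isomorphism; and (ii) $A$ is connected and $A \to 1$ is an epimorphism. Let $\mathcal{C}$ be the full subcategory of connected objects of $\mathcal{E}$. For a Galois object $A$, $\mathcal{C}_A \subset \mathcal{C}$ is the full subcategory of the objects $X \in \mathcal{C}$ below $A$, i.e. such that there exists a morphism $A \to X$ (this is not the comma category). If there is a morphism $A \to B$ of Galois objects then $\mathcal{C}_B \subset \mathcal{C}_A$. The category $\mathcal{D}_A$ is the bi-pullback of the functors $A\times(-) : \mathcal{C} \to \mathcal{E}_{/A}$ and $\gamma^* : \mathcal{S} \to \mathcal{E}_{/A}$ (sending $S$ to $A \times \gamma^* S \to A$). Explicitly: objects are triples $(X,S,\sigma)$ with $X \in \mathcal{C}$, $\emptyset \neq S \in \mathcal{S}$, and $\sigma : A \times \gamma^* S \to X$ such that $(\pi_1,\sigma) : A\times\gamma^*S \to A \times X$ is an isomorphism ($\pi_1$ the first projection); arrows $(X,S,\sigma) \to (Y,T,\xi)$ are pairs $(f,\eta)$, $f : X \to Y$ in $\mathcal{C}$, $\eta : S \to T$ a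 function, with $f \circ \sigma = \xi\circ(A\times\gamma^*\eta)$. $\mathcal{D}_A$ is regarded as a site with the topology in which every single arrow is a cover. The functor $q_A : \mathcal{D}_A \to \mathcal{C}_A$, $(X,S,\sigma) \mapsto X$, is an equivalence of categories. The functor $u^* : \mathcal{D}_B \to \mathcal{D}_A$ determined by $u : A \to B$ is $u^*(Y,T,\xi) = (Y,T,\xi\circ(u\times\gamma^*T))$ on objects and $u^*(f,\eta)=(f,\eta)$ on arrows. A point of a site is a flat functor to $\mathcal{S}$ sending covers to surjective families; equivalently, it corresponds to a point of the topos of sheaves. A morphism of sites $u^*:\mathcal{D}_B\to\mathcal{D}_A$ is a functor inducing a geometric morphism from the topos of sheaves on $\mathcal{D}_A$ to the topos of sheaves on $\mathcal{D}_B$. *)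

theory Defs
  imports Main "HOL-Library.FuncSet"
begin

section \<open>The universe of sets\<close>

text \<open>
  HOL has no type of all sets, so the distinction between small and large is made relative to a
  Grothendieck universe: a type with a notion of small subset that is closed under subsets, images,
  small unions and (up to bijection) power sets.  As in SGA 4, an infinite small set is not
  required, so that every Grothendieck universe of an ambient set theory is covered.
\<close>

class universe =
  fixes small :: "'a set \<Rightarrow> bool"
  assumes small_subset: "small X \<Longrightarrow> Y \<subseteq> X \<Longrightarrow> small Y"
    and small_image: "small X \<Longrightarrow> small ((f :: 'a \<Rightarrow> 'a) ` X)"
    and small_singleton: "small {x}"
    and small_Union: "small I \<Longrightarrow> (\<And>i. i \<in> I \<Longrightarrow> small (F i)) \<Longrightarrow> small (\<Union>i\<in>I. F i)"
    and small_Pow: "small X \<Longrightarrow> \<exists>Y (e :: 'a set \<Rightarrow> 'a). small Y \<and> bij_betw e (Pow X) Y"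

text \<open>The class is inhabited, by the universe of finite sets.\<close>

instantiation nat :: universe
begin

definition small_nat :: "nat set \<Rightarrow> bool" where
  "small_nat X \<longleftrightarrow> finite X"

instance
proof
  fix X :: "nat set"
  assume "small X"
  then have "finite (Pow X)"
    by (simp add: small_nat_def)
  then obtain e :: "nat set \<Rightarrow> nat" where "bij_betw e (Pow X) {0..<card (Pow X)}"
    using ex_bij_betw_finite_nat by blast
  then show "\<exists>Y (e :: nat set \<Rightarrow> nat). small Y \<and> bij_betw e (Pow X) Y"
    unfolding small_nat_def by blast
qed (auto simp: small_nat_def intro: finite_subset)

end


section \<open>Categories\<close>

record ('o, 'a) cat =
  Obj :: "'o set"
  Arr :: "'a set"
  Src :: "'a \<Rightarrow> 'o"
  Tgt :: "'a \<Rightarrow> 'o"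
  Id :: "'o \<Rightarrow> 'a"
  Comp :: "'a \<Rightarrow> 'a \<Rightarrow> 'a" (infixl "\<cdot>\<index>" 70)

definition hom :: "('o, 'a, 'z) cat_scheme \<Rightarrow> 'o \<Rightarrow> 'o \<Rightarrow> 'a set" where
  "hom C x y = {f \<in> Arr C. Src C f = x \<and> Tgt C f = y}"

definition category :: "('o, 'a, 'z) cat_scheme \<Rightarrow> bool" where
  "category C \<longleftrightarrow>
     (\<forall>f\<in>Arr C. Src C f \<in> Obj C \<and> Tgt C f \<in> Obj C) \<and>
     (\<forall>x\<in>Obj C. Id C x \<in> hom C x x) \<and>
     (\<forall>x\<in>Obj C. \<forall>y\<in>Obj C. \<forall>z\<in>Obj C. \<forall>f\<in>hom C x y. \<forall>g\<in>hom C y z. g \<cdot>\<^bsub>C\<^esub> f \<in> hom C x z) \<and>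
     (\<forall>f\<in>Arr C. f \<cdot>\<^bsub>C\<^esub> Id C (Src C f) = f \<and> Id C (Tgt C f) \<cdot>\<^bsub>C\<^esub> f = f) \<and>
     (\<forall>f\<in>Arr C. \<forall>g\<in>Arr C. \<forall>h\<in>Arr C. Tgt C f = Src C g \<longrightarrow> Tgt C g = Src C h \<longrightarrow>
        h \<cdot>\<^bsub>C\<^esub> (g \<cdot>\<^bsub>C\<^esub> f) = (h \<cdot>\<^bsub>C\<^esub> g) \<cdot>\<^bsub>C\<^esub> f)"

definition op :: "('o, 'a, 'z) cat_scheme \<Rightarrow> ('o, 'a) cat" where
  "op C = \<lparr>Obj = Obj C, Arr = Arr C, Src = Tgt C, Tgt = Src C, Id = Id C,
           Comp = (\<lambda>g f. f \<cdot>\<^bsub>C\<^esub> g)\<rparr>"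

definition full_subcategory :: "('o, 'a, 'z) cat_scheme \<Rightarrow> 'o set \<Rightarrow> ('o, 'a) cat" where
  "full_subcategory C P =
     \<lparr>Obj = Obj C \<inter> P, Arr = {f \<in> Arr C. Src C f \<in> P \<and> Tgt C f \<in> P}, Src = Src C, Tgt = Tgt C,
      Id = Id C, Comp = Comp C\<rparr>"

definition is_iso :: "('o, 'a, 'z) cat_scheme \<Rightarrow> 'a \<Rightarrow> bool" where
  "is_iso C f \<longleftrightarrow> f \<in> Arr C \<and>
     (\<exists>g\<in>hom C (Tgt C f) (Src C f). g \<cdot>\<^bsub>C\<^esub> f = Id C (Src C f) \<and> f \<cdot>\<^bsub>C\<^esub> g = Id C (Tgt C f))"

definition is_epi :: "('o, 'a, 'z) cat_scheme \<Rightarrow> 'a \<Rightarrow> bool" where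
  "is_epi C f \<longleftrightarrow> f \<in> Arr C \<and>
     (\<forall>z\<in>Obj C. \<forall>g\<in>hom C (Tgt C f) z. \<forall>h\<in>hom C (Tgt C f) z. g \<cdot>\<^bsub>C\<^esub> f = h \<cdot>\<^bsub>C\<^esub> f \<longrightarrow> g = h)"

definition is_terminal :: "('o, 'a, 'z) cat_scheme \<Rightarrow> 'o \<Rightarrow> bool" where
  "is_terminal C t \<longleftrightarrow> t \<in> Obj C \<and> (\<forall>x\<in>Obj C. \<exists>!f. f \<in> hom C x t)"

definition is_initial :: "('o, 'a, 'z) cat_scheme \<Rightarrow> 'o \<Rightarrow> bool" where
  "is_initial C i \<longleftrightarrow> i \<in> Obj C \<and> (\<forall>x\<in>Obj C. \<exists>!f. f \<in> hom C i x)"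

definition is_coproduct ::
  "('o, 'a, 'z) cat_scheme \<Rightarrow> 'o \<Rightarrow> 'o \<Rightarrow> 'o \<Rightarrow> 'a \<Rightarrow> 'a \<Rightarrow> bool" where
  "is_coproduct C y z x i j \<longleftrightarrow> y \<in> Obj C \<and> z \<in> Obj C \<and> x \<in> Obj C \<and> i \<in> hom C y x \<and> j \<in> hom C z x \<and>
     (\<forall>w\<in>Obj C. \<forall>f\<in>hom C y w. \<forall>g\<in>hom C z w. \<exists>!h. h \<in> hom C x w \<and> h \<cdot>\<^bsub>C\<^esub> i = f \<and> h \<cdot>\<^bsub>C\<^esub> j = g)"

definition is_product ::
  "('o, 'a, 'z) cat_scheme \<Rightarrow> 'o \<Rightarrow> 'o \<Rightarrow> 'o \<Rightarrow> 'a \<Rightarrow> 'a \<Rightarrow> bool" where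
  "is_product C y z x p q \<longleftrightarrow> y \<in> Obj C \<and> z \<in> Obj C \<and> x \<in> Obj C \<and> p \<in> hom C x y \<and> q \<in> hom C x z \<and>
     (\<forall>w\<in>Obj C. \<forall>f\<in>hom C w y. \<forall>g\<in>hom C w z. \<exists>!h. h \<in> hom C w x \<and> p \<cdot>\<^bsub>C\<^esub> h = f \<and> q \<cdot>\<^bsub>C\<^esub> h = g)"


section \<open>Functors and natural transformations\<close>

record ('o, 'a, 'p, 'b) fctr =
  FObj :: "'o \<Rightarrow> 'p"
  FArr :: "'a \<Rightarrow> 'b"

definition is_functor ::
  "('o, 'a, 'y) cat_scheme \<Rightarrow> ('p, 'b, 'z) cat_scheme \<Rightarrow> ('o, 'a, 'p, 'b) fctr \<Rightarrow> bool" where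
  "is_functor C D F \<longleftrightarrow> category C \<and> category D \<and>
     (\<forall>x\<in>Obj C. FObj F x \<in> Obj D \<and> FArr F (Id C x) = Id D (FObj F x)) \<and>
     (\<forall>f\<in>Arr C. FArr F f \<in> hom D (FObj F (Src C f)) (FObj F (Tgt C f))) \<and>
     (\<forall>f\<in>Arr C. \<forall>g\<in>Arr C. Tgt C f = Src C g \<longrightarrow>
        FArr F (g \<cdot>\<^bsub>C\<^esub> f) = FArr F g \<cdot>\<^bsub>D\<^esub> FArr F f)"

definition id_functor :: "('o, 'a, 'o, 'a) fctr" where
  "id_functor = \<lparr>FObj = (\<lambda>x. x), FArr = (\<lambda>f. f)\<rparr>"

definition comp_functor ::
  "('p, 'b, 'q, 'c) fctr \<Rightarrow> ('o, 'a, 'p, 'b) fctr \<Rightarrow> ('o, 'a, 'q, 'c) fctr" (infixl "\<odot>" 70) where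
  "G \<odot> F = \<lparr>FObj = FObj G \<circ> FObj F, FArr = FArr G \<circ> FArr F\<rparr>"

text \<open>Strict equality of functors on \<open>C\<close>; values outside \<open>C\<close> are irrelevant.\<close>

definition functor_eq ::
  "('o, 'a, 'z) cat_scheme \<Rightarrow> ('o, 'a, 'p, 'b) fctr \<Rightarrow> ('o, 'a, 'p, 'b) fctr \<Rightarrow> bool" where
  "functor_eq C F G \<longleftrightarrow>
     (\<forall>x\<in>Obj C. FObj F x = FObj G x) \<and> (\<forall>f\<in>Arr C. FArr F f = FArr G f)"

definition nat_trans ::
  "('o, 'a, 'y) cat_scheme \<Rightarrow> ('p, 'b, 'z) cat_scheme \<Rightarrow>
   ('o, 'a, 'p, 'b) fctr \<Rightarrow> ('o, 'a, 'p, 'b) fctr \<Rightarrow> ('o \<Rightarrow> 'b) \<Rightarrow> bool" where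
  "nat_trans C D F G \<tau> \<longleftrightarrow> is_functor C D F \<and> is_functor C D G \<and>
     (\<forall>x\<in>Obj C. \<tau> x \<in> hom D (FObj F x) (FObj G x)) \<and>
     (\<forall>f\<in>Arr C. FArr G f \<cdot>\<^bsub>D\<^esub> \<tau> (Src C f) = \<tau> (Tgt C f) \<cdot>\<^bsub>D\<^esub> FArr F f)"

definition vert_comp :: "('p, 'b, 'z) cat_scheme \<Rightarrow> ('o \<Rightarrow> 'b) \<Rightarrow> ('o \<Rightarrow> 'b) \<Rightarrow> 'o \<Rightarrow> 'b" where
  "vert_comp D \<sigma> \<tau> = (\<lambda>x. \<sigma> x \<cdot>\<^bsub>D\<^esub> \<tau> x)"

text \<open>The horizontal composite \<open>G F \<Rightarrow> G' F'\<close> of \<open>\<beta> : G \<Rightarrow> G'\<close> and \<open>\<alpha> : F \<Rightarrow> F'\<close>, where \<open>D\<close> is the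
  codomain of \<open>G\<close>.\<close>

definition horiz_comp ::
  "('q, 'c, 'z) cat_scheme \<Rightarrow> ('p, 'b, 'q, 'c) fctr \<Rightarrow> ('o, 'a, 'p, 'b) fctr \<Rightarrow>
   ('p \<Rightarrow> 'c) \<Rightarrow> ('o \<Rightarrow> 'b) \<Rightarrow> 'o \<Rightarrow> 'c" where
  "horiz_comp D G F' \<beta> \<alpha> = (\<lambda>x. \<beta> (FObj F' x) \<cdot>\<^bsub>D\<^esub> FArr G (\<alpha> x))"

definition naturally_isomorphic ::
  "('o, 'a, 'y) cat_scheme \<Rightarrow> ('p, 'b, 'z) cat_scheme \<Rightarrow>
   ('o, 'a, 'p, 'b) fctr \<Rightarrow> ('o, 'a, 'p, 'b) fctr \<Rightarrow> bool" where
  "naturally_isomorphic C D F G \<longleftrightarrow> (\<exists>\<tau>. nat_trans C D F G \<tau> \<and> (\<forall>x\<in>Obj C. is_iso D (\<tau> x)))"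

definition full_and_faithful ::
  "('o, 'a, 'y) cat_scheme \<Rightarrow> ('p, 'b, 'z) cat_scheme \<Rightarrow> ('o, 'a, 'p, 'b) fctr \<Rightarrow> bool" where
  "full_and_faithful C D F \<longleftrightarrow> is_functor C D F \<and>
     (\<forall>x\<in>Obj C. \<forall>y\<in>Obj C. bij_betw (FArr F) (hom C x y) (hom D (FObj F x) (FObj F y)))"

definition equivalent_categories ::
  "('o, 'a, 'y) cat_scheme \<Rightarrow> ('p, 'b, 'z) cat_scheme \<Rightarrow> bool" where
  "equivalent_categories C D \<longleftrightarrow> (\<exists>F G. is_functor C D F \<and> is_functor D C G \<and>
     naturally_isomorphic C C id_functor (G \<odot> F) \<and> naturally_isomorphic D D (F \<odot> G) id_functor)"

text \<open>\<open>L : C \<rightarrow> D\<close> is left adjoint to \<open>R : D \<rightarrow> C\<close>.\<close>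

definition adjunction ::
  "('o, 'a, 'y) cat_scheme \<Rightarrow> ('p, 'b, 'z) cat_scheme \<Rightarrow>
   ('o, 'a, 'p, 'b) fctr \<Rightarrow> ('p, 'b, 'o, 'a) fctr \<Rightarrow> bool" where
  "adjunction C D L R \<longleftrightarrow> is_functor C D L \<and> is_functor D C R \<and>
     (\<exists>\<eta> \<epsilon>. nat_trans C C id_functor (R \<odot> L) \<eta> \<and> nat_trans D D (L \<odot> R) id_functor \<epsilon> \<and>
        (\<forall>x\<in>Obj C. \<epsilon> (FObj L x) \<cdot>\<^bsub>D\<^esub> FArr L (\<eta> x) = Id D (FObj L x)) \<and>
        (\<forall>y\<in>Obj D. FArr R (\<epsilon> y) \<cdot>\<^bsub>C\<^esub> \<eta> (FObj R y) = Id C (FObj R y)))"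

definition is_cone ::
  "('i, 'j, 'y) cat_scheme \<Rightarrow> ('o, 'a, 'z) cat_scheme \<Rightarrow> ('i, 'j, 'o, 'a) fctr \<Rightarrow>
   'o \<Rightarrow> ('i \<Rightarrow> 'a) \<Rightarrow> bool" where
  "is_cone J C D n \<kappa> \<longleftrightarrow> n \<in> Obj C \<and> (\<forall>i\<in>Obj J. \<kappa> i \<in> hom C n (FObj D i)) \<and>
     (\<forall>f\<in>Arr J. FArr D f \<cdot>\<^bsub>C\<^esub> \<kappa> (Src J f) = \<kappa> (Tgt J f))"

definition is_limit ::
  "('i, 'j, 'y) cat_scheme \<Rightarrow> ('o, 'a, 'z) cat_scheme \<Rightarrow> ('i, 'j, 'o, 'a) fctr \<Rightarrow>
   'o \<Rightarrow> ('i \<Rightarrow> 'a) \<Rightarrow> bool" where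
  "is_limit J C D n \<kappa> \<longleftrightarrow> is_functor J C D \<and> is_cone J C D n \<kappa> \<and>
     (\<forall>m \<mu>. is_cone J C D m \<mu> \<longrightarrow> (\<exists>!h. h \<in> hom C m n \<and> (\<forall>i\<in>Obj J. \<kappa> i \<cdot>\<^bsub>C\<^esub> h = \<mu> i)))"

text \<open>Up to isomorphism every finite category has natural numbers as objects and arrows.\<close>

definition preserves_finite_limits ::
  "('o, 'a, 'y) cat_scheme \<Rightarrow> ('p, 'b, 'z) cat_scheme \<Rightarrow> ('o, 'a, 'p, 'b) fctr \<Rightarrow> bool" where
  "preserves_finite_limits C D F \<longleftrightarrow>
     (\<forall>(J :: (nat, nat) cat) G n \<kappa>. finite (Obj J) \<longrightarrow> finite (Arr J) \<longrightarrow> is_limit J C G n \<kappa> \<longrightarrow>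
        is_limit J D (F \<odot> G) (FObj F n) (\<lambda>i. FArr F (\<kappa> i)))"


section \<open>The category of sets\<close>

text \<open>An arrow is a triple of a domain, a function (extensional on the domain) and a codomain.\<close>

type_synonym 'v set_arr = "'v set \<times> ('v \<Rightarrow> 'v) \<times> 'v set"

definition SetC :: "('v::universe set, 'v set_arr) cat" where
  "SetC = \<lparr>Obj = {X. small X},
           Arr = {(X, f, Y). small X \<and> small Y \<and> f \<in> X \<rightarrow>\<^sub>E Y},
           Src = (\<lambda>(X, f, Y). X), Tgt = (\<lambda>(X, f, Y). Y),
           Id = (\<lambda>X. (X, \<lambda>x\<in>X. x, X)),
           Comp = (\<lambda>(Y', g, Z) (X, f, Y). (X, compose X g f, Z))\<rparr>"

definition set_app :: "'v set_arr \<Rightarrow> 'v \<Rightarrow> 'v" where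
  "set_app = (\<lambda>(X, f, Y). f)"

definition locally_small :: "('o, 'v::universe, 'z) cat_scheme \<Rightarrow> bool" where
  "locally_small C \<longleftrightarrow> (\<forall>x\<in>Obj C. \<forall>y\<in>Obj C. small (hom C x y))"

definition hom_functor ::
  "('o, 'v::universe, 'z) cat_scheme \<Rightarrow> 'o \<Rightarrow> ('o, 'v, 'v set, 'v set_arr) fctr" where
  "hom_functor C a =
     \<lparr>FObj = (\<lambda>x. hom C a x),
      FArr = (\<lambda>f. (hom C a (Src C f), \<lambda>g\<in>hom C a (Src C f). f \<cdot>\<^bsub>C\<^esub> g, hom C a (Tgt C f)))\<rparr>"


section \<open>Sites and sheaves\<close>

text \<open>
  Coverings are families \<open>R \<in> K c\<close> of arrows with target \<open>c\<close>.  The sheaf condition is stated for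
  arbitrary covering families; for covering sieves it is the usual one.
\<close>

type_synonym ('o, 'a, 'v) presheaf = "('o, 'a, 'v set, 'v set_arr) fctr"

definition matching_family ::
  "('o, 'a, 'z) cat_scheme \<Rightarrow> ('o, 'a, 'v) presheaf \<Rightarrow> 'a set \<Rightarrow> ('a \<Rightarrow> 'v) \<Rightarrow> bool" where
  "matching_family C P R x \<longleftrightarrow> (\<forall>f\<in>R. x f \<in> FObj P (Src C f)) \<and>
     (\<forall>f\<in>R. \<forall>g\<in>R. \<forall>h\<in>Arr C. \<forall>k\<in>Arr C.
        Tgt C h = Src C f \<longrightarrow> Tgt C k = Src C g \<longrightarrow> Src C h = Src C k \<longrightarrow> f \<cdot>\<^bsub>C\<^esub> h = g \<cdot>\<^bsub>C\<^esub> k \<longrightarrow>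
        set_app (FArr P h) (x f) = set_app (FArr P k) (x g))"

definition is_sheaf ::
  "('o, 'a, 'z) cat_scheme \<Rightarrow> ('o \<Rightarrow> 'a set set) \<Rightarrow> ('o, 'a, 'v::universe) presheaf \<Rightarrow> bool" where
  "is_sheaf C K P \<longleftrightarrow> is_functor (op C) SetC P \<and>
     (\<forall>c\<in>Obj C. \<forall>R\<in>K c. \<forall>x. matching_family C P R x \<longrightarrow>
        (\<exists>!y. y \<in> FObj P c \<and> (\<forall>f\<in>R. set_app (FArr P f) y = x f)))"

definition Sh ::
  "('o, 'a, 'z) cat_scheme \<Rightarrow> ('o \<Rightarrow> 'a set set) \<Rightarrow>
   (('o, 'a, 'v::universe) presheaf,
    ('o, 'a, 'v) presheaf \<times> ('o \<Rightarrow> 'v set_arr) \<times> ('o, 'a, 'v) presheaf) cat" where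
  "Sh C K =
     \<lparr>Obj = {P. is_sheaf C K P},
      Arr = {(P, \<tau>, Q). is_sheaf C K P \<and> is_sheaf C K Q \<and>
               nat_trans (op C) SetC P Q \<tau> \<and> \<tau> \<in> extensional (Obj C)},
      Src = (\<lambda>(P, \<tau>, Q). P), Tgt = (\<lambda>(P, \<tau>, Q). Q),
      Id = (\<lambda>P. (P, \<lambda>c\<in>Obj C. Id SetC (FObj P c), P)),
      Comp = (\<lambda>(Q', \<sigma>, R) (P, \<tau>, Q). (P, \<lambda>c\<in>Obj C. \<sigma> c \<cdot>\<^bsub>SetC\<^esub> \<tau> c, R))\<rparr>"

definition is_sieve :: "('o, 'a, 'z) cat_scheme \<Rightarrow> 'o \<Rightarrow> 'a set \<Rightarrow> bool" where
  "is_sieve C c S \<longleftrightarrow> S \<subseteq> {f \<in> Arr C. Tgt C f = c} \<and>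
     (\<forall>f\<in>S. \<forall>g\<in>Arr C. Tgt C g = Src C f \<longrightarrow> f \<cdot>\<^bsub>C\<^esub> g \<in> S)"

definition pullback_sieve :: "('o, 'a, 'z) cat_scheme \<Rightarrow> 'a \<Rightarrow> 'a set \<Rightarrow> 'a set" where
  "pullback_sieve C h S = {g \<in> Arr C. Tgt C g = Src C h \<and> h \<cdot>\<^bsub>C\<^esub> g \<in> S}"

definition grothendieck_topology ::
  "('o, 'a, 'z) cat_scheme \<Rightarrow> ('o \<Rightarrow> 'a set set) \<Rightarrow> bool" where
  "grothendieck_topology C K \<longleftrightarrow> (\<forall>c\<in>Obj C.
     (\<forall>S\<in>K c. is_sieve C c S) \<and>
     {f \<in> Arr C. Tgt C f = c} \<in> K c \<and>
     (\<forall>S\<in>K c. \<forall>h\<in>Arr C. Tgt C h = c \<longrightarrow> pullback_sieve C h S \<in> K (Src C h)) \<and>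
     (\<forall>S\<in>K c. \<forall>R. is_sieve C c R \<longrightarrow> (\<forall>f\<in>S. pullback_sieve C f R \<in> K (Src C f)) \<longrightarrow> R \<in> K c))"

definition grothendieck_topos :: "('o, 'v::universe, 'z) cat_scheme \<Rightarrow> bool" where
  "grothendieck_topos E \<longleftrightarrow> category E \<and> locally_small E \<and>
     (\<exists>(C :: ('v, 'v) cat) K. category C \<and> small (Obj C) \<and> small (Arr C) \<and>
        grothendieck_topology C K \<and>
        equivalent_categories E (Sh C K :: (('v, 'v, 'v) presheaf, _) cat))"

text \<open>The geometric morphism goes from \<open>E\<close> to \<open>F\<close>.\<close>

definition geometric_morphism ::
  "('o, 'a, 'y) cat_scheme \<Rightarrow> ('p, 'b, 'z) cat_scheme \<Rightarrow>
   ('p, 'b, 'o, 'a) fctr \<Rightarrow> ('o, 'a, 'p, 'b) fctr \<Rightarrow> bool" where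
  "geometric_morphism E F inv_im dir_im \<longleftrightarrow>
     adjunction F E inv_im dir_im \<and> preserves_finite_limits F E inv_im"

text \<open>Flatness: the category of elements is cofiltered.\<close>

definition flat_functor ::
  "('o, 'a, 'z) cat_scheme \<Rightarrow> ('o, 'a, 'v::universe set, 'v set_arr) fctr \<Rightarrow> bool" where
  "flat_functor C P \<longleftrightarrow> is_functor C SetC P \<and>
     (\<exists>c\<in>Obj C. FObj P c \<noteq> {}) \<and>
     (\<forall>c\<in>Obj C. \<forall>d\<in>Obj C. \<forall>x\<in>FObj P c. \<forall>y\<in>FObj P d.
        \<exists>e\<in>Obj C. \<exists>z\<in>FObj P e. \<exists>f\<in>hom C e c. \<exists>g\<in>hom C e d.
          set_app (FArr P f) z = x \<and> set_app (FArr P g) z = y) \<and>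
     (\<forall>c\<in>Obj C. \<forall>d\<in>Obj C. \<forall>f\<in>hom C c d. \<forall>g\<in>hom C c d. \<forall>x\<in>FObj P c.
        set_app (FArr P f) x = set_app (FArr P g) x \<longrightarrow>
        (\<exists>e\<in>Obj C. \<exists>z\<in>FObj P e. \<exists>h\<in>hom C e c.
           f \<cdot>\<^bsub>C\<^esub> h = g \<cdot>\<^bsub>C\<^esub> h \<and> set_app (FArr P h) z = x))"

definition point_of_site ::
  "('o, 'a, 'z) cat_scheme \<Rightarrow> ('o \<Rightarrow> 'a set set) \<Rightarrow>
   ('o, 'a, 'v::universe set, 'v set_arr) fctr \<Rightarrow> bool" where
  "point_of_site C K P \<longleftrightarrow> flat_functor C P \<and>
     (\<forall>c\<in>Obj C. \<forall>R\<in>K c. \<forall>x\<in>FObj P c. \<exists>f\<in>R. \<exists>y\<in>FObj P (Src C f). set_app (FArr P f) y = x)"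

definition precomposition ::
  "('o, 'a, 'z) cat_scheme \<Rightarrow> ('o, 'a, 'p, 'b) fctr \<Rightarrow>
   (('p, 'b, 'v) presheaf,
    ('p, 'b, 'v) presheaf \<times> ('p \<Rightarrow> 'v set_arr) \<times> ('p, 'b, 'v) presheaf,
    ('o, 'a, 'v) presheaf,
    ('o, 'a, 'v) presheaf \<times> ('o \<Rightarrow> 'v set_arr) \<times> ('o, 'a, 'v) presheaf) fctr" where
  "precomposition C F =
     \<lparr>FObj = (\<lambda>P. P \<odot> F), FArr = (\<lambda>(P, \<tau>, Q). (P \<odot> F, \<lambda>c\<in>Obj C. \<tau> (FObj F c), Q \<odot> F))\<rparr>"

text \<open>
  A functor \<open>F : C \<rightarrow> D\<close> is a morphism of sites if precomposition with \<open>F\<close> is the direct image of a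
  geometric morphism from sheaves on \<open>D\<close> to sheaves on \<open>C\<close>; in particular precomposition
  sends sheaves to sheaves.  The type argument selects the universe in which sheaves take values.
\<close>

definition morphism_of_sites ::
  "'v::universe itself \<Rightarrow> ('o, 'a, 'y) cat_scheme \<Rightarrow> ('o \<Rightarrow> 'a set set) \<Rightarrow>
   ('p, 'b, 'z) cat_scheme \<Rightarrow> ('p \<Rightarrow> 'b set set) \<Rightarrow> ('o, 'a, 'p, 'b) fctr \<Rightarrow> bool" where
  "morphism_of_sites _ C K D L F \<longleftrightarrow> is_functor C D F \<and>
     (\<exists>inv_im. geometric_morphism
        (Sh D L :: (('p, 'b, 'v) presheaf, _) cat) (Sh C K :: (('o, 'a, 'v) presheaf, _) cat)
        inv_im (precomposition C F))"

text \<open>The covering families of the topology in which every single arrow is a cover.\<close>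

definition single_covers :: "('o, 'a, 'z) cat_scheme \<Rightarrow> 'o \<Rightarrow> 'a set set" where
  "single_covers C c = {{f} | f. f \<in> Arr C \<and> Tgt C f = c}"


section \<open>Connected locally connected topoi\<close>

text \<open>
  A topos \<open>E\<close> with its structure morphism \<open>\<gamma>\<close> to the topos of sets and a choice of binary products.
  Arrows of \<open>E\<close> and elements of small sets live in the same type, so that hom-sets are sets of
  the universe.
\<close>

record ('o, 'v) topos = "('o, 'v) cat" +
  gam_inv :: "('v set, 'v set_arr, 'o, 'v) fctr"
  gam_dir :: "('o, 'v, 'v set, 'v set_arr) fctr"
  Prod :: "'o \<Rightarrow> 'o \<Rightarrow> 'o" (infixr "\<otimes>\<index>" 75)
  Pr1 :: "'o \<Rightarrow> 'o \<Rightarrow> 'v"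
  Pr2 :: "'o \<Rightarrow> 'o \<Rightarrow> 'v"

definition set_topos :: "('o, 'v::universe) topos \<Rightarrow> bool" where
  "set_topos E \<longleftrightarrow> grothendieck_topos E \<and>
     geometric_morphism E SetC (gam_inv E) (gam_dir E) \<and>
     (\<forall>x\<in>Obj E. \<forall>y\<in>Obj E. is_product E x y (x \<otimes>\<^bsub>E\<^esub> y) (Pr1 E x y) (Pr2 E x y))"

definition connected_topos :: "('o, 'v::universe) topos \<Rightarrow> bool" where
  "connected_topos E \<longleftrightarrow> full_and_faithful SetC E (gam_inv E)"

text \<open>Over the topos of sets the left adjoint of \<open>\<gamma>\<^sup>*\<close> is automatically an indexed one.\<close>

definition locally_connected_topos :: "('o, 'v::universe) topos \<Rightarrow> bool" where
  "locally_connected_topos E \<longleftrightarrow> (\<exists>gam_shriek. adjunction E SetC gam_shriek (gam_inv E))"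

definition pair :: "('o, 'v, 'z) topos_scheme \<Rightarrow> 'v \<Rightarrow> 'v \<Rightarrow> 'v" where
  "pair E f g =
     (THE h. h \<in> hom E (Src E f) (Tgt E f \<otimes>\<^bsub>E\<^esub> Tgt E g) \<and>
        Pr1 E (Tgt E f) (Tgt E g) \<cdot>\<^bsub>E\<^esub> h = f \<and> Pr2 E (Tgt E f) (Tgt E g) \<cdot>\<^bsub>E\<^esub> h = g)"

definition prod_arr :: "('o, 'v, 'z) topos_scheme \<Rightarrow> 'v \<Rightarrow> 'v \<Rightarrow> 'v" where
  "prod_arr E f g =
     pair E (f \<cdot>\<^bsub>E\<^esub> Pr1 E (Src E f) (Src E g)) (g \<cdot>\<^bsub>E\<^esub> Pr2 E (Src E f) (Src E g))"

definition connected_object :: "('o, 'v, 'z) cat_scheme \<Rightarrow> 'o \<Rightarrow> bool" where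
  "connected_object E X \<longleftrightarrow> X \<in> Obj E \<and> \<not> is_initial E X \<and>
     (\<forall>Y Z i j. is_coproduct E Y Z X i j \<longrightarrow> is_initial E Y \<or> is_initial E Z)"

definition Aut :: "('o, 'v, 'z) cat_scheme \<Rightarrow> 'o \<Rightarrow> 'v set" where
  "Aut E A = {h \<in> hom E A A. is_iso E h}"

text \<open>The arrow \<open>A \<rightarrow> \<gamma>\<^sup>* S\<close> that is constant at \<open>s \<in> S\<close>: the composite of \<open>A \<rightarrow> \<gamma>\<^sup>* {s}\<close>, whose
  codomain is terminal, and \<open>\<gamma>\<^sup>*\<close> of the inclusion \<open>{s} \<rightarrow> S\<close>.\<close>

definition const_arr :: "('o, 'v::universe) topos \<Rightarrow> 'o \<Rightarrow> 'v set \<Rightarrow> 'v \<Rightarrow> 'v" where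
  "const_arr E A S s =
     FArr (gam_inv E) ({s}, \<lambda>x\<in>{s}. x, S) \<cdot>\<^bsub>E\<^esub> (THE t. t \<in> hom E A (FObj (gam_inv E) {s}))"

text \<open>
  The canonical map \<open>A \<times> \<gamma>\<^sup>* Aut(A) \<rightarrow> A \<times> A\<close>, \<open>(a, h) \<mapsto> (a, h(a))\<close>.  Since \<open>A \<times> \<gamma>\<^sup>* H\<close> is the coproduct
  of \<open>H\<close>-many copies of \<open>A\<close>, with injections \<open>a \<mapsto> (a, h)\<close>, it is the only arrow with this property.
\<close>

definition canonical_map :: "('o, 'v::universe) topos \<Rightarrow> 'o \<Rightarrow> 'v \<Rightarrow> bool" where
  "canonical_map E A m \<longleftrightarrow> m \<in> hom E (A \<otimes>\<^bsub>E\<^esub> FObj (gam_inv E) (Aut E A)) (A \<otimes>\<^bsub>E\<^esub> A) \<and>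
     (\<forall>h\<in>Aut E A. m \<cdot>\<^bsub>E\<^esub> pair E (Id E A) (const_arr E A (Aut E A) h) = pair E (Id E A) h)"

definition galois_object :: "('o, 'v::universe) topos \<Rightarrow> 'o \<Rightarrow> bool" where
  "galois_object E A \<longleftrightarrow> (\<exists>m. canonical_map E A m \<and> is_iso E m) \<and> connected_object E A \<and>
     (\<exists>t f. is_terminal E t \<and> f \<in> hom E A t \<and> is_epi E f)"

definition CA :: "('o, 'v, 'z) cat_scheme \<Rightarrow> 'o \<Rightarrow> ('o, 'v) cat" where
  "CA E A = full_subcategory E {X. connected_object E X \<and> hom E A X \<noteq> {}}"


section \<open>The sites \<open>\<D>\<^sub>A\<close>\<close>

type_synonym ('o, 'v) dobj = "'o \<times> 'v set \<times> 'v"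

text \<open>An arrow of \<open>\<D>\<^sub>A\<close> carries its source and target, since the pair \<open>(f, \<eta>)\<close> does not determine
  the actions \<open>\<sigma>\<close> and \<open>\<xi>\<close>.\<close>

type_synonym ('o, 'v) darr = "('o, 'v) dobj \<times> 'v \<times> 'v set_arr \<times> ('o, 'v) dobj"

definition DA_obj :: "('o, 'v::universe) topos \<Rightarrow> 'o \<Rightarrow> ('o, 'v) dobj set" where
  "DA_obj E A = {(X, S, \<sigma>). connected_object E X \<and> small S \<and> S \<noteq> {} \<and>
     \<sigma> \<in> hom E (A \<otimes>\<^bsub>E\<^esub> FObj (gam_inv E) S) X \<and>
     is_iso E (pair E (Pr1 E A (FObj (gam_inv E) S)) \<sigma>)}"

definition DA_arr :: "('o, 'v::universe) topos \<Rightarrow> 'o \<Rightarrow> ('o, 'v) darr set" where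
  "DA_arr E A = {((X, S, \<sigma>), f, \<eta>, (Y, T, \<xi>)) | X S \<sigma> f \<eta> Y T \<xi>.
     (X, S, \<sigma>) \<in> DA_obj E A \<and> (Y, T, \<xi>) \<in> DA_obj E A \<and> f \<in> hom E X Y \<and> \<eta> \<in> hom SetC S T \<and>
     f \<cdot>\<^bsub>E\<^esub> \<sigma> = \<xi> \<cdot>\<^bsub>E\<^esub> prod_arr E (Id E A) (FArr (gam_inv E) \<eta>)}"

definition DA :: "('o, 'v::universe) topos \<Rightarrow> 'o \<Rightarrow> (('o, 'v) dobj, ('o, 'v) darr) cat" where
  "DA E A =
     \<lparr>Obj = DA_obj E A, Arr = DA_arr E A,
      Src = (\<lambda>(d, f, \<eta>, d'). d), Tgt = (\<lambda>(d, f, \<eta>, d'). d'),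
      Id = (\<lambda>(X, S, \<sigma>). ((X, S, \<sigma>), Id E X, Id SetC S, (X, S, \<sigma>))),
      Comp = (\<lambda>(e, g, \<zeta>, e') (d, f, \<eta>, d'). (d, g \<cdot>\<^bsub>E\<^esub> f, \<zeta> \<cdot>\<^bsub>SetC\<^esub> \<eta>, e'))\<rparr>"

text \<open>The functors \<open>p\<^sub>A\<^sup>*\<close> and \<open>q\<^sub>A\<close> are given by the same formulas for all \<open>A\<close>.\<close>

definition pA :: "(('o, 'v) dobj, ('o, 'v) darr, 'v set, 'v set_arr) fctr" where
  "pA = \<lparr>FObj = (\<lambda>(X, S, \<sigma>). S), FArr = (\<lambda>(d, f, \<eta>, d'). \<eta>)\<rparr>"

definition qA :: "(('o, 'v) dobj, ('o, 'v) darr, 'o, 'v) fctr" where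
  "qA = \<lparr>FObj = (\<lambda>(X, S, \<sigma>). X), FArr = (\<lambda>(d, f, \<eta>, d'). f)\<rparr>"

definition ustar_obj :: "('o, 'v::universe) topos \<Rightarrow> 'v \<Rightarrow> ('o, 'v) dobj \<Rightarrow> ('o, 'v) dobj" where
  "ustar_obj E u = (\<lambda>(Y, T, \<xi>). (Y, T, \<xi> \<cdot>\<^bsub>E\<^esub> prod_arr E u (Id E (FObj (gam_inv E) T))))"

definition ustar ::
  "('o, 'v::universe) topos \<Rightarrow> 'v \<Rightarrow>
   (('o, 'v) dobj, ('o, 'v) darr, ('o, 'v) dobj, ('o, 'v) darr) fctr" where
  "ustar E u =
     \<lparr>FObj = ustar_obj E u,
      FArr = (\<lambda>(d, f, \<eta>, d'). (ustar_obj E u d, f, \<eta>, ustar_obj E u d'))\<rparr>"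

end

theory Submission
  imports Defs
begin

text \<open>
  For an object \<open>(X, S, \<sigma>)\<close> of \<open>\<D>\<^sub>A\<close> the elements of \<open>S\<close> are the arrows \<open>A \<rightarrow> X\<close>: an arrow \<open>A \<rightarrow> X\<close> is a
  section of \<open>A \<times> X \<cong> A \<times> \<gamma>\<^sup>* S\<close> over \<open>A\<close>, that is an arrow \<open>A \<rightarrow> \<gamma>\<^sup>* S\<close>, and it is constant because \<open>A\<close>
  is connected.  Hence \<open>q\<^sub>A\<close> is fully faithful, and \<open>\<theta>\<close> is the unique lift of the identities.
  \<open>Aut(A)\<close> acts transitively on the arrows \<open>A \<rightarrow> X\<close>: the characteristic map of an orbit descends along the
  epimorphism \<open>A \<times> X \<rightarrow> X\<close> to an arrow \<open>X \<rightarrow> \<gamma>\<^sup>* S\<close>, which is constant because \<open>X\<close> is connected.  The facts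
  about the topos that this needs are checked on local elements of sheaves on a site.

  Sheaves on \<open>\<D>\<^sub>A\<close> are therefore sets with an action of \<open>Aut(A)\<close>, and an arrow \<open>u : A \<rightarrow> B\<close> gives a
  surjection from \<open>Aut(A)\<close> to \<open>Aut(B)\<close>.  Precomposition with \<open>u\<^sup>*\<close> takes the fixed points of its
  kernel; its left adjoint is inflation, which does not change the underlying sets and so preserves
  limits.
\<close>

section \<open>Categories\<close>

text \<open>The topos is given only up to an equivalence with sheaves on some small site. Each
  auxiliary object (subobject, product, object of truth values) is therefore written down as a
  presheaf that is already a sheaf and then carried back to \<open>E\<close>. That
  \<open>gam S\<close> is a coproduct of points is read off by transposing along the adjunction.
  Values of sheaves are subsets of the type \<open>'v\<close> of arrows. Pairs and sieves have to be
  coded as elements of \<open>'v\<close> through \<open>small_Pow\<close>, and arrows of D_A through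
  their component in \<open>E\<close>. Connectedness speaks of binary coproducts only, while
  \<open>gam S\<close> is indexed by an arbitrary small set; so one value is always separated from
  all the others together. On D_A the coverings are single arrows and not sieves. What makes their
  sheaves tractable is that every object is reached from the torsor (A, Aut A, \<sigma>) and that
  restriction along such an arrow is injective: sheaves and their morphisms are controlled by the
  value at the torsor. An arbitrary given limit cone can be tested there too, by mapping the free
  orbit into it, which gives preservation of limits without constructing any.\<close>

lemma in_hom: "f \<in> hom C x y \<longleftrightarrow> f \<in> Arr C \<and> Src C f = x \<and> Tgt C f = y"
  by (simp add: hom_def)

lemma arr_hom: "f \<in> Arr C \<Longrightarrow> f \<in> hom C (Src C f) (Tgt C f)"
  by (simp add: hom_def)

lemma hom_src: "f \<in> hom C x y \<Longrightarrow> Src C f = x"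
  and hom_tgt: "f \<in> hom C x y \<Longrightarrow> Tgt C f = y"
  and hom_arr: "f \<in> hom C x y \<Longrightarrow> f \<in> Arr C"
  by (simp_all add: hom_def)

lemma cat_dom: "category C \<Longrightarrow> f \<in> hom C x y \<Longrightarrow> x \<in> Obj C"
  and cat_cod: "category C \<Longrightarrow> f \<in> hom C x y \<Longrightarrow> y \<in> Obj C"
  by (auto simp: category_def in_hom)

lemma cat_Id: "category C \<Longrightarrow> x \<in> Obj C \<Longrightarrow> Id C x \<in> hom C x x"
  by (simp add: category_def)

lemma cat_comp:
  assumes "category C" "f \<in> hom C x y" "g \<in> hom C y z"
  shows "g \<cdot>\<^bsub>C\<^esub> f \<in> hom C x z"
proof -
  have "x \<in> Obj C" "y \<in> Obj C" "z \<in> Obj C"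
    using assms cat_dom cat_cod by metis+
  then show ?thesis
    using assms unfolding category_def by blast
qed

lemma cat_assoc:
  "category C \<Longrightarrow> f \<in> hom C x y \<Longrightarrow> g \<in> hom C y z \<Longrightarrow> h \<in> hom C z w \<Longrightarrow>
    (h \<cdot>\<^bsub>C\<^esub> g) \<cdot>\<^bsub>C\<^esub> f = h \<cdot>\<^bsub>C\<^esub> (g \<cdot>\<^bsub>C\<^esub> f)"
  by (simp add: category_def in_hom)

lemma cat_id_right: "category C \<Longrightarrow> f \<in> hom C x y \<Longrightarrow> f \<cdot>\<^bsub>C\<^esub> Id C x = f"
  and cat_id_left: "category C \<Longrightarrow> f \<in> hom C x y \<Longrightarrow> Id C y \<cdot>\<^bsub>C\<^esub> f = f"
  by (auto simp: category_def in_hom)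

lemma categoryI:
  assumes "\<And>f. f \<in> Arr C \<Longrightarrow> Src C f \<in> Obj C \<and> Tgt C f \<in> Obj C"
    and "\<And>x. x \<in> Obj C \<Longrightarrow> Id C x \<in> hom C x x"
    and "\<And>x y z f g. f \<in> hom C x y \<Longrightarrow> g \<in> hom C y z \<Longrightarrow> g \<cdot>\<^bsub>C\<^esub> f \<in> hom C x z"
    and "\<And>x y f. f \<in> hom C x y \<Longrightarrow> f \<cdot>\<^bsub>C\<^esub> Id C x = f"
    and "\<And>x y f. f \<in> hom C x y \<Longrightarrow> Id C y \<cdot>\<^bsub>C\<^esub> f = f"
    and "\<And>x y z w f g h. f \<in> hom C x y \<Longrightarrow> g \<in> hom C y z \<Longrightarrow> h \<in> hom C z w \<Longrightarrow>
      h \<cdot>\<^bsub>C\<^esub> (g \<cdot>\<^bsub>C\<^esub> f) = (h \<cdot>\<^bsub>C\<^esub> g) \<cdot>\<^bsub>C\<^esub> f"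
  shows "category C"
  unfolding category_def using assms by (auto simp: in_hom)

lemma is_iso_hom:
  assumes "f \<in> hom C x y"
  shows "is_iso C f \<longleftrightarrow> (\<exists>g\<in>hom C y x. g \<cdot>\<^bsub>C\<^esub> f = Id C x \<and> f \<cdot>\<^bsub>C\<^esub> g = Id C y)"
  using assms by (simp add: is_iso_def in_hom)

lemma op_simps [simp]:
  "Obj (op C) = Obj C" "Arr (op C) = Arr C" "Src (op C) = Tgt C" "Tgt (op C) = Src C"
  "Id (op C) = Id C" "Comp (op C) g f = f \<cdot>\<^bsub>C\<^esub> g"
  by (simp_all add: op_def)

lemma hom_op [simp]: "hom (op C) x y = hom C y x"
  by (auto simp: hom_def)

lemma category_op:
  assumes "category C"
  shows "category (op C)"
proof (rule categoryI)
  fix x y z w f g h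
  assume "f \<in> hom (op C) x y" "g \<in> hom (op C) y z" "h \<in> hom (op C) z w"
  then show "h \<cdot>\<^bsub>op C\<^esub> (g \<cdot>\<^bsub>op C\<^esub> f) = (h \<cdot>\<^bsub>op C\<^esub> g) \<cdot>\<^bsub>op C\<^esub> f"
    using cat_assoc[OF assms] by simp
qed (use assms in \<open>auto simp: cat_Id cat_id_left cat_id_right intro: cat_comp dest: arr_hom cat_dom cat_cod\<close>)

lemma functor_obj: "is_functor C D F \<Longrightarrow> x \<in> Obj C \<Longrightarrow> FObj F x \<in> Obj D"
  and functor_id: "is_functor C D F \<Longrightarrow> x \<in> Obj C \<Longrightarrow> FArr F (Id C x) = Id D (FObj F x)"
  and functor_dom: "is_functor C D F \<Longrightarrow> category C"
  and functor_cod: "is_functor C D F \<Longrightarrow> category D"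
  by (simp_all add: is_functor_def)

lemma functor_hom:
  "is_functor C D F \<Longrightarrow> f \<in> hom C x y \<Longrightarrow> FArr F f \<in> hom D (FObj F x) (FObj F y)"
  by (auto simp: is_functor_def in_hom)

lemma functor_comp:
  "is_functor C D F \<Longrightarrow> f \<in> hom C x y \<Longrightarrow> g \<in> hom C y z \<Longrightarrow>
    FArr F (g \<cdot>\<^bsub>C\<^esub> f) = FArr F g \<cdot>\<^bsub>D\<^esub> FArr F f"
  by (auto simp: is_functor_def in_hom)

lemma is_functorI:
  assumes "category C" "category D"
    and "\<And>x. x \<in> Obj C \<Longrightarrow> FObj F x \<in> Obj D"
    and "\<And>x. x \<in> Obj C \<Longrightarrow> FArr F (Id C x) = Id D (FObj F x)"
    and "\<And>x y f. f \<in> hom C x y \<Longrightarrow> FArr F f \<in> hom D (FObj F x) (FObj F y)"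
    and "\<And>x y z f g. f \<in> hom C x y \<Longrightarrow> g \<in> hom C y z \<Longrightarrow>
      FArr F (g \<cdot>\<^bsub>C\<^esub> f) = FArr F g \<cdot>\<^bsub>D\<^esub> FArr F f"
  shows "is_functor C D F"
  unfolding is_functor_def using assms by (auto simp: in_hom)

lemma comp_functor_simps [simp]:
  "FObj (G \<odot> F) x = FObj G (FObj F x)" "FArr (G \<odot> F) f = FArr G (FArr F f)"
  by (simp_all add: comp_functor_def)

lemma id_functor_simps [simp]: "FObj id_functor x = x" "FArr id_functor f = f"
  by (simp_all add: id_functor_def)

lemma is_functor_id: "category C \<Longrightarrow> is_functor C C id_functor"
  by (intro is_functorI) auto

lemma is_functor_comp:
  assumes F: "is_functor C D F" and G: "is_functor D B G"
  shows "is_functor C B (G \<odot> F)"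
proof (rule is_functorI)
  show "category C" "category B"
    using functor_dom[OF F] functor_cod[OF G] .
qed (auto simp: functor_obj[OF F] functor_obj[OF G] functor_id[OF F] functor_id[OF G]
    functor_comp[OF F] functor_comp[OF G functor_hom[OF F] functor_hom[OF F]]
    intro: functor_hom[OF F] functor_hom[OF G])

lemma nat_trans_hom:
  "nat_trans C D F G \<tau> \<Longrightarrow> x \<in> Obj C \<Longrightarrow> \<tau> x \<in> hom D (FObj F x) (FObj G x)"
  by (simp add: nat_trans_def)

lemma nat_trans_natural:
  "nat_trans C D F G \<tau> \<Longrightarrow> f \<in> hom C x y \<Longrightarrow> FArr G f \<cdot>\<^bsub>D\<^esub> \<tau> x = \<tau> y \<cdot>\<^bsub>D\<^esub> FArr F f"
  by (auto simp: nat_trans_def in_hom)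

lemma nat_transI:
  assumes "is_functor C D F" "is_functor C D G"
    and "\<And>x. x \<in> Obj C \<Longrightarrow> \<tau> x \<in> hom D (FObj F x) (FObj G x)"
    and "\<And>x y f. f \<in> hom C x y \<Longrightarrow> FArr G f \<cdot>\<^bsub>D\<^esub> \<tau> x = \<tau> y \<cdot>\<^bsub>D\<^esub> FArr F f"
  shows "nat_trans C D F G \<tau>"
  unfolding nat_trans_def using assms by (auto simp: in_hom)

text \<open>The inverse of transposition sends \<open>h\<close> to \<open>\<epsilon> y\<close> after
  \<open>FArr L h\<close>, and each triangle identity settles one of the two composites. Naturality
  of \<open>\<eta>\<close> is exported too, because coproducts of points are later read off from
  it.\<close>

lemma adjunction_transpose:
  assumes "adjunction C D L R"
  obtains \<eta> where "\<And>x. x \<in> Obj C \<Longrightarrow> \<eta> x \<in> hom C x (FObj R (FObj L x))"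
    and "\<And>f x x'. f \<in> hom C x x' \<Longrightarrow> FArr R (FArr L f) \<cdot>\<^bsub>C\<^esub> \<eta> x = \<eta> x' \<cdot>\<^bsub>C\<^esub> f"
    and "\<And>x y. x \<in> Obj C \<Longrightarrow> y \<in> Obj D \<Longrightarrow>
      bij_betw (\<lambda>g. FArr R g \<cdot>\<^bsub>C\<^esub> \<eta> x) (hom D (FObj L x) y) (hom C x (FObj R y))"
proof -
  from assms obtain \<eta> \<epsilon> where L: "is_functor C D L" and R: "is_functor D C R"
    and \<eta>: "nat_trans C C id_functor (R \<odot> L) \<eta>" and \<epsilon>: "nat_trans D D (L \<odot> R) id_functor \<epsilon>"
    and t1: "\<And>x. x \<in> Obj C \<Longrightarrow> \<epsilon> (FObj L x) \<cdot>\<^bsub>D\<^esub> FArr L (\<eta> x) = Id D (FObj L x)"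
    and t2: "\<And>y. y \<in> Obj D \<Longrightarrow> FArr R (\<epsilon> y) \<cdot>\<^bsub>C\<^esub> \<eta> (FObj R y) = Id C (FObj R y)"
    unfolding adjunction_def by blast
  note C = functor_dom[OF L] and D = functor_cod[OF L]
  have \<eta>h: "\<eta> x \<in> hom C x (FObj R (FObj L x))" if "x \<in> Obj C" for x
    using nat_trans_hom[OF \<eta> that] by simp
  have \<epsilon>h: "\<epsilon> y \<in> hom D (FObj L (FObj R y)) y" if "y \<in> Obj D" for y
    using nat_trans_hom[OF \<epsilon> that] by simp
  show thesis
  proof (rule that[of \<eta>])
    show "FArr R (FArr L f) \<cdot>\<^bsub>C\<^esub> \<eta> x = \<eta> x' \<cdot>\<^bsub>C\<^esub> f" if "f \<in> hom C x x'" for f x x'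
      using nat_trans_natural[OF \<eta> that] by simp
    show "bij_betw (\<lambda>g. FArr R g \<cdot>\<^bsub>C\<^esub> \<eta> x) (hom D (FObj L x) y) (hom C x (FObj R y))"
      if x: "x \<in> Obj C" and y: "y \<in> Obj D" for x y
    proof (rule bij_betw_byWitness[where f' = "\<lambda>h. \<epsilon> y \<cdot>\<^bsub>D\<^esub> FArr L h"])
      show "\<forall>g\<in>hom D (FObj L x) y. \<epsilon> y \<cdot>\<^bsub>D\<^esub> FArr L (FArr R g \<cdot>\<^bsub>C\<^esub> \<eta> x) = g"
      proof
        fix g assume g: "g \<in> hom D (FObj L x) y"
        have Rg: "FArr R g \<in> hom C (FObj R (FObj L x)) (FObj R y)"
          by (rule functor_hom[OF R g])
        have "\<epsilon> y \<cdot>\<^bsub>D\<^esub> FArr L (FArr R g \<cdot>\<^bsub>C\<^esub> \<eta> x) = \<epsilon> y \<cdot>\<^bsub>D\<^esub> (FArr L (FArr R g) \<cdot>\<^bsub>D\<^esub> FArr L (\<eta> x))"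
          by (simp add: functor_comp[OF L \<eta>h[OF x] Rg])
        also have "\<dots> = (\<epsilon> y \<cdot>\<^bsub>D\<^esub> FArr L (FArr R g)) \<cdot>\<^bsub>D\<^esub> FArr L (\<eta> x)"
          by (rule cat_assoc[OF D functor_hom[OF L \<eta>h[OF x]] functor_hom[OF L Rg] \<epsilon>h[OF y], symmetric])
        also have "\<epsilon> y \<cdot>\<^bsub>D\<^esub> FArr L (FArr R g) = g \<cdot>\<^bsub>D\<^esub> \<epsilon> (FObj L x)"
          using nat_trans_natural[OF \<epsilon> g] by simp
        also have "(g \<cdot>\<^bsub>D\<^esub> \<epsilon> (FObj L x)) \<cdot>\<^bsub>D\<^esub> FArr L (\<eta> x) = g \<cdot>\<^bsub>D\<^esub> (\<epsilon> (FObj L x) \<cdot>\<^bsub>D\<^esub> FArr L (\<eta> x))"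
          by (rule cat_assoc[OF D functor_hom[OF L \<eta>h[OF x]] \<epsilon>h[OF functor_obj[OF L x]] g])
        also have "\<dots> = g"
          by (simp add: t1[OF x] cat_id_right[OF D g])
        finally show "\<epsilon> y \<cdot>\<^bsub>D\<^esub> FArr L (FArr R g \<cdot>\<^bsub>C\<^esub> \<eta> x) = g" .
      qed
      show "\<forall>h\<in>hom C x (FObj R y). FArr R (\<epsilon> y \<cdot>\<^bsub>D\<^esub> FArr L h) \<cdot>\<^bsub>C\<^esub> \<eta> x = h"
      proof
        fix h assume h: "h \<in> hom C x (FObj R y)"
        have Lh: "FArr L h \<in> hom D (FObj L x) (FObj L (FObj R y))"
          by (rule functor_hom[OF L h])
        have "FArr R (\<epsilon> y \<cdot>\<^bsub>D\<^esub> FArr L h) \<cdot>\<^bsub>C\<^esub> \<eta> x = (FArr R (\<epsilon> y) \<cdot>\<^bsub>C\<^esub> FArr R (FArr L h)) \<cdot>\<^bsub>C\<^esub> \<eta> x"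
          by (simp add: functor_comp[OF R Lh \<epsilon>h[OF y]])
        also have "\<dots> = FArr R (\<epsilon> y) \<cdot>\<^bsub>C\<^esub> (FArr R (FArr L h) \<cdot>\<^bsub>C\<^esub> \<eta> x)"
          by (rule cat_assoc[OF C \<eta>h[OF x] functor_hom[OF R Lh] functor_hom[OF R \<epsilon>h[OF y]]])
        also have "FArr R (FArr L h) \<cdot>\<^bsub>C\<^esub> \<eta> x = \<eta> (FObj R y) \<cdot>\<^bsub>C\<^esub> h"
          using nat_trans_natural[OF \<eta> h] by simp
        also have "FArr R (\<epsilon> y) \<cdot>\<^bsub>C\<^esub> (\<eta> (FObj R y) \<cdot>\<^bsub>C\<^esub> h) = (FArr R (\<epsilon> y) \<cdot>\<^bsub>C\<^esub> \<eta> (FObj R y)) \<cdot>\<^bsub>C\<^esub> h"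
          by (rule cat_assoc[OF C h \<eta>h[OF functor_obj[OF R y]] functor_hom[OF R \<epsilon>h[OF y]], symmetric])
        also have "\<dots> = h"
          by (simp add: t2[OF y] cat_id_left[OF C h])
        finally show "FArr R (\<epsilon> y \<cdot>\<^bsub>D\<^esub> FArr L h) \<cdot>\<^bsub>C\<^esub> \<eta> x = h" .
      qed
    qed (auto intro!: cat_comp[OF C \<eta>h[OF x]] cat_comp[OF D _ \<epsilon>h[OF y]] functor_hom[OF R] functor_hom[OF L])
  qed (use \<eta>h in auto)
qed

text \<open>Uniqueness of factorizations through \<open>\<eta>\<close> does all the work: functor
  laws, naturality of the counit and the triangle identities are equations between arrows out of
  some \<open>L0 x\<close>, checked after transposition. The action of \<open>L\<close> on arrows is
  never given by hand; the last conclusion is what determines it.\<close>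

lemma adjunction_universal:
  assumes R: "is_functor D C R"
    and L0: "\<And>x. x \<in> Obj C \<Longrightarrow> L0 x \<in> Obj D"
    and \<eta>: "\<And>x. x \<in> Obj C \<Longrightarrow> \<eta> x \<in> hom C x (FObj R (L0 x))"
    and univ: "\<And>x y f. x \<in> Obj C \<Longrightarrow> y \<in> Obj D \<Longrightarrow> f \<in> hom C x (FObj R y) \<Longrightarrow>
      \<exists>!g. g \<in> hom D (L0 x) y \<and> FArr R g \<cdot>\<^bsub>C\<^esub> \<eta> x = f"
  obtains L where "adjunction C D L R" "\<And>x. FObj L x = L0 x"
    and "\<And>f x x'. f \<in> hom C x x' \<Longrightarrow> FArr R (FArr L f) \<cdot>\<^bsub>C\<^esub> \<eta> x = \<eta> x' \<cdot>\<^bsub>C\<^esub> f"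
proof -
  note C = functor_cod[OF R] and D = functor_dom[OF R]
  define ext where "ext x y f = (THE g. g \<in> hom D (L0 x) y \<and> FArr R g \<cdot>\<^bsub>C\<^esub> \<eta> x = f)" for x y f
  have ext: "ext x y f \<in> hom D (L0 x) y" "FArr R (ext x y f) \<cdot>\<^bsub>C\<^esub> \<eta> x = f"
    if "x \<in> Obj C" "y \<in> Obj D" "f \<in> hom C x (FObj R y)" for x y f
    using theI'[OF univ[OF that]] unfolding ext_def by auto
  have uniq: "g = h" if "x \<in> Obj C" "g \<in> hom D (L0 x) y" "h \<in> hom D (L0 x) y"
    "FArr R g \<cdot>\<^bsub>C\<^esub> \<eta> x = FArr R h \<cdot>\<^bsub>C\<^esub> \<eta> x" for x y g h
  proof -
    have "FArr R h \<cdot>\<^bsub>C\<^esub> \<eta> x \<in> hom C x (FObj R y)"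
      using cat_comp[OF C \<eta> functor_hom[OF R]] that by blast
    moreover have "y \<in> Obj D"
      using cat_cod[OF D that(2)] .
    ultimately show ?thesis
      using univ[of x y] that by blast
  qed
  define L where "L = \<lparr>FObj = L0, FArr = (\<lambda>f. ext (Src C f) (L0 (Tgt C f)) (\<eta> (Tgt C f) \<cdot>\<^bsub>C\<^esub> f))\<rparr>"
  have LO: "FObj L x = L0 x" for x
    by (simp add: L_def)
  have LA: "FArr L f \<in> hom D (L0 x) (L0 x')" "FArr R (FArr L f) \<cdot>\<^bsub>C\<^esub> \<eta> x = \<eta> x' \<cdot>\<^bsub>C\<^esub> f"
    if f: "f \<in> hom C x x'" for f x x'
    using ext[of x "L0 x'" "\<eta> x' \<cdot>\<^bsub>C\<^esub> f"] L0 cat_dom[OF C f] cat_cod[OF C f] cat_comp[OF C f \<eta>]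
    by (simp_all add: L_def hom_src[OF f] hom_tgt[OF f])
  have LF: "is_functor C D L"
  proof (rule is_functorI[OF C D])
    fix x assume x: "x \<in> Obj C"
    show "FArr L (Id C x) = Id D (FObj L x)"
      using uniq[OF x LA(1)[OF cat_Id[OF C x]] cat_Id[OF D L0[OF x]]] LA(2)[OF cat_Id[OF C x]]
      by (simp add: LO functor_id[OF R L0[OF x]] cat_id_left[OF C \<eta>[OF x]] cat_id_right[OF C \<eta>[OF x]])
  next
    fix x y z f g assume f: "f \<in> hom C x y" and g: "g \<in> hom C y z"
    have x: "x \<in> Obj C" and y: "y \<in> Obj C" and z: "z \<in> Obj C"
      using cat_dom[OF C f] cat_dom[OF C g] cat_cod[OF C g] .
    have gf: "g \<cdot>\<^bsub>C\<^esub> f \<in> hom C x z"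
      by (rule cat_comp[OF C f g])
    have "FArr R (FArr L g \<cdot>\<^bsub>D\<^esub> FArr L f) \<cdot>\<^bsub>C\<^esub> \<eta> x = FArr R (FArr L g) \<cdot>\<^bsub>C\<^esub> (\<eta> y \<cdot>\<^bsub>C\<^esub> f)"
      by (simp add: functor_comp[OF R LA(1)[OF f] LA(1)[OF g]]
          cat_assoc[OF C \<eta>[OF x] functor_hom[OF R LA(1)[OF f]] functor_hom[OF R LA(1)[OF g]]]
          LA(2)[OF f])
    also have "\<dots> = (FArr R (FArr L g) \<cdot>\<^bsub>C\<^esub> \<eta> y) \<cdot>\<^bsub>C\<^esub> f"
      by (rule cat_assoc[OF C f \<eta>[OF y] functor_hom[OF R LA(1)[OF g]], symmetric])
    also have "\<dots> = \<eta> z \<cdot>\<^bsub>C\<^esub> (g \<cdot>\<^bsub>C\<^esub> f)"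
      by (simp add: LA(2)[OF g] cat_assoc[OF C f g \<eta>[OF z]])
    finally have "FArr R (FArr L g \<cdot>\<^bsub>D\<^esub> FArr L f) \<cdot>\<^bsub>C\<^esub> \<eta> x = FArr R (FArr L (g \<cdot>\<^bsub>C\<^esub> f)) \<cdot>\<^bsub>C\<^esub> \<eta> x"
      by (simp add: LA(2)[OF gf])
    then show "FArr L (g \<cdot>\<^bsub>C\<^esub> f) = FArr L g \<cdot>\<^bsub>D\<^esub> FArr L f"
      using uniq[OF x LA(1)[OF gf] cat_comp[OF D LA(1)[OF f] LA(1)[OF g]]] by simp
  qed (use LO L0 LA in auto)
  \<comment> \<open>The counit is the extension of the identity of \<open>FObj R y\<close> along the
    unit.\<close>
  define \<epsilon> where "\<epsilon> y = ext (FObj R y) y (Id C (FObj R y))" for y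
  have \<epsilon>: "\<epsilon> y \<in> hom D (L0 (FObj R y)) y" "FArr R (\<epsilon> y) \<cdot>\<^bsub>C\<^esub> \<eta> (FObj R y) = Id C (FObj R y)"
    if y: "y \<in> Obj D" for y
    using ext[OF functor_obj[OF R y] y cat_Id[OF C functor_obj[OF R y]]] by (simp_all add: \<epsilon>_def)
  have "nat_trans C C id_functor (R \<odot> L) \<eta>"
    by (intro nat_transI is_functor_id[OF C] is_functor_comp[OF LF R]) (auto simp: LO \<eta> LA)
  moreover have "nat_trans D D (L \<odot> R) id_functor \<epsilon>"
  proof (intro nat_transI is_functor_id[OF D] is_functor_comp[OF R LF])
    fix y z g assume g: "g \<in> hom D y z"
    have y: "y \<in> Obj D" and z: "z \<in> Obj D"
      using cat_dom[OF D g] cat_cod[OF D g] .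
    note Ry = functor_obj[OF R y] and Rz = functor_obj[OF R z] and Rg = functor_hom[OF R g]
    have "FArr R (\<epsilon> z \<cdot>\<^bsub>D\<^esub> FArr L (FArr R g)) \<cdot>\<^bsub>C\<^esub> \<eta> (FObj R y)
        = FArr R (\<epsilon> z) \<cdot>\<^bsub>C\<^esub> (\<eta> (FObj R z) \<cdot>\<^bsub>C\<^esub> FArr R g)"
      by (simp add: functor_comp[OF R LA(1)[OF Rg] \<epsilon>(1)[OF z]] LA(2)[OF Rg]
          cat_assoc[OF C \<eta>[OF Ry] functor_hom[OF R LA(1)[OF Rg]] functor_hom[OF R \<epsilon>(1)[OF z]]])
    also have "\<dots> = (FArr R (\<epsilon> z) \<cdot>\<^bsub>C\<^esub> \<eta> (FObj R z)) \<cdot>\<^bsub>C\<^esub> FArr R g"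
      by (rule cat_assoc[OF C Rg \<eta>[OF Rz] functor_hom[OF R \<epsilon>(1)[OF z]], symmetric])
    also have "\<dots> = FArr R g \<cdot>\<^bsub>C\<^esub> (FArr R (\<epsilon> y) \<cdot>\<^bsub>C\<^esub> \<eta> (FObj R y))"
      by (simp add: \<epsilon>(2)[OF z] \<epsilon>(2)[OF y] cat_id_left[OF C Rg] cat_id_right[OF C Rg])
    also have "\<dots> = FArr R (g \<cdot>\<^bsub>D\<^esub> \<epsilon> y) \<cdot>\<^bsub>C\<^esub> \<eta> (FObj R y)"
      by (simp add: functor_comp[OF R \<epsilon>(1)[OF y] g]
          cat_assoc[OF C \<eta>[OF Ry] functor_hom[OF R \<epsilon>(1)[OF y]] Rg])
    finally show "FArr id_functor g \<cdot>\<^bsub>D\<^esub> \<epsilon> y = \<epsilon> z \<cdot>\<^bsub>D\<^esub> FArr (L \<odot> R) g"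
      using uniq[OF Ry cat_comp[OF D \<epsilon>(1)[OF y] g] cat_comp[OF D LA(1)[OF Rg] \<epsilon>(1)[OF z]]]
      by simp
  qed (auto simp: LO \<epsilon>)
  moreover have "\<epsilon> (FObj L x) \<cdot>\<^bsub>D\<^esub> FArr L (\<eta> x) = Id D (FObj L x)" if x: "x \<in> Obj C" for x
  proof -
    note e = \<epsilon>[OF L0[OF x]] and l = LA[OF \<eta>[OF x]] and Rx = functor_obj[OF R L0[OF x]]
    have "FArr R (\<epsilon> (L0 x) \<cdot>\<^bsub>D\<^esub> FArr L (\<eta> x)) \<cdot>\<^bsub>C\<^esub> \<eta> x
        = FArr R (\<epsilon> (L0 x)) \<cdot>\<^bsub>C\<^esub> (\<eta> (FObj R (L0 x)) \<cdot>\<^bsub>C\<^esub> \<eta> x)"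
      by (simp add: functor_comp[OF R l(1) e(1)] l(2)
          cat_assoc[OF C \<eta>[OF x] functor_hom[OF R l(1)] functor_hom[OF R e(1)]])
    also have "\<dots> = (FArr R (\<epsilon> (L0 x)) \<cdot>\<^bsub>C\<^esub> \<eta> (FObj R (L0 x))) \<cdot>\<^bsub>C\<^esub> \<eta> x"
      by (rule cat_assoc[OF C \<eta>[OF x] \<eta>[OF Rx] functor_hom[OF R e(1)], symmetric])
    also have "\<dots> = FArr R (Id D (L0 x)) \<cdot>\<^bsub>C\<^esub> \<eta> x"
      by (simp add: e(2) functor_id[OF R L0[OF x]])
    finally show ?thesis
      using uniq[OF x cat_comp[OF D l(1) e(1)] cat_Id[OF D L0[OF x]]] by (simp add: LO)
  qed
  ultimately have "adjunction C D L R"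
    unfolding adjunction_def using LF R \<epsilon>(2) by blast
  then show thesis
    using that LO LA by blast
qed


section \<open>The category of sets\<close>

definition set_arr :: "'v set \<Rightarrow> ('v \<Rightarrow> 'v) \<Rightarrow> 'v set \<Rightarrow> 'v set_arr" where
  "set_arr X f Y = (X, restrict f X, Y)"

lemma set_app_arr [simp]: "x \<in> X \<Longrightarrow> set_app (set_arr X f Y) x = f x"
  by (simp add: set_app_def set_arr_def)

lemma SetC_simps [simp]: "Obj SetC = {X. small X}" "Id SetC X = set_arr X (\<lambda>x. x) X"
  by (simp_all add: SetC_def set_arr_def)

lemma hom_SetC: "\<phi> \<in> hom SetC X Y \<longleftrightarrow> small X \<and> small Y \<and> (\<exists>f\<in>X \<rightarrow>\<^sub>E Y. \<phi> = (X, f, Y))"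
  by (auto simp: SetC_def hom_def)

lemma set_arr_hom: "small X \<Longrightarrow> small Y \<Longrightarrow> (\<And>x. x \<in> X \<Longrightarrow> f x \<in> Y) \<Longrightarrow> set_arr X f Y \<in> hom SetC X Y"
  by (auto simp: hom_SetC set_arr_def)

lemma set_app_in: "\<phi> \<in> hom SetC X Y \<Longrightarrow> x \<in> X \<Longrightarrow> set_app \<phi> x \<in> Y"
  by (auto simp: hom_SetC set_app_def)

lemma SetC_eqI:
  "\<phi> \<in> hom SetC X Y \<Longrightarrow> \<psi> \<in> hom SetC X Y \<Longrightarrow> (\<And>x. x \<in> X \<Longrightarrow> set_app \<phi> x = set_app \<psi> x) \<Longrightarrow> \<phi> = \<psi>"
  by (auto simp: hom_SetC set_app_def intro: PiE_ext)

lemma SetC_Comp: "(Y', g, Z) \<cdot>\<^bsub>SetC\<^esub> (X, f, Y) = (X, compose X g f, Z)"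
  by (simp add: SetC_def)

lemma SetC_comp: "\<phi> \<in> hom SetC X Y \<Longrightarrow> \<psi> \<in> hom SetC Y Z \<Longrightarrow> \<psi> \<cdot>\<^bsub>SetC\<^esub> \<phi> \<in> hom SetC X Z"
  by (auto simp: hom_SetC SetC_Comp compose_def PiE_def Pi_def)

lemma set_app_comp [simp]:
  "\<phi> \<in> hom SetC X Y \<Longrightarrow> \<psi> \<in> hom SetC Y Z \<Longrightarrow> x \<in> X \<Longrightarrow>
    set_app (\<psi> \<cdot>\<^bsub>SetC\<^esub> \<phi>) x = set_app \<psi> (set_app \<phi> x)"
  by (auto simp: hom_SetC SetC_Comp set_app_def compose_def)

lemma SetC_arr_eq: "\<phi> \<in> hom SetC X Y \<Longrightarrow> set_arr X (set_app \<phi>) Y = \<phi>"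
  by (auto simp: hom_SetC set_arr_def set_app_def intro: PiE_restrict)

lemma SetC_Id_hom: "small X \<Longrightarrow> set_arr X (\<lambda>x. x) X \<in> hom SetC X X"
  by (rule set_arr_hom)

lemma category_SetC: "category SetC"
proof (rule categoryI)
  fix f :: "'a set_arr"
  assume "f \<in> Arr SetC"
  then show "Src SetC f \<in> Obj SetC \<and> Tgt SetC f \<in> Obj SetC"
    by (auto simp: SetC_def)
next
  fix X Y :: "'a set" and f
  assume f: "f \<in> hom SetC X Y"
  then have sm: "small X" "small Y"
    by (auto simp: hom_SetC)
  show "f \<cdot>\<^bsub>SetC\<^esub> Id SetC X = f"
    by (rule SetC_eqI[of _ X Y])
      (use f sm SetC_Id_hom[OF sm(1)] in \<open>auto simp: intro: SetC_comp\<close>)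
  show "Id SetC Y \<cdot>\<^bsub>SetC\<^esub> f = f"
    by (rule SetC_eqI[of _ X Y])
      (use f sm SetC_Id_hom[OF sm(2)] in \<open>auto simp: set_app_in intro: SetC_comp\<close>)
next
  fix X Y Z W :: "'a set" and f g h
  assume h: "f \<in> hom SetC X Y" "g \<in> hom SetC Y Z" "h \<in> hom SetC Z W"
  note gf = SetC_comp[OF h(1,2)] and hg = SetC_comp[OF h(2,3)]
  show "h \<cdot>\<^bsub>SetC\<^esub> (g \<cdot>\<^bsub>SetC\<^esub> f) = h \<cdot>\<^bsub>SetC\<^esub> g \<cdot>\<^bsub>SetC\<^esub> f"
    by (rule SetC_eqI[of _ X W])
      (use h gf hg in \<open>auto simp: set_app_in intro: SetC_comp\<close>)
qed (auto intro: SetC_Id_hom SetC_comp)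

lemma is_iso_SetC:
  assumes f: "f \<in> hom SetC X Y" and bij: "bij_betw (set_app f) X Y"
  shows "is_iso SetC f"
proof -
  define h where "h = the_inv_into X (set_app f)"
  have hY: "h y \<in> X" "set_app f (h y) = y" if "y \<in> Y" for y
    using that bij f_the_inv_into_f_bij_betw[OF bij] the_inv_into_into[of "set_app f" X y X]
    by (auto simp: h_def bij_betw_def)
  have hX: "h (set_app f x) = x" if "x \<in> X" for x
    using that bij by (auto simp: h_def bij_betw_def intro: the_inv_into_f_f)
  have sm: "small X" "small Y"
    using f by (auto simp: hom_SetC)
  have g: "set_arr Y h X \<in> hom SetC Y X"
    using hY sm by (intro set_arr_hom) auto
  have "set_arr Y h X \<cdot>\<^bsub>SetC\<^esub> f = Id SetC X"
    by (rule SetC_eqI[OF SetC_comp[OF f g]])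
      (use f g hX sm in \<open>auto simp: set_app_in intro: SetC_Id_hom\<close>)
  moreover have "f \<cdot>\<^bsub>SetC\<^esub> set_arr Y h X = Id SetC Y"
    by (rule SetC_eqI[OF SetC_comp[OF g f]])
      (use f g hY sm in \<open>auto simp: set_app_in intro: SetC_Id_hom\<close>)
  ultimately show ?thesis
    using g by (auto simp: is_iso_hom[OF f])
qed

section \<open>Sheaves\<close>

text \<open>Presheaves as plain restriction functions, without the extensional arrows of
  \<open>SetC\<close>. Sheaves can then be built and checked elementwise, and
  \<open>mk_presheaf\<close> packs the result into a functor.\<close>

definition presheaf_data ::
  "('o, 'a, 'z) cat_scheme \<Rightarrow> ('o \<Rightarrow> 'v::universe set) \<Rightarrow> ('a \<Rightarrow> 'v \<Rightarrow> 'v) \<Rightarrow> bool" where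
  "presheaf_data C ob r \<longleftrightarrow>
     (\<forall>c\<in>Obj C. small (ob c) \<and> (\<forall>x\<in>ob c. r (Id C c) x = x)) \<and>
     (\<forall>c d f x. f \<in> hom C c d \<longrightarrow> x \<in> ob d \<longrightarrow> r f x \<in> ob c) \<and>
     (\<forall>b c d f g x. f \<in> hom C c d \<longrightarrow> g \<in> hom C b c \<longrightarrow> x \<in> ob d \<longrightarrow> r (f \<cdot>\<^bsub>C\<^esub> g) x = r g (r f x))"

definition matching ::
  "('o, 'a, 'z) cat_scheme \<Rightarrow> ('o \<Rightarrow> 'v set) \<Rightarrow> ('a \<Rightarrow> 'v \<Rightarrow> 'v) \<Rightarrow> 'a set \<Rightarrow> ('a \<Rightarrow> 'v) \<Rightarrow> bool" where
  "matching C ob r R x \<longleftrightarrow> (\<forall>f\<in>R. x f \<in> ob (Src C f)) \<and>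
     (\<forall>f\<in>R. \<forall>g\<in>R. \<forall>h\<in>Arr C. \<forall>k\<in>Arr C.
        Tgt C h = Src C f \<longrightarrow> Tgt C k = Src C g \<longrightarrow> Src C h = Src C k \<longrightarrow> f \<cdot>\<^bsub>C\<^esub> h = g \<cdot>\<^bsub>C\<^esub> k \<longrightarrow>
        r h (x f) = r k (x g))"

definition sheaf_data ::
  "('o, 'a, 'z) cat_scheme \<Rightarrow> ('o \<Rightarrow> 'a set set) \<Rightarrow> ('o \<Rightarrow> 'v::universe set) \<Rightarrow> ('a \<Rightarrow> 'v \<Rightarrow> 'v) \<Rightarrow> bool"
  where
  "sheaf_data C K ob r \<longleftrightarrow> presheaf_data C ob r \<and>
     (\<forall>c\<in>Obj C. \<forall>R\<in>K c. \<forall>x. matching C ob r R x \<longrightarrow> (\<exists>!y. y \<in> ob c \<and> (\<forall>f\<in>R. r f y = x f)))"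

definition mk_presheaf ::
  "('o, 'a, 'z) cat_scheme \<Rightarrow> ('o \<Rightarrow> 'v set) \<Rightarrow> ('a \<Rightarrow> 'v \<Rightarrow> 'v) \<Rightarrow> ('o, 'a, 'v) presheaf" where
  "mk_presheaf C ob r = \<lparr>FObj = ob, FArr = (\<lambda>f. set_arr (ob (Tgt C f)) (r f) (ob (Src C f)))\<rparr>"

abbreviation res :: "('o, 'a, 'v) presheaf \<Rightarrow> 'a \<Rightarrow> 'v \<Rightarrow> 'v" where
  "res P f x \<equiv> set_app (FArr P f) x"

text \<open>Common to the two kinds of coverings in use, sieves of a topology and single arrows, so
  that uniqueness of amalgamations is proved once for both.\<close>

definition covers_into :: "('o, 'a, 'z) cat_scheme \<Rightarrow> ('o \<Rightarrow> 'a set set) \<Rightarrow> bool" where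
  "covers_into C K \<longleftrightarrow> (\<forall>c\<in>Obj C. \<forall>R\<in>K c. R \<subseteq> {f \<in> Arr C. Tgt C f = c})"

lemma presheaf_dataD:
  assumes "presheaf_data C ob r"
  shows presheaf_small: "c \<in> Obj C \<Longrightarrow> small (ob c)"
    and presheaf_Id: "c \<in> Obj C \<Longrightarrow> x \<in> ob c \<Longrightarrow> r (Id C c) x = x"
    and presheaf_in: "f \<in> hom C c d \<Longrightarrow> x \<in> ob d \<Longrightarrow> r f x \<in> ob c"
    and presheaf_comp: "f \<in> hom C c d \<Longrightarrow> g \<in> hom C b c \<Longrightarrow> x \<in> ob d \<Longrightarrow>
      r (f \<cdot>\<^bsub>C\<^esub> g) x = r g (r f x)"
  using assms unfolding presheaf_data_def by blast+

lemma sheaf_presheaf: "sheaf_data C K ob r \<Longrightarrow> presheaf_data C ob r"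
  by (simp add: sheaf_data_def)

lemma sheaf_glue:
  "sheaf_data C K ob r \<Longrightarrow> c \<in> Obj C \<Longrightarrow> R \<in> K c \<Longrightarrow> matching C ob r R x \<Longrightarrow>
    \<exists>!y. y \<in> ob c \<and> (\<forall>f\<in>R. r f y = x f)"
  by (simp add: sheaf_data_def)

text \<open>The restrictions of \<open>x\<close> form a matching family, and by \<open>eq\<close>
  both \<open>x\<close> and \<open>y\<close> amalgamate it.\<close>

lemma sheaf_separated:
  assumes sh: "sheaf_data C K ob r" and C: "category C" and into: "covers_into C K"
    and c: "c \<in> Obj C" "R \<in> K c" and xy: "x \<in> ob c" "y \<in> ob c"
    and eq: "\<And>f. f \<in> R \<Longrightarrow> r f x = r f y"
  shows "x = y"
proof -
  have R: "f \<in> hom C (Src C f) c" if "f \<in> R" for f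
    using that into c by (auto simp: covers_into_def in_hom)
  have "matching C ob r R (\<lambda>f. r f x)"
    unfolding matching_def
  proof (intro conjI ballI impI)
    fix f assume "f \<in> R"
    then show "r f x \<in> ob (Src C f)"
      using presheaf_in[OF sheaf_presheaf[OF sh] R xy(1)] by blast
  next
    fix f g h k
    assume *: "f \<in> R" "g \<in> R" "h \<in> Arr C" "k \<in> Arr C" "Tgt C h = Src C f" "Tgt C k = Src C g"
      "Src C h = Src C k" "f \<cdot>\<^bsub>C\<^esub> h = g \<cdot>\<^bsub>C\<^esub> k"
    have "h \<in> hom C (Src C h) (Src C f)" "k \<in> hom C (Src C h) (Src C g)"
      using * by (auto simp: in_hom)
    then show "r h (r f x) = r k (r g x)"
      using presheaf_comp[OF sheaf_presheaf[OF sh] R[OF *(1)] _ xy(1)]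
        presheaf_comp[OF sheaf_presheaf[OF sh] R[OF *(2)] _ xy(1)] *(8) by metis
  qed
  from sheaf_glue[OF sh c this] show ?thesis
    using xy eq by metis
qed

lemma sheaf_dataI:
  assumes "is_sheaf C K P" "category C"
  shows "sheaf_data C K (FObj P) (res P)"
proof -
  have P: "is_functor (op C) SetC P"
    using assms by (simp add: is_sheaf_def)
  have hom: "FArr P f \<in> hom SetC (FObj P d) (FObj P c)" if "f \<in> hom C c d" for f c d
    using functor_hom[OF P] that by simp
  have "presheaf_data C (FObj P) (res P)"
    unfolding presheaf_data_def
  proof (intro conjI ballI allI impI)
    fix c assume c: "c \<in> Obj C"
    show "small (FObj P c)"
      using functor_obj[OF P] c by simp
    show "res P (Id C c) x = x" if "x \<in> FObj P c" for x
      using functor_id[OF P] c that by simp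
  next
    fix c d f x assume "f \<in> hom C c d" "x \<in> FObj P d"
    then show "res P f x \<in> FObj P c"
      using set_app_in[OF hom] by blast
  next
    fix b c d f g x assume f: "f \<in> hom C c d" and g: "g \<in> hom C b c" and x: "x \<in> FObj P d"
    then show "res P (f \<cdot>\<^bsub>C\<^esub> g) x = res P g (res P f x)"
      using functor_comp[OF P, of f d c g b] set_app_comp[OF hom[OF f] hom[OF g] x] by simp
  qed
  then show ?thesis
    using assms(1) unfolding sheaf_data_def is_sheaf_def matching_def matching_family_def
    by (elim conjE, intro conjI)
qed

lemma is_functor_mk_presheaf:
  assumes C: "category C" and p: "presheaf_data C ob r"
  shows "is_functor (op C) SetC (mk_presheaf C ob r)"
proof (rule is_functorI[OF category_op[OF C] category_SetC])
  show "FObj (mk_presheaf C ob r) x \<in> Obj SetC" if "x \<in> Obj (op C)" for x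
    using that presheaf_small[OF p] by (simp add: mk_presheaf_def)
  show h: "FArr (mk_presheaf C ob r) f \<in> hom SetC (FObj (mk_presheaf C ob r) x) (FObj (mk_presheaf C ob r) y)"
    if "f \<in> hom (op C) x y" for x y f
  proof -
    have f: "f \<in> hom C y x"
      using that by simp
    have "set_arr (ob x) (r f) (ob y) \<in> hom SetC (ob x) (ob y)"
      using presheaf_in[OF p f] presheaf_small[OF p cat_dom[OF C f]] presheaf_small[OF p cat_cod[OF C f]]
      by (intro set_arr_hom)
    then show ?thesis
      by (simp add: mk_presheaf_def hom_src[OF f] hom_tgt[OF f])
  qed
  show "FArr (mk_presheaf C ob r) (Id (op C) x) = Id SetC (FObj (mk_presheaf C ob r) x)"
    if x: "x \<in> Obj (op C)" for x
  proof (rule SetC_eqI)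
    show "FArr (mk_presheaf C ob r) (Id (op C) x)
        \<in> hom SetC (FObj (mk_presheaf C ob r) x) (FObj (mk_presheaf C ob r) x)"
      using x by (intro h) (simp add: cat_Id[OF C])
    show "Id SetC (FObj (mk_presheaf C ob r) x)
        \<in> hom SetC (FObj (mk_presheaf C ob r) x) (FObj (mk_presheaf C ob r) x)"
      using x presheaf_small[OF p] by (auto simp: mk_presheaf_def intro: SetC_Id_hom)
  qed (use x cat_Id[OF C, of x] in \<open>auto simp: mk_presheaf_def in_hom presheaf_Id[OF p]\<close>)
  show "FArr (mk_presheaf C ob r) (g \<cdot>\<^bsub>op C\<^esub> f)
      = FArr (mk_presheaf C ob r) g \<cdot>\<^bsub>SetC\<^esub> FArr (mk_presheaf C ob r) f"
    if f: "f \<in> hom (op C) x y" and g: "g \<in> hom (op C) y z" for x y z f g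
  proof (rule SetC_eqI)
    show "FArr (mk_presheaf C ob r) (g \<cdot>\<^bsub>op C\<^esub> f)
        \<in> hom SetC (FObj (mk_presheaf C ob r) x) (FObj (mk_presheaf C ob r) z)"
      by (intro h cat_comp[OF category_op[OF C] f g])
    show "FArr (mk_presheaf C ob r) g \<cdot>\<^bsub>SetC\<^esub> FArr (mk_presheaf C ob r) f
        \<in> hom SetC (FObj (mk_presheaf C ob r) x) (FObj (mk_presheaf C ob r) z)"
      by (rule SetC_comp[OF h[OF f] h[OF g]])
    fix u assume u: "u \<in> FObj (mk_presheaf C ob r) x"
    then have "r f u \<in> ob y"
      using presheaf_in[OF p] f by (auto simp: mk_presheaf_def)
    then show "set_app (FArr (mk_presheaf C ob r) (g \<cdot>\<^bsub>op C\<^esub> f)) u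
        = set_app (FArr (mk_presheaf C ob r) g \<cdot>\<^bsub>SetC\<^esub> FArr (mk_presheaf C ob r) f) u"
      using u set_app_comp[OF h[OF f] h[OF g] u] f g cat_comp[OF C, of g z y f x]
        presheaf_comp[OF p, of f y x g z u]
      by (simp add: mk_presheaf_def in_hom)
  qed
qed

lemma mk_presheaf_simps [simp]:
  "FObj (mk_presheaf C ob r) = ob"
  "f \<in> hom C c d \<Longrightarrow> x \<in> ob d \<Longrightarrow> set_app (FArr (mk_presheaf C ob r) f) x = r f x"
  by (auto simp: mk_presheaf_def in_hom)

lemma is_sheaf_mk_presheaf:
  assumes C: "category C" and into: "covers_into C K" and sh: "sheaf_data C K ob r"
  shows "is_sheaf C K (mk_presheaf C ob r)"
  unfolding is_sheaf_def
proof (intro conjI ballI allI impI)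
  show "is_functor (op C) SetC (mk_presheaf C ob r)"
    by (rule is_functor_mk_presheaf[OF C sheaf_presheaf[OF sh]])
next
  fix c R x
  assume c: "c \<in> Obj C" "R \<in> K c" and m: "matching_family C (mk_presheaf C ob r) R x"
  have R: "f \<in> hom C (Src C f) c" if "f \<in> R" for f
    using that into c by (auto simp: covers_into_def in_hom)
  have x: "x f \<in> ob (Src C f)" if "f \<in> R" for f
    using m that by (simp add: matching_family_def)
  have "matching C ob r R x"
    unfolding matching_def
  proof (intro conjI ballI impI)
    fix f g h k
    assume *: "f \<in> R" "g \<in> R" "h \<in> Arr C" "k \<in> Arr C" "Tgt C h = Src C f" "Tgt C k = Src C g"
      "Src C h = Src C k" "f \<cdot>\<^bsub>C\<^esub> h = g \<cdot>\<^bsub>C\<^esub> k"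
    then have "set_app (FArr (mk_presheaf C ob r) h) (x f) = set_app (FArr (mk_presheaf C ob r) k) (x g)"
      using m unfolding matching_family_def by blast
    then show "r h (x f) = r k (x g)"
      using x[OF *(1)] x[OF *(2)] *(5,6) by (simp add: mk_presheaf_def)
  qed (rule x)
  from sheaf_glue[OF sh c this]
  have "\<exists>!y. y \<in> ob c \<and> (\<forall>f\<in>R. r f y = x f)" .
  moreover have "(y \<in> FObj (mk_presheaf C ob r) c \<and> (\<forall>f\<in>R. set_app (FArr (mk_presheaf C ob r) f) y = x f))
      \<longleftrightarrow> (y \<in> ob c \<and> (\<forall>f\<in>R. r f y = x f))" for y
    using mk_presheaf_simps(2)[OF R, of _ y ob r] by auto
  ultimately show "\<exists>!y. y \<in> FObj (mk_presheaf C ob r) c \<and> (\<forall>f\<in>R. set_app (FArr (mk_presheaf C ob r) f) y = x f)"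
    by presburger
qed

section \<open>Morphisms of sheaves through their action on elements\<close>

definition app :: "'p \<times> ('o \<Rightarrow> 'v set_arr) \<times> 'q \<Rightarrow> 'o \<Rightarrow> 'v \<Rightarrow> 'v" where
  "app \<tau> c = set_app (fst (snd \<tau>) c)"

definition mk_trans ::
  "('o, 'a, 'z) cat_scheme \<Rightarrow> ('o, 'a, 'v) presheaf \<Rightarrow> ('o \<Rightarrow> 'v \<Rightarrow> 'v) \<Rightarrow> ('o, 'a, 'v) presheaf \<Rightarrow>
    ('o, 'a, 'v) presheaf \<times> ('o \<Rightarrow> 'v set_arr) \<times> ('o, 'a, 'v) presheaf" where
  "mk_trans C P t Q = (P, \<lambda>c\<in>Obj C. set_arr (FObj P c) (t c) (FObj Q c), Q)"

lemma app_mk_trans [simp]: "c \<in> Obj C \<Longrightarrow> x \<in> FObj P c \<Longrightarrow> app (mk_trans C P t Q) c x = t c x"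
  by (simp add: app_def mk_trans_def)

lemma Obj_Sh [simp]: "P \<in> Obj (Sh C K) \<longleftrightarrow> is_sheaf C K P"
  by (simp add: Sh_def)

lemma hom_Sh: "\<tau> \<in> hom (Sh C K) P Q \<longleftrightarrow> is_sheaf C K P \<and> is_sheaf C K Q \<and>
    (\<exists>t. \<tau> = (P, t, Q) \<and> nat_trans (op C) SetC P Q t \<and> t \<in> extensional (Obj C))"
  by (auto simp: Sh_def hom_def)

lemma Sh_homE:
  assumes "\<tau> \<in> hom (Sh C K) P Q"
  shows Sh_dom: "is_sheaf C K P" and Sh_cod: "is_sheaf C K Q"
    and app_in: "c \<in> Obj C \<Longrightarrow> x \<in> FObj P c \<Longrightarrow> app \<tau> c x \<in> FObj Q c"
    and app_arr: "c \<in> Obj C \<Longrightarrow> fst (snd \<tau>) c \<in> hom SetC (FObj P c) (FObj Q c)"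
    and app_natural: "f \<in> hom C c d \<Longrightarrow> x \<in> FObj P d \<Longrightarrow>
      app \<tau> c (res P f x) = res Q f (app \<tau> d x)"
proof -
  from assms obtain t where t: "\<tau> = (P, t, Q)" "nat_trans (op C) SetC P Q t"
    and P: "is_sheaf C K P" and Q: "is_sheaf C K Q"
    unfolding hom_Sh by blast
  show "is_sheaf C K P" "is_sheaf C K Q"
    by fact+
  show arr: "fst (snd \<tau>) c \<in> hom SetC (FObj P c) (FObj Q c)" if "c \<in> Obj C" for c
    using nat_trans_hom[OF t(2)] that by (simp add: t)
  show "app \<tau> c x \<in> FObj Q c" if "c \<in> Obj C" "x \<in> FObj P c"
    using set_app_in[OF arr[OF that(1)] that(2)] by (simp add: app_def)
  assume f: "f \<in> hom C c d" and x: "x \<in> FObj P d"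
  have fn: "is_functor (op C) SetC P" "is_functor (op C) SetC Q"
    using P Q by (simp_all add: is_sheaf_def)
  have "category (op C)"
    by (rule functor_dom[OF fn(1)])
  then have cd: "c \<in> Obj C" "d \<in> Obj C"
    using f cat_dom[of "op C" f d c] cat_cod[of "op C" f d c] by simp_all
  have n: "FArr Q f \<cdot>\<^bsub>SetC\<^esub> t d = t c \<cdot>\<^bsub>SetC\<^esub> FArr P f"
    using nat_trans_natural[OF t(2), of f d c] f by simp
  have Pf: "FArr P f \<in> hom SetC (FObj P d) (FObj P c)" and Qf: "FArr Q f \<in> hom SetC (FObj Q d) (FObj Q c)"
    using functor_hom[OF fn(1), of f d c] functor_hom[OF fn(2), of f d c] f by simp_all
  have "set_app (FArr Q f \<cdot>\<^bsub>SetC\<^esub> t d) x = set_app (t c \<cdot>\<^bsub>SetC\<^esub> FArr P f) x"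
    by (simp add: n)
  then show "app \<tau> c (res P f x) = res Q f (app \<tau> d x)"
    using set_app_comp[OF arr[OF cd(2)] Qf x] set_app_comp[OF Pf arr[OF cd(1)] x]
    by (simp add: app_def t)
qed

lemma mk_trans_hom:
  assumes C: "category C" and P: "is_sheaf C K P" and Q: "is_sheaf C K Q"
    and t: "\<And>c x. c \<in> Obj C \<Longrightarrow> x \<in> FObj P c \<Longrightarrow> t c x \<in> FObj Q c"
    and nat: "\<And>c d f x. f \<in> hom C c d \<Longrightarrow> x \<in> FObj P d \<Longrightarrow> t c (res P f x) = res Q f (t d x)"
  shows "mk_trans C P t Q \<in> hom (Sh C K) P Q"
proof -
  have fn: "is_functor (op C) SetC P" "is_functor (op C) SetC Q"
    using P Q by (simp_all add: is_sheaf_def)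
  define s where "s = (\<lambda>c\<in>Obj C. set_arr (FObj P c) (t c) (FObj Q c))"
  have sh: "s c \<in> hom SetC (FObj P c) (FObj Q c)" if "c \<in> Obj C" for c
    using that t functor_obj[OF fn(1)] functor_obj[OF fn(2)] by (auto simp: s_def intro: set_arr_hom)
  have "nat_trans (op C) SetC P Q s"
  proof (rule nat_transI[OF fn])
    fix d c f assume "f \<in> hom (op C) d c"
    then have f: "f \<in> hom C c d"
      by simp
    have cd: "c \<in> Obj C" "d \<in> Obj C"
      using cat_dom[OF C f] cat_cod[OF C f] .
    have Pf: "FArr P f \<in> hom SetC (FObj P d) (FObj P c)" and Qf: "FArr Q f \<in> hom SetC (FObj Q d) (FObj Q c)"
      using functor_hom[OF fn(1), of f d c] functor_hom[OF fn(2), of f d c] f by simp_all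
    show "FArr Q f \<cdot>\<^bsub>SetC\<^esub> s d = s c \<cdot>\<^bsub>SetC\<^esub> FArr P f"
    proof (rule SetC_eqI[OF SetC_comp[OF sh Qf] SetC_comp[OF Pf sh]])
      fix x assume x: "x \<in> FObj P d"
      show "set_app (FArr Q f \<cdot>\<^bsub>SetC\<^esub> s d) x = set_app (s c \<cdot>\<^bsub>SetC\<^esub> FArr P f) x"
        using set_app_comp[OF sh[OF cd(2)] Qf x] set_app_comp[OF Pf sh[OF cd(1)] x]
          nat[OF f x] set_app_in[OF Pf x] cd x by (simp add: s_def)
    qed (rule cd)+
  qed (use sh in simp)
  then show ?thesis
    using P Q by (auto simp: hom_Sh mk_trans_def s_def[symmetric]) (simp add: s_def)
qed

text \<open>Components are extensional in the object and arrows of \<open>SetC\<close> are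
  extensional in the element, so equal values leave no room for different representatives.\<close>

lemma Sh_eqI:
  assumes \<sigma>: "\<sigma> \<in> hom (Sh C K) P Q" and \<tau>: "\<tau> \<in> hom (Sh C K) P Q"
    and eq: "\<And>c x. c \<in> Obj C \<Longrightarrow> x \<in> FObj P c \<Longrightarrow> app \<sigma> c x = app \<tau> c x"
  shows "\<sigma> = \<tau>"
proof -
  from \<sigma> \<tau> obtain s t where st: "\<sigma> = (P, s, Q)" "\<tau> = (P, t, Q)"
    "s \<in> extensional (Obj C)" "t \<in> extensional (Obj C)"
    unfolding hom_Sh by blast
  have "s c = t c" if "c \<in> Obj C" for c
    by (rule SetC_eqI[of _ "FObj P c" "FObj Q c"])
      (use app_arr[OF \<sigma> that] app_arr[OF \<tau> that] eq[OF that] in \<open>simp_all add: st app_def\<close>)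
  then have "s = t"
    using st by (auto intro: extensionalityI)
  then show ?thesis
    by (simp add: st)
qed

lemma Sh_comp:
  assumes \<tau>: "\<tau> \<in> hom (Sh C K) P Q" and \<sigma>: "\<sigma> \<in> hom (Sh C K) Q R"
  shows "\<sigma> \<cdot>\<^bsub>Sh C K\<^esub> \<tau> = mk_trans C P (\<lambda>c x. app \<sigma> c (app \<tau> c x)) R"
proof -
  from \<sigma> \<tau> obtain s t where st: "\<sigma> = (Q, s, R)" "\<tau> = (P, t, Q)"
    unfolding hom_Sh by blast
  have "s c \<cdot>\<^bsub>SetC\<^esub> t c = set_arr (FObj P c) (\<lambda>x. app \<sigma> c (app \<tau> c x)) (FObj R c)" if c: "c \<in> Obj C" for c
  proof -
    have t: "t c \<in> hom SetC (FObj P c) (FObj Q c)" and s: "s c \<in> hom SetC (FObj Q c) (FObj R c)"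
      using app_arr[OF \<tau> c] app_arr[OF \<sigma> c] by (simp_all add: st)
    have "small (FObj P c)" "small (FObj R c)"
      using s t by (auto simp: hom_SetC)
    then show ?thesis
      by (intro SetC_eqI[OF SetC_comp[OF t s]] set_arr_hom)
        (use t s c in \<open>auto simp: app_in[OF \<tau>] app_in[OF \<sigma>] set_app_comp[OF t s], auto simp: st app_def\<close>)
  qed
  then have eq: "(\<lambda>c\<in>Obj C. s c \<cdot>\<^bsub>SetC\<^esub> t c)
      = (\<lambda>c\<in>Obj C. set_arr (FObj P c) (\<lambda>x. app \<sigma> c (app \<tau> c x)) (FObj R c))"
    by (auto simp: restrict_def)
  have "\<sigma> \<cdot>\<^bsub>Sh C K\<^esub> \<tau> = (P, \<lambda>c\<in>Obj C. s c \<cdot>\<^bsub>SetC\<^esub> t c, R)"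
    by (simp add: Sh_def st)
  then show ?thesis
    by (simp add: eq mk_trans_def)
qed

lemma Sh_comp_hom:
  assumes C: "category C" and \<tau>: "\<tau> \<in> hom (Sh C K) P Q" and \<sigma>: "\<sigma> \<in> hom (Sh C K) Q R"
  shows "\<sigma> \<cdot>\<^bsub>Sh C K\<^esub> \<tau> \<in> hom (Sh C K) P R"
  unfolding Sh_comp[OF \<tau> \<sigma>]
proof (rule mk_trans_hom[OF C Sh_dom[OF \<tau>] Sh_cod[OF \<sigma>]])
  fix c d f x assume f: "f \<in> hom C c d" and x: "x \<in> FObj P d"
  show "app \<sigma> c (app \<tau> c (res P f x)) = res R f (app \<sigma> d (app \<tau> d x))"
    using app_natural[OF \<tau> f x] app_natural[OF \<sigma> f app_in[OF \<tau> cat_cod[OF C f] x]] by simp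
qed (simp add: app_in[OF \<tau>] app_in[OF \<sigma>])

lemma app_comp:
  assumes "\<tau> \<in> hom (Sh C K) P Q" "\<sigma> \<in> hom (Sh C K) Q R" "c \<in> Obj C" "x \<in> FObj P c"
  shows "app (\<sigma> \<cdot>\<^bsub>Sh C K\<^esub> \<tau>) c x = app \<sigma> c (app \<tau> c x)"
  using assms(3,4) by (simp add: Sh_comp[OF assms(1,2)])

lemma Sh_Id: "Id (Sh C K) P = mk_trans C P (\<lambda>c x. x) P"
  by (simp add: Sh_def mk_trans_def)

lemma app_Id: "c \<in> Obj C \<Longrightarrow> x \<in> FObj P c \<Longrightarrow> app (Id (Sh C K) P) c x = x"
  by (simp add: Sh_Id)

lemma Sh_Id_hom: "category C \<Longrightarrow> is_sheaf C K P \<Longrightarrow> Id (Sh C K) P \<in> hom (Sh C K) P P"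
  unfolding Sh_Id by (rule mk_trans_hom) auto

lemma category_Sh:
  assumes C: "category C"
  shows "category (Sh C K)"
proof (rule categoryI)
  show "Src (Sh C K) f \<in> Obj (Sh C K) \<and> Tgt (Sh C K) f \<in> Obj (Sh C K)" if "f \<in> Arr (Sh C K)" for f
    using that by (auto simp: Sh_def)
next
  fix P Q f assume f: "f \<in> hom (Sh C K) P Q"
  note P = Sh_Id_hom[OF C Sh_dom[OF f]] and Q = Sh_Id_hom[OF C Sh_cod[OF f]]
  show "f \<cdot>\<^bsub>Sh C K\<^esub> Id (Sh C K) P = f"
    by (rule Sh_eqI[OF Sh_comp_hom[OF C P f] f]) (simp add: app_comp[OF P f] app_Id)
  show "Id (Sh C K) Q \<cdot>\<^bsub>Sh C K\<^esub> f = f"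
    by (rule Sh_eqI[OF Sh_comp_hom[OF C f Q] f]) (simp add: app_comp[OF f Q] app_Id app_in[OF f])
next
  fix P Q R S f g h
  assume f: "f \<in> hom (Sh C K) P Q" and g: "g \<in> hom (Sh C K) Q R" and h: "h \<in> hom (Sh C K) R S"
  note gf = Sh_comp_hom[OF C f g] and hg = Sh_comp_hom[OF C g h]
  show "h \<cdot>\<^bsub>Sh C K\<^esub> (g \<cdot>\<^bsub>Sh C K\<^esub> f) = h \<cdot>\<^bsub>Sh C K\<^esub> g \<cdot>\<^bsub>Sh C K\<^esub> f"
    by (rule Sh_eqI[OF Sh_comp_hom[OF C gf h] Sh_comp_hom[OF C f hg]])
      (simp add: app_comp[OF gf h] app_comp[OF f g] app_comp[OF f hg] app_comp[OF g h] app_in[OF f])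
qed (auto intro: Sh_Id_hom[OF C] Sh_comp_hom[OF C])

section \<open>Reasoning with local elements in a Grothendieck topos\<close>

text \<open>Of an equivalence with sheaves only a fully faithful and essentially surjective functor
  is kept. Faithfulness lets arrows be compared on elements, fullness turns natural maps of elements
  into arrows, and essential surjectivity turns sheaves into objects.\<close>

locale sheaf_representation =
  fixes E :: "('o, 'v::universe, 'z) cat_scheme" (structure) and C :: "('v, 'v) cat" and K
    and F :: "('o, 'v, ('v, 'v, 'v) presheaf, ('v, 'v, 'v) presheaf \<times> ('v \<Rightarrow> 'v set_arr) \<times> ('v, 'v, 'v) presheaf) fctr"
  assumes E: "category E" and C: "category C" and small_Arr: "small (Arr C)"
    and topology: "grothendieck_topology C K"
    and F: "is_functor E (Sh C K) F"
    and ff: "\<And>X Y. X \<in> Obj E \<Longrightarrow> Y \<in> Obj E \<Longrightarrow>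
      bij_betw (FArr F) (hom E X Y) (hom (Sh C K) (FObj F X) (FObj F Y))"
    and es: "\<And>P. is_sheaf C K P \<Longrightarrow> \<exists>Z\<in>Obj E. \<exists>\<tau>\<in>hom (Sh C K) (FObj F Z) P. is_iso (Sh C K) \<tau>"
begin

definition el :: "'o \<Rightarrow> 'v \<Rightarrow> 'v set" where
  "el X c = FObj (FObj F X) c"

definition rs :: "'o \<Rightarrow> 'v \<Rightarrow> 'v \<Rightarrow> 'v" where
  "rs X g x = res (FObj F X) g x"

definition ap :: "'v \<Rightarrow> 'v \<Rightarrow> 'v \<Rightarrow> 'v" where
  "ap f c x = app (FArr F f) c x"

lemma covers_into: "covers_into C K"
  using topology by (auto simp: covers_into_def grothendieck_topology_def is_sieve_def)

lemma F_sheaf: "X \<in> Obj E \<Longrightarrow> is_sheaf C K (FObj F X)"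
  using functor_obj[OF F] by simp

lemma el_sheaf: "X \<in> Obj E \<Longrightarrow> sheaf_data C K (el X) (rs X)"
  using sheaf_dataI[OF F_sheaf C] unfolding el_def[abs_def] rs_def[abs_def] .

lemma el_presheaf: "X \<in> Obj E \<Longrightarrow> presheaf_data C (el X) (rs X)"
  by (rule sheaf_presheaf[OF el_sheaf])

lemmas rs_in = presheaf_in[OF el_presheaf]
  and rs_Id = presheaf_Id[OF el_presheaf]
  and rs_comp = presheaf_comp[OF el_presheaf]

lemma ap_in: "f \<in> hom E X Y \<Longrightarrow> c \<in> Obj C \<Longrightarrow> x \<in> el X c \<Longrightarrow> ap f c x \<in> el Y c"
  unfolding el_def ap_def by (rule app_in[OF functor_hom[OF F]])

lemma ap_natural: "f \<in> hom E X Y \<Longrightarrow> g \<in> hom C c d \<Longrightarrow> x \<in> el X d \<Longrightarrow>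
    ap f c (rs X g x) = rs Y g (ap f d x)"
  unfolding el_def ap_def rs_def by (rule app_natural[OF functor_hom[OF F]])

lemma ap_comp: "f \<in> hom E X Y \<Longrightarrow> g \<in> hom E Y Z \<Longrightarrow> c \<in> Obj C \<Longrightarrow> x \<in> el X c \<Longrightarrow>
    ap (g \<cdot> f) c x = ap g c (ap f c x)"
  unfolding el_def ap_def
  by (simp add: functor_comp[OF F] app_comp[OF functor_hom[OF F] functor_hom[OF F]])

lemma ap_Id: "X \<in> Obj E \<Longrightarrow> c \<in> Obj C \<Longrightarrow> x \<in> el X c \<Longrightarrow> ap (Id E X) c x = x"
  unfolding el_def ap_def by (simp add: functor_id[OF F] app_Id)

lemma arr_eqI:
  assumes f: "f \<in> hom E X Y" and g: "g \<in> hom E X Y"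
    and eq: "\<And>c x. c \<in> Obj C \<Longrightarrow> x \<in> el X c \<Longrightarrow> ap f c x = ap g c x"
  shows "f = g"
proof -
  have "FArr F f = FArr F g"
    by (rule Sh_eqI[OF functor_hom[OF F f] functor_hom[OF F g]])
      (use eq in \<open>simp add: el_def ap_def\<close>)
  then show ?thesis
    using ff[OF cat_dom[OF E f] cat_cod[OF E f]] f g by (auto simp: bij_betw_def dest: inj_onD)
qed

lemma arr_exists:
  assumes X: "X \<in> Obj E" and Y: "Y \<in> Obj E"
    and t: "\<And>c x. c \<in> Obj C \<Longrightarrow> x \<in> el X c \<Longrightarrow> t c x \<in> el Y c"
    and nat: "\<And>c d g x. g \<in> hom C c d \<Longrightarrow> x \<in> el X d \<Longrightarrow> t c (rs X g x) = rs Y g (t d x)"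
  obtains f where "f \<in> hom E X Y" "\<And>c x. c \<in> Obj C \<Longrightarrow> x \<in> el X c \<Longrightarrow> ap f c x = t c x"
proof -
  have "mk_trans C (FObj F X) t (FObj F Y) \<in> hom (Sh C K) (FObj F X) (FObj F Y)"
    by (rule mk_trans_hom[OF C F_sheaf[OF X] F_sheaf[OF Y]])
      (use t nat in \<open>simp_all add: el_def rs_def\<close>)
  then have "mk_trans C (FObj F X) t (FObj F Y) \<in> FArr F ` hom E X Y"
    using bij_betw_imp_surj_on[OF ff[OF X Y]] by simp
  then obtain f where f: "f \<in> hom E X Y" "FArr F f = mk_trans C (FObj F X) t (FObj F Y)"
    by (elim imageE) simp
  show thesis
    by (rule that[OF f(1)]) (simp add: ap_def f(2) el_def)
qed

text \<open>The source of all auxiliary objects below: a sheaf written down by hand is represented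
  by some \<open>Z\<close>, with \<open>t\<close> translating elements of \<open>Z\<close> into the
  hand-made ones.\<close>

lemma obj_exists:
  fixes ob :: "'v \<Rightarrow> 'v set"
  assumes sh: "sheaf_data C K ob r"
  obtains Z t where "Z \<in> Obj E" "\<And>c. c \<in> Obj C \<Longrightarrow> bij_betw (t c) (el Z c) (ob c)"
    "\<And>c d g x. g \<in> hom C c d \<Longrightarrow> x \<in> el Z d \<Longrightarrow> t c (rs Z g x) = r g (t d x)"
proof -
  define P where "P = mk_presheaf C ob r"
  have "is_sheaf C K P"
    unfolding P_def by (rule is_sheaf_mk_presheaf[OF C covers_into sh])
  from es[OF this] obtain Z \<tau> where Z: "Z \<in> Obj E" and \<tau>: "\<tau> \<in> hom (Sh C K) (FObj F Z) P"
    and iso: "is_iso (Sh C K) \<tau>"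
    by blast
  from iso obtain \<sigma> where \<sigma>: "\<sigma> \<in> hom (Sh C K) P (FObj F Z)"
    and inv: "\<sigma> \<cdot>\<^bsub>Sh C K\<^esub> \<tau> = Id (Sh C K) (FObj F Z)" "\<tau> \<cdot>\<^bsub>Sh C K\<^esub> \<sigma> = Id (Sh C K) P"
    unfolding is_iso_hom[OF \<tau>] by blast
  have P: "FObj P = ob"
    by (simp add: P_def)
  show thesis
  proof (rule that[OF Z, of "app \<tau>"])
    fix c assume c: "c \<in> Obj C"
    show "bij_betw (app \<tau> c) (el Z c) (ob c)"
    proof (rule bij_betw_byWitness[where f' = "app \<sigma> c"])
      show "\<forall>x\<in>el Z c. app \<sigma> c (app \<tau> c x) = x"
        using app_comp[OF \<tau> \<sigma> c] c by (simp add: inv app_Id el_def)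
      show "\<forall>y\<in>ob c. app \<tau> c (app \<sigma> c y) = y"
        using app_comp[OF \<sigma> \<tau> c] c by (simp add: inv app_Id P)
      show "app \<tau> c ` el Z c \<subseteq> ob c"
        using app_in[OF \<tau> c] by (auto simp: el_def P)
      show "app \<sigma> c ` ob c \<subseteq> el Z c"
        using app_in[OF \<sigma> c] by (auto simp: el_def P)
    qed
  next
    fix c d g x assume g: "g \<in> hom C c d" and x: "x \<in> el Z d"
    have "app \<tau> d x \<in> ob d"
      using app_in[OF \<tau> cat_cod[OF C g], of x] x by (simp add: el_def P)
    then show "app \<tau> c (rs Z g x) = r g (app \<tau> d x)"
      using app_natural[OF \<tau> g, of x] x mk_presheaf_simps(2)[OF g] by (simp add: el_def rs_def P_def)
  qed
qed

subsection \<open>Coverings\<close>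

text \<open>Local truth as in Kripke-Joyal semantics. The property is one of arrows into
  \<open>c\<close>, since it usually speaks of elements restricted along them; it need not itself be
  stable under composition.\<close>

definition locally :: "'v \<Rightarrow> ('v \<Rightarrow> bool) \<Rightarrow> bool" where
  "locally c Q \<longleftrightarrow> (\<exists>R\<in>K c. \<forall>g\<in>R. Q g)"

lemma cover_arr: "c \<in> Obj C \<Longrightarrow> R \<in> K c \<Longrightarrow> g \<in> R \<Longrightarrow> g \<in> hom C (Src C g) c"
  using covers_into by (auto simp: covers_into_def in_hom)

lemma cover_sieve: "c \<in> Obj C \<Longrightarrow> R \<in> K c \<Longrightarrow> is_sieve C c R"
  using topology by (simp add: grothendieck_topology_def)

lemma sieve_comp: "is_sieve C c R \<Longrightarrow> g \<in> R \<Longrightarrow> k \<in> hom C d (Src C g) \<Longrightarrow> g \<cdot>\<^bsub>C\<^esub> k \<in> R"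
  by (auto simp: is_sieve_def in_hom)

lemma cover_max: "c \<in> Obj C \<Longrightarrow> {f \<in> Arr C. Tgt C f = c} \<in> K c"
  using topology by (simp add: grothendieck_topology_def)

lemma cover_pull: "R \<in> K c \<Longrightarrow> h \<in> hom C d c \<Longrightarrow> pullback_sieve C h R \<in> K d"
proof -
  assume R: "R \<in> K c" and h: "h \<in> hom C d c"
  then have "\<forall>h\<in>Arr C. Tgt C h = c \<longrightarrow> pullback_sieve C h R \<in> K (Src C h)"
    using topology cat_cod[OF C h] unfolding grothendieck_topology_def by blast
  then show ?thesis
    using h by (auto simp: in_hom)
qed

lemma cover_trans:
  "c \<in> Obj C \<Longrightarrow> S \<in> K c \<Longrightarrow> is_sieve C c R \<Longrightarrow>
    (\<And>f. f \<in> S \<Longrightarrow> pullback_sieve C f R \<in> K (Src C f)) \<Longrightarrow> R \<in> K c"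
  using topology unfolding grothendieck_topology_def by blast

lemma in_pullback_sieve:
  "h \<in> hom C d c \<Longrightarrow> g \<in> pullback_sieve C h R \<longleftrightarrow> g \<in> hom C (Src C g) d \<and> h \<cdot>\<^bsub>C\<^esub> g \<in> R"
  by (auto simp: pullback_sieve_def in_hom)

text \<open>Pulled back along a member of \<open>S\<close>, the larger sieve becomes the maximal
  one, so transitivity applies.\<close>

lemma cover_super:
  assumes c: "c \<in> Obj C" and S: "S \<in> K c" "S \<subseteq> R" and R: "is_sieve C c R"
  shows "R \<in> K c"
proof (rule cover_trans[OF c S(1) R])
  fix f assume f: "f \<in> S"
  have "pullback_sieve C f R = {g \<in> Arr C. Tgt C g = Src C f}"
    using f S R by (auto simp: pullback_sieve_def is_sieve_def)
  then show "pullback_sieve C f R \<in> K (Src C f)"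
    using cover_max cat_dom[OF C cover_arr[OF c S(1) f]] by simp
qed

lemma locally_mono:
  assumes c: "c \<in> Obj C" and Q: "locally c Q" and QP: "\<And>d g. g \<in> hom C d c \<Longrightarrow> Q g \<Longrightarrow> P g"
  shows "locally c P"
proof -
  from Q obtain R where R: "R \<in> K c" "\<And>g. g \<in> R \<Longrightarrow> Q g"
    by (auto simp: locally_def)
  have "\<forall>g\<in>R. P g"
    using QP[OF cover_arr[OF c R(1)] R(2)] by blast
  then show ?thesis
    using R(1) by (auto simp: locally_def)
qed

lemma locally_all:
  assumes "c \<in> Obj C" "\<And>d g. g \<in> hom C d c \<Longrightarrow> P g"
  shows "locally c P"
proof -
  have "\<forall>g\<in>{f \<in> Arr C. Tgt C f = c}. P g"
    using assms(2) by (simp add: in_hom)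
  then show ?thesis
    unfolding locally_def using cover_max[OF assms(1)] by blast
qed

lemma locally_pull:
  assumes "locally c Q" "h \<in> hom C d c"
  shows "locally d (\<lambda>g. Q (h \<cdot>\<^bsub>C\<^esub> g))"
proof -
  from assms obtain R where R: "R \<in> K c" "\<forall>g\<in>R. Q g"
    by (auto simp: locally_def)
  have "\<forall>g\<in>pullback_sieve C h R. Q (h \<cdot>\<^bsub>C\<^esub> g)"
    using R(2) by (simp add: pullback_sieve_def)
  then show ?thesis
    unfolding locally_def using cover_pull[OF R(1) assms(2)] by blast
qed

text \<open>Transitivity of the topology, stated for properties. A cover of the source of each
  member of \<open>R\<close> is chosen; the composites form a sieve \<open>T\<close>, whose pullback
  along a member of \<open>R\<close> contains the cover chosen there.\<close>

lemma locally_bind: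
  assumes c: "c \<in> Obj C" and Q: "locally c Q"
    and P: "\<And>d g. g \<in> hom C d c \<Longrightarrow> Q g \<Longrightarrow> locally d (\<lambda>k. P (g \<cdot>\<^bsub>C\<^esub> k))"
  shows "locally c P"
proof -
  from Q obtain R where R: "R \<in> K c" "\<And>g. g \<in> R \<Longrightarrow> Q g"
    by (auto simp: locally_def)
  note Rh = cover_arr[OF c R(1)]
  have "\<exists>S\<in>K (Src C g). \<forall>k\<in>S. P (g \<cdot>\<^bsub>C\<^esub> k)" if "g \<in> R" for g
    using P[OF Rh[OF that] R(2)[OF that]] by (simp add: locally_def)
  then obtain S where S: "\<And>g. g \<in> R \<Longrightarrow> S g \<in> K (Src C g)"
    and SP: "\<And>g k. g \<in> R \<Longrightarrow> k \<in> S g \<Longrightarrow> P (g \<cdot>\<^bsub>C\<^esub> k)"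
    by metis
  have Sh: "k \<in> hom C (Src C k) (Src C g)" if "g \<in> R" "k \<in> S g" for g k
    using cover_arr[OF cat_dom[OF C Rh[OF that(1)]] S[OF that(1)] that(2)] .
  define T where "T = {g \<cdot>\<^bsub>C\<^esub> k | g k. g \<in> R \<and> k \<in> S g}"
  have Ts: "is_sieve C c T"
    unfolding is_sieve_def
  proof (intro conjI ballI subsetI impI)
    fix f assume "f \<in> T"
    then obtain g k where gk: "g \<in> R" "k \<in> S g" "f = g \<cdot>\<^bsub>C\<^esub> k"
      by (auto simp: T_def)
    then show "f \<in> {f \<in> Arr C. Tgt C f = c}"
      using cat_comp[OF C Sh[OF gk(1,2)] Rh[OF gk(1)]] by (simp add: in_hom)
    fix h assume h: "h \<in> Arr C" "Tgt C h = Src C f"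
    then have h': "h \<in> hom C (Src C h) (Src C k)"
      using gk cat_comp[OF C Sh[OF gk(1,2)] Rh[OF gk(1)]] by (simp add: in_hom)
    have "k \<cdot>\<^bsub>C\<^esub> h \<in> S g"
      by (rule sieve_comp[OF cover_sieve[OF cat_dom[OF C Rh[OF gk(1)]] S[OF gk(1)]] gk(2) h'])
    then show "f \<cdot>\<^bsub>C\<^esub> h \<in> T"
      using gk cat_assoc[OF C h' Sh[OF gk(1,2)] Rh[OF gk(1)]] by (auto simp: T_def)
  qed
  have "T \<in> K c"
  proof (rule cover_trans[OF c R(1) Ts])
    fix g assume g: "g \<in> R"
    have ps: "is_sieve C (Src C g) (pullback_sieve C g T)"
      unfolding is_sieve_def
    proof (intro conjI ballI subsetI impI)
      fix f assume f: "f \<in> pullback_sieve C g T"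
      then show "f \<in> {f \<in> Arr C. Tgt C f = Src C g}"
        by (simp add: pullback_sieve_def)
      fix h assume h: "h \<in> Arr C" "Tgt C h = Src C f"
      have f': "f \<in> hom C (Src C f) (Src C g)" "g \<cdot>\<^bsub>C\<^esub> f \<in> T"
        using f in_pullback_sieve[OF Rh[OF g]] by blast+
      have h': "h \<in> hom C (Src C h) (Src C f)"
        using h by (simp add: in_hom)
      have "g \<cdot>\<^bsub>C\<^esub> f \<cdot>\<^bsub>C\<^esub> h \<in> T"
        using sieve_comp[OF Ts f'(2), of h] h' hom_src[OF cat_comp[OF C f'(1) Rh[OF g]]] by simp
      then show "f \<cdot>\<^bsub>C\<^esub> h \<in> pullback_sieve C g T"
        using cat_comp[OF C h' f'(1)] cat_assoc[OF C h' f'(1) Rh[OF g]]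
        by (simp add: pullback_sieve_def in_hom)
    qed
    show "pullback_sieve C g T \<in> K (Src C g)"
    proof (rule cover_super[OF cat_dom[OF C Rh[OF g]] S[OF g] _ ps])
      show "S g \<subseteq> pullback_sieve C g T"
        using Sh[OF g] g by (auto simp: pullback_sieve_def T_def in_hom)
    qed
  qed
  moreover have "\<forall>f\<in>T. P f"
    using SP by (auto simp: T_def)
  ultimately show ?thesis
    by (auto simp: locally_def)
qed

text \<open>Stages covered by the empty family play the role of falsity: all sections of an object
  coincide there, and an object is initial exactly when it has elements at such stages only.\<close>

definition void :: "'v \<Rightarrow> bool" where
  "void c \<longleftrightarrow> locally c (\<lambda>_. False)"

lemma void_locally: "c \<in> Obj C \<Longrightarrow> void c \<Longrightarrow> locally c P"
  unfolding void_def by (drule (1) locally_mono) auto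

lemma void_pull: "void c \<Longrightarrow> h \<in> hom C d c \<Longrightarrow> void d"
  using locally_pull[of c "\<lambda>_. False"] by (simp add: void_def)

lemma void_bind:
  assumes "c \<in> Obj C" "locally c Q" "\<And>d g. g \<in> hom C d c \<Longrightarrow> Q g \<Longrightarrow> void d"
  shows "void c"
  unfolding void_def by (rule locally_bind[OF assms(1,2)]) (use assms(3) in \<open>simp add: void_def\<close>)

section \<open>Sections and arrows glued from relations\<close>

lemma el_separated:
  assumes X: "X \<in> Obj E" and c: "c \<in> Obj C" and xy: "x \<in> el X c" "y \<in> el X c"
    and l: "locally c (\<lambda>g. rs X g x = rs X g y)"
  shows "x = y"
proof -
  from l obtain R where "R \<in> K c" "\<forall>g\<in>R. rs X g x = rs X g y"
    by (auto simp: locally_def)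
  then show ?thesis
    using sheaf_separated[OF el_sheaf[OF X] C covers_into c _ xy] by blast
qed

lemma void_unique: "X \<in> Obj E \<Longrightarrow> c \<in> Obj C \<Longrightarrow> void c \<Longrightarrow> x \<in> el X c \<Longrightarrow> y \<in> el X c \<Longrightarrow> x = y"
  by (rule el_separated[OF _ _ _ _ void_locally])

text \<open>Amalgamation for a relation instead of a family indexed by a cover. Values are chosen
  here once and for all on some cover; stability and single-valuedness make the choice a matching
  family. Later constructions then only have to describe the values.\<close>

lemma el_glue:
  assumes X: "X \<in> Obj E" and c: "c \<in> Obj C"
    and \<Phi>_in: "\<And>d g w. g \<in> hom C d c \<Longrightarrow> \<Phi> g w \<Longrightarrow> w \<in> el X d"
    and \<Phi>_stable: "\<And>d e g k w. g \<in> hom C d c \<Longrightarrow> k \<in> hom C e d \<Longrightarrow> \<Phi> g w \<Longrightarrow> \<Phi> (g \<cdot>\<^bsub>C\<^esub> k) (rs X k w)"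
    and \<Phi>_unique: "\<And>d g w w'. g \<in> hom C d c \<Longrightarrow> \<Phi> g w \<Longrightarrow> \<Phi> g w' \<Longrightarrow> w = w'"
    and \<Phi>_total: "locally c (\<lambda>g. \<exists>w. \<Phi> g w)"
  obtains y where "y \<in> el X c" "\<And>d g w. g \<in> hom C d c \<Longrightarrow> \<Phi> g w \<Longrightarrow> rs X g y = w"
proof -
  from \<Phi>_total obtain R where R: "R \<in> K c" "\<And>g. g \<in> R \<Longrightarrow> \<exists>w. \<Phi> g w"
    by (auto simp: locally_def)
  note Rh = cover_arr[OF c R(1)]
  define x where "x g = (SOME w. \<Phi> g w)" for g
  have x: "\<Phi> g (x g)" if "g \<in> R" for g
    unfolding x_def by (rule someI_ex[OF R(2)[OF that]])
  have "matching C (el X) (rs X) R x"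
    unfolding matching_def
  proof (intro conjI ballI impI)
    fix f g h k
    assume *: "f \<in> R" "g \<in> R" "h \<in> Arr C" "k \<in> Arr C" "Tgt C h = Src C f" "Tgt C k = Src C g"
      "Src C h = Src C k" "f \<cdot>\<^bsub>C\<^esub> h = g \<cdot>\<^bsub>C\<^esub> k"
    have h: "h \<in> hom C (Src C h) (Src C f)" and k: "k \<in> hom C (Src C h) (Src C g)"
      using * by (simp_all add: in_hom)
    show "rs X h (x f) = rs X k (x g)"
      using \<Phi>_stable[OF Rh[OF *(1)] h x[OF *(1)]] \<Phi>_stable[OF Rh[OF *(2)] k x[OF *(2)]]
        \<Phi>_unique[OF cat_comp[OF C h Rh[OF *(1)]]] *(8) by simp
  qed (use \<Phi>_in[OF Rh x] in simp)
  from sheaf_glue[OF el_sheaf[OF X] c R(1) this] obtain y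
    where y: "y \<in> el X c" "\<And>g. g \<in> R \<Longrightarrow> rs X g y = x g"
    by blast
  show thesis
  proof (rule that[OF y(1)])
    fix d g w assume g: "g \<in> hom C d c" and w: "\<Phi> g w"
    note d = cat_dom[OF C g]
    show "rs X g y = w"
    proof (rule el_separated[OF X d rs_in[OF X g y(1)] \<Phi>_in[OF g w]])
      \<comment> \<open>The arrow \<open>g\<close> need not belong to the chosen cover, so the
        equation is checked on the cover pulled back along \<open>g\<close>.\<close>
      have "locally c (\<lambda>g. g \<in> R)"
        using R(1) by (auto simp: locally_def)
      then have "locally d (\<lambda>k. g \<cdot>\<^bsub>C\<^esub> k \<in> R)"
        using locally_pull[OF _ g] by blast
      then show "locally d (\<lambda>k. rs X k (rs X g y) = rs X k w)"
      proof (rule locally_mono[OF d])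
        fix e k assume k: "k \<in> hom C e d" and gk: "g \<cdot>\<^bsub>C\<^esub> k \<in> R"
        have "rs X k (rs X g y) = x (g \<cdot>\<^bsub>C\<^esub> k)"
          using rs_comp[OF X g k y(1)] y(2)[OF gk] by simp
        then show "rs X k (rs X g y) = rs X k w"
          using \<Phi>_unique[OF cat_comp[OF C k g] x[OF gk] \<Phi>_stable[OF g k w]] by simp
      qed
    qed
  qed
qed

text \<open>Relational gluing applied at every element of \<open>X\<close>. Naturality and
  uniqueness come from the same fact \<open>t_eq\<close>: two sections that agree wherever
  \<open>\<Theta>\<close> prescribes a value are equal, because values are prescribed locally
  everywhere.\<close>

lemma arr_glue:
  assumes X: "X \<in> Obj E" and Y: "Y \<in> Obj E"
    and in': "\<And>c x w. c \<in> Obj C \<Longrightarrow> x \<in> el X c \<Longrightarrow> \<Theta> c x w \<Longrightarrow> w \<in> el Y c"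
    and stable: "\<And>c d g x w. g \<in> hom C d c \<Longrightarrow> x \<in> el X c \<Longrightarrow> \<Theta> c x w \<Longrightarrow> \<Theta> d (rs X g x) (rs Y g w)"
    and unique: "\<And>c x w w'. c \<in> Obj C \<Longrightarrow> x \<in> el X c \<Longrightarrow> \<Theta> c x w \<Longrightarrow> \<Theta> c x w' \<Longrightarrow> w = w'"
    and total: "\<And>c x. c \<in> Obj C \<Longrightarrow> x \<in> el X c \<Longrightarrow> locally c (\<lambda>g. \<exists>w. \<Theta> (Src C g) (rs X g x) w)"
  obtains h where "h \<in> hom E X Y"
    "\<And>c x w. c \<in> Obj C \<Longrightarrow> x \<in> el X c \<Longrightarrow> \<Theta> c x w \<Longrightarrow> ap h c x = w"
    "\<forall>h'. h' \<in> hom E X Y \<longrightarrow> (\<forall>c x w. c \<in> Obj C \<longrightarrow> x \<in> el X c \<longrightarrow> \<Theta> c x w \<longrightarrow> ap h' c x = w) \<longrightarrow> h' = h"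
proof -
  have ex: "\<exists>y. y \<in> el Y c \<and> (\<forall>d g w. g \<in> hom C d c \<longrightarrow> \<Theta> d (rs X g x) w \<longrightarrow> rs Y g y = w)"
    if c: "c \<in> Obj C" and x: "x \<in> el X c" for c x
  proof (rule el_glue[OF Y c, where \<Phi> = "\<lambda>g w. \<Theta> (Src C g) (rs X g x) w"])
    show "w \<in> el Y d" if "g \<in> hom C d c" "\<Theta> (Src C g) (rs X g x) w" for d g w
      using in'[OF cat_dom[OF C that(1)] rs_in[OF X that(1) x]] that hom_src[OF that(1)] by simp
    show "\<Theta> (Src C (g \<cdot>\<^bsub>C\<^esub> k)) (rs X (g \<cdot>\<^bsub>C\<^esub> k) x) (rs Y k w)"
      if g: "g \<in> hom C d c" and k: "k \<in> hom C e d" and "\<Theta> (Src C g) (rs X g x) w" for d e g k w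
      using stable[OF k rs_in[OF X g x]] that hom_src[OF g] hom_src[OF cat_comp[OF C k g]]
        rs_comp[OF X g k x] by simp
    show "w = w'" if g: "g \<in> hom C d c" and "\<Theta> (Src C g) (rs X g x) w" "\<Theta> (Src C g) (rs X g x) w'" for d g w w'
      using unique[OF cat_dom[OF C g] rs_in[OF X g x]] that hom_src[OF g] by simp
    show "locally c (\<lambda>g. \<exists>w. \<Theta> (Src C g) (rs X g x) w)"
      by (rule total[OF c x])
  next
    fix y assume "y \<in> el Y c" "\<And>d g w. g \<in> hom C d c \<Longrightarrow> \<Theta> (Src C g) (rs X g x) w \<Longrightarrow> rs Y g y = w"
    then show ?thesis
      by (metis hom_src)
  qed
  define t where "t c x = (SOME y. y \<in> el Y c \<and> (\<forall>d g w. g \<in> hom C d c \<longrightarrow> \<Theta> d (rs X g x) w \<longrightarrow> rs Y g y = w))" for c x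
  have t: "t c x \<in> el Y c" "\<And>d g w. g \<in> hom C d c \<Longrightarrow> \<Theta> d (rs X g x) w \<Longrightarrow> rs Y g (t c x) = w"
    if "c \<in> Obj C" "x \<in> el X c" for c x
    using someI_ex[OF ex[OF that]] unfolding t_def by blast+
  have t_eq: "y = z" if c: "c \<in> Obj C" and x: "x \<in> el X c" and y: "y \<in> el Y c" and z: "z \<in> el Y c"
    and "\<And>d g w. g \<in> hom C d c \<Longrightarrow> \<Theta> d (rs X g x) w \<Longrightarrow> rs Y g y = w"
    and "\<And>d g w. g \<in> hom C d c \<Longrightarrow> \<Theta> d (rs X g x) w \<Longrightarrow> rs Y g z = w" for c x y z
    by (rule el_separated[OF Y c y z], rule locally_mono[OF c total[OF c x]]) (use that hom_src in metis)
  show thesis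
  proof (rule arr_exists[OF X Y, of t])
    fix c d g x assume g: "g \<in> hom C c d" and x: "x \<in> el X d"
    note c = cat_dom[OF C g] and d = cat_cod[OF C g] and gx = rs_in[OF X g x]
    show "t c (rs X g x) = rs Y g (t d x)"
    proof (rule t_eq[OF c gx t(1)[OF c gx] rs_in[OF Y g t(1)[OF d x]]])
      fix e k w assume k: "k \<in> hom C e c" and w: "\<Theta> e (rs X k (rs X g x)) w"
      show "rs Y k (t c (rs X g x)) = w"
        by (rule t(2)[OF c gx k w])
      show "rs Y k (rs Y g (t d x)) = w"
        using t(2)[OF d x cat_comp[OF C k g]] w rs_comp[OF X g k x] rs_comp[OF Y g k t(1)[OF d x]] by simp
    qed
  next
    fix h assume h: "h \<in> hom E X Y" "\<And>c x. c \<in> Obj C \<Longrightarrow> x \<in> el X c \<Longrightarrow> ap h c x = t c x"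
    have Id: "rs X (Id C c) x = x" "rs Y (Id C c) (t c x) = t c x" if "c \<in> Obj C" "x \<in> el X c" for c x
      using rs_Id[OF X that] rs_Id[OF Y that(1) t(1)[OF that]] .
    show thesis
    proof (rule that[OF h(1)])
      show "ap h c x = w" if "c \<in> Obj C" "x \<in> el X c" "\<Theta> c x w" for c x w
        using t(2)[OF that(1,2) cat_Id[OF C that(1)], of w] Id[OF that(1,2)] that h(2) by simp
    next
      show "\<forall>h'. h' \<in> hom E X Y \<longrightarrow> (\<forall>c x w. c \<in> Obj C \<longrightarrow> x \<in> el X c \<longrightarrow> \<Theta> c x w \<longrightarrow> ap h' c x = w) \<longrightarrow> h' = h"
      proof (intro allI impI)
        fix h' assume h': "h' \<in> hom E X Y" "\<forall>c x w. c \<in> Obj C \<longrightarrow> x \<in> el X c \<longrightarrow> \<Theta> c x w \<longrightarrow> ap h' c x = w"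
        show "h' = h"
        proof (rule arr_eqI[OF h'(1) h(1)])
          fix c x assume c: "c \<in> Obj C" and x: "x \<in> el X c"
          show "ap h' c x = ap h c x"
            unfolding h(2)[OF c x]
          proof (rule t_eq[OF c x ap_in[OF h'(1) c x] t(1)[OF c x]])
            fix d g w assume g: "g \<in> hom C d c" and w: "\<Theta> d (rs X g x) w"
            show "rs Y g (ap h' c x) = w"
              using h'(2)[rule_format, OF cat_dom[OF C g] rs_in[OF X g x] w] ap_natural[OF h'(1) g x] by simp
            show "rs Y g (t c x) = w"
              by (rule t(2)[OF c x g w])
          qed
        qed
      qed
    qed
  qed (rule t)
qed

subsection \<open>Subobjects\<close>

text \<open>These are the subsheaves of \<open>X\<close>: the first clause makes the elements
  satisfying \<open>\<phi>\<close> a subpresheaf, the second closes it under gluing.\<close>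

definition local_pred :: "'o \<Rightarrow> ('v \<Rightarrow> 'v \<Rightarrow> bool) \<Rightarrow> bool" where
  "local_pred X \<phi> \<longleftrightarrow>
     (\<forall>c d g x. g \<in> hom C d c \<longrightarrow> x \<in> el X c \<longrightarrow> \<phi> c x \<longrightarrow> \<phi> d (rs X g x)) \<and>
     (\<forall>c x. c \<in> Obj C \<longrightarrow> x \<in> el X c \<longrightarrow> locally c (\<lambda>g. \<phi> (Src C g) (rs X g x)) \<longrightarrow> \<phi> c x)"

lemma local_predI:
  assumes "\<And>c d g x. g \<in> hom C d c \<Longrightarrow> x \<in> el X c \<Longrightarrow> \<phi> c x \<Longrightarrow> \<phi> d (rs X g x)"
    and "\<And>c x. c \<in> Obj C \<Longrightarrow> x \<in> el X c \<Longrightarrow> locally c (\<lambda>g. \<phi> (Src C g) (rs X g x)) \<Longrightarrow> \<phi> c x"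
  shows "local_pred X \<phi>"
  using assms unfolding local_pred_def by blast

text \<open>Truth on a cover of a cover is truth on a cover. Images and complements, which are only
  stable predicates at first, are made into subsheaves in this way.\<close>

lemma local_pred_locally:
  assumes X: "X \<in> Obj E"
    and stable: "\<And>c d g x. g \<in> hom C d c \<Longrightarrow> x \<in> el X c \<Longrightarrow> \<psi> c x \<Longrightarrow> \<psi> d (rs X g x)"
  shows "local_pred X (\<lambda>c x. locally c (\<lambda>g. \<psi> (Src C g) (rs X g x)))"
proof (rule local_predI)
  fix c d g x assume g: "g \<in> hom C d c" and x: "x \<in> el X c"
    and l: "locally c (\<lambda>g. \<psi> (Src C g) (rs X g x))"
  show "locally d (\<lambda>k. \<psi> (Src C k) (rs X k (rs X g x)))"
    by (rule locally_mono[OF cat_dom[OF C g] locally_pull[OF l g]])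
      (use rs_comp[OF X g _ x] hom_src[OF cat_comp[OF C _ g]] hom_src[where C = C] in simp)
next
  fix c x assume c: "c \<in> Obj C" and x: "x \<in> el X c"
    and l: "locally c (\<lambda>g. locally (Src C g) (\<lambda>k. \<psi> (Src C k) (rs X k (rs X g x))))"
  show "locally c (\<lambda>g. \<psi> (Src C g) (rs X g x))"
  proof (rule locally_bind[OF c l])
    fix d g assume g: "g \<in> hom C d c" and l: "locally (Src C g) (\<lambda>k. \<psi> (Src C k) (rs X k (rs X g x)))"
    show "locally d (\<lambda>k. \<psi> (Src C (g \<cdot>\<^bsub>C\<^esub> k)) (rs X (g \<cdot>\<^bsub>C\<^esub> k) x))"
      by (rule locally_mono[OF cat_dom[OF C g] l[unfolded hom_src[OF g]]])
        (use rs_comp[OF X g _ x] hom_src[OF cat_comp[OF C _ g]] hom_src[where C = C] in simp)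
  qed
qed

lemma local_pred_eq:
  assumes X: "X \<in> Obj E" and f: "f \<in> hom E X Y" and g: "g \<in> hom E X Y"
  shows "local_pred X (\<lambda>c x. ap f c x = ap g c x)"
proof (rule local_predI)
  note Y = cat_cod[OF E f]
  fix c x assume c: "c \<in> Obj C" and x: "x \<in> el X c"
    and l: "locally c (\<lambda>k. ap f (Src C k) (rs X k x) = ap g (Src C k) (rs X k x))"
  show "ap f c x = ap g c x"
    by (rule el_separated[OF Y c ap_in[OF f c x] ap_in[OF g c x]], rule locally_mono[OF c l])
      (use ap_natural[OF f _ x] ap_natural[OF g _ x] hom_src[where C = C] in simp)
qed (simp add: ap_natural[OF f] ap_natural[OF g])

lemma local_pred_void:
  assumes X: "X \<in> Obj E"
  shows "local_pred X (\<lambda>c x. void c)"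
proof (rule local_predI)
  fix c x assume c: "c \<in> Obj C" and l: "locally c (\<lambda>g. void (Src C g))"
  show "void c"
    by (rule void_bind[OF c l]) (simp add: hom_src[where C = C])
qed (rule void_pull)

text \<open>An amalgamation of elements satisfying \<open>\<phi>\<close> satisfies it locally and
  hence outright, so these elements form a sheaf. The object representing it is the subobject cut
  out by \<open>\<phi>\<close>.\<close>

lemma comprehension:
  assumes X: "X \<in> Obj E" and \<phi>: "local_pred X \<phi>"
  obtains Z i where "i \<in> hom E Z X"
    "\<And>c z. c \<in> Obj C \<Longrightarrow> z \<in> el Z c \<Longrightarrow> \<phi> c (ap i c z)"
    "\<And>c x. c \<in> Obj C \<Longrightarrow> x \<in> el X c \<Longrightarrow> \<phi> c x \<Longrightarrow> \<exists>z\<in>el Z c. ap i c z = x"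
    "\<And>c z z'. c \<in> Obj C \<Longrightarrow> z \<in> el Z c \<Longrightarrow> z' \<in> el Z c \<Longrightarrow> ap i c z = ap i c z' \<Longrightarrow> z = z'"
    "\<forall>Y f. f \<in> hom E Y X \<longrightarrow> (\<forall>c y. c \<in> Obj C \<longrightarrow> y \<in> el Y c \<longrightarrow> \<phi> c (ap f c y)) \<longrightarrow>
      (\<exists>g\<in>hom E Y Z. i \<cdot> g = f)"
proof -
  define ob where "ob c = {x \<in> el X c. \<phi> c x}" for c
  have stable: "\<phi> d (rs X g x)" if "g \<in> hom C d c" "x \<in> el X c" "\<phi> c x" for c d g x
    using \<phi> that unfolding local_pred_def by blast
  have local: "\<phi> c x" if "c \<in> Obj C" "x \<in> el X c" "locally c (\<lambda>g. \<phi> (Src C g) (rs X g x))" for c x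
    using \<phi> that unfolding local_pred_def by blast
  have "sheaf_data C K ob (rs X)"
    unfolding sheaf_data_def
  proof (intro conjI ballI allI impI)
    show "presheaf_data C ob (rs X)"
      unfolding presheaf_data_def ob_def
      using presheaf_small[OF el_presheaf[OF X]] rs_Id[OF X] rs_in[OF X] rs_comp[OF X] stable
      by (auto intro: small_subset)
  next
    fix c R x assume c: "c \<in> Obj C" and R: "R \<in> K c" and m: "matching C ob (rs X) R x"
    have "matching C (el X) (rs X) R x"
      using m unfolding matching_def ob_def by blast
    from sheaf_glue[OF el_sheaf[OF X] c R this]
    obtain y where y: "y \<in> el X c" "\<forall>f\<in>R. rs X f y = x f"
      and uniq: "\<And>y'. y' \<in> el X c \<Longrightarrow> \<forall>f\<in>R. rs X f y' = x f \<Longrightarrow> y' = y"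
      by blast
    have "locally c (\<lambda>g. \<phi> (Src C g) (rs X g y))"
      using R m y(2) unfolding locally_def matching_def ob_def by force
    then have "\<phi> c y"
      by (rule local[OF c y(1)])
    then show "\<exists>!y. y \<in> ob c \<and> (\<forall>f\<in>R. rs X f y = x f)"
      using y uniq unfolding ob_def by blast
  qed
  from obj_exists[OF this] obtain Z t where Z: "Z \<in> Obj E"
    and bij: "\<And>c. c \<in> Obj C \<Longrightarrow> bij_betw (t c) (el Z c) (ob c)"
    and nat: "\<And>c d g x. g \<in> hom C c d \<Longrightarrow> x \<in> el Z d \<Longrightarrow> t c (rs Z g x) = rs X g (t d x)"
    by metis
  have t_in: "t c z \<in> ob c" if "c \<in> Obj C" "z \<in> el Z c" for c z
    using bij[OF that(1)] that(2) by (rule bij_betwE[rule_format])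
  have t_inj: "z = z'" if "c \<in> Obj C" "z \<in> el Z c" "z' \<in> el Z c" "t c z = t c z'" for c z z'
    using bij[OF that(1)] that by (auto simp: bij_betw_def dest: inj_onD)
  have t_surj: "\<exists>z\<in>el Z c. t c z = x" if "c \<in> Obj C" "x \<in> ob c" for c x
    using bij[OF that(1)] that(2) by (metis bij_betw_imp_surj_on imageE)
  obtain i where i: "i \<in> hom E Z X" and it: "\<And>c x. c \<in> Obj C \<Longrightarrow> x \<in> el Z c \<Longrightarrow> ap i c x = t c x"
    by (rule arr_exists[OF Z X, of t]) (use t_in nat in \<open>auto simp: ob_def\<close>)
  show thesis
  proof (rule that[OF i])
    have "\<exists>g\<in>hom E Y Z. i \<cdot> g = f" if f: "f \<in> hom E Y X"
      and \<phi>f: "\<forall>c y. c \<in> Obj C \<longrightarrow> y \<in> el Y c \<longrightarrow> \<phi> c (ap f c y)" for Y f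
    proof -
      note Y = cat_dom[OF E f]
      define s where "s c y = (SOME z. z \<in> el Z c \<and> t c z = ap f c y)" for c y
      have s: "s c y \<in> el Z c" "t c (s c y) = ap f c y" if "c \<in> Obj C" "y \<in> el Y c" for c y
        using someI_ex[OF t_surj[unfolded Bex_def], of c "ap f c y"] that \<phi>f ap_in[OF f that]
        unfolding s_def[symmetric] ob_def by auto
      obtain g where g: "g \<in> hom E Y Z" and gs: "\<And>c y. c \<in> Obj C \<Longrightarrow> y \<in> el Y c \<Longrightarrow> ap g c y = s c y"
      proof (rule arr_exists[OF Y Z, of s])
        fix c d k y assume k: "k \<in> hom C c d" and y: "y \<in> el Y d"
        note c = cat_dom[OF C k] and d = cat_cod[OF C k] and ky = rs_in[OF Y k y]
        show "s c (rs Y k y) = rs Z k (s d y)"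
          by (rule t_inj[OF c s(1)[OF c ky] rs_in[OF Z k s(1)[OF d y]]])
            (simp add: s(2)[OF c ky] nat[OF k s(1)[OF d y]] s(2)[OF d y] ap_natural[OF f k y])
      qed (use s in auto)
      have "i \<cdot> g = f"
        by (rule arr_eqI[OF cat_comp[OF E g i] f]) (simp add: ap_comp[OF g i] gs it s)
      then show ?thesis
        using g by blast
    qed
    then show "\<forall>Y f. f \<in> hom E Y X \<longrightarrow> (\<forall>c y. c \<in> Obj C \<longrightarrow> y \<in> el Y c \<longrightarrow> \<phi> c (ap f c y)) \<longrightarrow>
      (\<exists>g\<in>hom E Y Z. i \<cdot> g = f)"
      by blast
  qed (use it t_in t_inj t_surj in \<open>auto simp: ob_def\<close>)
qed

subsection \<open>Initial objects\<close>

text \<open>Initiality supplies an arrow from \<open>X\<close> to its own subobject of elements at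
  void stages, and this arrow carries \<open>x\<close> to an element at the same stage.\<close>

lemma initial_void:
  assumes init: "is_initial E X" and c: "c \<in> Obj C" and x: "x \<in> el X c"
  shows "void c"
proof -
  have X: "X \<in> Obj E" and un: "\<And>Y. Y \<in> Obj E \<Longrightarrow> \<exists>!f. f \<in> hom E X Y"
    using init by (simp_all add: is_initial_def)
  obtain Z i where i: "i \<in> hom E Z X" and v: "\<And>c z. c \<in> Obj C \<Longrightarrow> z \<in> el Z c \<Longrightarrow> void c"
    by (rule comprehension[OF X local_pred_void[OF X]]) (rule that)
  obtain k where k: "k \<in> hom E X Z"
    using un[OF cat_dom[OF E i]] by blast
  show ?thesis
    by (rule v[OF c ap_in[OF k c x]])
qed

text \<open>The empty relation is stable and single valued, and on void stages it is even locally
  total, so gluing yields exactly one arrow to each object.\<close>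

lemma void_initial:
  assumes X: "X \<in> Obj E" and v: "\<And>c x. c \<in> Obj C \<Longrightarrow> x \<in> el X c \<Longrightarrow> void c"
  shows "is_initial E X"
  unfolding is_initial_def
proof (intro conjI ballI X)
  fix Y assume Y: "Y \<in> Obj E"
  show "\<exists>!f. f \<in> hom E X Y"
  proof (rule arr_glue[OF X Y, where \<Theta> = "\<lambda>_ _ _. False"])
    show "locally c (\<lambda>g. \<exists>w. False)" if "c \<in> Obj C" "x \<in> el X c" for c x
      using v[OF that] by (simp add: void_def)
  qed blast+
qed

end

section \<open>Encodings in the universe\<close>

text \<open>The two subsets of a singleton have distinct codes. With two elements at hand a binary
  union becomes an indexed one.\<close>

lemma small_two: "\<exists>a b :: 'v::universe. a \<noteq> b \<and> small {a, b}"
proof -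
  obtain Y and e :: "'v set \<Rightarrow> 'v" where Y: "small Y" and e: "bij_betw e (Pow {undefined}) Y"
    using small_Pow[OF small_singleton] by blast
  have "e {} \<noteq> e {undefined}"
    using e by (auto simp: bij_betw_def dest: inj_onD)
  moreover have "small {e {}, e {undefined}}"
    by (rule small_subset[OF Y]) (use e in \<open>auto simp: bij_betw_def\<close>)
  ultimately show ?thesis
    by blast
qed

lemma small_Un:
  fixes X Y :: "'v::universe set"
  assumes "small X" "small Y"
  shows "small (X \<union> Y)"
proof -
  obtain a b :: 'v where ab: "a \<noteq> b" "small {a, b}"
    using small_two by blast
  have "small (\<Union>i\<in>{a, b}. if i = a then X else Y)"
    using assms by (intro small_Union[OF ab(2)]) auto
  moreover have "(\<Union>i\<in>{a, b}. if i = a then X else Y) = X \<union> Y"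
    using ab(1) by auto
  ultimately show ?thesis
    by simp
qed

text \<open>Kuratowski pairs: the inner sets are coded by a code \<open>e1\<close> for subsets of
  \<open>X \<union> Y\<close>, the outer set by a code \<open>e2\<close> for sets of such
  codes.\<close>

lemma small_pairing:
  fixes X Y :: "'v::universe set"
  assumes "small X" "small Y"
  obtains e :: "'v \<times> 'v \<Rightarrow> 'v" where "inj_on e (X \<times> Y)" "small (e ` (X \<times> Y))"
proof -
  obtain A and e1 :: "'v set \<Rightarrow> 'v" where A: "small A" and e1: "bij_betw e1 (Pow (X \<union> Y)) A"
    using small_Pow[OF small_Un[OF assms]] by blast
  obtain B and e2 :: "'v set \<Rightarrow> 'v" where B: "small B" and e2: "bij_betw e2 (Pow A) B"
    using small_Pow[OF A] by blast
  have e1_eq: "e1 P = e1 Q \<longleftrightarrow> P = Q" if "P \<subseteq> X \<union> Y" "Q \<subseteq> X \<union> Y" for P Q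
    using e1 that by (auto simp: bij_betw_def dest: inj_onD)
  have e1_in: "e1 P \<in> A" if "P \<subseteq> X \<union> Y" for P
    using e1 that by (auto simp: bij_betw_def)
  have e2_eq: "e2 P = e2 Q \<longleftrightarrow> P = Q" if "P \<subseteq> A" "Q \<subseteq> A" for P Q
    using e2 that by (auto simp: bij_betw_def dest: inj_onD)
  define e where "e p = e2 {e1 {fst p}, e1 {fst p, snd p}}" for p
  show thesis
  proof (rule that[of e])
    show "inj_on e (X \<times> Y)"
    proof (rule inj_onI)
      fix p q assume p: "p \<in> X \<times> Y" and q: "q \<in> X \<times> Y" and "e p = e q"
      then have "{e1 {fst p}, e1 {fst p, snd p}} = {e1 {fst q}, e1 {fst q, snd q}}"
        unfolding e_def by (subst (asm) e2_eq) (auto intro!: e1_in)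
      then show "p = q"
        using p q by (auto simp: doubleton_eq_iff e1_eq prod_eq_iff)
    qed
    show "small (e ` (X \<times> Y))"
    proof (rule small_subset[OF B])
      show "e ` (X \<times> Y) \<subseteq> B"
        using e2 e1_in by (fastforce simp: e_def bij_betw_def)
    qed
  qed
qed

section \<open>Elements of products, terminal objects and truth values\<close>

context sheaf_representation
begin

lemma small_Obj: "small (Obj C)"
proof -
  have "Obj C \<subseteq> Src C ` Arr C"
    using hom_src[OF cat_Id[OF C]] hom_arr[OF cat_Id[OF C]] by force
  then show ?thesis
    using small_subset[OF small_image[OF small_Arr]] by blast
qed

lemma el_small_Union: "X \<in> Obj E \<Longrightarrow> small (\<Union>c\<in>Obj C. el X c)"
  by (rule small_Union[OF small_Obj presheaf_small[OF el_presheaf]])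

text \<open>The pairs of elements form a sheaf. The object \<open>Z\<close> that represents it maps
  to \<open>X\<close> and \<open>Y\<close>, hence to \<open>P\<close> by the universal property, and
  the element of \<open>Z\<close> named by (x, y) is sent to the wanted one.\<close>

lemma product_el:
  assumes prod: "is_product E X Y P p q" and c: "c \<in> Obj C" and x: "x \<in> el X c" and y: "y \<in> el Y c"
  obtains z where "z \<in> el P c" "ap p c z = x" "ap q c z = y"
proof -
  have X: "X \<in> Obj E" and Y: "Y \<in> Obj E" and p: "p \<in> hom E P X" and q: "q \<in> hom E P Y"
    and univ: "\<And>W f g. W \<in> Obj E \<Longrightarrow> f \<in> hom E W X \<Longrightarrow> g \<in> hom E W Y \<Longrightarrow>
      \<exists>!h. h \<in> hom E W P \<and> p \<cdot> h = f \<and> q \<cdot> h = g"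
    using prod by (auto simp: is_product_def)
  \<comment> \<open>One code of pairs for all stages at once, so that restriction can decode,
    restrict and encode again.\<close>
  define U where "U = (\<Union>c\<in>Obj C. el X c) \<times> (\<Union>c\<in>Obj C. el Y c)"
  obtain e :: "'v \<times> 'v \<Rightarrow> 'v" where e: "inj_on e U" "small (e ` U)"
    unfolding U_def by (rule small_pairing[OF el_small_Union[OF X] el_small_Union[OF Y]]) blast
  define ob where "ob c = e ` (el X c \<times> el Y c)" for c
  define fs where "fs u = fst (inv_into U e u)" for u
  define sn where "sn u = snd (inv_into U e u)" for u
  define r where "r g u = e (rs X g (fs u), rs Y g (sn u))" for g u
  have dec: "fs (e (x, y)) = x" "sn (e (x, y)) = y" if "c \<in> Obj C" "x \<in> el X c" "y \<in> el Y c" for c x y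
  proof -
    have "(x, y) \<in> U"
      using that by (auto simp: U_def)
    then show "fs (e (x, y)) = x" "sn (e (x, y)) = y"
      using inv_into_f_f[OF e(1)] by (simp_all add: fs_def sn_def)
  qed
  have ob: "fs u \<in> el X c" "sn u \<in> el Y c" "e (fs u, sn u) = u" if "c \<in> Obj C" "u \<in> ob c" for c u
    using that dec by (auto simp: ob_def)
  have r_in: "r g u \<in> ob c" "fs (r g u) = rs X g (fs u)" "sn (r g u) = rs Y g (sn u)"
    if g: "g \<in> hom C c d" and u: "u \<in> ob d" for c d g u
  proof -
    note X' = rs_in[OF X g ob(1)[OF cat_cod[OF C g] u]] and Y' = rs_in[OF Y g ob(2)[OF cat_cod[OF C g] u]]
    show "r g u \<in> ob c"
      unfolding r_def ob_def using X' Y' by blast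
    show "fs (r g u) = rs X g (fs u)" "sn (r g u) = rs Y g (sn u)"
      using dec[OF cat_dom[OF C g] X' Y'] by (simp_all only: r_def)
  qed
  have eqI: "u = v" if "c \<in> Obj C" "u \<in> ob c" "v \<in> ob c" "fs u = fs v" "sn u = sn v" for c u v
    using ob(3)[OF that(1,2)] ob(3)[OF that(1,3)] that(4,5) by metis
  have pre: "presheaf_data C ob r"
    unfolding presheaf_data_def
  proof (intro conjI ballI allI impI)
    fix c assume c: "c \<in> Obj C"
    show "small (ob c)"
      by (rule small_subset[OF e(2)]) (use c in \<open>auto simp: ob_def U_def\<close>)
    fix u assume u: "u \<in> ob c"
    show "r (Id C c) u = u"
      by (simp add: r_def rs_Id[OF X c ob(1)[OF c u]] rs_Id[OF Y c ob(2)[OF c u]] ob(3)[OF c u])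
  next
    fix b c d f g u assume f: "f \<in> hom C c d" and g: "g \<in> hom C b c" and u: "u \<in> ob d"
    show "r (f \<cdot>\<^bsub>C\<^esub> g) u = r g (r f u)"
      using r_in[OF f u] rs_comp[OF X f g ob(1)[OF cat_cod[OF C f] u]]
        rs_comp[OF Y f g ob(2)[OF cat_cod[OF C f] u]]
      by (simp add: r_def[of g] r_def[of "f \<cdot>\<^bsub>C\<^esub> g"])
  qed (rule r_in)
  have "sheaf_data C K ob r"
    unfolding sheaf_data_def
  proof (intro conjI ballI allI impI pre)
    fix c R x assume c: "c \<in> Obj C" and R: "R \<in> K c" and m: "matching C ob r R x"
    note Rh = cover_arr[OF c R]
    have x: "x f \<in> ob (Src C f)" if "f \<in> R" for f
      using m that unfolding matching_def by blast
    note Rd = cat_dom[OF C Rh]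
    have mm: "rs X h (fs (x f)) = rs X k (fs (x g))" "rs Y h (sn (x f)) = rs Y k (sn (x g))"
      if "f \<in> R" "g \<in> R" "h \<in> Arr C" "k \<in> Arr C" "Tgt C h = Src C f" "Tgt C k = Src C g"
        "Src C h = Src C k" "f \<cdot>\<^bsub>C\<^esub> h = g \<cdot>\<^bsub>C\<^esub> k" for f g h k
    proof -
      have h: "h \<in> hom C (Src C h) (Src C f)" and k: "k \<in> hom C (Src C k) (Src C g)"
        using that by (simp_all add: in_hom)
      have "r h (x f) = r k (x g)"
        using m that unfolding matching_def by blast
      then show "rs X h (fs (x f)) = rs X k (fs (x g))" "rs Y h (sn (x f)) = rs Y k (sn (x g))"
        using r_in(2,3)[OF h x[OF that(1)]] r_in(2,3)[OF k x[OF that(2)]] by simp_all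
    qed
    have "matching C (el X) (rs X) R (\<lambda>f. fs (x f))" "matching C (el Y) (rs Y) R (\<lambda>f. sn (x f))"
      unfolding matching_def using ob(1,2)[OF Rd x] mm by blast+
    from sheaf_glue[OF el_sheaf[OF X] c R this(1)] sheaf_glue[OF el_sheaf[OF Y] c R this(2)]
    obtain a b where a: "a \<in> el X c" "\<And>f. f \<in> R \<Longrightarrow> rs X f a = fs (x f)"
      and b: "b \<in> el Y c" "\<And>f. f \<in> R \<Longrightarrow> rs Y f b = sn (x f)"
      and ua: "\<And>a'. a' \<in> el X c \<Longrightarrow> \<forall>f\<in>R. rs X f a' = fs (x f) \<Longrightarrow> a' = a"
      and ub: "\<And>b'. b' \<in> el Y c \<Longrightarrow> \<forall>f\<in>R. rs Y f b' = sn (x f) \<Longrightarrow> b' = b"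
      by blast
    show "\<exists>!y. y \<in> ob c \<and> (\<forall>f\<in>R. r f y = x f)"
    proof (rule ex1I[of _ "e (a, b)"])
      show "e (a, b) \<in> ob c \<and> (\<forall>f\<in>R. r f (e (a, b)) = x f)"
        using a b dec[OF c a(1) b(1)] ob(3)[OF Rd x] by (auto simp: ob_def r_def)
      fix u assume u: "u \<in> ob c \<and> (\<forall>f\<in>R. r f u = x f)"
      have "rs X f (fs u) = fs (x f)" "rs Y f (sn u) = sn (x f)" if "f \<in> R" for f
        using u that r_in(2,3)[OF Rh[OF that], of u] by auto
      then have "fs u = a" "sn u = b"
        using ua[OF ob(1)[OF c]] ub[OF ob(2)[OF c]] u by auto
      then show "u = e (a, b)"
        using ob(3)[OF c, of u] u by simp
    qed
  qed
  from obj_exists[OF this] obtain Z t where Z: "Z \<in> Obj E"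
    and bij: "\<And>c. c \<in> Obj C \<Longrightarrow> bij_betw (t c) (el Z c) (ob c)"
    and nat: "\<And>c d g x. g \<in> hom C c d \<Longrightarrow> x \<in> el Z d \<Longrightarrow> t c (rs Z g x) = r g (t d x)"
    by metis
  have t_in: "t c z \<in> ob c" if "c \<in> Obj C" "z \<in> el Z c" for c z
    using bij_betwE[OF bij[OF that(1)]] that(2) by blast
  obtain f where f: "f \<in> hom E Z X" "\<And>c z. c \<in> Obj C \<Longrightarrow> z \<in> el Z c \<Longrightarrow> ap f c z = fs (t c z)"
    by (rule arr_exists[OF Z X, of "\<lambda>c z. fs (t c z)"])
      (use nat r_in t_in[OF cat_cod[OF C]] ob t_in in auto)
  obtain g where g: "g \<in> hom E Z Y" "\<And>c z. c \<in> Obj C \<Longrightarrow> z \<in> el Z c \<Longrightarrow> ap g c z = sn (t c z)"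
    by (rule arr_exists[OF Z Y, of "\<lambda>c z. sn (t c z)"])
      (use nat r_in t_in[OF cat_cod[OF C]] ob t_in in auto)
  obtain h where h: "h \<in> hom E Z P" "p \<cdot> h = f" "q \<cdot> h = g"
    using univ[OF Z f(1) g(1)] by blast
  have "e (x, y) \<in> t c ` el Z c"
    using bij_betw_imp_surj_on[OF bij[OF c]] x y by (auto simp: ob_def)
  then obtain z where z: "z \<in> el Z c" "t c z = e (x, y)"
    by force
  show thesis
    using that[OF ap_in[OF h(1) c z(1)]] ap_comp[OF h(1) p c z(1)] ap_comp[OF h(1) q c z(1)]
      f(2)[OF c z(1)] g(2)[OF c z(1)] dec[OF c x y] by (simp add: h z)
qed

text \<open>The constant singleton sheaf is represented by some \<open>Z\<close> with arrows
  \<open>f\<close> to \<open>T\<close> and \<open>g\<close> back. Terminality forces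
  \<open>f\<close> after \<open>g\<close> to be the identity, so every element of \<open>T\<close>
  comes from the only element of \<open>Z\<close>.\<close>

lemma terminal_el:
  assumes T: "is_terminal E T" and c: "c \<in> Obj C"
  shows "\<exists>!x. x \<in> el T c"
proof -
  have TO: "T \<in> Obj E" and un: "\<And>X. X \<in> Obj E \<Longrightarrow> \<exists>!f. f \<in> hom E X T"
    using T by (simp_all add: is_terminal_def)
  define u where "u = (undefined :: 'v)"
  have "sheaf_data C K (\<lambda>c. {u}) (\<lambda>g x. u)"
    unfolding sheaf_data_def presheaf_data_def matching_def by (auto simp: small_singleton)
  from obj_exists[OF this] obtain Z t where Z: "Z \<in> Obj E"
    and bij: "\<And>c. c \<in> Obj C \<Longrightarrow> bij_betw (t c) (el Z c) {u}"
    by metis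
  have inj: "x = y" if c: "c \<in> Obj C" and x: "x \<in> el Z c" and y: "y \<in> el Z c" for c x y
  proof (rule inj_onD[OF bij_betw_imp_inj_on[OF bij[OF c]] _ x y])
    show "t c x = t c y"
      using bij_betwE[OF bij[OF c]] x y by simp
  qed
  have ex: "\<exists>z. z \<in> el Z c" if "c \<in> Obj C" for c
    using bij_betw_imp_surj_on[OF bij[OF that]] by blast
  have some: "(SOME z. z \<in> el Z c) \<in> el Z c" if "c \<in> Obj C" for c
    by (rule someI_ex[OF ex[OF that]])
  obtain z where z: "z \<in> el Z c"
    using ex[OF c] by blast
  obtain f where f: "f \<in> hom E Z T"
    using un[OF Z] by blast
  obtain g where g: "g \<in> hom E T Z"
  proof (rule arr_exists[OF TO Z, of "\<lambda>c x. SOME z. z \<in> el Z c"])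
    show "(SOME z. z \<in> el Z c) = rs Z g (SOME z. z \<in> el Z d)" if g: "g \<in> hom C c d" for c d g
      by (rule inj[OF cat_dom[OF C g] some[OF cat_dom[OF C g]] rs_in[OF Z g some[OF cat_cod[OF C g]]]])
  qed (rule some)
  have fg: "f \<cdot> g = Id E T"
    using un[OF TO] cat_comp[OF E g f] cat_Id[OF E TO] by blast
  have eq: "x = ap f c z" if x: "x \<in> el T c" for x
  proof -
    have "ap f c (ap g c x) = x"
      using ap_comp[OF g f c x] ap_Id[OF TO c x] by (simp add: fg)
    then show ?thesis
      using inj[OF c ap_in[OF g c x] z] by simp
  qed
  then show ?thesis
    using ap_in[OF f c z] by blast
qed

section \<open>Closed sieves as truth values\<close>

definition closed_sieve :: "'v \<Rightarrow> 'v set \<Rightarrow> bool" where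
  "closed_sieve c R \<longleftrightarrow> is_sieve C c R \<and>
     (\<forall>d g. g \<in> hom C d c \<longrightarrow> locally d (\<lambda>k. g \<cdot>\<^bsub>C\<^esub> k \<in> R) \<longrightarrow> g \<in> R)"

lemma sieve_hom: "is_sieve C c R \<Longrightarrow> g \<in> R \<Longrightarrow> g \<in> hom C (Src C g) c"
  by (auto simp: is_sieve_def in_hom)

lemma in_pullback: "h \<in> hom C d c \<Longrightarrow> k \<in> hom C e d \<Longrightarrow> k \<in> pullback_sieve C h R \<longleftrightarrow> h \<cdot>\<^bsub>C\<^esub> k \<in> R"
  by (auto simp: pullback_sieve_def in_hom)

lemma sieve_eqI:
  assumes "is_sieve C c R" "is_sieve C c S"
    and "\<And>d g. g \<in> hom C d c \<Longrightarrow> g \<in> R \<longleftrightarrow> g \<in> S"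
  shows "R = S"
  using assms sieve_hom by blast

lemma pullback_is_sieve:
  assumes h: "h \<in> hom C d c" and R: "is_sieve C c R"
  shows "is_sieve C d (pullback_sieve C h R)"
  unfolding is_sieve_def
proof (intro conjI ballI subsetI impI)
  fix f assume f: "f \<in> pullback_sieve C h R"
  have f': "f \<in> hom C (Src C f) d" "h \<cdot>\<^bsub>C\<^esub> f \<in> R"
    using f in_pullback_sieve[OF h] by blast+
  then show "f \<in> {f \<in> Arr C. Tgt C f = d}"
    by (simp add: in_hom)
  fix g assume "g \<in> Arr C" "Tgt C g = Src C f"
  then have g: "g \<in> hom C (Src C g) (Src C f)"
    by (simp add: in_hom)
  have "h \<cdot>\<^bsub>C\<^esub> f \<cdot>\<^bsub>C\<^esub> g \<in> R"
    using sieve_comp[OF R f'(2), of g] g hom_src[OF cat_comp[OF C f'(1) h]] by simp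
  then show "f \<cdot>\<^bsub>C\<^esub> g \<in> pullback_sieve C h R"
    using in_pullback[OF h cat_comp[OF C g f'(1)]] cat_assoc[OF C g f'(1) h] by simp
qed

lemma closed_pullback:
  assumes h: "h \<in> hom C d c" and R: "closed_sieve c R"
  shows "closed_sieve d (pullback_sieve C h R)"
proof -
  have Rs: "is_sieve C c R" and Rc: "\<And>d g. g \<in> hom C d c \<Longrightarrow> locally d (\<lambda>k. g \<cdot>\<^bsub>C\<^esub> k \<in> R) \<Longrightarrow> g \<in> R"
    using R unfolding closed_sieve_def by blast+
  show ?thesis
    unfolding closed_sieve_def
  proof (intro conjI allI impI pullback_is_sieve[OF h Rs])
    fix e g assume g: "g \<in> hom C e d" and l: "locally e (\<lambda>k. g \<cdot>\<^bsub>C\<^esub> k \<in> pullback_sieve C h R)"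
    have "h \<cdot>\<^bsub>C\<^esub> g \<in> R"
    proof (rule Rc[OF cat_comp[OF C g h]], rule locally_mono[OF cat_dom[OF C g] l])
      fix b k assume k: "k \<in> hom C b e" and gk: "g \<cdot>\<^bsub>C\<^esub> k \<in> pullback_sieve C h R"
      then show "h \<cdot>\<^bsub>C\<^esub> g \<cdot>\<^bsub>C\<^esub> k \<in> R"
        using in_pullback[OF h cat_comp[OF C k g]] cat_assoc[OF C k g h] by simp
    qed
    then show "g \<in> pullback_sieve C h R"
      using in_pullback[OF h g] by simp
  qed
qed

lemma pullback_comp:
  assumes f: "f \<in> hom C d c" and g: "g \<in> hom C e d" and R: "is_sieve C c R"
  shows "pullback_sieve C (f \<cdot>\<^bsub>C\<^esub> g) R = pullback_sieve C g (pullback_sieve C f R)"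
proof (rule sieve_eqI[OF pullback_is_sieve[OF cat_comp[OF C g f] R] pullback_is_sieve[OF g pullback_is_sieve[OF f R]]])
  fix b k assume k: "k \<in> hom C b e"
  show "k \<in> pullback_sieve C (f \<cdot>\<^bsub>C\<^esub> g) R \<longleftrightarrow> k \<in> pullback_sieve C g (pullback_sieve C f R)"
    by (simp add: in_pullback[OF cat_comp[OF C g f] k] in_pullback[OF g k]
        in_pullback[OF f cat_comp[OF C k g]] cat_assoc[OF C k g f])
qed

lemma pullback_Id:
  assumes c: "c \<in> Obj C" and R: "is_sieve C c R"
  shows "pullback_sieve C (Id C c) R = R"
  by (rule sieve_eqI[OF pullback_is_sieve[OF cat_Id[OF C c] R] R])
    (simp add: in_pullback[OF cat_Id[OF C c]] cat_id_left[OF C])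

text \<open>The sheaf of closed sieves is the subobject classifier; the two arrows are the characteristic
  maps of \<open>\<phi>\<close> and of the whole of \<open>X\<close>.\<close>

lemma classifier:
  assumes X: "X \<in> Obj E" and \<phi>: "local_pred X \<phi>"
  obtains Y f g where "f \<in> hom E X Y" "g \<in> hom E X Y"
    "\<And>c x. c \<in> Obj C \<Longrightarrow> x \<in> el X c \<Longrightarrow> ap f c x = ap g c x \<longleftrightarrow> \<phi> c x"
proof -
  \<comment> \<open>Sieves are sets of arrows and must become elements of \<open>'v\<close>; a
    single code for all sets of arrows serves every stage.\<close>
  obtain e :: "'v set \<Rightarrow> 'v" and V where V: "small V" and e: "bij_betw e (Pow (Arr C)) V"
    using small_Pow[OF small_Arr] by blast
  define dec where "dec = inv_into (Pow (Arr C)) e"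
  have sub: "R \<subseteq> Arr C" if "is_sieve C c R" for c R
    using that by (auto simp: is_sieve_def)
  have closedD: "is_sieve C c R" "\<And>d g. g \<in> hom C d c \<Longrightarrow> locally d (\<lambda>k. g \<cdot>\<^bsub>C\<^esub> k \<in> R) \<Longrightarrow> g \<in> R"
    if "closed_sieve c R" for c R
    using that unfolding closed_sieve_def by blast+
  have dec: "dec (e R) = R" if "closed_sieve c R" for c R
    unfolding dec_def using e sub[OF closedD(1)[OF that]] by (simp add: bij_betw_def)
  define ob where "ob c = e ` {R. closed_sieve c R}" for c
  define r where "r g u = e (pullback_sieve C g (dec u))" for g u
  have ob: "closed_sieve c (dec u)" "e (dec u) = u" if "u \<in> ob c" for c u
    using that dec by (auto simp: ob_def)
  have r_in: "r g u \<in> ob c" "dec (r g u) = pullback_sieve C g (dec u)"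
    if "g \<in> hom C c d" "u \<in> ob d" for c d g u
    using closed_pullback[OF that(1) ob(1)[OF that(2)]] dec by (auto simp: r_def ob_def)
  have "sheaf_data C K ob r"
    unfolding sheaf_data_def
  proof (intro conjI ballI allI impI)
    show "presheaf_data C ob r"
      unfolding presheaf_data_def
    proof (intro conjI ballI allI impI)
      fix c assume c: "c \<in> Obj C"
      show "small (ob c)"
        by (rule small_subset[OF V]) (use bij_betwE[OF e] sub[OF closedD(1)] in \<open>auto simp: ob_def\<close>)
      fix u assume u: "u \<in> ob c"
      show "r (Id C c) u = u"
        by (simp add: r_def pullback_Id[OF c closedD(1)[OF ob(1)[OF u]]] ob(2)[OF u])
    next
      fix b c d f g u assume f: "f \<in> hom C c d" and g: "g \<in> hom C b c" and u: "u \<in> ob d"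
      show "r (f \<cdot>\<^bsub>C\<^esub> g) u = r g (r f u)"
        using r_in(2)[OF f u] pullback_comp[OF f g closedD(1)[OF ob(1)[OF u]]]
        by (simp add: r_def[of g] r_def[of "f \<cdot>\<^bsub>C\<^esub> g"])
    qed (rule r_in)
  next
    fix c S x assume c: "c \<in> Obj C" and S: "S \<in> K c" and m: "matching C ob r S x"
    note Sh = cover_arr[OF c S] and Ss = cover_sieve[OF c S]
    note Sd = cat_dom[OF C Sh]
    have x: "x f \<in> ob (Src C f)" if "f \<in> S" for f
      using m that unfolding matching_def by blast
    have x_comp: "dec (x (f \<cdot>\<^bsub>C\<^esub> k)) = pullback_sieve C k (dec (x f))"
      if f: "f \<in> S" and k: "k \<in> hom C d (Src C f)" for f k d
    proof -
      have fk: "f \<cdot>\<^bsub>C\<^esub> k \<in> S" "f \<cdot>\<^bsub>C\<^esub> k \<in> hom C d c"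
        using sieve_comp[OF Ss f k] cat_comp[OF C k Sh[OF f]] .
      have d: "Id C d \<in> hom C d d"
        by (rule cat_Id[OF C cat_dom[OF C k]])
      have mm: "\<forall>f\<in>S. \<forall>g\<in>S. \<forall>h\<in>Arr C. \<forall>k\<in>Arr C. Tgt C h = Src C f \<longrightarrow> Tgt C k = Src C g \<longrightarrow>
          Src C h = Src C k \<longrightarrow> f \<cdot>\<^bsub>C\<^esub> h = g \<cdot>\<^bsub>C\<^esub> k \<longrightarrow> r h (x f) = r k (x g)"
        using m unfolding matching_def by (rule conjunct2)
      have "r k (x f) = r (Id C d) (x (f \<cdot>\<^bsub>C\<^esub> k))"
        by (rule mm[rule_format, OF f fk(1) hom_arr[OF k] hom_arr[OF d]])
          (use k d fk(2) in \<open>simp_all add: in_hom cat_id_right[OF C fk(2)]\<close>)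
      then have "dec (r k (x f)) = dec (r (Id C d) (x (f \<cdot>\<^bsub>C\<^esub> k)))"
        by simp
      moreover have "x (f \<cdot>\<^bsub>C\<^esub> k) \<in> ob d"
        using x[OF fk(1)] hom_src[OF fk(2)] by simp
      ultimately show ?thesis
        using r_in(2)[OF k x[OF f]] r_in(2)[OF d] pullback_Id[OF cat_dom[OF C k]] closedD(1)[OF ob(1)]
        by metis
    qed
    \<comment> \<open>The amalgamated sieve: \<open>g\<close> belongs to it if the prescribed value
      is true at every restriction of \<open>g\<close> that falls into the cover. Containing the
      identity says that a sieve is maximal, that is, true.\<close>
    define y where "y = {g \<in> Arr C. Tgt C g = c \<and>
      (\<forall>d h. h \<in> hom C d (Src C g) \<longrightarrow> g \<cdot>\<^bsub>C\<^esub> h \<in> S \<longrightarrow> Id C d \<in> dec (x (g \<cdot>\<^bsub>C\<^esub> h)))}"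
    have in_y: "g \<in> y \<longleftrightarrow> (\<forall>d h. h \<in> hom C d e \<longrightarrow> g \<cdot>\<^bsub>C\<^esub> h \<in> S \<longrightarrow> Id C d \<in> dec (x (g \<cdot>\<^bsub>C\<^esub> h)))"
      if "g \<in> hom C e c" for g e
      using that by (auto simp: y_def in_hom)
    have Id_in: "Id C d \<in> dec (x (f \<cdot>\<^bsub>C\<^esub> k)) \<longleftrightarrow> k \<in> dec (x f)"
      if f: "f \<in> S" and k: "k \<in> hom C d (Src C f)" for f k d
      using x_comp[OF f k] in_pullback[OF k cat_Id[OF C cat_dom[OF C k]]] cat_id_right[OF C k] by simp
    have y: "closed_sieve c y"
      unfolding closed_sieve_def
    proof (intro conjI allI impI)
      show "is_sieve C c y"
        unfolding is_sieve_def
      proof (intro conjI ballI subsetI impI)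
        fix f g assume f: "f \<in> y" and g: "g \<in> Arr C" "Tgt C g = Src C f"
        have f': "f \<in> hom C (Src C f) c"
          using f by (simp add: y_def in_hom)
        have g': "g \<in> hom C (Src C g) (Src C f)"
          using g by (simp add: in_hom)
        show "f \<cdot>\<^bsub>C\<^esub> g \<in> y"
          unfolding in_y[OF cat_comp[OF C g' f']]
        proof (intro allI impI)
          fix d h assume h: "h \<in> hom C d (Src C g)" "f \<cdot>\<^bsub>C\<^esub> g \<cdot>\<^bsub>C\<^esub> h \<in> S"
          then show "Id C d \<in> dec (x (f \<cdot>\<^bsub>C\<^esub> g \<cdot>\<^bsub>C\<^esub> h))"
            using f[unfolded in_y[OF f']] cat_comp[OF C h(1) g'] cat_assoc[OF C h(1) g' f'] by simp
        qed
      qed (simp add: y_def)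
      fix d g assume g: "g \<in> hom C d c" and l: "locally d (\<lambda>k. g \<cdot>\<^bsub>C\<^esub> k \<in> y)"
      show "g \<in> y"
        unfolding in_y[OF g]
      proof (intro allI impI)
        fix b h assume h: "h \<in> hom C b d" and gh: "g \<cdot>\<^bsub>C\<^esub> h \<in> S"
        note gh' = cat_comp[OF C h g]
        note b = cat_dom[OF C h]
        have "x (g \<cdot>\<^bsub>C\<^esub> h) \<in> ob b"
          using x[OF gh] hom_src[OF gh'] by simp
        note cl = closedD(2)[OF ob(1)[OF this] cat_Id[OF C b]]
        show "Id C b \<in> dec (x (g \<cdot>\<^bsub>C\<^esub> h))"
        proof (rule cl, rule locally_mono[OF b locally_pull[OF l h]])
          fix a k assume k: "k \<in> hom C a b" and in_y': "g \<cdot>\<^bsub>C\<^esub> (h \<cdot>\<^bsub>C\<^esub> k) \<in> y"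
          note hk = cat_comp[OF C k h] and a = cat_dom[OF C k]
          have k': "k \<in> hom C a (Src C (g \<cdot>\<^bsub>C\<^esub> h))"
            using k hom_src[OF gh'] by simp
          have "g \<cdot>\<^bsub>C\<^esub> h \<cdot>\<^bsub>C\<^esub> k \<in> S"
            by (rule sieve_comp[OF Ss gh k'])
          then have "Id C a \<in> dec (x (g \<cdot>\<^bsub>C\<^esub> h \<cdot>\<^bsub>C\<^esub> k))"
            using in_y'[unfolded in_y[OF cat_comp[OF C hk g]]] cat_Id[OF C a]
              cat_id_right[OF C cat_comp[OF C hk g]] cat_assoc[OF C k h g] by metis
          then have "k \<in> dec (x (g \<cdot>\<^bsub>C\<^esub> h))"
            using Id_in[OF gh k'] by simp
          then show "Id C b \<cdot>\<^bsub>C\<^esub> k \<in> dec (x (g \<cdot>\<^bsub>C\<^esub> h))"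
            by (simp add: cat_id_left[OF C k])
        qed
      qed
    qed
    have yf: "pullback_sieve C f y = dec (x f)" if f: "f \<in> S" for f
    proof (rule sieve_eqI[OF pullback_is_sieve[OF Sh[OF f] closedD(1)[OF y]] closedD(1)[OF ob(1)[OF x[OF f]]]])
      fix d g assume g: "g \<in> hom C d (Src C f)"
      have fg: "f \<cdot>\<^bsub>C\<^esub> g \<in> S" "f \<cdot>\<^bsub>C\<^esub> g \<in> hom C d c"
        using sieve_comp[OF Ss f g] cat_comp[OF C g Sh[OF f]] .
      have "f \<cdot>\<^bsub>C\<^esub> g \<in> y \<longleftrightarrow> (\<forall>b h. h \<in> hom C b d \<longrightarrow> Id C b \<in> dec (x (f \<cdot>\<^bsub>C\<^esub> g \<cdot>\<^bsub>C\<^esub> h)))"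
        using in_y[OF fg(2)] sieve_comp[OF Ss fg(1)] hom_src[OF fg(2)] by metis
      also have "\<dots> \<longleftrightarrow> (\<forall>b h. h \<in> hom C b d \<longrightarrow> g \<cdot>\<^bsub>C\<^esub> h \<in> dec (x f))"
        using Id_in[OF f cat_comp[OF C _ g]] cat_assoc[OF C _ g Sh[OF f]] by metis
      also have "\<dots> \<longleftrightarrow> g \<in> dec (x f)"
      proof
        assume "\<forall>b h. h \<in> hom C b d \<longrightarrow> g \<cdot>\<^bsub>C\<^esub> h \<in> dec (x f)"
        then have "g \<cdot>\<^bsub>C\<^esub> Id C d \<in> dec (x f)"
          using cat_Id[OF C cat_dom[OF C g]] by blast
        then show "g \<in> dec (x f)"
          by (simp add: cat_id_right[OF C g])
      next
        assume gx: "g \<in> dec (x f)"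
        show "\<forall>b h. h \<in> hom C b d \<longrightarrow> g \<cdot>\<^bsub>C\<^esub> h \<in> dec (x f)"
          using sieve_comp[OF closedD(1)[OF ob(1)[OF x[OF f]]] gx] hom_src[OF g] by simp
      qed
      finally show "g \<in> pullback_sieve C f y \<longleftrightarrow> g \<in> dec (x f)"
        by (simp add: in_pullback[OF Sh[OF f] g])
    qed
    show "\<exists>!u. u \<in> ob c \<and> (\<forall>f\<in>S. r f u = x f)"
    proof (rule ex1I[of _ "e y"])
      show "e y \<in> ob c \<and> (\<forall>f\<in>S. r f (e y) = x f)"
        using y by (auto simp: ob_def r_def dec[OF y] yf ob(2)[OF x])
      fix u assume u: "u \<in> ob c \<and> (\<forall>f\<in>S. r f u = x f)"
      then have cu: "closed_sieve c (dec u)"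
        using ob by blast
      have ps: "pullback_sieve C f (dec u) = pullback_sieve C f y" if f: "f \<in> S" for f
        using r_in(2)[OF Sh[OF f], of u] u f yf[OF f] by auto
      have lS: "locally c (\<lambda>g. g \<in> S)"
        using S by (auto simp: locally_def)
      \<comment> \<open>Closed sieves are determined on a cover: a member of \<open>R\<close> lies
        locally in \<open>S\<close>, hence locally in \<open>R'\<close>, hence in \<open>R'\<close>
        by closedness.\<close>
      have half: "g \<in> R'" if R: "closed_sieve c R" and R': "closed_sieve c R'" and g: "g \<in> hom C d c" "g \<in> R"
        and pR: "\<And>f. f \<in> S \<Longrightarrow> pullback_sieve C f R = pullback_sieve C f R'" for R R' g d
      proof (rule closedD(2)[OF R' g(1)], rule locally_mono[OF cat_dom[OF C g(1)] locally_pull[OF lS g(1)]])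
        fix b k assume k: "k \<in> hom C b d" and gk: "g \<cdot>\<^bsub>C\<^esub> k \<in> S"
        note gk' = cat_comp[OF C k g(1)] and b = cat_Id[OF C cat_dom[OF C k]]
        have "g \<cdot>\<^bsub>C\<^esub> k \<in> R"
          using sieve_comp[OF closedD(1)[OF R] g(2)] k hom_src[OF g(1)] by simp
        then show "g \<cdot>\<^bsub>C\<^esub> k \<in> R'"
          using pR[OF gk] in_pullback[OF gk' b] cat_id_right[OF C gk'] by metis
      qed
      have "dec u = y"
      proof (rule sieve_eqI[OF closedD(1)[OF cu] closedD(1)[OF y]])
        fix d g assume g: "g \<in> hom C d c"
        show "g \<in> dec u \<longleftrightarrow> g \<in> y"
          using half[OF cu y g] half[OF y cu g] ps by metis
      qed
      then show "u = e y"
        using ob(2)[of u c] u by simp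
    qed
  qed
  from obj_exists[OF this] obtain Z t where Z: "Z \<in> Obj E"
    and bij: "\<And>c. c \<in> Obj C \<Longrightarrow> bij_betw (t c) (el Z c) (ob c)"
    and nat: "\<And>c d g x. g \<in> hom C c d \<Longrightarrow> x \<in> el Z d \<Longrightarrow> t c (rs Z g x) = r g (t d x)"
    by metis
  have stable: "\<phi> d (rs X g x)" if "g \<in> hom C d c" "x \<in> el X c" "\<phi> c x" for c d g x
    using \<phi> that unfolding local_pred_def by blast
  have local: "\<phi> c x" if "c \<in> Obj C" "x \<in> el X c" "locally c (\<lambda>g. \<phi> (Src C g) (rs X g x))" for c x
    using \<phi> that unfolding local_pred_def by blast
  \<comment> \<open>The characteristic map of \<open>\<psi>\<close>: an element is sent to the sieve
    of arrows along which its restriction satisfies \<open>\<psi>\<close>, which is closed because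
    \<open>\<psi>\<close> is local.\<close>
  have char: "\<exists>f\<in>hom E X Z. \<forall>c x. c \<in> Obj C \<longrightarrow> x \<in> el X c \<longrightarrow>
      t c (ap f c x) = e {g \<in> Arr C. Tgt C g = c \<and> \<psi> (Src C g) (rs X g x)}"
    if \<psi>: "local_pred X \<psi>" for \<psi>
  proof -
    define s where "s c x = {g \<in> Arr C. Tgt C g = c \<and> \<psi> (Src C g) (rs X g x)}" for c x
    have in_s: "g \<in> s c x \<longleftrightarrow> \<psi> d (rs X g x)" if "g \<in> hom C d c" for c d g x
      using that by (auto simp: s_def in_hom)
    have cl: "closed_sieve c (s c x)" if c: "c \<in> Obj C" and x: "x \<in> el X c" for c x
      unfolding closed_sieve_def is_sieve_def
    proof (intro conjI ballI subsetI impI allI)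
      fix f g assume f: "f \<in> s c x" and g: "g \<in> Arr C" "Tgt C g = Src C f"
      have f': "f \<in> hom C (Src C f) c"
        using f by (simp add: s_def in_hom)
      have g': "g \<in> hom C (Src C g) (Src C f)"
        using g by (simp add: in_hom)
      show "f \<cdot>\<^bsub>C\<^esub> g \<in> s c x"
        using f \<psi> g' rs_in[OF X f' x] rs_comp[OF X f' g' x]
        unfolding in_s[OF f'] in_s[OF cat_comp[OF C g' f']] local_pred_def by auto
    next
      fix d g assume g: "g \<in> hom C d c" and l: "locally d (\<lambda>k. g \<cdot>\<^bsub>C\<^esub> k \<in> s c x)"
      have "locally d (\<lambda>k. \<psi> (Src C k) (rs X k (rs X g x)))"
        by (rule locally_mono[OF cat_dom[OF C g] l])
          (use in_s[OF cat_comp[OF C _ g]] rs_comp[OF X g _ x] hom_src[where C = C] in metis)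
      then show "g \<in> s c x"
        using \<psi> rs_in[OF X g x] cat_dom[OF C g] unfolding in_s[OF g] local_pred_def by blast
    qed (simp add: s_def)
    define u where "u c x = the_inv_into (el Z c) (t c) (e (s c x))" for c x
    have u: "u c x \<in> el Z c" "t c (u c x) = e (s c x)" if "c \<in> Obj C" "x \<in> el X c" for c x
    proof -
      have "e (s c x) \<in> ob c"
        using cl[OF that] by (auto simp: ob_def)
      then show "u c x \<in> el Z c" "t c (u c x) = e (s c x)"
        using bij[OF that(1)] f_the_inv_into_f_bij_betw[OF bij[OF that(1)]]
          the_inv_into_into[of "t c" "el Z c"] unfolding u_def by (auto simp: bij_betw_def)
    qed
    obtain f where f: "f \<in> hom E X Z" "\<And>c x. c \<in> Obj C \<Longrightarrow> x \<in> el X c \<Longrightarrow> ap f c x = u c x"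
    proof (rule arr_exists[OF X Z, of u])
      fix c d g x assume g: "g \<in> hom C c d" and x: "x \<in> el X d"
      note c = cat_dom[OF C g] and d = cat_cod[OF C g] and gx = rs_in[OF X g x]
      have "s c (rs X g x) = pullback_sieve C g (s d x)"
      proof (rule sieve_eqI[OF closedD(1)[OF cl[OF c gx]] pullback_is_sieve[OF g closedD(1)[OF cl[OF d x]]]])
        fix b k assume k: "k \<in> hom C b c"
        show "k \<in> s c (rs X g x) \<longleftrightarrow> k \<in> pullback_sieve C g (s d x)"
          by (simp add: in_s[OF k] in_pullback[OF g k] in_s[OF cat_comp[OF C k g]] rs_comp[OF X g k x])
      qed
      then have "t c (u c (rs X g x)) = t c (rs Z g (u d x))"
        by (simp add: u(2)[OF c gx] nat[OF g u(1)[OF d x]] u(2)[OF d x] r_def dec[OF cl[OF d x]])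
      then show "u c (rs X g x) = rs Z g (u d x)"
        using bij[OF c] u(1)[OF c gx] rs_in[OF Z g u(1)[OF d x]]
        by (auto simp: bij_betw_def dest: inj_onD)
    qed (use u in auto)
    have "\<forall>c x. c \<in> Obj C \<longrightarrow> x \<in> el X c \<longrightarrow>
        t c (ap f c x) = e {g \<in> Arr C. Tgt C g = c \<and> \<psi> (Src C g) (rs X g x)}"
      using f(2) u(2) by (simp add: s_def)
    then show ?thesis
      using f(1) by blast
  qed
  have true: "local_pred X (\<lambda>_ _. True)"
    by (rule local_predI) auto
  obtain f where f: "f \<in> hom E X Z" "\<And>c x. c \<in> Obj C \<Longrightarrow> x \<in> el X c \<Longrightarrow>
      t c (ap f c x) = e {g \<in> Arr C. Tgt C g = c \<and> \<phi> (Src C g) (rs X g x)}"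
    using char[OF \<phi>] by blast
  obtain g where g: "g \<in> hom E X Z" "\<And>c x. c \<in> Obj C \<Longrightarrow> x \<in> el X c \<Longrightarrow>
      t c (ap g c x) = e {g \<in> Arr C. Tgt C g = c \<and> True}"
    using char[OF true] by blast
  show thesis
  proof (rule that[OF f(1) g(1)])
    fix c x assume c: "c \<in> Obj C" and x: "x \<in> el X c"
    have "ap f c x = ap g c x \<longleftrightarrow> t c (ap f c x) = t c (ap g c x)"
      using bij[OF c] ap_in[OF f(1) c x] ap_in[OF g(1) c x] by (auto simp: bij_betw_def dest: inj_onD)
    also have "\<dots> \<longleftrightarrow> {g \<in> Arr C. Tgt C g = c \<and> \<phi> (Src C g) (rs X g x)} = {g \<in> Arr C. Tgt C g = c}"
      unfolding f(2)[OF c x] g(2)[OF c x] using e by (auto simp: bij_betw_def inj_on_eq_iff)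
    also have "\<dots> \<longleftrightarrow> \<phi> c x"
    proof
      assume "{g \<in> Arr C. Tgt C g = c \<and> \<phi> (Src C g) (rs X g x)} = {g \<in> Arr C. Tgt C g = c}"
      then have "Id C c \<in> {g \<in> Arr C. Tgt C g = c \<and> \<phi> (Src C g) (rs X g x)}"
        using cat_Id[OF C c] by (simp add: in_hom)
      then show "\<phi> c x"
        using cat_Id[OF C c] rs_Id[OF X c x] by (simp add: in_hom)
    next
      assume "\<phi> c x"
      then show "{g \<in> Arr C. Tgt C g = c \<and> \<phi> (Src C g) (rs X g x)} = {g \<in> Arr C. Tgt C g = c}"
        using stable[OF _ x] by (auto simp: in_hom)
    qed
    finally show "ap f c x = ap g c x \<longleftrightarrow> \<phi> c x" .
  qed
qed

text \<open>The local closure of the image of \<open>e\<close> is a subsheaf. Its characteristic map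
  and that of the whole of \<open>X\<close> agree after \<open>e\<close>; an epimorphism makes them
  equal, so every element of \<open>X\<close> is locally in the image.\<close>

lemma epi_locally_surjective:
  assumes epi: "is_epi E e" and e: "e \<in> hom E A X" and c: "c \<in> Obj C" and x: "x \<in> el X c"
  shows "locally c (\<lambda>g. \<exists>a\<in>el A (Src C g). ap e (Src C g) a = rs X g x)"
proof -
  note A = cat_dom[OF E e] and X = cat_cod[OF E e]
  have stable: "\<exists>a\<in>el A d. ap e d a = rs X g x"
    if g: "g \<in> hom C d c" and x: "x \<in> el X c" and ex: "\<exists>a\<in>el A c. ap e c a = x" for c d g x
    using ex rs_in[OF A g] ap_natural[OF e g] by metis
  have lp: "local_pred X (\<lambda>c x. locally c (\<lambda>g. \<exists>a\<in>el A (Src C g). ap e (Src C g) a = rs X g x))"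
    by (rule local_pred_locally[OF X, where \<psi> = "\<lambda>c x. \<exists>a\<in>el A c. ap e c a = x"]) (rule stable)
  obtain Y f g where f: "f \<in> hom E X Y" and g: "g \<in> hom E X Y"
    and eq: "\<And>c x. c \<in> Obj C \<Longrightarrow> x \<in> el X c \<Longrightarrow> ap f c x = ap g c x \<longleftrightarrow>
      locally c (\<lambda>g. \<exists>a\<in>el A (Src C g). ap e (Src C g) a = rs X g x)"
    by (rule classifier[OF X lp]) (rule that)
  have "f \<cdot> e = g \<cdot> e"
  proof (rule arr_eqI[OF cat_comp[OF E e f] cat_comp[OF E e g]])
    fix c a assume c: "c \<in> Obj C" and a: "a \<in> el A c"
    have "locally c (\<lambda>g. \<exists>a'\<in>el A (Src C g). ap e (Src C g) a' = rs X g (ap e c a))"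
    proof (rule locally_all[OF c])
      fix d g assume g: "g \<in> hom C d c"
      show "\<exists>a'\<in>el A (Src C g). ap e (Src C g) a' = rs X g (ap e c a)"
        using stable[OF g ap_in[OF e c a]] a hom_src[OF g] by auto
    qed
    then show "ap (f \<cdot> e) c a = ap (g \<cdot> e) c a"
      using eq[OF c ap_in[OF e c a]] by (simp add: ap_comp[OF e f c a] ap_comp[OF e g c a])
  qed
  then have "f = g"
    using epi f g cat_cod[OF E f] hom_tgt[OF e] unfolding is_epi_def by blast
  then show ?thesis
    using eq[OF c x] by simp
qed

end

section \<open>The representation of a Grothendieck topos by sheaves\<close>

text \<open>Naturality computes \<open>\<alpha> y\<close> after \<open>f\<close> from
  \<open>FArr F f\<close>, and \<open>\<alpha> y\<close> can be cancelled.\<close>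

lemma retraction_faithful:
  assumes F: "is_functor C D F" and \<alpha>: "nat_trans C C id_functor (G \<odot> F) \<alpha>"
    and iso: "\<And>x. x \<in> Obj C \<Longrightarrow> is_iso C (\<alpha> x)"
    and f: "f \<in> hom C x y" and g: "g \<in> hom C x y" and eq: "FArr F f = FArr F g"
  shows "f = g"
proof -
  note C = functor_dom[OF F]
  note y = cat_cod[OF C f]
  have \<alpha>y: "\<alpha> y \<in> hom C y (FObj G (FObj F y))"
    using nat_trans_hom[OF \<alpha> y] by simp
  obtain b where b: "b \<in> hom C (FObj G (FObj F y)) y" "b \<cdot>\<^bsub>C\<^esub> \<alpha> y = Id C y"
    using iso[OF y] unfolding is_iso_hom[OF \<alpha>y] by blast
  have "\<alpha> y \<cdot>\<^bsub>C\<^esub> f = \<alpha> y \<cdot>\<^bsub>C\<^esub> g"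
    using nat_trans_natural[OF \<alpha> f] nat_trans_natural[OF \<alpha> g] eq by simp
  then have "b \<cdot>\<^bsub>C\<^esub> (\<alpha> y \<cdot>\<^bsub>C\<^esub> f) = b \<cdot>\<^bsub>C\<^esub> (\<alpha> y \<cdot>\<^bsub>C\<^esub> g)"
    by simp
  then show ?thesis
    by (simp add: cat_assoc[OF C f \<alpha>y b(1), symmetric] cat_assoc[OF C g \<alpha>y b(1), symmetric] b(2)
        cat_id_left[OF C f] cat_id_left[OF C g])
qed

text \<open>The counterpart for the other functor of an equivalence: \<open>f\<close> after
  \<open>\<beta> x\<close> is computed from \<open>FArr G f\<close>, and \<open>\<beta> x\<close>
  can be cancelled on the right.\<close>

lemma coretraction_faithful:
  assumes G: "is_functor D C G" and \<beta>: "nat_trans D D (F \<odot> G) id_functor \<beta>"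
    and iso: "\<And>x. x \<in> Obj D \<Longrightarrow> is_iso D (\<beta> x)"
    and f: "f \<in> hom D x y" and g: "g \<in> hom D x y" and eq: "FArr G f = FArr G g"
  shows "f = g"
proof -
  note D = functor_dom[OF G]
  note x = cat_dom[OF D f]
  have \<beta>x: "\<beta> x \<in> hom D (FObj F (FObj G x)) x"
    using nat_trans_hom[OF \<beta> x] by simp
  obtain b where b: "b \<in> hom D x (FObj F (FObj G x))" "\<beta> x \<cdot>\<^bsub>D\<^esub> b = Id D x"
    using iso[OF x] unfolding is_iso_hom[OF \<beta>x] by blast
  have "f \<cdot>\<^bsub>D\<^esub> \<beta> x = g \<cdot>\<^bsub>D\<^esub> \<beta> x"
    using nat_trans_natural[OF \<beta> f] nat_trans_natural[OF \<beta> g] eq by simp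
  then have "(f \<cdot>\<^bsub>D\<^esub> \<beta> x) \<cdot>\<^bsub>D\<^esub> b = (g \<cdot>\<^bsub>D\<^esub> \<beta> x) \<cdot>\<^bsub>D\<^esub> b"
    by simp
  then show ?thesis
    by (simp add: cat_assoc[OF D b(1) \<beta>x f] cat_assoc[OF D b(1) \<beta>x g] b(2)
        cat_id_right[OF D f] cat_id_right[OF D g])
qed

text \<open>The candidate is \<open>h\<close> transported by \<open>G\<close> and conjugated by
  \<open>\<alpha>\<close>. Naturality shows that it has the right image under \<open>F\<close>
  followed by \<open>G\<close>, and faithfulness of \<open>G\<close> removes the latter.\<close>

lemma equivalence_full:
  assumes F: "is_functor C D F" and G: "is_functor D C G"
    and \<alpha>: "nat_trans C C id_functor (G \<odot> F) \<alpha>" and \<alpha>_iso: "\<And>x. x \<in> Obj C \<Longrightarrow> is_iso C (\<alpha> x)"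
    and G_faithful: "\<And>f g x y. f \<in> hom D x y \<Longrightarrow> g \<in> hom D x y \<Longrightarrow> FArr G f = FArr G g \<Longrightarrow> f = g"
    and x: "x \<in> Obj C" and y: "y \<in> Obj C" and h: "h \<in> hom D (FObj F x) (FObj F y)"
  shows "\<exists>f\<in>hom C x y. FArr F f = h"
proof -
  note C = functor_dom[OF F]
  have \<alpha>h: "\<alpha> x \<in> hom C x (FObj G (FObj F x))" if "x \<in> Obj C" for x
    using nat_trans_hom[OF \<alpha> that] by simp
  obtain a where a: "a \<in> hom C (FObj G (FObj F x)) x" "\<alpha> x \<cdot>\<^bsub>C\<^esub> a = Id C (FObj G (FObj F x))"
    using \<alpha>_iso[OF x] unfolding is_iso_hom[OF \<alpha>h[OF x]] by blast
  obtain b where b: "b \<in> hom C (FObj G (FObj F y)) y" "\<alpha> y \<cdot>\<^bsub>C\<^esub> b = Id C (FObj G (FObj F y))"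
    using \<alpha>_iso[OF y] unfolding is_iso_hom[OF \<alpha>h[OF y]] by blast
  note Gh = functor_hom[OF G h]
  note Gha = cat_comp[OF C \<alpha>h[OF x] Gh]
  define f where "f = b \<cdot>\<^bsub>C\<^esub> (FArr G h \<cdot>\<^bsub>C\<^esub> \<alpha> x)"
  have f: "f \<in> hom C x y"
    unfolding f_def by (rule cat_comp[OF C Gha b(1)])
  have "FArr G (FArr F f) \<cdot>\<^bsub>C\<^esub> \<alpha> x = \<alpha> y \<cdot>\<^bsub>C\<^esub> f"
    using nat_trans_natural[OF \<alpha> f] by simp
  also have "\<dots> = FArr G h \<cdot>\<^bsub>C\<^esub> \<alpha> x"
    unfolding f_def using cat_assoc[OF C Gha b(1) \<alpha>h[OF y]] by (simp add: b(2) cat_id_left[OF C Gha])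
  finally have "(FArr G (FArr F f) \<cdot>\<^bsub>C\<^esub> \<alpha> x) \<cdot>\<^bsub>C\<^esub> a = (FArr G h \<cdot>\<^bsub>C\<^esub> \<alpha> x) \<cdot>\<^bsub>C\<^esub> a"
    by simp
  moreover have GFf: "FArr G (FArr F f) \<in> hom C (FObj G (FObj F x)) (FObj G (FObj F y))"
    by (intro functor_hom[OF G] functor_hom[OF F] f)
  ultimately have "FArr G (FArr F f) = FArr G h"
    by (simp add: cat_assoc[OF C a(1) \<alpha>h[OF x]] a(2) cat_id_right[OF C GFf] cat_id_right[OF C Gh]
        cat_assoc[OF C a(1) \<alpha>h[OF x] Gh] cat_assoc[OF C a(1) \<alpha>h[OF x] GFf])
  then have "FArr F f = h"
    by (rule G_faithful[OF functor_hom[OF F f] h])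
  then show ?thesis
    using f by blast
qed

lemma sheaf_representation_exists:
  fixes E :: "('o, 'v::universe, 'z) cat_scheme"
  assumes "grothendieck_topos E"
  obtains C K F where "sheaf_representation E C K F"
proof -
  from assms obtain C :: "('v, 'v) cat" and K where E: "category E" and C: "category C" "small (Arr C)"
    "grothendieck_topology C K"
    and eq: "equivalent_categories E (Sh C K :: (('v, 'v, 'v) presheaf, _) cat)"
    unfolding grothendieck_topos_def by blast
  from eq obtain F G \<alpha> \<beta> where F: "is_functor E (Sh C K :: (('v, 'v, 'v) presheaf, _) cat) F"
    and G: "is_functor (Sh C K) E G"
    and \<alpha>: "nat_trans E E id_functor (G \<odot> F) \<alpha>" "\<And>x. x \<in> Obj E \<Longrightarrow> is_iso E (\<alpha> x)"
    and \<beta>: "nat_trans (Sh C K) (Sh C K) (F \<odot> G) id_functor \<beta>"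
      "\<And>x. x \<in> Obj (Sh C K) \<Longrightarrow> is_iso (Sh C K) (\<beta> x)"
    unfolding equivalent_categories_def naturally_isomorphic_def by blast
  have "sheaf_representation E C K F"
  proof (rule sheaf_representation.intro[OF E C F])
    fix X Y assume X: "X \<in> Obj E" and Y: "Y \<in> Obj E"
    show "bij_betw (FArr F) (hom E X Y) (hom (Sh C K) (FObj F X) (FObj F Y))"
      unfolding bij_betw_def
    proof
      show "inj_on (FArr F) (hom E X Y)"
        by (rule inj_onI) (rule retraction_faithful[OF F \<alpha>])
      have "\<exists>f\<in>hom E X Y. FArr F f = h" if "h \<in> hom (Sh C K) (FObj F X) (FObj F Y)" for h
        by (rule equivalence_full[OF F G \<alpha>(1) _ _ X Y that])
          (erule \<alpha>(2), rule coretraction_faithful[OF G \<beta>(1) \<beta>(2)])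
      then show "FArr F ` hom E X Y = hom (Sh C K) (FObj F X) (FObj F Y)"
        using functor_hom[OF F] by blast
    qed
  next
    fix P :: "('v, 'v, 'v) presheaf" assume "is_sheaf C K P"
    then have P: "P \<in> Obj (Sh C K)"
      by simp
    show "\<exists>Z\<in>Obj E. \<exists>\<tau>\<in>hom (Sh C K) (FObj F Z) P. is_iso (Sh C K) \<tau>"
      using functor_obj[OF G P] nat_trans_hom[OF \<beta>(1) P] \<beta>(2)[OF P] by auto
  qed
  then show thesis
    by (rule that)
qed

section \<open>Constant objects\<close>

locale topos_representation = sheaf_representation E C K F
  for E :: "('o, 'v::universe) topos" (structure) and C :: "('v, 'v) cat" and K
    and F :: "('o, 'v, ('v, 'v, 'v) presheaf, ('v, 'v, 'v) presheaf \<times> ('v \<Rightarrow> 'v set_arr) \<times> ('v, 'v, 'v) presheaf) fctr" +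
  assumes topos: "set_topos E"
begin

abbreviation gam :: "'v set \<Rightarrow> 'o" where
  "gam S \<equiv> FObj (gam_inv E) S"

abbreviation gam_arr :: "'v set_arr \<Rightarrow> 'v" where
  "gam_arr \<phi> \<equiv> FArr (gam_inv E) \<phi>"

definition incl :: "'v \<Rightarrow> 'v set \<Rightarrow> 'v set_arr" where
  "incl s S = set_arr {s} (\<lambda>x. x) S"

lemma gam_adj: "adjunction SetC E (gam_inv E) (gam_dir E)"
  using topos by (simp add: set_topos_def geometric_morphism_def)

lemma gam_functor: "is_functor SetC E (gam_inv E)"
  using gam_adj by (simp add: adjunction_def)

lemma dir_functor: "is_functor E SetC (gam_dir E)"
  using gam_adj by (simp add: adjunction_def)

lemma gam_obj: "small S \<Longrightarrow> gam S \<in> Obj E"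
  using functor_obj[OF gam_functor] by simp

lemma product: "X \<in> Obj E \<Longrightarrow> Y \<in> Obj E \<Longrightarrow> is_product E X Y (X \<otimes> Y) (Pr1 E X Y) (Pr2 E X Y)"
  using topos by (simp add: set_topos_def)

lemma incl_hom: "small S \<Longrightarrow> s \<in> S \<Longrightarrow> incl s S \<in> hom SetC {s} S"
  unfolding incl_def by (rule set_arr_hom) (auto simp: small_singleton)

lemma gam_incl_hom: "small S \<Longrightarrow> s \<in> S \<Longrightarrow> gam_arr (incl s S) \<in> hom E (gam {s}) (gam S)"
  by (rule functor_hom[OF gam_functor incl_hom])

text \<open>A terminal object is a limit of the empty diagram, and the inverse image functor
  preserves that limit.\<close>

lemma gam_terminal: "is_terminal E (gam {s})"
proof -
  \<comment> \<open>The empty index category; the values chosen for its operations, for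
    \<open>G\<close> and for \<open>\<kappa>\<close> are dummies.\<close>
  define J :: "(nat, nat) cat" where
    "J = \<lparr>Obj = {}, Arr = {}, Src = (\<lambda>_. 0), Tgt = (\<lambda>_. 0), Id = (\<lambda>_. 0), Comp = (\<lambda>_ _. 0)\<rparr>"
  define G :: "(nat, nat, 'v set, 'v set_arr) fctr" where
    "G = \<lparr>FObj = (\<lambda>_. {s}), FArr = (\<lambda>_. incl s {s})\<rparr>"
  define \<kappa> :: "nat \<Rightarrow> 'v set_arr" where "\<kappa> = (\<lambda>_. incl s {s})"
  have J: "category J"
    by (auto simp: category_def J_def hom_def)
  have G: "is_functor J SetC G"
    using J category_SetC by (auto simp: is_functor_def J_def)
  have cone: "is_cone J SetC G m \<mu> \<longleftrightarrow> small m" for m \<mu>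
    by (auto simp: is_cone_def J_def)
  have lim: "is_limit J SetC G {s} \<kappa>"
    unfolding is_limit_def cone
  proof (intro conjI allI impI G small_singleton)
    fix m :: "'v set" assume m: "small m"
    show "\<exists>!h. h \<in> hom SetC m {s} \<and> (\<forall>i\<in>Obj J. \<kappa> i \<cdot>\<^bsub>SetC\<^esub> h = \<mu> i)" for \<mu>
    proof (rule ex1I[of _ "set_arr m (\<lambda>_. s) {s}"])
      have h: "set_arr m (\<lambda>_. s) {s} \<in> hom SetC m {s}"
        using m small_singleton by (intro set_arr_hom) auto
      then show "set_arr m (\<lambda>_. s) {s} \<in> hom SetC m {s} \<and> (\<forall>i\<in>Obj J. \<kappa> i \<cdot>\<^bsub>SetC\<^esub> set_arr m (\<lambda>_. s) {s} = \<mu> i)"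
        by (simp add: J_def)
      fix k assume k: "k \<in> hom SetC m {s} \<and> (\<forall>i\<in>Obj J. \<kappa> i \<cdot>\<^bsub>SetC\<^esub> k = \<mu> i)"
      show "k = set_arr m (\<lambda>_. s) {s}"
        by (rule SetC_eqI[OF _ h]) (use k set_app_in[of k m "{s}"] in auto)
    qed
  qed
  have "is_limit J E (gam_inv E \<odot> G) (gam {s}) (\<lambda>i. gam_arr (\<kappa> i))"
  proof -
    have "preserves_finite_limits SetC E (gam_inv E)"
      using topos by (simp add: set_topos_def geometric_morphism_def)
    moreover have "finite (Obj J)" "finite (Arr J)"
      by (simp_all add: J_def)
    ultimately show ?thesis
      using lim unfolding preserves_finite_limits_def by blast
  qed
  then have univ: "\<forall>m \<mu>. is_cone J E (gam_inv E \<odot> G) m \<mu> \<longrightarrow>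
      (\<exists>!h. h \<in> hom E m (gam {s}) \<and> (\<forall>i\<in>Obj J. gam_arr (\<kappa> i) \<cdot> h = \<mu> i))"
    unfolding is_limit_def by (elim conjE)
  have "\<exists>!h. h \<in> hom E m (gam {s})" if m: "m \<in> Obj E" for m
  proof -
    have "is_cone J E (gam_inv E \<odot> G) m (\<lambda>_. undefined)"
      using m by (simp add: is_cone_def J_def)
    from univ[rule_format, OF this] show ?thesis
      by (simp add: J_def)
  qed
  then show ?thesis
    unfolding is_terminal_def by (intro conjI ballI gam_obj small_singleton)
qed

section \<open>Constant arrows\<close>

lemma to_point: "X \<in> Obj E \<Longrightarrow> (THE t. t \<in> hom E X (gam {s})) \<in> hom E X (gam {s})"
  using gam_terminal[of s] theI'[of "\<lambda>t. t \<in> hom E X (gam {s})"] by (simp add: is_terminal_def)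

lemma to_point_unique: "f \<in> hom E X (gam {s}) \<Longrightarrow> g \<in> hom E X (gam {s}) \<Longrightarrow> f = g"
  using gam_terminal[of s] cat_dom[OF E, of f X] unfolding is_terminal_def by metis

lemma const_arr_eq: "const_arr E X S s = gam_arr (incl s S) \<cdot> (THE t. t \<in> hom E X (gam {s}))"
  by (simp add: const_arr_def incl_def set_arr_def)

lemma const_arr_hom: "X \<in> Obj E \<Longrightarrow> small S \<Longrightarrow> s \<in> S \<Longrightarrow> const_arr E X S s \<in> hom E X (gam S)"
  unfolding const_arr_eq by (rule cat_comp[OF E to_point gam_incl_hom])

lemma const_arr_factor:
  assumes "f \<in> hom E X (gam {s})" "small S" "s \<in> S"
  shows "gam_arr (incl s S) \<cdot> f = const_arr E X S s"
  using to_point_unique[OF assms(1) to_point[OF cat_dom[OF E assms(1)]]] by (simp add: const_arr_eq)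

lemma const_arr_comp:
  assumes f: "f \<in> hom E X Y" and s: "small S" "s \<in> S"
  shows "const_arr E Y S s \<cdot> f = const_arr E X S s"
proof -
  note t = to_point[OF cat_cod[OF E f], of s]
  show ?thesis
    unfolding const_arr_eq[of Y] cat_assoc[OF E f t gam_incl_hom[OF s]]
    by (rule const_arr_factor[OF cat_comp[OF E f t] s])
qed

text \<open>Including \<open>s\<close> and applying \<open>\<phi>\<close> is the same as going to
  the singleton of the image and including that. The rest is uniqueness of arrows into the image of
  a singleton, which is terminal.\<close>

lemma gam_const_arr:
  assumes X: "X \<in> Obj E" and \<phi>: "\<phi> \<in> hom SetC S T" and s: "s \<in> S"
  shows "gam_arr \<phi> \<cdot> const_arr E X S s = const_arr E X T (set_app \<phi> s)"
proof -
  have S: "small S" and T: "small T"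
    using \<phi> by (auto simp: hom_SetC)
  define t where "t = set_app \<phi> s"
  have t: "t \<in> T"
    using set_app_in[OF \<phi> s] by (simp add: t_def)
  define j where "j = set_arr {s} (\<lambda>_. t) {t}"
  have j: "j \<in> hom SetC {s} {t}"
    unfolding j_def by (rule set_arr_hom) (auto simp: small_singleton)
  have sq: "\<phi> \<cdot>\<^bsub>SetC\<^esub> incl s S = incl t T \<cdot>\<^bsub>SetC\<^esub> j"
  proof (rule SetC_eqI[OF SetC_comp[OF incl_hom[OF S s] \<phi>] SetC_comp[OF j incl_hom[OF T t]]])
    fix x assume x: "x \<in> {s}"
    show "set_app (\<phi> \<cdot>\<^bsub>SetC\<^esub> incl s S) x = set_app (incl t T \<cdot>\<^bsub>SetC\<^esub> j) x"
      using x set_app_comp[OF incl_hom[OF S s] \<phi> x] set_app_comp[OF j incl_hom[OF T t] x]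
      by (simp add: incl_def j_def t_def)
  qed
  note p = to_point[OF X, of s]
  have gj: "gam_arr j \<in> hom E (gam {s}) (gam {t})"
    by (rule functor_hom[OF gam_functor j])
  have "gam_arr \<phi> \<cdot> const_arr E X S s = gam_arr \<phi> \<cdot> gam_arr (incl s S) \<cdot> (THE t. t \<in> hom E X (gam {s}))"
    unfolding const_arr_eq using cat_assoc[OF E p gam_incl_hom[OF S s] functor_hom[OF gam_functor \<phi>]] by simp
  also have "gam_arr \<phi> \<cdot> gam_arr (incl s S) = gam_arr (incl t T) \<cdot> gam_arr j"
    using functor_comp[OF gam_functor incl_hom[OF S s] \<phi>] functor_comp[OF gam_functor j incl_hom[OF T t]] sq
    by simp
  also have "gam_arr (incl t T) \<cdot> gam_arr j \<cdot> (THE t. t \<in> hom E X (gam {s})) = const_arr E X T t"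
    unfolding cat_assoc[OF E p gj gam_incl_hom[OF T t]]
    by (rule const_arr_factor[OF cat_comp[OF E p gj] T t])
  finally show ?thesis
    by (simp add: t_def)
qed

text \<open>A set is the coproduct of its singletons and a left adjoint preserves this. Concretely,
  arrows out of \<open>gam S\<close> are transposed to functions on \<open>S\<close>, and a function
  may be prescribed value by value.\<close>

lemma gam_copair:
  assumes S: "small S" and Y: "Y \<in> Obj E" and w: "\<And>s. s \<in> S \<Longrightarrow> w s \<in> hom E (gam {s}) Y"
  shows "\<exists>!k. k \<in> hom E (gam S) Y \<and> (\<forall>s\<in>S. k \<cdot> gam_arr (incl s S) = w s)"
proof -
  obtain \<eta> where \<eta>: "\<And>x. x \<in> Obj SetC \<Longrightarrow> \<eta> x \<in> hom SetC x (FObj (gam_dir E) (gam x))"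
    and nat: "\<And>f x x'. f \<in> hom SetC x x' \<Longrightarrow> FArr (gam_dir E) (gam_arr f) \<cdot>\<^bsub>SetC\<^esub> \<eta> x = \<eta> x' \<cdot>\<^bsub>SetC\<^esub> f"
    and bij: "\<And>x y. x \<in> Obj SetC \<Longrightarrow> y \<in> Obj E \<Longrightarrow>
      bij_betw (\<lambda>g. FArr (gam_dir E) g \<cdot>\<^bsub>SetC\<^esub> \<eta> x) (hom E (gam x) y) (hom SetC x (FObj (gam_dir E) y))"
    by (rule adjunction_transpose[OF gam_adj]) (rule that)
  define tr where "tr x g = FArr (gam_dir E) g \<cdot>\<^bsub>SetC\<^esub> \<eta> x" for x g
  define W where "W = FObj (gam_dir E) Y"
  have W: "small W"
    using functor_obj[OF dir_functor Y] by (simp add: W_def)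
  have tr: "bij_betw (tr x) (hom E (gam x) Y) (hom SetC x W)" if "small x" for x
    using bij[of x Y] that Y unfolding tr_def[abs_def] W_def by simp
  have tr_hom: "tr x g \<in> hom SetC x W" if "small x" "g \<in> hom E (gam x) Y" for x g
    using bij_betwE[OF tr[OF that(1)]] that(2) by blast
  have restr: "tr {s} (k \<cdot> gam_arr (incl s S)) = tr S k \<cdot>\<^bsub>SetC\<^esub> incl s S"
    if k: "k \<in> hom E (gam S) Y" and s: "s \<in> S" for k s
  proof -
    note i = incl_hom[OF S s]
    have \<eta>s: "\<eta> {s} \<in> hom SetC {s} (FObj (gam_dir E) (gam {s}))" and \<eta>S: "\<eta> S \<in> hom SetC S (FObj (gam_dir E) (gam S))"
      using \<eta>[of "{s}"] \<eta>[of S] S small_singleton[of s] by simp_all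
    note gi = functor_hom[OF dir_functor gam_incl_hom[OF S s]]
    note dk = functor_hom[OF dir_functor k]
    show ?thesis
      unfolding tr_def functor_comp[OF dir_functor gam_incl_hom[OF S s] k]
        cat_assoc[OF category_SetC \<eta>s gi dk] nat[OF i] cat_assoc[OF category_SetC i \<eta>S dk] ..
  qed
  \<comment> \<open>A function on \<open>{s}\<close> has only one value, so each condition on an
    injection becomes a single equation between values of transposes.\<close>
  have key: "k \<cdot> gam_arr (incl s S) = w s \<longleftrightarrow> set_app (tr S k) s = set_app (tr {s} (w s)) s"
    if k: "k \<in> hom E (gam S) Y" and s: "s \<in> S" for k s
  proof -
    note kh = cat_comp[OF E gam_incl_hom[OF S s] k]
    have "k \<cdot> gam_arr (incl s S) = w s \<longleftrightarrow> tr {s} (k \<cdot> gam_arr (incl s S)) = tr {s} (w s)"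
      by (rule inj_on_eq_iff[OF bij_betw_imp_inj_on[OF tr[OF small_singleton]] kh w[OF s], symmetric])
    also have "\<dots> \<longleftrightarrow> set_app (tr {s} (k \<cdot> gam_arr (incl s S))) s = set_app (tr {s} (w s)) s"
    proof
      assume "set_app (tr {s} (k \<cdot> gam_arr (incl s S))) s = set_app (tr {s} (w s)) s"
      then show "tr {s} (k \<cdot> gam_arr (incl s S)) = tr {s} (w s)"
        by (intro SetC_eqI[OF tr_hom[OF small_singleton kh] tr_hom[OF small_singleton w[OF s]]]) simp
    qed simp
    also have "set_app (tr {s} (k \<cdot> gam_arr (incl s S))) s = set_app (tr S k) s"
      unfolding restr[OF k s] using set_app_comp[OF incl_hom[OF S s] tr_hom[OF S k], of s] by (simp add: incl_def)
    finally show ?thesis .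
  qed
  define \<phi> where "\<phi> = set_arr S (\<lambda>s. set_app (tr {s} (w s)) s) W"
  have \<phi>: "\<phi> \<in> hom SetC S W"
    unfolding \<phi>_def using set_app_in[OF tr_hom[OF small_singleton w]] by (intro set_arr_hom S W) auto
  have iff: "(\<forall>s\<in>S. k \<cdot> gam_arr (incl s S) = w s) \<longleftrightarrow> tr S k = \<phi>" if k: "k \<in> hom E (gam S) Y" for k
  proof
    assume "\<forall>s\<in>S. k \<cdot> gam_arr (incl s S) = w s"
    then show "tr S k = \<phi>"
      by (intro SetC_eqI[OF tr_hom[OF S k] \<phi>]) (simp add: key[OF k] \<phi>_def)
  next
    assume "tr S k = \<phi>"
    then show "\<forall>s\<in>S. k \<cdot> gam_arr (incl s S) = w s"
      by (simp add: key[OF k] \<phi>_def)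
  qed
  have "\<phi> \<in> tr S ` hom E (gam S) Y"
    using bij_betw_imp_surj_on[OF tr[OF S]] \<phi> by simp
  then obtain k where k: "k \<in> hom E (gam S) Y" "tr S k = \<phi>"
    by force
  show ?thesis
  proof (rule ex1I[of _ k])
    show "k \<in> hom E (gam S) Y \<and> (\<forall>s\<in>S. k \<cdot> gam_arr (incl s S) = w s)"
      using k iff by blast
    fix l assume l: "l \<in> hom E (gam S) Y \<and> (\<forall>s\<in>S. l \<cdot> gam_arr (incl s S) = w s)"
    then have "tr S l = tr S k"
      using iff[of l] k(2) by simp
    then show "l = k"
      using inj_onD[OF bij_betw_imp_inj_on[OF tr[OF S]] _ _ k(1)] l by blast
  qed
qed

section \<open>Sections of constant objects\<close>

definition pt :: "'v \<Rightarrow> 'v \<Rightarrow> 'v" where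
  "pt s c = (THE x. x \<in> el (gam {s}) c)"

lemma pt: "c \<in> Obj C \<Longrightarrow> pt s c \<in> el (gam {s}) c"
  unfolding pt_def by (rule theI'[OF terminal_el[OF gam_terminal]])

lemma pt_unique: "c \<in> Obj C \<Longrightarrow> x \<in> el (gam {s}) c \<Longrightarrow> x = pt s c"
  using terminal_el[OF gam_terminal, of c s] pt by blast

definition cst :: "'v \<Rightarrow> 'v set \<Rightarrow> 'v \<Rightarrow> 'v" where
  "cst s S c = ap (gam_arr (incl s S)) c (pt s c)"

lemma cst_in: "small S \<Longrightarrow> s \<in> S \<Longrightarrow> c \<in> Obj C \<Longrightarrow> cst s S c \<in> el (gam S) c"
  unfolding cst_def by (rule ap_in[OF gam_incl_hom _ pt])

lemma ap_incl: "c \<in> Obj C \<Longrightarrow> x \<in> el (gam {s}) c \<Longrightarrow> ap (gam_arr (incl s S)) c x = cst s S c"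
  using pt_unique by (auto simp: cst_def)

lemma rs_cst:
  assumes S: "small S" "s \<in> S" and g: "g \<in> hom C d c"
  shows "rs (gam S) g (cst s S c) = cst s S d"
  unfolding cst_def[of s S c] ap_natural[OF gam_incl_hom[OF S] g pt[OF cat_cod[OF C g]], symmetric]
  by (rule ap_incl[OF cat_dom[OF C g] rs_in[OF gam_obj[OF small_singleton] g pt[OF cat_cod[OF C g]]]])

lemma ap_const:
  assumes "X \<in> Obj E" "small S" "s \<in> S" "c \<in> Obj C" "x \<in> el X c"
  shows "ap (const_arr E X S s) c x = cst s S c"
  unfolding const_arr_eq
  using ap_comp[OF to_point[OF assms(1)] gam_incl_hom[OF assms(2,3)] assms(4,5)]
    ap_incl[OF assms(4) ap_in[OF to_point[OF assms(1)] assms(4,5)]] by simp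

text \<open>The locally constant sections form a subobject \<open>Z\<close>. All the points of
  \<open>gam S\<close> factor through it, so copairing gives a section \<open>k\<close> of its
  inclusion; every section of \<open>gam S\<close> thus lies in \<open>Z\<close>.\<close>

lemma gam_locally_constant:
  assumes S: "small S" and c: "c \<in> Obj C" and x: "x \<in> el (gam S) c"
  shows "locally c (\<lambda>g. \<exists>s\<in>S. rs (gam S) g x = cst s S (Src C g))"
proof -
  note X = gam_obj[OF S]
  have lp: "local_pred (gam S) (\<lambda>c x. locally c (\<lambda>g. \<exists>s\<in>S. rs (gam S) g x = cst s S (Src C g)))"
    by (rule local_pred_locally[OF X, where \<psi> = "\<lambda>c x. \<exists>s\<in>S. x = cst s S c"]) (use rs_cst[OF S] in blast)
  obtain Z i where i: "i \<in> hom E Z (gam S)"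
    and Z: "\<And>c z. c \<in> Obj C \<Longrightarrow> z \<in> el Z c \<Longrightarrow> locally c (\<lambda>g. \<exists>s\<in>S. rs (gam S) g (ap i c z) = cst s S (Src C g))"
    and "\<And>c x. c \<in> Obj C \<Longrightarrow> x \<in> el (gam S) c \<Longrightarrow>
      locally c (\<lambda>g. \<exists>s\<in>S. rs (gam S) g x = cst s S (Src C g)) \<Longrightarrow> \<exists>z\<in>el Z c. ap i c z = x"
    and "\<And>c z z'. c \<in> Obj C \<Longrightarrow> z \<in> el Z c \<Longrightarrow> z' \<in> el Z c \<Longrightarrow> ap i c z = ap i c z' \<Longrightarrow> z = z'"
    and fac: "\<forall>Y f. f \<in> hom E Y (gam S) \<longrightarrow> (\<forall>c y. c \<in> Obj C \<longrightarrow> y \<in> el Y c \<longrightarrow>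
      locally c (\<lambda>g. \<exists>s\<in>S. rs (gam S) g (ap f c y) = cst s S (Src C g))) \<longrightarrow> (\<exists>g\<in>hom E Y Z. i \<cdot> g = f)"
    by (rule comprehension[OF X lp]) (rule that)
  have "\<exists>g\<in>hom E (gam {s}) Z. i \<cdot> g = gam_arr (incl s S)" if s: "s \<in> S" for s
  proof (rule fac[rule_format, OF gam_incl_hom[OF S s]])
    fix c y assume c: "c \<in> Obj C" and y: "y \<in> el (gam {s}) c"
    show "locally c (\<lambda>g. \<exists>r\<in>S. rs (gam S) g (ap (gam_arr (incl s S)) c y) = cst r S (Src C g))"
      unfolding ap_incl[OF c y]
      by (rule locally_all[OF c]) (use rs_cst[OF S s] s hom_src[where C = C] in auto)
  qed
  then obtain w where w: "\<And>s. s \<in> S \<Longrightarrow> w s \<in> hom E (gam {s}) Z" "\<And>s. s \<in> S \<Longrightarrow> i \<cdot> w s = gam_arr (incl s S)"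
    by metis
  obtain k where k: "k \<in> hom E (gam S) Z" "\<And>s. s \<in> S \<Longrightarrow> k \<cdot> gam_arr (incl s S) = w s"
    using gam_copair[OF S cat_dom[OF E i] w(1)] by blast
  have "\<exists>!h. h \<in> hom E (gam S) (gam S) \<and> (\<forall>s\<in>S. h \<cdot> gam_arr (incl s S) = gam_arr (incl s S))"
    by (rule gam_copair[OF S X gam_incl_hom[OF S]])
  moreover have "(i \<cdot> k) \<cdot> gam_arr (incl s S) = gam_arr (incl s S)" if "s \<in> S" for s
    using cat_assoc[OF E gam_incl_hom[OF S that] k(1) i] k(2) w(2) that by simp
  moreover have "Id E (gam S) \<cdot> gam_arr (incl s S) = gam_arr (incl s S)" if "s \<in> S" for s
    by (rule cat_id_left[OF E gam_incl_hom[OF S that]])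
  ultimately have ik: "i \<cdot> k = Id E (gam S)"
    using cat_comp[OF E k(1) i] cat_Id[OF E X] by blast
  have "ap i c (ap k c x) = x"
    using ap_comp[OF k(1) i c x] ap_Id[OF X c x] by (simp add: ik)
  then show ?thesis
    using Z[OF c ap_in[OF k(1) c x]] by simp
qed

text \<open>The classifier provides two arrows \<open>f\<close> and \<open>g\<close> on a point that
  agree at void stages only. Copairing \<open>f\<close> at \<open>s\<close> with \<open>g\<close> at
  all other indices gives an arrow on \<open>gam S\<close>, and equality of the two sections then
  makes \<open>f\<close> and \<open>g\<close> agree at \<open>c\<close>.\<close>

lemma cst_disjoint:
  assumes S: "small S" and s: "s \<in> S" and t: "t \<in> S" and st: "s \<noteq> t" and c: "c \<in> Obj C"
    and eq: "cst s S c = cst t S c"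
  shows "void c"
proof -
  note X = gam_obj[OF small_singleton[of s]]
  obtain Y f g where f: "f \<in> hom E (gam {s}) Y" and g: "g \<in> hom E (gam {s}) Y"
    and fg: "\<And>c x. c \<in> Obj C \<Longrightarrow> x \<in> el (gam {s}) c \<Longrightarrow> ap f c x = ap g c x \<longleftrightarrow> void c"
    by (rule classifier[OF X local_pred_void[OF X]]) (rule that)
  define p where "p r = (THE t. t \<in> hom E (gam {r}) (gam {s}))" for r
  have p: "p r \<in> hom E (gam {r}) (gam {s})" for r
    unfolding p_def by (rule to_point[OF gam_obj[OF small_singleton]])
  define w where "w r = (if r = s then f else g \<cdot> p r)" for r
  have w: "w r \<in> hom E (gam {r}) Y" for r
    using f cat_comp[OF E p g] by (simp add: w_def)
  obtain k where k: "k \<in> hom E (gam S) Y" "\<And>r. r \<in> S \<Longrightarrow> k \<cdot> gam_arr (incl r S) = w r"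
    using gam_copair[OF S cat_cod[OF E f], of w] w by blast
  have kc: "ap k c (cst r S c) = ap (w r) c (pt r c)" if "r \<in> S" for r
    using ap_comp[OF gam_incl_hom[OF S that] k(1) c pt[OF c]] k(2)[OF that] by (simp add: cst_def)
  have "ap f c (pt s c) = ap g c (pt s c)"
    using kc[OF s] kc[OF t] eq st ap_comp[OF p g c pt[OF c], of t] pt_unique[OF c ap_in[OF p c pt[OF c]], of t]
    by (simp add: w_def)
  then show ?thesis
    using fg[OF c pt[OF c]] by simp
qed

text \<open>The fibres of \<open>k\<close> over the constants cover \<open>X\<close>, so arrows out
  of \<open>X\<close> may be compared on generalized elements along which \<open>k\<close> is
  constant. This packages local constancy as a statement inside the topos, and the arguments about
  Galois objects use it in this form.\<close>

lemma constant_cover: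
  assumes k: "k \<in> hom E X (gam S)" and S: "small S" and g: "g \<in> hom E X W" and h: "h \<in> hom E X W"
    and eq: "\<And>s Z r. s \<in> S \<Longrightarrow> r \<in> hom E Z X \<Longrightarrow> k \<cdot> r = const_arr E Z S s \<Longrightarrow> g \<cdot> r = h \<cdot> r"
  shows "g = h"
proof (rule arr_eqI[OF g h])
  note X = cat_dom[OF E k] and W = cat_cod[OF E g]
  fix c x assume c: "c \<in> Obj C" and x: "x \<in> el X c"
  show "ap g c x = ap h c x"
  proof (rule el_separated[OF W c ap_in[OF g c x] ap_in[OF h c x]],
      rule locally_mono[OF c gam_locally_constant[OF S c ap_in[OF k c x]]])
    fix d u assume u: "u \<in> hom C d c" and "\<exists>s\<in>S. rs (gam S) u (ap k c x) = cst s S (Src C u)"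
    then obtain s where s: "s \<in> S" and kx: "ap k d (rs X u x) = cst s S d"
      using ap_natural[OF k u x] hom_src[OF u] by auto
    note d = cat_dom[OF C u] and ux = rs_in[OF X u x]
    note con = const_arr_hom[OF X S s]
    obtain Z i where i: "i \<in> hom E Z X"
      and Z: "\<And>c z. c \<in> Obj C \<Longrightarrow> z \<in> el Z c \<Longrightarrow> ap k c (ap i c z) = ap (const_arr E X S s) c (ap i c z)"
      and ex: "\<And>c x. c \<in> Obj C \<Longrightarrow> x \<in> el X c \<Longrightarrow> ap k c x = ap (const_arr E X S s) c x \<Longrightarrow> \<exists>z\<in>el Z c. ap i c z = x"
      by (rule comprehension[OF X local_pred_eq[OF X k con]]) (rule that)
    have "k \<cdot> i = const_arr E X S s \<cdot> i"
      by (rule arr_eqI[OF cat_comp[OF E i k] cat_comp[OF E i con]])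
        (simp add: ap_comp[OF i k] ap_comp[OF i con] Z)
    then have gi: "g \<cdot> i = h \<cdot> i"
      using eq[OF s i] const_arr_comp[OF i S s] by simp
    obtain z where z: "z \<in> el Z d" "ap i d z = rs X u x"
      using ex[OF d ux] ap_const[OF X S s d ux] kx by auto
    have "ap g d (rs X u x) = ap h d (rs X u x)"
      using ap_comp[OF i g d z(1)] ap_comp[OF i h d z(1)] gi z(2) by simp
    then show "rs W u (ap g c x) = rs W u (ap h c x)"
      by (simp add: ap_natural[OF g u x] ap_natural[OF h u x])
  qed
qed

text \<open>An arrow out of \<open>X\<close> is glued from its values on the two parts. Where the
  parts overlap the stage is void, and there all sections coincide, so the relation is single
  valued.\<close>

lemma disjoint_cover_coproduct:
  assumes i: "i \<in> hom E Y X" and j: "j \<in> hom E Z X"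
    and i_inj: "\<And>c y y'. c \<in> Obj C \<Longrightarrow> y \<in> el Y c \<Longrightarrow> y' \<in> el Y c \<Longrightarrow> ap i c y = ap i c y' \<Longrightarrow> y = y'"
    and j_inj: "\<And>c y y'. c \<in> Obj C \<Longrightarrow> y \<in> el Z c \<Longrightarrow> y' \<in> el Z c \<Longrightarrow> ap j c y = ap j c y' \<Longrightarrow> y = y'"
    and disj: "\<And>c y z. c \<in> Obj C \<Longrightarrow> y \<in> el Y c \<Longrightarrow> z \<in> el Z c \<Longrightarrow> ap i c y = ap j c z \<Longrightarrow> void c"
    and cov: "\<And>c x. c \<in> Obj C \<Longrightarrow> x \<in> el X c \<Longrightarrow>
      locally c (\<lambda>g. (\<exists>y\<in>el Y (Src C g). ap i (Src C g) y = rs X g x) \<or> (\<exists>z\<in>el Z (Src C g). ap j (Src C g) z = rs X g x))"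
  shows "is_coproduct E Y Z X i j"
  unfolding is_coproduct_def
proof (intro conjI ballI)
  show Y: "Y \<in> Obj E" and Z: "Z \<in> Obj E" and X: "X \<in> Obj E"
    using cat_dom[OF E i] cat_dom[OF E j] cat_cod[OF E i] .
  fix W f g assume W: "W \<in> Obj E" and f: "f \<in> hom E Y W" and g: "g \<in> hom E Z W"
  define \<Theta> where "\<Theta> c x w \<longleftrightarrow> (\<exists>y\<in>el Y c. ap i c y = x \<and> w = ap f c y) \<or> (\<exists>z\<in>el Z c. ap j c z = x \<and> w = ap g c z)"
    for c x w
  have iff: "h \<cdot> i = f \<and> h \<cdot> j = g \<longleftrightarrow>
      (\<forall>c x w. c \<in> Obj C \<longrightarrow> x \<in> el X c \<longrightarrow> \<Theta> c x w \<longrightarrow> ap h c x = w)" if h: "h \<in> hom E X W" for h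
  proof
    assume eq: "h \<cdot> i = f \<and> h \<cdot> j = g"
    show "\<forall>c x w. c \<in> Obj C \<longrightarrow> x \<in> el X c \<longrightarrow> \<Theta> c x w \<longrightarrow> ap h c x = w"
      unfolding \<Theta>_def using ap_comp[OF i h] ap_comp[OF j h] eq by force
  next
    assume \<Theta>: "\<forall>c x w. c \<in> Obj C \<longrightarrow> x \<in> el X c \<longrightarrow> \<Theta> c x w \<longrightarrow> ap h c x = w"
    show "h \<cdot> i = f \<and> h \<cdot> j = g"
    proof
      show "h \<cdot> i = f"
      proof (rule arr_eqI[OF cat_comp[OF E i h] f])
        fix c y assume c: "c \<in> Obj C" and y: "y \<in> el Y c"
        have "\<Theta> c (ap i c y) (ap f c y)"
          using y by (auto simp: \<Theta>_def)
        then show "ap (h \<cdot> i) c y = ap f c y"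
          using \<Theta> c ap_in[OF i c y] ap_comp[OF i h c y] by simp
      qed
      show "h \<cdot> j = g"
      proof (rule arr_eqI[OF cat_comp[OF E j h] g])
        fix c y assume c: "c \<in> Obj C" and y: "y \<in> el Z c"
        have "\<Theta> c (ap j c y) (ap g c y)"
          using y by (auto simp: \<Theta>_def)
        then show "ap (h \<cdot> j) c y = ap g c y"
          using \<Theta> c ap_in[OF j c y] ap_comp[OF j h c y] by simp
      qed
    qed
  qed
  obtain h where h: "h \<in> hom E X W"
    "\<And>c x w. c \<in> Obj C \<Longrightarrow> x \<in> el X c \<Longrightarrow> \<Theta> c x w \<Longrightarrow> ap h c x = w"
    "\<forall>h'. h' \<in> hom E X W \<longrightarrow> (\<forall>c x w. c \<in> Obj C \<longrightarrow> x \<in> el X c \<longrightarrow> \<Theta> c x w \<longrightarrow> ap h' c x = w) \<longrightarrow> h' = h"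
  proof (rule arr_glue[OF X W, of \<Theta>])
    show "w \<in> el W c" if "c \<in> Obj C" "\<Theta> c x w" for c x w
      using that(2) ap_in[OF f that(1)] ap_in[OF g that(1)] by (auto simp: \<Theta>_def)
    show "\<Theta> d (rs X u x) (rs W u w)" if u: "u \<in> hom C d c" and "\<Theta> c x w" for c d u x w
      using that(2) unfolding \<Theta>_def
    proof (elim disjE bexE conjE)
      fix y assume y: "y \<in> el Y c" and "ap i c y = x" "w = ap f c y"
      then show "(\<exists>y\<in>el Y d. ap i d y = rs X u x \<and> rs W u w = ap f d y) \<or>
          (\<exists>z\<in>el Z d. ap j d z = rs X u x \<and> rs W u w = ap g d z)"
        by (intro disjI1 bexI[of _ "rs Y u y"]) (simp_all add: ap_natural[OF i u y] ap_natural[OF f u y] rs_in[OF Y u y])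
    next
      fix y assume y: "y \<in> el Z c" and "ap j c y = x" "w = ap g c y"
      then show "(\<exists>y\<in>el Y d. ap i d y = rs X u x \<and> rs W u w = ap f d y) \<or>
          (\<exists>z\<in>el Z d. ap j d z = rs X u x \<and> rs W u w = ap g d z)"
        by (intro disjI2 bexI[of _ "rs Z u y"]) (simp_all add: ap_natural[OF j u y] ap_natural[OF g u y] rs_in[OF Z u y])
    qed
    show "w = w'" if c: "c \<in> Obj C" and w: "\<Theta> c x w" "\<Theta> c x w'" for c x w w'
    proof (cases "void c")
      case True
      have "w \<in> el W c" "w' \<in> el W c"
        using w ap_in[OF f c] ap_in[OF g c] by (auto simp: \<Theta>_def)
      then show ?thesis
        by (rule void_unique[OF W c True])
    next
      case False
      then show ?thesis
        using w i_inj[OF c] j_inj[OF c] disj[OF c] unfolding \<Theta>_def by metis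
    qed
    show "locally c (\<lambda>g. \<exists>w. \<Theta> (Src C g) (rs X g x) w)" if "c \<in> Obj C" "x \<in> el X c" for c x
      by (rule locally_mono[OF that(1) cov[OF that]]) (auto simp: \<Theta>_def)
  qed (rule that)
  show "\<exists>!h. h \<in> hom E X W \<and> h \<cdot> i = f \<and> h \<cdot> j = g"
  proof (rule ex1I[of _ h])
    show "h \<in> hom E X W \<and> h \<cdot> i = f \<and> h \<cdot> j = g"
      using h(1,2) iff[OF h(1)] by blast
    fix h' assume h': "h' \<in> hom E X W \<and> h' \<cdot> i = f \<and> h' \<cdot> j = g"
    then show "h' = h"
      using h(3)[rule_format, of h'] iff[of h'] by blast
  qed
qed (rule i j)+

text \<open>For each \<open>s\<close>, \<open>A\<close> is the coproduct of the fibre of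
  \<open>f\<close> over \<open>s\<close> and of the part where \<open>f\<close> takes other values.
  If the second part is initial, \<open>f\<close> is constant at \<open>s\<close>. If instead the
  first part is initial for every \<open>s\<close>, each value is taken at void stages only; since
  \<open>f\<close> is locally constant, \<open>A\<close> itself would be initial.\<close>

lemma connected_constant:
  assumes A: "connected_object E A" and S: "small S" and f: "f \<in> hom E A (gam S)"
  shows "\<exists>s\<in>S. f = const_arr E A S s"
proof (rule ccontr)
  assume no: "\<not> (\<exists>s\<in>S. f = const_arr E A S s)"
  have AO: "A \<in> Obj E"
    using A by (simp add: connected_object_def)
  note lc = gam_locally_constant[OF S _ ap_in[OF f]]
  have v: "void c" if s: "s \<in> S" and c: "c \<in> Obj C" and x: "x \<in> el A c" and fx: "ap f c x = cst s S c" for s c x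
  proof -
    note con = const_arr_hom[OF AO S s]
    obtain Y i where i: "i \<in> hom E Y A"
      and Y: "\<And>c z. c \<in> Obj C \<Longrightarrow> z \<in> el Y c \<Longrightarrow> ap f c (ap i c z) = ap (const_arr E A S s) c (ap i c z)"
      and Yex: "\<And>c x. c \<in> Obj C \<Longrightarrow> x \<in> el A c \<Longrightarrow> ap f c x = ap (const_arr E A S s) c x \<Longrightarrow> \<exists>z\<in>el Y c. ap i c z = x"
      and i_inj: "\<And>c y y'. c \<in> Obj C \<Longrightarrow> y \<in> el Y c \<Longrightarrow> y' \<in> el Y c \<Longrightarrow> ap i c y = ap i c y' \<Longrightarrow> y = y'"
      by (rule comprehension[OF AO local_pred_eq[OF AO f con]]) (rule that)
    \<comment> \<open>All values other than \<open>s\<close> are lumped together, which keeps the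
      decomposition binary for any size of \<open>S\<close>.\<close>
    let ?\<psi> = "\<lambda>c x. \<exists>t\<in>S - {s}. ap f c x = cst t S c"
    have \<psi>_stable: "?\<psi> d (rs A g x)" if g: "g \<in> hom C d c" and x: "x \<in> el A c" and "?\<psi> c x" for c d g x
      using that(3) ap_natural[OF f g x] rs_cst[OF S _ g] by auto
    obtain Z j where j: "j \<in> hom E Z A"
      and Z: "\<And>c z. c \<in> Obj C \<Longrightarrow> z \<in> el Z c \<Longrightarrow> locally c (\<lambda>g. ?\<psi> (Src C g) (rs A g (ap j c z)))"
      and Zex: "\<And>c x. c \<in> Obj C \<Longrightarrow> x \<in> el A c \<Longrightarrow> locally c (\<lambda>g. ?\<psi> (Src C g) (rs A g x)) \<Longrightarrow> \<exists>z\<in>el Z c. ap j c z = x"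
      and j_inj: "\<And>c y y'. c \<in> Obj C \<Longrightarrow> y \<in> el Z c \<Longrightarrow> y' \<in> el Z c \<Longrightarrow> ap j c y = ap j c y' \<Longrightarrow> y = y'"
      by (rule comprehension[OF AO local_pred_locally[OF AO, where \<psi> = ?\<psi>]]) (erule (2) \<psi>_stable, rule that)
    have clash: "void c" if c: "c \<in> Obj C" and x: "x \<in> el A c" and fx: "ap f c x = cst s S c"
      and l: "locally c (\<lambda>g. ?\<psi> (Src C g) (rs A g x))" for c x
    proof (rule void_bind[OF c l])
      fix d g assume g: "g \<in> hom C d c" and "?\<psi> (Src C g) (rs A g x)"
      then obtain t where t: "t \<in> S" "s \<noteq> t" "ap f d (rs A g x) = cst t S d"
        using hom_src[OF g] by auto
      have "cst s S d = cst t S d"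
        using t(3) ap_natural[OF f g x] fx rs_cst[OF S s g] by simp
      then show "void d"
        by (rule cst_disjoint[OF S s t(1,2) cat_dom[OF C g]])
    qed
    have "is_coproduct E Y Z A i j"
    proof (rule disjoint_cover_coproduct[OF i j i_inj j_inj])
      show "void c" if c: "c \<in> Obj C" and y: "y \<in> el Y c" and z: "z \<in> el Z c" and eq: "ap i c y = ap j c z" for c y z
        by (rule clash[OF c ap_in[OF i c y]])
          (use Y[OF c y] ap_const[OF AO S s c ap_in[OF i c y]] Z[OF c z] eq in simp_all)
      fix c x assume c: "c \<in> Obj C" and x: "x \<in> el A c"
      show "locally c (\<lambda>g. (\<exists>y\<in>el Y (Src C g). ap i (Src C g) y = rs A g x) \<or>
          (\<exists>z\<in>el Z (Src C g). ap j (Src C g) z = rs A g x))"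
      proof (rule locally_mono[OF c lc[OF c c x]])
        fix d g assume g: "g \<in> hom C d c" and "\<exists>s\<in>S. rs (gam S) g (ap f c x) = cst s S (Src C g)"
        then obtain t where t: "t \<in> S" "ap f d (rs A g x) = cst t S d"
          using ap_natural[OF f g x] hom_src[OF g] by auto
        note d = cat_dom[OF C g] and gx = rs_in[OF AO g x]
        show "(\<exists>y\<in>el Y (Src C g). ap i (Src C g) y = rs A g x) \<or> (\<exists>z\<in>el Z (Src C g). ap j (Src C g) z = rs A g x)"
        proof (cases "t = s")
          case True
          then show ?thesis
            using Yex[OF d gx] ap_const[OF AO S s d gx] t(2) hom_src[OF g] by simp
        next
          case False
          have "locally d (\<lambda>k. ?\<psi> (Src C k) (rs A k (rs A g x)))"
            by (rule locally_all[OF d]) (use \<psi>_stable[OF _ gx] t False hom_src[where C = C] in auto)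
          then show ?thesis
            using Zex[OF d gx] hom_src[OF g] by simp
        qed
      qed
    qed
    then consider "is_initial E Y" | "is_initial E Z"
      using A unfolding connected_object_def by blast
    then show "void c"
    proof cases
      case 1
      obtain z where "z \<in> el Y c"
        using Yex[OF c x] fx ap_const[OF AO S s c x] by auto
      then show ?thesis
        by (rule initial_void[OF 1 c])
    next
      case 2
      have "f = const_arr E A S s"
      proof (rule arr_eqI[OF f con])
        fix c x assume c: "c \<in> Obj C" and x: "x \<in> el A c"
        show "ap f c x = ap (const_arr E A S s) c x"
          unfolding ap_const[OF AO S s c x]
        proof (rule el_separated[OF gam_obj[OF S] c ap_in[OF f c x] cst_in[OF S s c]],
            rule locally_mono[OF c lc[OF c c x]])
          fix d g assume g: "g \<in> hom C d c" and "\<exists>s\<in>S. rs (gam S) g (ap f c x) = cst s S (Src C g)"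
          then obtain t where t: "t \<in> S" "ap f d (rs A g x) = cst t S d"
            using ap_natural[OF f g x] hom_src[OF g] by auto
          note d = cat_dom[OF C g] and gx = rs_in[OF AO g x]
          show "rs (gam S) g (ap f c x) = rs (gam S) g (cst s S c)"
          proof (cases "t = s")
            case True
            then show ?thesis
              using t ap_natural[OF f g x] rs_cst[OF S s g] by simp
          next
            case False
            have "locally d (\<lambda>k. ?\<psi> (Src C k) (rs A k (rs A g x)))"
              by (rule locally_all[OF d]) (use \<psi>_stable[OF _ gx] t False hom_src[where C = C] in auto)
            then obtain z where "z \<in> el Z d"
              using Zex[OF d gx] by blast
            then have "void d"
              by (rule initial_void[OF 2 d])
            then show ?thesis
              using void_unique[OF gam_obj[OF S] d] rs_in[OF gam_obj[OF S] g] ap_in[OF f c x] cst_in[OF S s c]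
              by blast
          qed
        qed
      qed
      then show ?thesis
        using no s by blast
    qed
  qed
  have "is_initial E A"
  proof (rule void_initial[OF AO])
    fix c x assume c: "c \<in> Obj C" and x: "x \<in> el A c"
    show "void c"
    proof (rule void_bind[OF c lc[OF c c x]])
      fix d g assume g: "g \<in> hom C d c" and "\<exists>s\<in>S. rs (gam S) g (ap f c x) = cst s S (Src C g)"
      then show "void d"
        using v[OF _ cat_dom[OF C g] rs_in[OF AO g x]] ap_natural[OF f g x] hom_src[OF g] by auto
    qed
  qed
  then show False
    using A by (simp add: connected_object_def)
qed

text \<open>Where \<open>A\<close> has an element the sections \<open>s\<close> and \<open>t\<close>
  would coincide, so every such stage would be void and \<open>A\<close> initial.\<close>

lemma const_arr_inj:
  assumes A: "A \<in> Obj E" "\<not> is_initial E A" and S: "small S" and s: "s \<in> S" and t: "t \<in> S"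
    and eq: "const_arr E A S s = const_arr E A S t"
  shows "s = t"
proof (rule ccontr)
  assume st: "s \<noteq> t"
  have "is_initial E A"
  proof (rule void_initial[OF A(1)])
    fix c x assume c: "c \<in> Obj C" and x: "x \<in> el A c"
    show "void c"
      by (rule cst_disjoint[OF S s t st c])
        (use ap_const[OF A(1) S s c x] ap_const[OF A(1) S t c x] eq in simp)
  qed
  then show False
    using A(2) by simp
qed

text \<open>Since \<open>A\<close> covers the terminal object, it has elements locally, so every
  element of \<open>Y\<close> lifts locally to the product. The values of \<open>f\<close> on such
  lifts agree by \<open>eq\<close> and can be glued.\<close>

lemma descent:
  assumes T: "is_terminal E T" and e: "e \<in> hom E A T" "is_epi E e"
    and prod: "is_product E A Y P p q" and f: "f \<in> hom E P W"
    and eq: "\<And>Z r r'. r \<in> hom E Z P \<Longrightarrow> r' \<in> hom E Z P \<Longrightarrow> q \<cdot> r = q \<cdot> r' \<Longrightarrow> f \<cdot> r = f \<cdot> r'"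
  shows "\<exists>g\<in>hom E Y W. g \<cdot> q = f"
proof -
  have A: "A \<in> Obj E" and Y: "Y \<in> Obj E" and P: "P \<in> Obj E" and p: "p \<in> hom E P A" and q: "q \<in> hom E P Y"
    using prod by (simp_all add: is_product_def)
  note W = cat_cod[OF E f]
  have PP: "is_product E P P (P \<otimes> P) (Pr1 E P P) (Pr2 E P P)"
    by (rule product[OF P P])
  have PPO: "P \<otimes> P \<in> Obj E" and p1: "Pr1 E P P \<in> hom E (P \<otimes> P) P" and p2: "Pr2 E P P \<in> hom E (P \<otimes> P) P"
    using PP by (simp_all add: is_product_def)
  note q1 = cat_comp[OF E p1 q] and q2 = cat_comp[OF E p2 q]
  have ker: "ap f c z = ap f c z'" if c: "c \<in> Obj C" and z: "z \<in> el P c" and z': "z' \<in> el P c"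
    and qz: "ap q c z = ap q c z'" for c z z'
  proof -
    \<comment> \<open>The kernel pair of \<open>q\<close>, on which the hypothesis about generalized
      elements becomes a statement about pairs of elements.\<close>
    obtain Z i where i: "i \<in> hom E Z (P \<otimes> P)"
      and Z: "\<And>c z. c \<in> Obj C \<Longrightarrow> z \<in> el Z c \<Longrightarrow> ap (q \<cdot> Pr1 E P P) c (ap i c z) = ap (q \<cdot> Pr2 E P P) c (ap i c z)"
      and ex: "\<And>c x. c \<in> Obj C \<Longrightarrow> x \<in> el (P \<otimes> P) c \<Longrightarrow> ap (q \<cdot> Pr1 E P P) c x = ap (q \<cdot> Pr2 E P P) c x \<Longrightarrow>
        \<exists>z\<in>el Z c. ap i c z = x"
      by (rule comprehension[OF PPO local_pred_eq[OF PPO q1 q2]]) (rule that)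
    note i1 = cat_comp[OF E i p1] and i2 = cat_comp[OF E i p2]
    have "(q \<cdot> Pr1 E P P) \<cdot> i = (q \<cdot> Pr2 E P P) \<cdot> i"
      by (rule arr_eqI[OF cat_comp[OF E i q1] cat_comp[OF E i q2]]) (simp add: ap_comp[OF i q1] ap_comp[OF i q2] Z)
    then have fi: "f \<cdot> (Pr1 E P P \<cdot> i) = f \<cdot> (Pr2 E P P \<cdot> i)"
      by (intro eq[OF i1 i2]) (simp add: cat_assoc[OF E i p1 q] cat_assoc[OF E i p2 q])
    obtain x where x: "x \<in> el (P \<otimes> P) c" "ap (Pr1 E P P) c x = z" "ap (Pr2 E P P) c x = z'"
      by (rule product_el[OF PP c z z']) (rule that)
    obtain y where y: "y \<in> el Z c" "ap i c y = x"
      using ex[OF c x(1)] ap_comp[OF p1 q c x(1)] ap_comp[OF p2 q c x(1)] x qz by auto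
    show ?thesis
      using ap_comp[OF i1 f c y(1)] ap_comp[OF i2 f c y(1)] fi ap_comp[OF i p1 c y(1)] ap_comp[OF i p2 c y(1)] x y
      by simp
  qed
  define \<Theta> where "\<Theta> c y w \<longleftrightarrow> (\<exists>z\<in>el P c. ap q c z = y \<and> w = ap f c z)" for c y w
  obtain g where g: "g \<in> hom E Y W" "\<And>c y w. c \<in> Obj C \<Longrightarrow> y \<in> el Y c \<Longrightarrow> \<Theta> c y w \<Longrightarrow> ap g c y = w"
  proof (rule arr_glue[OF Y W, of \<Theta>])
    show "w \<in> el W c" if "c \<in> Obj C" "\<Theta> c y w" for c y w
      using that ap_in[OF f that(1)] by (auto simp: \<Theta>_def)
    show "\<Theta> d (rs Y g y) (rs W g w)" if g: "g \<in> hom C d c" and "\<Theta> c y w" for c d g y w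
      using that(2) ap_natural[OF q g] ap_natural[OF f g] rs_in[OF P g] unfolding \<Theta>_def by metis
    show "w = w'" if "c \<in> Obj C" "\<Theta> c y w" "\<Theta> c y w'" for c y w w'
      using that(2,3) ker[OF that(1)] unfolding \<Theta>_def by metis
    fix c y assume c: "c \<in> Obj C" and y: "y \<in> el Y c"
    obtain t where t: "t \<in> el T c"
      using terminal_el[OF T c] by blast
    show "locally c (\<lambda>g. \<exists>w. \<Theta> (Src C g) (rs Y g y) w)"
    proof (rule locally_mono[OF c epi_locally_surjective[OF e(2,1) c t]])
      fix d g assume g: "g \<in> hom C d c" and "\<exists>a\<in>el A (Src C g). ap e (Src C g) a = rs T g t"
      then obtain a where a: "a \<in> el A d"
        using hom_src[OF g] by auto
      obtain z where "z \<in> el P d" "ap q d z = rs Y g y"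
        by (rule product_el[OF prod cat_dom[OF C g] a rs_in[OF Y g y]]) (rule that)
      then show "\<exists>w. \<Theta> (Src C g) (rs Y g y) w"
        unfolding \<Theta>_def hom_src[OF g] by blast
    qed
  qed (rule that)
  have "g \<cdot> q = f"
  proof (rule arr_eqI[OF cat_comp[OF E q g(1)] f])
    fix c z assume c: "c \<in> Obj C" and z: "z \<in> el P c"
    show "ap (g \<cdot> q) c z = ap f c z"
      unfolding ap_comp[OF q g(1) c z] by (rule g(2)[OF c ap_in[OF q c z]]) (use z in \<open>auto simp: \<Theta>_def\<close>)
  qed
  then show ?thesis
    using g(1) by blast
qed

end

section \<open>The categories \<open>\<D>\<^sub>A\<close>\<close>

text \<open>The copy of \<open>A\<close> indexed by \<open>s\<close> inside the product of
  \<open>A\<close> with \<open>gam S\<close>, followed by the action: the arrow from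
  \<open>A\<close> that corresponds to the element \<open>s\<close>.\<close>

definition pnt :: "('o, 'v::universe) topos \<Rightarrow> 'o \<Rightarrow> ('o, 'v) dobj \<Rightarrow> 'v \<Rightarrow> 'v" where
  "pnt E A = (\<lambda>(X, S, \<sigma>) s. \<sigma> \<cdot>\<^bsub>E\<^esub> pair E (Id E A) (const_arr E A S s))"

context topos_representation
begin

section \<open>Calculus of the chosen products\<close>

lemma prod_facts:
  assumes "X \<in> Obj E" "Y \<in> Obj E"
  shows prod_obj: "X \<otimes> Y \<in> Obj E" and Pr1_hom: "Pr1 E X Y \<in> hom E (X \<otimes> Y) X"
    and Pr2_hom: "Pr2 E X Y \<in> hom E (X \<otimes> Y) Y"
  using product[OF assms] by (simp_all add: is_product_def)

lemma pair_facts: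
  assumes f: "f \<in> hom E Z X" and g: "g \<in> hom E Z Y"
  shows pair_hom: "pair E f g \<in> hom E Z (X \<otimes> Y)"
    and Pr1_pair: "Pr1 E X Y \<cdot> pair E f g = f" and Pr2_pair: "Pr2 E X Y \<cdot> pair E f g = g"
proof -
  have "\<exists>!h. h \<in> hom E Z (X \<otimes> Y) \<and> Pr1 E X Y \<cdot> h = f \<and> Pr2 E X Y \<cdot> h = g"
    using product[OF cat_cod[OF E f] cat_cod[OF E g]] cat_dom[OF E f] f g by (simp add: is_product_def)
  from theI'[OF this] show "pair E f g \<in> hom E Z (X \<otimes> Y)" "Pr1 E X Y \<cdot> pair E f g = f"
    "Pr2 E X Y \<cdot> pair E f g = g"
    by (simp_all add: pair_def hom_src[OF f] hom_tgt[OF f] hom_tgt[OF g])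
qed

lemma prod_eqI:
  assumes X: "X \<in> Obj E" "Y \<in> Obj E" and h: "h \<in> hom E Z (X \<otimes> Y)" and k: "k \<in> hom E Z (X \<otimes> Y)"
    and eq: "Pr1 E X Y \<cdot> h = Pr1 E X Y \<cdot> k" "Pr2 E X Y \<cdot> h = Pr2 E X Y \<cdot> k"
  shows "h = k"
proof -
  note f = cat_comp[OF E h Pr1_hom[OF X]] and g = cat_comp[OF E h Pr2_hom[OF X]]
  have "\<exists>!l. l \<in> hom E Z (X \<otimes> Y) \<and> Pr1 E X Y \<cdot> l = Pr1 E X Y \<cdot> h \<and>
      Pr2 E X Y \<cdot> l = Pr2 E X Y \<cdot> h"
    using product[OF X] cat_dom[OF E h] f g by (simp add: is_product_def)
  then show ?thesis
    using h k eq by auto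
qed

lemma pair_eqI:
  assumes f: "f \<in> hom E Z X" and g: "g \<in> hom E Z Y" and h: "h \<in> hom E Z (X \<otimes> Y)"
    and "Pr1 E X Y \<cdot> h = f" "Pr2 E X Y \<cdot> h = g"
  shows "h = pair E f g"
  by (rule prod_eqI[OF cat_cod[OF E f] cat_cod[OF E g] h pair_hom[OF f g]])
    (simp_all add: assms Pr1_pair[OF f g] Pr2_pair[OF f g])

lemma pair_comp:
  assumes f: "f \<in> hom E Z X" and g: "g \<in> hom E Z Y" and r: "r \<in> hom E W Z"
  shows "pair E f g \<cdot> r = pair E (f \<cdot> r) (g \<cdot> r)"
proof -
  note XY = cat_cod[OF E f] cat_cod[OF E g]
  show ?thesis
    by (rule pair_eqI[OF cat_comp[OF E r f] cat_comp[OF E r g] cat_comp[OF E r pair_hom[OF f g]]])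
      (simp_all add: cat_assoc[OF E r pair_hom[OF f g] Pr1_hom[OF XY], symmetric]
        cat_assoc[OF E r pair_hom[OF f g] Pr2_hom[OF XY], symmetric] Pr1_pair[OF f g] Pr2_pair[OF f g])
qed

lemma prod_arr_hom:
  assumes f: "f \<in> hom E X X'" and g: "g \<in> hom E Y Y'"
  shows "prod_arr E f g \<in> hom E (X \<otimes> Y) (X' \<otimes> Y')"
  unfolding prod_arr_def hom_src[OF f] hom_src[OF g]
  using cat_dom[OF E f] cat_dom[OF E g] by (intro pair_hom cat_comp[OF E _ f] cat_comp[OF E _ g] Pr1_hom Pr2_hom)

lemma prod_arr_pair:
  assumes f: "f \<in> hom E X X'" and g: "g \<in> hom E Y Y'" and a: "a \<in> hom E Z X" and b: "b \<in> hom E Z Y"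
  shows "prod_arr E f g \<cdot> pair E a b = pair E (f \<cdot> a) (g \<cdot> b)"
proof -
  note XY = cat_dom[OF E f] cat_dom[OF E g]
  note p1 = Pr1_hom[OF XY] and p2 = Pr2_hom[OF XY] and ab = pair_hom[OF a b]
  show ?thesis
    unfolding prod_arr_def hom_src[OF f] hom_src[OF g] pair_comp[OF cat_comp[OF E p1 f] cat_comp[OF E p2 g] ab]
      cat_assoc[OF E ab p1 f] cat_assoc[OF E ab p2 g] Pr1_pair[OF a b] Pr2_pair[OF a b] ..
qed

lemma Pr_prod_arr:
  assumes f: "f \<in> hom E X X'" and g: "g \<in> hom E Y Y'"
  shows Pr1_prod_arr: "Pr1 E X' Y' \<cdot> prod_arr E f g = f \<cdot> Pr1 E X Y"
    and Pr2_prod_arr: "Pr2 E X' Y' \<cdot> prod_arr E f g = g \<cdot> Pr2 E X Y"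
proof -
  note XY = cat_dom[OF E f] cat_dom[OF E g]
  note p1 = cat_comp[OF E Pr1_hom[OF XY] f] and p2 = cat_comp[OF E Pr2_hom[OF XY] g]
  show "Pr1 E X' Y' \<cdot> prod_arr E f g = f \<cdot> Pr1 E X Y" "Pr2 E X' Y' \<cdot> prod_arr E f g = g \<cdot> Pr2 E X Y"
    unfolding prod_arr_def hom_src[OF f] hom_src[OF g] by (rule Pr1_pair[OF p1 p2], rule Pr2_pair[OF p1 p2])
qed

abbreviation sect :: "'o \<Rightarrow> 'v set \<Rightarrow> 'v \<Rightarrow> 'v" where
  "sect A S s \<equiv> pair E (Id E A) (const_arr E A S s)"

lemma sect_hom: "A \<in> Obj E \<Longrightarrow> small S \<Longrightarrow> s \<in> S \<Longrightarrow> sect A S s \<in> hom E A (A \<otimes> gam S)"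
  by (rule pair_hom[OF cat_Id[OF E] const_arr_hom])

text \<open>A generalized element whose second component is constant at \<open>s\<close> lies in the
  copy of \<open>A\<close> with index \<open>s\<close>, and its first component is its position
  there.\<close>

lemma sect_factor:
  assumes A: "A \<in> Obj E" and S: "small S" "s \<in> S" and r: "r \<in> hom E Z (A \<otimes> gam S)"
    and eq: "Pr2 E A (gam S) \<cdot> r = const_arr E Z S s"
  shows "r = sect A S s \<cdot> (Pr1 E A (gam S) \<cdot> r)"
proof -
  note gS = gam_obj[OF S(1)]
  note b = cat_comp[OF E r Pr1_hom[OF A gS]]
  have "r = pair E (Pr1 E A (gam S) \<cdot> r) (const_arr E Z S s)"
    by (rule pair_eqI[OF b const_arr_hom[OF cat_dom[OF E r] S] r refl eq])
  then show ?thesis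
    unfolding pair_comp[OF cat_Id[OF E A] const_arr_hom[OF A S] b] cat_id_left[OF E b] const_arr_comp[OF b S] .
qed

text \<open>The second projection splits the product into pieces on which it is constant, and each
  piece factors through a copy of \<open>A\<close>.\<close>

lemma sect_jointly_epic:
  assumes A: "A \<in> Obj E" and S: "small S"
    and g: "g \<in> hom E (A \<otimes> gam S) W" and h: "h \<in> hom E (A \<otimes> gam S) W"
    and eq: "\<And>s. s \<in> S \<Longrightarrow> g \<cdot> sect A S s = h \<cdot> sect A S s"
  shows "g = h"
proof (rule constant_cover[OF Pr2_hom[OF A gam_obj[OF S]] S g h])
  fix s Z r assume s: "s \<in> S" and r: "r \<in> hom E Z (A \<otimes> gam S)"
    and "Pr2 E A (gam S) \<cdot> r = const_arr E Z S s"
  then have req: "r = sect A S s \<cdot> (Pr1 E A (gam S) \<cdot> r)"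
    by (intro sect_factor[OF A S])
  note b = cat_comp[OF E r Pr1_hom[OF A gam_obj[OF S]]]
  show "g \<cdot> r = h \<cdot> r"
    using cat_assoc[OF E b sect_hom[OF A S s] g] cat_assoc[OF E b sect_hom[OF A S s] h] eq[OF s] req by metis
qed

section \<open>Objects of D_A and the arrows out of A that they classify\<close>

lemma DA_objE:
  assumes "(X, S, \<sigma>) \<in> DA_obj E A"
  shows DA_connected: "connected_object E X" and DA_small: "small S" and DA_nonempty: "S \<noteq> {}"
    and DA_hom: "\<sigma> \<in> hom E (A \<otimes> gam S) X"
    and DA_iso: "is_iso E (pair E (Pr1 E A (gam S)) \<sigma>)"
  using assms by (simp_all add: DA_obj_def)

lemma connected_obj: "connected_object E X \<Longrightarrow> X \<in> Obj E"
  by (simp add: connected_object_def)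

lemma pnt_eq: "pnt E A (X, S, \<sigma>) s = \<sigma> \<cdot> sect A S s"
  by (simp add: pnt_def)

lemma pnt_hom:
  "A \<in> Obj E \<Longrightarrow> (X, S, \<sigma>) \<in> DA_obj E A \<Longrightarrow> s \<in> S \<Longrightarrow> pnt E A (X, S, \<sigma>) s \<in> hom E A X"
  unfolding pnt_eq by (rule cat_comp[OF E sect_hom DA_hom]) (auto dest: DA_small)

text \<open>Collects the equations satisfied by the inverse \<open>j\<close> of the structure
  isomorphism: it lies over \<open>A\<close>, it recovers the second projection through
  \<open>\<sigma>\<close>, and it turns the graph of the arrow named by \<open>s\<close> into the
  copy of \<open>A\<close> indexed by \<open>s\<close>.\<close>

lemma DA_inverse:
  assumes A: "A \<in> Obj E" and d: "(X, S, \<sigma>) \<in> DA_obj E A"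
  obtains j where "j \<in> hom E (A \<otimes> X) (A \<otimes> gam S)"
    "j \<cdot> pair E (Pr1 E A (gam S)) \<sigma> = Id E (A \<otimes> gam S)"
    "pair E (Pr1 E A (gam S)) \<sigma> \<cdot> j = Id E (A \<otimes> X)"
    "Pr1 E A (gam S) \<cdot> j = Pr1 E A X" "\<sigma> \<cdot> j = Pr2 E A X"
    "\<And>s. s \<in> S \<Longrightarrow> j \<cdot> pair E (Id E A) (pnt E A (X, S, \<sigma>) s) = sect A S s"
proof -
  note S = DA_small[OF d] and gS = gam_obj[OF DA_small[OF d]]
  note X = connected_obj[OF DA_connected[OF d]]
  note p1 = Pr1_hom[OF A gS] and \<sigma> = DA_hom[OF d]
  define i where "i = pair E (Pr1 E A (gam S)) \<sigma>"
  have i: "i \<in> hom E (A \<otimes> gam S) (A \<otimes> X)"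
    unfolding i_def by (rule pair_hom[OF p1 \<sigma>])
  obtain j where j: "j \<in> hom E (A \<otimes> X) (A \<otimes> gam S)"
    and ji: "j \<cdot> i = Id E (A \<otimes> gam S)" and ij: "i \<cdot> j = Id E (A \<otimes> X)"
    using DA_iso[OF d] unfolding i_def[symmetric] is_iso_hom[OF i] by blast
  have i1: "Pr1 E A X \<cdot> i = Pr1 E A (gam S)" and i2: "Pr2 E A X \<cdot> i = \<sigma>"
    unfolding i_def by (rule Pr1_pair[OF p1 \<sigma>], rule Pr2_pair[OF p1 \<sigma>])
  show thesis
  proof (rule that[OF j ji[unfolded i_def] ij[unfolded i_def]])
    show "Pr1 E A (gam S) \<cdot> j = Pr1 E A X"
      using cat_assoc[OF E j i Pr1_hom[OF A X]] by (simp add: i1 ij cat_id_right[OF E Pr1_hom[OF A X]])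
    show "\<sigma> \<cdot> j = Pr2 E A X"
      using cat_assoc[OF E j i Pr2_hom[OF A X]] by (simp add: i2 ij cat_id_right[OF E Pr2_hom[OF A X]])
    fix s assume s: "s \<in> S"
    note c = sect_hom[OF A S s]
    have "i \<cdot> sect A S s = pair E (Id E A) (pnt E A (X, S, \<sigma>) s)"
      unfolding i_def pair_comp[OF p1 \<sigma> c] pnt_eq Pr1_pair[OF cat_Id[OF E A] const_arr_hom[OF A S s]] ..
    then show "j \<cdot> pair E (Id E A) (pnt E A (X, S, \<sigma>) s) = sect A S s"
      using cat_assoc[OF E c i j] by (simp add: ji cat_id_left[OF E c])
  qed
qed

text \<open>For injectivity, \<open>j\<close> recovers the constant \<open>s\<close> from its arrow,
  and distinct constants differ on the non-initial \<open>A\<close>. Surjectivity is the constancy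
  of arrows from a connected object to \<open>gam S\<close>.\<close>

lemma pnt_bij:
  assumes A: "connected_object E A" and d: "(X, S, \<sigma>) \<in> DA_obj E A"
  shows "bij_betw (pnt E A (X, S, \<sigma>)) S (hom E A X)"
proof -
  note AO = connected_obj[OF A]
  note S = DA_small[OF d] and gS = gam_obj[OF DA_small[OF d]]
  note X = connected_obj[OF DA_connected[OF d]]
  note p1 = Pr1_hom[OF AO gS] and p2 = Pr2_hom[OF AO gS] and \<sigma> = DA_hom[OF d]
  note idA = cat_Id[OF E AO]
  obtain j where j: "j \<in> hom E (A \<otimes> X) (A \<otimes> gam S)"
    and j1: "Pr1 E A (gam S) \<cdot> j = Pr1 E A X" and j2: "\<sigma> \<cdot> j = Pr2 E A X"
    and js: "\<And>s. s \<in> S \<Longrightarrow> j \<cdot> pair E (Id E A) (pnt E A (X, S, \<sigma>) s) = sect A S s"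
    by (rule DA_inverse[OF AO d]) (rule that)
  show ?thesis
    unfolding bij_betw_def
  proof
    show "inj_on (pnt E A (X, S, \<sigma>)) S"
    proof (rule inj_onI)
      fix s t assume s: "s \<in> S" and t: "t \<in> S" and "pnt E A (X, S, \<sigma>) s = pnt E A (X, S, \<sigma>) t"
      then have "sect A S s = sect A S t"
        using js[OF s] js[OF t] by metis
      then have "const_arr E A S s = const_arr E A S t"
        using Pr2_pair[OF idA const_arr_hom[OF AO S s]] Pr2_pair[OF idA const_arr_hom[OF AO S t]] by metis
      then show "s = t"
        using A by (intro const_arr_inj[OF AO _ S s t]) (simp add: connected_object_def)
    qed
    show "pnt E A (X, S, \<sigma>) ` S = hom E A X"
    proof
      show "pnt E A (X, S, \<sigma>) ` S \<subseteq> hom E A X"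
        using pnt_hom[OF AO d] by blast
      show "hom E A X \<subseteq> pnt E A (X, S, \<sigma>) ` S"
      proof
        fix x assume x: "x \<in> hom E A X"
        note ix = pair_hom[OF idA x]
        define r where "r = j \<cdot> pair E (Id E A) x"
        have r: "r \<in> hom E A (A \<otimes> gam S)"
          unfolding r_def by (rule cat_comp[OF E ix j])
        have r1: "Pr1 E A (gam S) \<cdot> r = Id E A"
          unfolding r_def cat_assoc[OF E ix j p1, symmetric] j1 by (rule Pr1_pair[OF idA x])
        obtain s where s: "s \<in> S" "Pr2 E A (gam S) \<cdot> r = const_arr E A S s"
          using connected_constant[OF A S cat_comp[OF E r p2]] by blast
        have "r = sect A S s"
          using sect_factor[OF AO S s(1) r s(2)] by (simp add: r1 cat_id_right[OF E sect_hom[OF AO S s(1)]])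
        then have "pnt E A (X, S, \<sigma>) s = \<sigma> \<cdot> r"
          by (simp add: pnt_eq)
        also have "\<dots> = x"
          unfolding r_def cat_assoc[OF E ix j \<sigma>, symmetric] j2 by (rule Pr2_pair[OF idA x])
        finally show "x \<in> pnt E A (X, S, \<sigma>) ` S"
          using s(1) by blast
      qed
    qed
  qed
qed

text \<open>The copies of \<open>A\<close> are jointly epic, so the defining square of an arrow of
  D_A may be checked on points. From here on arrows of D_A are handled through their action on
  points.\<close>

lemma DA_square_iff:
  assumes A: "A \<in> Obj E" and d: "(X, S, \<sigma>) \<in> DA_obj E A" and d': "(Y, T, \<xi>) \<in> DA_obj E A"
    and f: "f \<in> hom E X Y" and \<eta>: "\<eta> \<in> hom SetC S T"
  shows "f \<cdot> \<sigma> = \<xi> \<cdot> prod_arr E (Id E A) (gam_arr \<eta>) \<longleftrightarrow>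
    (\<forall>s\<in>S. f \<cdot> pnt E A (X, S, \<sigma>) s = pnt E A (Y, T, \<xi>) (set_app \<eta> s))"
proof -
  note S = DA_small[OF d] and \<sigma> = DA_hom[OF d] and \<xi> = DA_hom[OF d'] and idA = cat_Id[OF E A]
  note g\<eta> = functor_hom[OF gam_functor \<eta>]
  note P = prod_arr_hom[OF idA g\<eta>]
  have l: "(f \<cdot> \<sigma>) \<cdot> sect A S s = f \<cdot> pnt E A (X, S, \<sigma>) s" if "s \<in> S" for s
    unfolding pnt_eq by (rule cat_assoc[OF E sect_hom[OF A S that] \<sigma> f])
  have r: "(\<xi> \<cdot> prod_arr E (Id E A) (gam_arr \<eta>)) \<cdot> sect A S s = pnt E A (Y, T, \<xi>) (set_app \<eta> s)"
    if s: "s \<in> S" for s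
    unfolding pnt_eq cat_assoc[OF E sect_hom[OF A S s] P \<xi>]
      prod_arr_pair[OF idA g\<eta> idA const_arr_hom[OF A S s]] gam_const_arr[OF A \<eta> s] cat_id_left[OF E idA] ..
  show ?thesis
    using l r sect_jointly_epic[OF A S cat_comp[OF E \<sigma> f] cat_comp[OF E P \<xi>]] by metis
qed

section \<open>Arrows of D_A\<close>

lemma Obj_DA [simp]: "Obj (DA E A) = DA_obj E A"
  by (simp add: DA_def)

lemma hom_DA:
  assumes A: "A \<in> Obj E"
  shows "u \<in> hom (DA E A) (X, S, \<sigma>) (Y, T, \<xi>) \<longleftrightarrow>
    (X, S, \<sigma>) \<in> DA_obj E A \<and> (Y, T, \<xi>) \<in> DA_obj E A \<and>
    (\<exists>f \<eta>. u = ((X, S, \<sigma>), f, \<eta>, (Y, T, \<xi>)) \<and> f \<in> hom E X Y \<and> \<eta> \<in> hom SetC S T \<and>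
      (\<forall>s\<in>S. f \<cdot> pnt E A (X, S, \<sigma>) s = pnt E A (Y, T, \<xi>) (set_app \<eta> s)))"
  (is "?l \<longleftrightarrow> ?r")
proof -
  have "?l \<longleftrightarrow> (X, S, \<sigma>) \<in> DA_obj E A \<and> (Y, T, \<xi>) \<in> DA_obj E A \<and>
      (\<exists>f \<eta>. u = ((X, S, \<sigma>), f, \<eta>, (Y, T, \<xi>)) \<and> f \<in> hom E X Y \<and> \<eta> \<in> hom SetC S T \<and>
        f \<cdot> \<sigma> = \<xi> \<cdot> prod_arr E (Id E A) (gam_arr \<eta>))"
    unfolding DA_def DA_arr_def hom_def[of "DA E A", unfolded DA_def DA_arr_def] by auto
  also have "\<dots> \<longleftrightarrow> ?r"
    using DA_square_iff[OF A, of X S \<sigma> Y T \<xi>] by blast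
  finally show ?thesis .
qed

lemma DA_arrE:
  assumes A: "A \<in> Obj E" and u: "u \<in> hom (DA E A) d d'"
  obtains X S \<sigma> Y T \<xi> f \<eta> where "d = (X, S, \<sigma>)" "d' = (Y, T, \<xi>)" "u = (d, f, \<eta>, d')"
    "(X, S, \<sigma>) \<in> DA_obj E A" "(Y, T, \<xi>) \<in> DA_obj E A" "f \<in> hom E X Y" "\<eta> \<in> hom SetC S T"
    "\<And>s. s \<in> S \<Longrightarrow> f \<cdot> pnt E A d s = pnt E A d' (set_app \<eta> s)"
proof -
  obtain X S \<sigma> Y T \<xi> where d: "d = (X, S, \<sigma>)" "d' = (Y, T, \<xi>)"
    by (metis prod_cases3)
  from u[unfolded d hom_DA[OF A]] show thesis
    using that[OF d] d by blast
qed

lemma qA_simps [simp]: "FObj qA d = fst d" "FArr qA u = fst (snd u)"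
  by (simp_all add: qA_def case_prod_beta)

lemma pA_simps [simp]: "FObj pA d = fst (snd d)" "FArr pA u = fst (snd (snd u))"
  by (simp_all add: pA_def case_prod_beta)

lemma qA_hom:
  assumes "A \<in> Obj E" "u \<in> hom (DA E A) d d'"
  shows "fst (snd u) \<in> hom E (fst d) (fst d')"
  by (rule DA_arrE[OF assms]) simp

lemma pA_hom:
  assumes "A \<in> Obj E" "u \<in> hom (DA E A) d d'"
  shows "fst (snd (snd u)) \<in> hom SetC (fst (snd d)) (fst (snd d'))"
  by (rule DA_arrE[OF assms]) simp

lemma pnt_natural:
  assumes "A \<in> Obj E" "u \<in> hom (DA E A) d d'" "s \<in> fst (snd d)"
  shows "fst (snd u) \<cdot> pnt E A d s = pnt E A d' (set_app (fst (snd (snd u))) s)"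
  by (rule DA_arrE[OF assms(1,2)]) (use assms(3) in simp)

text \<open>The component on sets is forced: it sends \<open>s\<close> to the element naming
  \<open>f\<close> after the arrow named by \<open>s\<close>.\<close>

lemma DA_full:
  assumes A: "connected_object E A" and d: "d \<in> DA_obj E A" and d': "d' \<in> DA_obj E A"
    and f: "f \<in> hom E (fst d) (fst d')"
  obtains u where "u \<in> hom (DA E A) d d'" "fst (snd u) = f"
proof -
  obtain X S \<sigma> where dd: "d = (X, S, \<sigma>)"
    by (cases d) auto
  obtain Y T \<xi> where dd': "d' = (Y, T, \<xi>)"
    by (cases d') auto
  note AO = connected_obj[OF A]
  note d = d[unfolded dd] and d' = d'[unfolded dd']
  have f: "f \<in> hom E X Y"
    using f by (simp add: dd dd')
  have "\<exists>t\<in>T. pnt E A (Y, T, \<xi>) t = f \<cdot> pnt E A (X, S, \<sigma>) s" if "s \<in> S" for s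
    using bij_betw_imp_surj_on[OF pnt_bij[OF A d']] cat_comp[OF E pnt_hom[OF AO d that] f] by (metis imageE)
  then obtain t where t: "\<And>s. s \<in> S \<Longrightarrow> t s \<in> T"
    "\<And>s. s \<in> S \<Longrightarrow> pnt E A (Y, T, \<xi>) (t s) = f \<cdot> pnt E A (X, S, \<sigma>) s"
    by metis
  have \<eta>: "set_arr S t T \<in> hom SetC S T"
    using t(1) DA_small[OF d] DA_small[OF d'] by (intro set_arr_hom)
  have "(d, f, set_arr S t T, d') \<in> hom (DA E A) d d'"
    unfolding dd dd' hom_DA[OF AO] using d d' f \<eta> t by simp
  then show thesis
    by (rule that) simp
qed

text \<open>The component in \<open>E\<close> determines the component on sets because
  \<open>pnt\<close> is injective. Equations in D_A are therefore checked in \<open>E\<close>, which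
  is how all of them are proved below.\<close>

lemma DA_eqI:
  assumes A: "connected_object E A" and u: "u \<in> hom (DA E A) d d'" and v: "v \<in> hom (DA E A) d d'"
    and eq: "fst (snd u) = fst (snd v)"
  shows "u = v"
proof -
  note AO = connected_obj[OF A]
  obtain X S \<sigma> Y T \<xi> f \<eta> where d: "d = (X, S, \<sigma>)" "d' = (Y, T, \<xi>)" and u': "u = (d, f, \<eta>, d')"
    and dO: "(Y, T, \<xi>) \<in> DA_obj E A" and \<eta>: "\<eta> \<in> hom SetC S T"
    by (rule DA_arrE[OF AO u]) (rule that)
  obtain g \<zeta> where v': "v = (d, g, \<zeta>, d')" and \<zeta>: "\<zeta> \<in> hom SetC S T"
    by (rule DA_arrE[OF AO v]) (use d in simp)
  have "\<eta> = \<zeta>"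
  proof (rule SetC_eqI[OF \<eta> \<zeta>])
    fix s assume s: "s \<in> S"
    have "pnt E A d' (set_app \<eta> s) = pnt E A d' (set_app \<zeta> s)"
      using pnt_natural[OF AO u, of s] pnt_natural[OF AO v, of s] s eq by (simp add: d u' v')
    then show "set_app \<eta> s = set_app \<zeta> s"
      using inj_onD[OF bij_betw_imp_inj_on[OF pnt_bij[OF A dO]]] set_app_in[OF \<eta> s] set_app_in[OF \<zeta> s]
      unfolding d by blast
  qed
  then show ?thesis
    using eq by (simp add: u' v')
qed

lemma DA_Comp: "(e, g, \<zeta>, e') \<cdot>\<^bsub>DA E A\<^esub> (d, f, \<eta>, d') = (d, g \<cdot> f, \<zeta> \<cdot>\<^bsub>SetC\<^esub> \<eta>, e')"
  by (simp add: DA_def)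

lemma fst_snd_DA_Comp [simp]: "fst (snd (v \<cdot>\<^bsub>DA E A\<^esub> u)) = fst (snd v) \<cdot> fst (snd u)"
  "fst (snd (snd (v \<cdot>\<^bsub>DA E A\<^esub> u))) = fst (snd (snd v)) \<cdot>\<^bsub>SetC\<^esub> fst (snd (snd u))"
  by (simp_all add: DA_def case_prod_beta)

lemma DA_Id: "Id (DA E A) d = (d, Id E (fst d), Id SetC (fst (snd d)), d)"
  by (simp add: DA_def case_prod_beta)

lemma DA_comp_hom:
  assumes A: "A \<in> Obj E" and u: "u \<in> hom (DA E A) d d'" and v: "v \<in> hom (DA E A) d' d''"
  shows "v \<cdot>\<^bsub>DA E A\<^esub> u \<in> hom (DA E A) d d''"
proof -
  obtain X S \<sigma> Y T \<xi> f \<eta> where d: "d = (X, S, \<sigma>)" "d' = (Y, T, \<xi>)" "u = (d, f, \<eta>, d')"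
    and dO: "(X, S, \<sigma>) \<in> DA_obj E A" and f: "f \<in> hom E X Y" and \<eta>: "\<eta> \<in> hom SetC S T"
    by (rule DA_arrE[OF A u]) (rule that)
  obtain Z V \<rho> g \<zeta> where d'': "d'' = (Z, V, \<rho>)" "v = (d', g, \<zeta>, d'')"
    and dO'': "(Z, V, \<rho>) \<in> DA_obj E A" and g: "g \<in> hom E Y Z" and \<zeta>: "\<zeta> \<in> hom SetC T V"
    by (rule DA_arrE[OF A v]) (use d in simp)
  have "g \<cdot> f \<cdot> pnt E A d s = pnt E A d'' (set_app (\<zeta> \<cdot>\<^bsub>SetC\<^esub> \<eta>) s)" if s: "s \<in> S" for s
    unfolding set_app_comp[OF \<eta> \<zeta> s]
    using cat_assoc[OF E pnt_hom[OF A dO s] f g] pnt_natural[OF A u, of s] pnt_natural[OF A v, of "set_app \<eta> s"]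
      s set_app_in[OF \<eta> s] by (simp add: d d'')
  then show ?thesis
    using cat_comp[OF E f g] SetC_comp[OF \<eta> \<zeta>] dO dO'' by (simp add: d d'' DA_Comp hom_DA[OF A])
qed

lemma DA_Id_hom:
  assumes A: "A \<in> Obj E" and d: "d \<in> DA_obj E A"
  shows "Id (DA E A) d \<in> hom (DA E A) d d"
proof -
  obtain X S \<sigma> where dd: "d = (X, S, \<sigma>)"
    by (cases d) auto
  note d = d[unfolded dd]
  show ?thesis
    unfolding dd DA_Id hom_DA[OF A]
    using d cat_Id[OF E connected_obj[OF DA_connected[OF d]]] SetC_Id_hom[OF DA_small[OF d]]
      cat_id_left[OF E pnt_hom[OF A d]] by simp
qed

lemma category_DA:
  assumes A: "connected_object E A"
  shows "category (DA E A)"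
proof (rule categoryI)
  note AO = connected_obj[OF A]
  show "Src (DA E A) u \<in> Obj (DA E A) \<and> Tgt (DA E A) u \<in> Obj (DA E A)" if "u \<in> Arr (DA E A)" for u
    by (rule DA_arrE[OF AO arr_hom[OF that]]) simp
  show "Id (DA E A) x \<in> hom (DA E A) x x" if "x \<in> Obj (DA E A)" for x
    using DA_Id_hom[OF AO] that by simp
  show "g \<cdot>\<^bsub>DA E A\<^esub> f \<in> hom (DA E A) x z" if "f \<in> hom (DA E A) x y" "g \<in> hom (DA E A) y z" for x y z f g
    by (rule DA_comp_hom[OF AO that])
  fix x y f assume f: "f \<in> hom (DA E A) x y"
  have xy: "x \<in> DA_obj E A" "y \<in> DA_obj E A"
    by (rule DA_arrE[OF AO f], simp)+
  show "f \<cdot>\<^bsub>DA E A\<^esub> Id (DA E A) x = f"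
    by (rule DA_eqI[OF A DA_comp_hom[OF AO DA_Id_hom[OF AO xy(1)] f] f])
      (simp add: DA_Id cat_id_right[OF E qA_hom[OF AO f]])
  show "Id (DA E A) y \<cdot>\<^bsub>DA E A\<^esub> f = f"
    by (rule DA_eqI[OF A DA_comp_hom[OF AO f DA_Id_hom[OF AO xy(2)]] f])
      (simp add: DA_Id cat_id_left[OF E qA_hom[OF AO f]])
  fix z w g h assume g: "g \<in> hom (DA E A) y z" and h: "h \<in> hom (DA E A) z w"
  show "h \<cdot>\<^bsub>DA E A\<^esub> (g \<cdot>\<^bsub>DA E A\<^esub> f) = h \<cdot>\<^bsub>DA E A\<^esub> g \<cdot>\<^bsub>DA E A\<^esub> f"
    by (rule DA_eqI[OF A DA_comp_hom[OF AO DA_comp_hom[OF AO f g] h] DA_comp_hom[OF AO f DA_comp_hom[OF AO g h]]])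
      (simp add: cat_assoc[OF E qA_hom[OF AO f] qA_hom[OF AO g] qA_hom[OF AO h]])
qed

section \<open>Galois objects\<close>

lemma galois_connected: "galois_object E A \<Longrightarrow> connected_object E A"
  by (simp add: galois_object_def)

lemma galois_obj: "galois_object E A \<Longrightarrow> A \<in> Obj E"
  by (rule connected_obj[OF galois_connected])

lemma small_hom: "X \<in> Obj E \<Longrightarrow> Y \<in> Obj E \<Longrightarrow> small (hom E X Y)"
  using topos by (simp add: set_topos_def grothendieck_topos_def locally_small_def)

lemma small_Aut: "A \<in> Obj E \<Longrightarrow> small (Aut E A)"
  by (rule small_subset[OF small_hom]) (auto simp: Aut_def)

lemma Aut_hom: "h \<in> Aut E A \<Longrightarrow> h \<in> hom E A A"
  by (simp add: Aut_def)

lemma Id_Aut: "A \<in> Obj E \<Longrightarrow> Id E A \<in> Aut E A"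
  using cat_Id[OF E, of A] cat_id_left[OF E cat_Id[OF E, of A]] by (auto simp: Aut_def is_iso_hom)

text \<open>The canonical isomorphism is prescribed only on the copies of \<open>A\<close>; joint
  epicness identifies its first component with the projection, and its second component is the
  action. In this object of D_A an automorphism \<open>h\<close> names the arrow \<open>h\<close>,
  so the identity is a distinguished element.\<close>

lemma galois_torsor:
  assumes G: "galois_object E A"
  obtains \<sigma> where "(A, Aut E A, \<sigma>) \<in> DA_obj E A" "\<And>h. h \<in> Aut E A \<Longrightarrow> pnt E A (A, Aut E A, \<sigma>) h = h"
proof -
  note A = galois_obj[OF G] and c = galois_connected[OF G]
  note S = small_Aut[OF A] and gS = gam_obj[OF small_Aut[OF A]]
  note idA = cat_Id[OF E A] and p1 = Pr1_hom[OF A gS] and q1 = Pr1_hom[OF A A] and q2 = Pr2_hom[OF A A]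
  obtain m where m: "m \<in> hom E (A \<otimes> gam (Aut E A)) (A \<otimes> A)" "is_iso E m"
    and ms: "\<And>h. h \<in> Aut E A \<Longrightarrow> m \<cdot> sect A (Aut E A) h = pair E (Id E A) h"
    using G unfolding galois_object_def canonical_map_def by blast
  define \<sigma> where "\<sigma> = Pr2 E A A \<cdot> m"
  have \<sigma>: "\<sigma> \<in> hom E (A \<otimes> gam (Aut E A)) A"
    unfolding \<sigma>_def by (rule cat_comp[OF E m(1) q2])
  have "Pr1 E A A \<cdot> m = Pr1 E A (gam (Aut E A))"
  proof (rule sect_jointly_epic[OF A S cat_comp[OF E m(1) q1] p1])
    fix h assume h: "h \<in> Aut E A"
    show "Pr1 E A A \<cdot> m \<cdot> sect A (Aut E A) h = Pr1 E A (gam (Aut E A)) \<cdot> sect A (Aut E A) h"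
      unfolding cat_assoc[OF E sect_hom[OF A S h] m(1) q1] ms[OF h] Pr1_pair[OF idA Aut_hom[OF h]]
        Pr1_pair[OF idA const_arr_hom[OF A S h]] ..
  qed
  then have "m = pair E (Pr1 E A (gam (Aut E A))) \<sigma>"
    by (intro pair_eqI[OF p1 \<sigma> m(1)]) (simp_all add: \<sigma>_def)
  then have "(A, Aut E A, \<sigma>) \<in> DA_obj E A"
    using c S \<sigma> m(2) Id_Aut[OF A] by (auto simp: DA_obj_def)
  moreover have "pnt E A (A, Aut E A, \<sigma>) h = h" if h: "h \<in> Aut E A" for h
    unfolding pnt_eq \<sigma>_def cat_assoc[OF E sect_hom[OF A S h] m(1) q2] ms[OF h] by (rule Pr2_pair[OF idA Aut_hom[OF h]])
  ultimately show thesis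
    by (rule that)
qed

text \<open>Every arrow from \<open>A\<close> to itself is named by an element of the torsor, and
  those elements are the automorphisms. The monoid \<open>hom E A A\<close> can thus be used as the
  group.\<close>

lemma galois_endo_Aut:
  assumes G: "galois_object E A" and h: "h \<in> hom E A A"
  shows "h \<in> Aut E A"
proof -
  obtain \<sigma> where d: "(A, Aut E A, \<sigma>) \<in> DA_obj E A" and p: "\<And>h. h \<in> Aut E A \<Longrightarrow> pnt E A (A, Aut E A, \<sigma>) h = h"
    by (rule galois_torsor[OF G]) (rule that)
  have "h \<in> pnt E A (A, Aut E A, \<sigma>) ` Aut E A"
    using bij_betw_imp_surj_on[OF pnt_bij[OF galois_connected[OF G] d]] h by simp
  then show ?thesis
    using p by auto
qed

lemma galois_endo_inverse:
  assumes "galois_object E A" "h \<in> hom E A A"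
  obtains k where "k \<in> hom E A A" "k \<cdot> h = Id E A" "h \<cdot> k = Id E A"
  using galois_endo_Aut[OF assms] unfolding Aut_def is_iso_hom[OF assms(2)] by (auto simp: is_iso_hom[OF assms(2)])

text \<open>Any two generalized elements of \<open>A\<close> differ locally by an automorphism.\<close>

lemma galois_cover:
  assumes G: "galois_object E A" and a: "a \<in> hom E Z A" and a': "a' \<in> hom E Z A"
    and f: "f \<in> hom E Z W" and g: "g \<in> hom E Z W"
    and eq: "\<And>h Z' r. h \<in> hom E A A \<Longrightarrow> r \<in> hom E Z' Z \<Longrightarrow> a' \<cdot> r = h \<cdot> (a \<cdot> r) \<Longrightarrow> f \<cdot> r = g \<cdot> r"
  shows "f = g"
proof -
  note A = galois_obj[OF G] and c = galois_connected[OF G]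
  obtain \<sigma> where d: "(A, Aut E A, \<sigma>) \<in> DA_obj E A" and p: "\<And>h. h \<in> Aut E A \<Longrightarrow> pnt E A (A, Aut E A, \<sigma>) h = h"
    by (rule galois_torsor[OF G]) (rule that)
  note S = small_Aut[OF A] and gS = gam_obj[OF small_Aut[OF A]] and \<sigma> = DA_hom[OF d]
  obtain j where j: "j \<in> hom E (A \<otimes> A) (A \<otimes> gam (Aut E A))"
    and j1: "Pr1 E A (gam (Aut E A)) \<cdot> j = Pr1 E A A" and j2: "\<sigma> \<cdot> j = Pr2 E A A"
    by (rule DA_inverse[OF A d]) (rule that)
  note aa = pair_hom[OF a a'] and p2 = Pr2_hom[OF A gS] and p1 = Pr1_hom[OF A gS]
  \<comment> \<open>The pair (a, a') carried through the isomorphism with the product of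
    \<open>A\<close> and \<open>gam (Aut E A)\<close>. Where its second component is constant at
    \<open>h\<close>, the two elements satisfy a' = h a.\<close>
  define l where "l = j \<cdot> pair E a a'"
  have l: "l \<in> hom E Z (A \<otimes> gam (Aut E A))"
    unfolding l_def by (rule cat_comp[OF E aa j])
  have l1: "Pr1 E A (gam (Aut E A)) \<cdot> l = a"
    unfolding l_def cat_assoc[OF E aa j p1, symmetric] j1 by (rule Pr1_pair[OF a a'])
  have l2: "\<sigma> \<cdot> l = a'"
    unfolding l_def cat_assoc[OF E aa j \<sigma>, symmetric] j2 by (rule Pr2_pair[OF a a'])
  show ?thesis
  proof (rule constant_cover[OF cat_comp[OF E l p2] S f g])
    fix h Z' r assume h: "h \<in> Aut E A" and r: "r \<in> hom E Z' Z"
      and k: "Pr2 E A (gam (Aut E A)) \<cdot> l \<cdot> r = const_arr E Z' (Aut E A) h"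
    note lr = cat_comp[OF E r l] and ar = cat_comp[OF E r a]
    have "l \<cdot> r = sect A (Aut E A) h \<cdot> (Pr1 E A (gam (Aut E A)) \<cdot> (l \<cdot> r))"
      by (rule sect_factor[OF A S h lr]) (simp add: cat_assoc[OF E r l p2, symmetric] k)
    then have lr': "l \<cdot> r = sect A (Aut E A) h \<cdot> (a \<cdot> r)"
      by (simp add: cat_assoc[OF E r l p1, symmetric] l1)
    have "a' \<cdot> r = \<sigma> \<cdot> (l \<cdot> r)"
      using cat_assoc[OF E r l \<sigma>] l2 by simp
    also have "\<dots> = pnt E A (A, Aut E A, \<sigma>) h \<cdot> (a \<cdot> r)"
      unfolding lr' pnt_eq by (rule cat_assoc[OF E ar sect_hom[OF A S h] \<sigma>, symmetric])
    finally show "f \<cdot> r = g \<cdot> r"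
      using eq[OF Aut_hom[OF h] r] by (simp add: p[OF h])
  qed
qed

lemma galois_transitive:
  assumes G: "galois_object E A" and d: "(X, S, \<sigma>) \<in> DA_obj E A"
    and x: "x \<in> hom E A X" and y: "y \<in> hom E A X"
  shows "\<exists>g\<in>hom E A A. y = x \<cdot> g"
proof (rule ccontr)
  assume no: "\<not> (\<exists>g\<in>hom E A A. y = x \<cdot> g)"
  note A = galois_obj[OF G] and c = galois_connected[OF G]
  note S = DA_small[OF d] and gS = gam_obj[OF DA_small[OF d]] and \<sigma> = DA_hom[OF d]
  note Xc = DA_connected[OF d] and X = connected_obj[OF DA_connected[OF d]] and idA = cat_Id[OF E A]
  let ?p = "pnt E A (X, S, \<sigma>)"
  note bij = pnt_bij[OF c d]
  have ps_surj: "\<exists>s\<in>S. ?p s = z" if "z \<in> hom E A X" for z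
    using bij_betw_imp_surj_on[OF bij] that by (metis imageE)
  obtain s0 where s0: "s0 \<in> S" "?p s0 = x"
    using ps_surj[OF x] by blast
  obtain s1 where s1: "s1 \<in> S" "?p s1 = y"
    using ps_surj[OF y] by blast
  \<comment> \<open>The indices of the arrows in the orbit of \<open>x\<close>; by assumption
    \<open>s1\<close>, the index of \<open>y\<close>, is not among them.\<close>
  define S' where "S' = {s \<in> S. \<exists>g\<in>hom E A A. ?p s = x \<cdot> g}"
  have s0': "s0 \<in> S'"
    using s0 idA cat_id_right[OF E x] unfolding S'_def by force
  have s1': "s1 \<notin> S'"
    using s1 no by (auto simp: S'_def)
  have S'_act: "s' \<in> S'" if s: "s \<in> S'" and s': "s' \<in> S" and h: "h \<in> hom E A A" and eq: "?p s' = ?p s \<cdot> h" for s s' h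
  proof -
    from s obtain g where g: "g \<in> hom E A A" "?p s = x \<cdot> g"
      by (auto simp: S'_def)
    then have "?p s' = x \<cdot> (g \<cdot> h)"
      using eq cat_assoc[OF E h g(1) x] by simp
    then show ?thesis
      using s' cat_comp[OF E h g(1)] by (auto simp: S'_def)
  qed
  \<comment> \<open>The characteristic function of the orbit, with the distinct elements
    \<open>s0\<close> and \<open>s1\<close> of \<open>S\<close> serving as the two truth values, so
    that it is an endofunction of \<open>S\<close>.\<close>
  define \<chi> where "\<chi> = set_arr S (\<lambda>s. if s \<in> S' then s0 else s1) S"
  have \<chi>: "\<chi> \<in> hom SetC S S"
    unfolding \<chi>_def using S s0 s1 by (intro set_arr_hom) auto
  have \<chi>_app: "set_app \<chi> s = (if s \<in> S' then s0 else s1)" if "s \<in> S" for s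
    using that by (simp add: \<chi>_def)
  obtain j where j: "j \<in> hom E (A \<otimes> X) (A \<otimes> gam S)"
    and ij: "pair E (Pr1 E A (gam S)) \<sigma> \<cdot> j = Id E (A \<otimes> X)"
    and j1: "Pr1 E A (gam S) \<cdot> j = Pr1 E A X" and j2: "\<sigma> \<cdot> j = Pr2 E A X"
    and js: "\<And>s. s \<in> S \<Longrightarrow> j \<cdot> pair E (Id E A) (?p s) = sect A S s"
    by (rule DA_inverse[OF A d]) (rule that)
  note p2 = Pr2_hom[OF A gS] and p1 = Pr1_hom[OF A gS] and q1 = Pr1_hom[OF A X] and q2 = Pr2_hom[OF A X]
  note p2j = cat_comp[OF E j p2]
  \<comment> \<open>In terms of elements, (a, x) is sent to \<open>\<chi>\<close> of that index
    \<open>s\<close> for which the arrow named by \<open>s\<close> takes \<open>a\<close> to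
    \<open>x\<close>; \<open>fpb\<close> states this for generalized elements.\<close>
  define f where "f = gam_arr \<chi> \<cdot> (Pr2 E A (gam S) \<cdot> j)"
  note g\<chi> = functor_hom[OF gam_functor \<chi>]
  have f: "f \<in> hom E (A \<otimes> X) (gam S)"
    unfolding f_def by (rule cat_comp[OF E p2j g\<chi>])
  have fp: "f \<cdot> pair E (Id E A) (?p s) = const_arr E A S (set_app \<chi> s)" if s: "s \<in> S" for s
  proof -
    note ip = pair_hom[OF idA pnt_hom[OF A d s]]
    show ?thesis
      unfolding f_def cat_assoc[OF E ip p2j g\<chi>] cat_assoc[OF E ip j p2] js[OF s]
        Pr2_pair[OF idA const_arr_hom[OF A S s]] by (rule gam_const_arr[OF A \<chi> s])
  qed
  have fpb: "f \<cdot> r = const_arr E Z S (set_app \<chi> s)"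
    if r: "r \<in> hom E Z (A \<otimes> X)" and b: "b \<in> hom E Z A" "Pr1 E A X \<cdot> r = b"
      and s: "s \<in> S" "Pr2 E A X \<cdot> r = ?p s \<cdot> b" for r Z b s
  proof -
    note ps = pnt_hom[OF A d s(1)]
    have "r = pair E b (?p s \<cdot> b)"
      by (rule pair_eqI[OF b(1) cat_comp[OF E b(1) ps] r b(2) s(2)])
    also have "\<dots> = pair E (Id E A) (?p s) \<cdot> b"
      unfolding pair_comp[OF idA ps b(1)] cat_id_left[OF E b(1)] ..
    finally show ?thesis
      using cat_assoc[OF E b(1) pair_hom[OF idA ps] f] fp[OF s(1)]
        const_arr_comp[OF b(1) S set_app_in[OF \<chi> s(1)]] by simp
  qed
  obtain T e where T: "is_terminal E T" and e: "e \<in> hom E A T" "is_epi E e"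
    using G unfolding galois_object_def by blast
  have "\<exists>g\<in>hom E X (gam S). g \<cdot> Pr2 E A X = f"
  proof (rule descent[OF T e product[OF A X] f])
    fix Z r r' assume r: "r \<in> hom E Z (A \<otimes> X)" and r': "r' \<in> hom E Z (A \<otimes> X)"
      and rr: "Pr2 E A X \<cdot> r = Pr2 E A X \<cdot> r'"
    note fr = cat_comp[OF E r f] and fr' = cat_comp[OF E r' f]
    note a = cat_comp[OF E r q1] and a' = cat_comp[OF E r' q1]
    show "f \<cdot> r = f \<cdot> r'"
    \<comment> \<open>Two points over the same element of \<open>X\<close> have to receive the same
      value. Locally their components in \<open>A\<close> differ by an automorphism
      \<open>h\<close>.\<close>
    proof (rule galois_cover[OF G a a' fr fr'])
      fix h Z' t assume h: "h \<in> hom E A A" and t: "t \<in> hom E Z' Z"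
        and at: "Pr1 E A X \<cdot> r' \<cdot> t = h \<cdot> (Pr1 E A X \<cdot> r \<cdot> t)"
      note rt = cat_comp[OF E t r] and rt' = cat_comp[OF E t r']
      have "f \<cdot> (r \<cdot> t) = f \<cdot> (r' \<cdot> t)"
      proof (rule constant_cover[OF cat_comp[OF E rt p2j] S cat_comp[OF E rt f] cat_comp[OF E rt' f]])
        fix s Z'' w assume s: "s \<in> S" and w: "w \<in> hom E Z'' Z'"
          and con: "Pr2 E A (gam S) \<cdot> j \<cdot> (r \<cdot> t) \<cdot> w = const_arr E Z'' S s"
        define \<rho> where "\<rho> = r \<cdot> t \<cdot> w"
        define \<rho>' where "\<rho>' = r' \<cdot> t \<cdot> w"
        have \<rho>: "\<rho> \<in> hom E Z'' (A \<otimes> X)" and \<rho>': "\<rho>' \<in> hom E Z'' (A \<otimes> X)"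
          unfolding \<rho>_def \<rho>'_def by (rule cat_comp[OF E w rt], rule cat_comp[OF E w rt'])
        define b where "b = Pr1 E A X \<cdot> \<rho>"
        have b: "b \<in> hom E Z'' A"
          unfolding b_def by (rule cat_comp[OF E \<rho> q1])
        note ps = pnt_hom[OF A d s]
        note j\<rho> = cat_comp[OF E \<rho> j]
        have "Pr2 E A (gam S) \<cdot> (j \<cdot> \<rho>) = const_arr E Z'' S s"
          using con unfolding \<rho>_def cat_assoc[OF E w rt p2j] cat_assoc[OF E cat_comp[OF E w rt] j p2] .
        from sect_factor[OF A S s j\<rho> this]
        have j\<rho>': "j \<cdot> \<rho> = sect A S s \<cdot> b"
          by (simp add: cat_assoc[OF E \<rho> j p1, symmetric] j1 b_def)
        have "Pr2 E A X \<cdot> \<rho> = \<sigma> \<cdot> (j \<cdot> \<rho>)"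
          using cat_assoc[OF E \<rho> j \<sigma>] by (simp add: j2)
        then have \<rho>2: "Pr2 E A X \<cdot> \<rho> = ?p s \<cdot> b"
          unfolding j\<rho>' pnt_eq using cat_assoc[OF E b sect_hom[OF A S s] \<sigma>] by simp
        obtain k where k: "k \<in> hom E A A" "k \<cdot> h = Id E A" "h \<cdot> k = Id E A"
          by (rule galois_endo_inverse[OF G h])
        \<comment> \<open>The first point is a pair of \<open>b\<close> and the value at
          \<open>b\<close> of the arrow named by \<open>s\<close>. Seen from \<open>h b\<close> the
          same element of \<open>X\<close> is the value of that arrow composed with the inverse of
          \<open>h\<close>, which is in the same orbit; hence \<open>\<chi>\<close> agrees at
          \<open>s\<close> and \<open>s'\<close>.\<close>
        obtain s' where s': "s' \<in> S" "?p s' = ?p s \<cdot> k"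
          using ps_surj[OF cat_comp[OF E k(1) ps]] by blast
        have ps_back: "?p s = ?p s' \<cdot> h"
          unfolding s'(2) cat_assoc[OF E h k(1) ps] k(2) cat_id_right[OF E ps] ..
        note hb = cat_comp[OF E b h]
        have \<rho>'1: "Pr1 E A X \<cdot> \<rho>' = h \<cdot> b"
        proof -
          have "Pr1 E A X \<cdot> \<rho>' = Pr1 E A X \<cdot> r' \<cdot> t \<cdot> w"
            unfolding \<rho>'_def cat_assoc[OF E t r' q1] cat_assoc[OF E w rt' q1] ..
          also have "\<dots> = h \<cdot> (Pr1 E A X \<cdot> r \<cdot> t \<cdot> w)"
            unfolding at by (rule cat_assoc[OF E w cat_comp[OF E t a] h])
          also have "Pr1 E A X \<cdot> r \<cdot> t \<cdot> w = b"
            unfolding b_def \<rho>_def cat_assoc[OF E t r q1] cat_assoc[OF E w rt q1] ..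
          finally show ?thesis .
        qed
        have "Pr2 E A X \<cdot> \<rho>' = Pr2 E A X \<cdot> \<rho>"
          unfolding \<rho>_def \<rho>'_def cat_assoc[OF E w rt q2, symmetric] cat_assoc[OF E w rt' q2, symmetric]
            cat_assoc[OF E t r q2, symmetric] cat_assoc[OF E t r' q2, symmetric] rr ..
        then have \<rho>'2: "Pr2 E A X \<cdot> \<rho>' = ?p s' \<cdot> (h \<cdot> b)"
          unfolding \<rho>2 ps_back using cat_assoc[OF E b h pnt_hom[OF A d s'(1)]] by simp
        have "s \<in> S' \<longleftrightarrow> s' \<in> S'"
          using S'_act[OF _ s'(1) k(1) s'(2)] S'_act[OF _ s h ps_back] by blast
        then have "f \<cdot> \<rho> = f \<cdot> \<rho>'"
          using fpb[OF \<rho> b _ s \<rho>2] fpb[OF \<rho>' hb \<rho>'1 s'(1) \<rho>'2] \<chi>_app[OF s] \<chi>_app[OF s'(1)] by (simp add: b_def)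
        then show "f \<cdot> (r \<cdot> t) \<cdot> w = f \<cdot> (r' \<cdot> t) \<cdot> w"
          unfolding cat_assoc[OF E w rt f] cat_assoc[OF E w rt' f] \<rho>_def \<rho>'_def .
      qed
      then show "f \<cdot> r \<cdot> t = f \<cdot> r' \<cdot> t"
        unfolding cat_assoc[OF E t r f] cat_assoc[OF E t r' f] .
    qed
  qed
  then obtain g where g: "g \<in> hom E X (gam S)" "g \<cdot> Pr2 E A X = f"
    by blast
  obtain s where s: "s \<in> S" "g = const_arr E X S s"
    using connected_constant[OF Xc S g(1)] by blast
  have fc: "f = const_arr E (A \<otimes> X) S s"
    using g(2) const_arr_comp[OF q2 S s(1)] by (simp add: s(2))
  \<comment> \<open>The descended arrow is constant on the connected object \<open>X\<close>, so
    \<open>\<chi>\<close> itself is constant, against its two values at \<open>s0\<close> and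
    \<open>s1\<close>.\<close>
  have "set_app \<chi> t = s" if t: "t \<in> S" for t
  proof (rule const_arr_inj[OF A _ S set_app_in[OF \<chi> t] s(1)])
    show "\<not> is_initial E A"
      using c by (simp add: connected_object_def)
    show "const_arr E A S (set_app \<chi> t) = const_arr E A S s"
      using fp[OF t] const_arr_comp[OF pair_hom[OF idA pnt_hom[OF A d t]] S s(1)] by (simp add: fc)
  qed
  then have "s0 = s1"
    using \<chi>_app[OF s0(1)] \<chi>_app[OF s1(1)] s0' s1' s0(1) s1(1) by simp
  then show False
    using s0' s1' by simp
qed

end

section \<open>The point of \<open>\<D>\<^sub>A\<close>\<close>

context topos_representation
begin

lemma pA_functor:
  assumes A: "connected_object E A"
  shows "is_functor (DA E A) SetC pA"
proof (rule is_functorI[OF category_DA[OF A] category_SetC])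
  fix d assume "d \<in> Obj (DA E A)"
  then show "FObj pA d \<in> Obj SetC"
    by (auto simp: DA_obj_def)
qed (use pA_hom[OF connected_obj[OF A]] in \<open>simp_all add: DA_Id\<close>)

section \<open>The category C_A and the functor to it\<close>

lemma CA_simps [simp]: "Id (CA E A) X = Id E X" "g \<cdot>\<^bsub>CA E A\<^esub> f = g \<cdot> f"
  by (simp_all add: CA_def full_subcategory_def)

lemma Obj_CA: "X \<in> Obj (CA E A) \<longleftrightarrow> connected_object E X \<and> hom E A X \<noteq> {}"
  by (auto simp: CA_def full_subcategory_def connected_object_def)

lemma hom_CA_iff: "f \<in> hom (CA E A) X Y \<longleftrightarrow> X \<in> Obj (CA E A) \<and> Y \<in> Obj (CA E A) \<and> f \<in> hom E X Y"
  unfolding Obj_CA by (auto simp: CA_def full_subcategory_def hom_def)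

lemma category_CA: "category (CA E A)"
proof (rule categoryI)
  show "Src (CA E A) f \<in> Obj (CA E A) \<and> Tgt (CA E A) f \<in> Obj (CA E A)" if "f \<in> Arr (CA E A)" for f
    using arr_hom[OF that] hom_CA_iff by blast
  show "Id (CA E A) X \<in> hom (CA E A) X X" if "X \<in> Obj (CA E A)" for X
    using that cat_Id[OF E connected_obj] by (simp add: hom_CA_iff Obj_CA)
qed (auto simp: hom_CA_iff cat_id_left[OF E] cat_id_right[OF E] cat_assoc[OF E] intro: cat_comp[OF E])

lemma DA_obj_CA:
  assumes A: "A \<in> Obj E" and d: "d \<in> DA_obj E A"
  shows "fst d \<in> Obj (CA E A)"
proof -
  obtain X S \<sigma> where dd: "d = (X, S, \<sigma>)"
    by (cases d) auto
  obtain s where "s \<in> S"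
    using DA_nonempty[OF d[unfolded dd]] by blast
  then show ?thesis
    using pnt_hom[OF A d[unfolded dd]] DA_connected[OF d[unfolded dd]] by (auto simp: Obj_CA dd)
qed

lemma qA_functor:
  assumes A: "connected_object E A"
  shows "is_functor (DA E A) (CA E A) qA"
proof (rule is_functorI[OF category_DA[OF A] category_CA])
  note AO = connected_obj[OF A]
  show "FObj qA d \<in> Obj (CA E A)" if "d \<in> Obj (DA E A)" for d
    using DA_obj_CA[OF AO] that by simp
  show "FArr qA u \<in> hom (CA E A) (FObj qA d) (FObj qA d')" if u: "u \<in> hom (DA E A) d d'" for d d' u
    using DA_obj_CA[OF AO] qA_hom[OF AO u] cat_dom[OF category_DA[OF A] u] cat_cod[OF category_DA[OF A] u]
    by (simp add: hom_CA_iff)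
qed (simp_all add: DA_Id)

lemma CA_self: "connected_object E A \<Longrightarrow> A \<in> Obj (CA E A)"
  using cat_Id[OF E connected_obj] by (auto simp: Obj_CA)

lemma hom_functor_functor:
  fixes D :: "('p, 'v) cat"
  assumes D: "category D" and sm: "locally_small D" and a: "a \<in> Obj D"
  shows "is_functor D SetC (hom_functor D a)"
proof (rule is_functorI[OF D category_SetC])
  have small: "small (hom D a x)" if "x \<in> Obj D" for x
    using sm a that by (simp add: locally_small_def)
  have FA: "FArr (hom_functor D a) f = set_arr (hom D a x) (\<lambda>g. f \<cdot>\<^bsub>D\<^esub> g) (hom D a y)" if "f \<in> hom D x y" for f x y
    by (simp add: hom_functor_def set_arr_def hom_src[OF that] hom_tgt[OF that])
  have h: "set_arr (hom D a x) (\<lambda>g. f \<cdot>\<^bsub>D\<^esub> g) (hom D a y) \<in> hom SetC (hom D a x) (hom D a y)"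
    if f: "f \<in> hom D x y" for f x y
    by (rule set_arr_hom[OF small[OF cat_dom[OF D f]] small[OF cat_cod[OF D f]] cat_comp[OF D _ f]])
  show "FObj (hom_functor D a) x \<in> Obj SetC" if "x \<in> Obj D" for x
    using small[OF that] by (simp add: hom_functor_def)
  show "FArr (hom_functor D a) (Id D x) = Id SetC (FObj (hom_functor D a) x)" if x: "x \<in> Obj D" for x
  proof -
    have "set_arr (hom D a x) (\<lambda>g. Id D x \<cdot>\<^bsub>D\<^esub> g) (hom D a x) = set_arr (hom D a x) (\<lambda>g. g) (hom D a x)"
      by (rule SetC_eqI[OF h[OF cat_Id[OF D x]] SetC_Id_hom[OF small[OF x]]]) (simp add: cat_id_left[OF D])
    then show ?thesis
      unfolding FA[OF cat_Id[OF D x]] by (simp add: hom_functor_def)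
  qed
  show "FArr (hom_functor D a) f \<in> hom SetC (FObj (hom_functor D a) x) (FObj (hom_functor D a) y)"
    if f: "f \<in> hom D x y" for f x y
    using h[OF f] by (simp add: FA[OF f]) (simp add: hom_functor_def)
  show "FArr (hom_functor D a) (g \<cdot>\<^bsub>D\<^esub> f) = FArr (hom_functor D a) g \<cdot>\<^bsub>SetC\<^esub> FArr (hom_functor D a) f"
    if f: "f \<in> hom D x y" and g: "g \<in> hom D y z" for x y z f g
    unfolding FA[OF f] FA[OF g] FA[OF cat_comp[OF D f g]]
  proof (rule SetC_eqI[OF h[OF cat_comp[OF D f g]] SetC_comp[OF h[OF f] h[OF g]]])
    fix k assume k: "k \<in> hom D a x"
    show "set_app (set_arr (hom D a x) (\<lambda>k. g \<cdot>\<^bsub>D\<^esub> f \<cdot>\<^bsub>D\<^esub> k) (hom D a z)) k =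
        set_app (set_arr (hom D a y) (\<lambda>k. g \<cdot>\<^bsub>D\<^esub> k) (hom D a z) \<cdot>\<^bsub>SetC\<^esub>
          set_arr (hom D a x) (\<lambda>k. f \<cdot>\<^bsub>D\<^esub> k) (hom D a y)) k"
      unfolding set_app_comp[OF h[OF f] h[OF g] k] using k cat_comp[OF D k f] cat_assoc[OF D k f g] by simp
  qed
qed

lemma locally_small_CA: "locally_small (CA E A)"
  unfolding locally_small_def
proof (intro ballI)
  fix X Y assume "X \<in> Obj (CA E A)" "Y \<in> Obj (CA E A)"
  then have "small (hom E X Y)"
    using small_hom connected_obj by (simp add: Obj_CA)
  then show "small (hom (CA E A) X Y)"
    by (rule small_subset) (auto simp: hom_CA_iff)
qed

lemma pA_representable:
  assumes A: "connected_object E A"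
  shows "naturally_isomorphic (DA E A) SetC pA (hom_functor (CA E A) A \<odot> qA)"
proof -
  note AO = connected_obj[OF A]
  let ?H = "hom_functor (CA E A) A"
  define \<tau> where "\<tau> d = set_arr (fst (snd d)) (pnt E A d) (hom (CA E A) A (fst d))" for d
  have H: "is_functor (CA E A) SetC ?H"
    by (rule hom_functor_functor[OF category_CA locally_small_CA CA_self[OF A]])
  have homCA: "hom (CA E A) A (fst d) = hom E A (fst d)" if "d \<in> DA_obj E A" for d
    using DA_obj_CA[OF AO that] CA_self[OF A] by (auto simp: hom_CA_iff)
  have bij: "bij_betw (pnt E A d) (fst (snd d)) (hom (CA E A) A (fst d))" if "d \<in> DA_obj E A" for d
    using pnt_bij[OF A, of "fst d" "fst (snd d)" "snd (snd d)"] that homCA[OF that] by simp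
  have \<tau>: "\<tau> d \<in> hom SetC (fst (snd d)) (hom (CA E A) A (fst d))" if d: "d \<in> DA_obj E A" for d
    unfolding \<tau>_def
  proof (rule set_arr_hom)
    show "small (fst (snd d))"
      using d by (auto simp: DA_obj_def)
    show "small (hom (CA E A) A (fst d))"
      using locally_small_CA DA_obj_CA[OF AO d] CA_self[OF A] by (simp add: locally_small_def)
  qed (use bij_betwE[OF bij[OF d]] in blast)
  have "nat_trans (DA E A) SetC pA (?H \<odot> qA) \<tau>"
  proof (rule nat_transI[OF pA_functor[OF A] is_functor_comp[OF qA_functor[OF A] H]])
    show "\<tau> d \<in> hom SetC (FObj pA d) (FObj (?H \<odot> qA) d)" if "d \<in> Obj (DA E A)" for d
      using \<tau>[of d] that by (simp add: hom_functor_def)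
    fix d d' u assume u: "u \<in> hom (DA E A) d d'"
    have d: "d \<in> DA_obj E A" and d': "d' \<in> DA_obj E A"
      using cat_dom[OF category_DA[OF A] u] cat_cod[OF category_DA[OF A] u] by simp_all
    have qu: "FArr qA u \<in> hom (CA E A) (fst d) (fst d')"
      using functor_hom[OF qA_functor[OF A] u] by simp
    have Hu: "FArr ?H (FArr qA u) \<in> hom SetC (hom (CA E A) A (fst d)) (hom (CA E A) A (fst d'))"
      using functor_hom[OF H qu] by (simp add: hom_functor_def)
    have Hu_app: "set_app (FArr ?H (FArr qA u)) x = fst (snd u) \<cdot> x" if "x \<in> hom (CA E A) A (fst d)" for x
      using that by (simp add: hom_functor_def set_app_def hom_src[OF qu[simplified]])
    note pu = pA_hom[OF AO u]
    show "FArr (?H \<odot> qA) u \<cdot>\<^bsub>SetC\<^esub> \<tau> d = \<tau> d' \<cdot>\<^bsub>SetC\<^esub> FArr pA u"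
      unfolding comp_functor_simps pA_simps(2)
    proof (rule SetC_eqI[OF SetC_comp[OF \<tau>[OF d] Hu] SetC_comp[OF pu \<tau>[OF d']]])
      fix s assume s: "s \<in> fst (snd d)"
      have "set_app (\<tau> d) s = pnt E A d s" "pnt E A d s \<in> hom (CA E A) A (fst d)"
        using s bij_betwE[OF bij[OF d]] by (simp_all add: \<tau>_def)
      then show "set_app (FArr ?H (FArr qA u) \<cdot>\<^bsub>SetC\<^esub> \<tau> d) s = set_app (\<tau> d' \<cdot>\<^bsub>SetC\<^esub> fst (snd (snd u))) s"
        using set_app_comp[OF \<tau>[OF d] Hu s] set_app_comp[OF pu \<tau>[OF d'] s] Hu_app
          pnt_natural[OF AO u s] set_app_in[OF pu s] by (simp add: \<tau>_def[of d'])
    qed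
  qed
  moreover have "is_iso SetC (\<tau> d)" if "d \<in> Obj (DA E A)" for d
  proof (rule is_iso_SetC[OF \<tau>])
    show d: "d \<in> DA_obj E A"
      using that by simp
    have "bij_betw (set_app (\<tau> d)) (fst (snd d)) (hom (CA E A) A (fst d)) \<longleftrightarrow>
        bij_betw (pnt E A d) (fst (snd d)) (hom (CA E A) A (fst d))"
      by (rule bij_betw_cong) (simp add: \<tau>_def)
    then show "bij_betw (set_app (\<tau> d)) (fst (snd d)) (hom (CA E A) A (fst d))"
      using bij[OF d] by simp
  qed
  ultimately show ?thesis
    unfolding naturally_isomorphic_def by blast
qed

text \<open>A Yoneda argument: the element naming the identity of \<open>A\<close> is universal for
  \<open>pA\<close>, as \<open>s\<close> is its image under the lift of the arrow that
  \<open>s\<close> names.\<close>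

lemma torsor_arrow:
  assumes A: "connected_object E A" and a: "(A, S, \<sigma>) \<in> DA_obj E A" and i: "i \<in> S" "pnt E A (A, S, \<sigma>) i = Id E A"
    and d: "d \<in> DA_obj E A" and s: "s \<in> fst (snd d)"
  obtains u where "u \<in> hom (DA E A) (A, S, \<sigma>) d" "fst (snd u) = pnt E A d s" "set_app (FArr pA u) i = s"
proof -
  note AO = connected_obj[OF A]
  obtain X T \<xi> where dd: "d = (X, T, \<xi>)"
    by (cases d) auto
  have ps: "pnt E A d s \<in> hom E A (fst d)"
    using pnt_hom[OF AO d[unfolded dd]] s by (simp add: dd)
  obtain u where u: "u \<in> hom (DA E A) (A, S, \<sigma>) d" "fst (snd u) = pnt E A d s"
    by (rule DA_full[OF A a d, of "pnt E A d s"]) (use ps in \<open>auto intro: that\<close>)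
  have "pnt E A d s \<cdot> Id E A = pnt E A d (set_app (FArr pA u) i)"
    using pnt_natural[OF AO u(1), of i] i u(2) by simp
  then have "pnt E A d s = pnt E A d (set_app (FArr pA u) i)"
    by (simp add: cat_id_right[OF E ps])
  then have "set_app (FArr pA u) i = s"
    using inj_onD[OF bij_betw_imp_inj_on[OF pnt_bij[OF A d[unfolded dd]]]] s set_app_in[OF pA_hom[OF AO u(1)]] i
    by (simp add: dd)
  then show thesis
    by (rule that[OF u])
qed

text \<open>The torsor with its identity element maps to every object of the category of elements,
  and two arrows agreeing at an element agree after the corresponding map from the torsor; this
  gives flatness. Surjectivity on covers is the transitivity of the group on arrows out of
  \<open>A\<close>.\<close>

lemma pA_point:
  assumes G: "galois_object E A"
  shows "point_of_site (DA E A) (single_covers (DA E A)) pA"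
proof -
  note A = galois_connected[OF G] and AO = galois_obj[OF G]
  obtain \<sigma> where a: "(A, Aut E A, \<sigma>) \<in> DA_obj E A" and p: "\<And>h. h \<in> Aut E A \<Longrightarrow> pnt E A (A, Aut E A, \<sigma>) h = h"
    by (rule galois_torsor[OF G]) (rule that)
  define i where "i = Id E A"
  have i: "i \<in> Aut E A" "pnt E A (A, Aut E A, \<sigma>) i = Id E A"
    using Id_Aut[OF AO] p by (simp_all add: i_def)
  have ex: "\<exists>u\<in>hom (DA E A) (A, Aut E A, \<sigma>) d. fst (snd u) = pnt E A d s \<and> set_app (FArr pA u) i = s"
    if "d \<in> DA_obj E A" "s \<in> fst (snd d)" for d s
    by (rule torsor_arrow[OF A a i that]) blast
  have flat: "flat_functor (DA E A) pA"
    unfolding flat_functor_def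
  proof (intro conjI ballI impI pA_functor[OF A])
    show "\<exists>c\<in>Obj (DA E A). FObj pA c \<noteq> {}"
      using a i(1) by force
  next
    fix c d x y
    assume "c \<in> Obj (DA E A)" "d \<in> Obj (DA E A)" "x \<in> FObj pA c" "y \<in> FObj pA d"
    then obtain f g where "f \<in> hom (DA E A) (A, Aut E A, \<sigma>) c" "set_app (FArr pA f) i = x"
      "g \<in> hom (DA E A) (A, Aut E A, \<sigma>) d" "set_app (FArr pA g) i = y"
      using ex[of c x] ex[of d y] by auto
    moreover have "(A, Aut E A, \<sigma>) \<in> Obj (DA E A)" "i \<in> FObj pA (A, Aut E A, \<sigma>)"
      using a i(1) by simp_all
    ultimately show "\<exists>e\<in>Obj (DA E A). \<exists>z\<in>FObj pA e. \<exists>f\<in>hom (DA E A) e c. \<exists>g\<in>hom (DA E A) e d.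
        set_app (FArr pA f) z = x \<and> set_app (FArr pA g) z = y"
      by blast
  next
    fix c d f g x
    assume c: "c \<in> Obj (DA E A)" and f: "f \<in> hom (DA E A) c d" and g: "g \<in> hom (DA E A) c d"
      and x: "x \<in> FObj pA c" and eq: "set_app (FArr pA f) x = set_app (FArr pA g) x"
    obtain h where h: "h \<in> hom (DA E A) (A, Aut E A, \<sigma>) c" "fst (snd h) = pnt E A c x" "set_app (FArr pA h) i = x"
      using ex[of c x] c x by auto
    have "f \<cdot>\<^bsub>DA E A\<^esub> h = g \<cdot>\<^bsub>DA E A\<^esub> h"
      by (rule DA_eqI[OF A DA_comp_hom[OF AO h(1) f] DA_comp_hom[OF AO h(1) g]])
        (use pnt_natural[OF AO f, of x] pnt_natural[OF AO g, of x] x eq h(2) in simp)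
    moreover have "(A, Aut E A, \<sigma>) \<in> Obj (DA E A)" "i \<in> FObj pA (A, Aut E A, \<sigma>)"
      using a i(1) by simp_all
    ultimately show "\<exists>e\<in>Obj (DA E A). \<exists>z\<in>FObj pA e. \<exists>h\<in>hom (DA E A) e c.
        f \<cdot>\<^bsub>DA E A\<^esub> h = g \<cdot>\<^bsub>DA E A\<^esub> h \<and> set_app (FArr pA h) z = x"
      using h by blast
  qed
  have "\<exists>f\<in>R. \<exists>y\<in>FObj pA (Src (DA E A) f). set_app (FArr pA f) y = x"
    if c: "c \<in> Obj (DA E A)" and R: "R \<in> single_covers (DA E A) c" and x: "x \<in> FObj pA c" for c R x
  proof -
    from R obtain f where f: "R = {f}" "f \<in> hom (DA E A) (Src (DA E A) f) c"
      by (auto simp: single_covers_def in_hom)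
    obtain X S \<xi> where dd: "Src (DA E A) f = (X, S, \<xi>)"
      by (cases "Src (DA E A) f") auto
    have d: "(X, S, \<xi>) \<in> DA_obj E A"
      using cat_dom[OF category_DA[OF A] f(2)] by (simp add: dd)
    obtain Y T \<zeta> where cc: "c = (Y, T, \<zeta>)"
      by (cases c) auto
    have c': "(Y, T, \<zeta>) \<in> DA_obj E A" and xT: "x \<in> T"
      using c x by (simp_all add: cc)
    note f' = f(2)[unfolded dd cc]
    obtain s where s: "s \<in> S"
      using DA_nonempty[OF d] by blast
    note ps = pnt_hom[OF AO d s]
    have q: "fst (snd f) \<in> hom E X Y"
      using qA_hom[OF AO f'] by simp
    \<comment> \<open>Any \<open>s\<close> gives an arrow to the target of the cover. It differs
      from the arrow named by \<open>x\<close> by some \<open>g\<close>, so moving \<open>s\<close>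
      by \<open>g\<close> produces a preimage of \<open>x\<close>.\<close>
    obtain g where g: "g \<in> hom E A A" "pnt E A (Y, T, \<zeta>) x = fst (snd f) \<cdot> pnt E A (X, S, \<xi>) s \<cdot> g"
      using galois_transitive[OF G c' cat_comp[OF E ps q] pnt_hom[OF AO c' xT]] by blast
    have "pnt E A (X, S, \<xi>) s \<cdot> g \<in> pnt E A (X, S, \<xi>) ` S"
      using bij_betw_imp_surj_on[OF pnt_bij[OF A d]] cat_comp[OF E g(1) ps] by simp
    then obtain t where t: "t \<in> S" "pnt E A (X, S, \<xi>) t = pnt E A (X, S, \<xi>) s \<cdot> g"
      by force
    have \<eta>: "set_app (FArr pA f) t \<in> T"
      using set_app_in[OF pA_hom[OF AO f']] t(1) by simp
    have "pnt E A (Y, T, \<zeta>) (set_app (FArr pA f) t) = pnt E A (Y, T, \<zeta>) x"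
      using pnt_natural[OF AO f', of t] t cat_assoc[OF E g(1) ps q] g(2) by simp
    then have "set_app (FArr pA f) t = x"
      using inj_onD[OF bij_betw_imp_inj_on[OF pnt_bij[OF A c']]] \<eta> xT by blast
    then show ?thesis
      using f(1) t(1) dd by auto
  qed
  then show ?thesis
    unfolding point_of_site_def using flat by blast
qed

section \<open>The functors \<open>u\<^sup>*\<close>\<close>

lemma ustar_obj_eq: "ustar_obj E u (Y, T, \<xi>) = (Y, T, \<xi> \<cdot> prod_arr E u (Id E (gam T)))"
  by (simp add: ustar_obj_def)

lemma ustar_obj_simps [simp]:
  "fst (ustar_obj E u d) = fst d" "fst (snd (ustar_obj E u d)) = fst (snd d)"
  by (simp_all add: ustar_obj_def case_prod_beta)

text \<open>Naturality of constants lets the copy of \<open>A\<close> indexed by \<open>t\<close> be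
  compared with that of \<open>B\<close>. Hence the element \<open>t\<close> is kept and the arrow
  it names is precomposed with \<open>u\<close>.\<close>

lemma pnt_ustar:
  assumes u: "u \<in> hom E A B" and d: "d \<in> DA_obj E B" and t: "t \<in> fst (snd d)"
  shows "pnt E A (ustar_obj E u d) t = pnt E B d t \<cdot> u"
proof -
  obtain Y T \<xi> where dd: "d = (Y, T, \<xi>)"
    by (cases d) auto
  note d = d[unfolded dd]
  have t: "t \<in> T"
    using t by (simp add: dd)
  note A = cat_dom[OF E u] and B = cat_cod[OF E u] and T = DA_small[OF d] and \<xi> = DA_hom[OF d]
  note gT = gam_obj[OF T] and c = const_arr_hom[OF A T t] and idA = cat_Id[OF E A] and idB = cat_Id[OF E B]
  note idT = cat_Id[OF E gT]
  note P = prod_arr_hom[OF u idT]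
  have "prod_arr E u (Id E (gam T)) \<cdot> sect A T t = sect B T t \<cdot> u"
    unfolding prod_arr_pair[OF u idT idA c] pair_comp[OF idB const_arr_hom[OF B T t] u]
    by (simp add: cat_id_right[OF E u] cat_id_left[OF E u] cat_id_left[OF E c] const_arr_comp[OF u T t])
  then show ?thesis
    unfolding dd ustar_obj_eq pnt_eq
    using cat_assoc[OF E sect_hom[OF A T t] P \<xi>] cat_assoc[OF E u sect_hom[OF B T t] \<xi>] by simp
qed

text \<open>The structure map over \<open>A\<close> is the base change along \<open>u\<close> of the
  isomorphism over \<open>B\<close>. Its inverse is written down explicitly, and the equations are
  checked on the projections.\<close>

lemma ustar_obj_DA:
  assumes u: "u \<in> hom E A B" and d: "d \<in> DA_obj E B"
  shows "ustar_obj E u d \<in> DA_obj E A"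
proof -
  obtain Y T \<xi> where dd: "d = (Y, T, \<xi>)"
    by (cases d) auto
  note d = d[unfolded dd]
  note A = cat_dom[OF E u] and B = cat_cod[OF E u] and T = DA_small[OF d] and \<xi> = DA_hom[OF d]
  note gT = gam_obj[OF T] and Y = connected_obj[OF DA_connected[OF d]]
  note idT = cat_Id[OF E gT] and idY = cat_Id[OF E Y]
  obtain j where j: "j \<in> hom E (B \<otimes> Y) (B \<otimes> gam T)"
    and ji: "j \<cdot> pair E (Pr1 E B (gam T)) \<xi> = Id E (B \<otimes> gam T)"
    and ij: "pair E (Pr1 E B (gam T)) \<xi> \<cdot> j = Id E (B \<otimes> Y)"
    and j1: "Pr1 E B (gam T) \<cdot> j = Pr1 E B Y" and j2: "\<xi> \<cdot> j = Pr2 E B Y"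
    by (rule DA_inverse[OF B d]) (rule that)
  note aT1 = Pr1_hom[OF A gT] and aT2 = Pr2_hom[OF A gT] and bT1 = Pr1_hom[OF B gT] and bT2 = Pr2_hom[OF B gT]
  note aY1 = Pr1_hom[OF A Y] and aY2 = Pr2_hom[OF A Y] and bY1 = Pr1_hom[OF B Y] and bY2 = Pr2_hom[OF B Y]
  define uT where "uT = prod_arr E u (Id E (gam T))"
  define uY where "uY = prod_arr E u (Id E Y)"
  have uT: "uT \<in> hom E (A \<otimes> gam T) (B \<otimes> gam T)" and uY: "uY \<in> hom E (A \<otimes> Y) (B \<otimes> Y)"
    unfolding uT_def uY_def by (rule prod_arr_hom[OF u idT], rule prod_arr_hom[OF u idY])
  have uT1: "Pr1 E B (gam T) \<cdot> uT = u \<cdot> Pr1 E A (gam T)"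
    and uT2: "Pr2 E B (gam T) \<cdot> uT = Pr2 E A (gam T)"
    unfolding uT_def Pr1_prod_arr[OF u idT] Pr2_prod_arr[OF u idT] by (simp_all add: cat_id_left[OF E aT2])
  have uY1: "Pr1 E B Y \<cdot> uY = u \<cdot> Pr1 E A Y" and uY2: "Pr2 E B Y \<cdot> uY = Pr2 E A Y"
    unfolding uY_def Pr1_prod_arr[OF u idY] Pr2_prod_arr[OF u idY] by (simp_all add: cat_id_left[OF E aY2])
  define i where "i = pair E (Pr1 E B (gam T)) \<xi>"
  have i: "i \<in> hom E (B \<otimes> gam T) (B \<otimes> Y)"
    unfolding i_def by (rule pair_hom[OF bT1 \<xi>])
  have i1: "Pr1 E B Y \<cdot> i = Pr1 E B (gam T)" and i2: "Pr2 E B Y \<cdot> i = \<xi>"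
    unfolding i_def by (rule Pr1_pair[OF bT1 \<xi>], rule Pr2_pair[OF bT1 \<xi>])
  define \<zeta> where "\<zeta> = \<xi> \<cdot> uT"
  have \<zeta>: "\<zeta> \<in> hom E (A \<otimes> gam T) Y"
    unfolding \<zeta>_def by (rule cat_comp[OF E uT \<xi>])
  define k where "k = pair E (Pr1 E A (gam T)) \<zeta>"
  have k: "k \<in> hom E (A \<otimes> gam T) (A \<otimes> Y)" and k1: "Pr1 E A Y \<cdot> k = Pr1 E A (gam T)"
    and k2: "Pr2 E A Y \<cdot> k = \<zeta>"
    unfolding k_def by (rule pair_hom[OF aT1 \<zeta>], rule Pr1_pair[OF aT1 \<zeta>], rule Pr2_pair[OF aT1 \<zeta>])
  \<comment> \<open>The second component of the inverse over \<open>A\<close> is that of the inverse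
    \<open>j\<close> over \<open>B\<close>, evaluated after \<open>u\<close> has been applied to the
    first coordinate.\<close>
  define b where "b = Pr2 E B (gam T) \<cdot> (j \<cdot> uY)"
  note juY = cat_comp[OF E uY j]
  have b: "b \<in> hom E (A \<otimes> Y) (gam T)"
    unfolding b_def by (rule cat_comp[OF E juY bT2])
  define l where "l = pair E (Pr1 E A Y) b"
  have l: "l \<in> hom E (A \<otimes> Y) (A \<otimes> gam T)" and l1: "Pr1 E A (gam T) \<cdot> l = Pr1 E A Y"
    and l2: "Pr2 E A (gam T) \<cdot> l = b"
    unfolding l_def by (rule pair_hom[OF aY1 b], rule Pr1_pair[OF aY1 b], rule Pr2_pair[OF aY1 b])
  have uYk: "uY \<cdot> k = i \<cdot> uT"
  proof (rule prod_eqI[OF B Y cat_comp[OF E k uY] cat_comp[OF E uT i]])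
    show "Pr1 E B Y \<cdot> (uY \<cdot> k) = Pr1 E B Y \<cdot> (i \<cdot> uT)"
      unfolding cat_assoc[OF E k uY bY1, symmetric] cat_assoc[OF E uT i bY1, symmetric] uY1 i1 uT1
        cat_assoc[OF E k aY1 u] k1 ..
    show "Pr2 E B Y \<cdot> (uY \<cdot> k) = Pr2 E B Y \<cdot> (i \<cdot> uT)"
      unfolding cat_assoc[OF E k uY bY2, symmetric] cat_assoc[OF E uT i bY2, symmetric] uY2 i2 k2 \<zeta>_def ..
  qed
  have uTl: "uT \<cdot> l = j \<cdot> uY"
  proof (rule prod_eqI[OF B gT cat_comp[OF E l uT] juY])
    show "Pr1 E B (gam T) \<cdot> (uT \<cdot> l) = Pr1 E B (gam T) \<cdot> (j \<cdot> uY)"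
      unfolding cat_assoc[OF E l uT bT1, symmetric] uT1 cat_assoc[OF E l aT1 u] l1
        cat_assoc[OF E uY j bT1, symmetric] j1 uY1 ..
    show "Pr2 E B (gam T) \<cdot> (uT \<cdot> l) = Pr2 E B (gam T) \<cdot> (j \<cdot> uY)"
      unfolding cat_assoc[OF E l uT bT2, symmetric] uT2 l2 b_def ..
  qed
  have lk: "l \<cdot> k = Id E (A \<otimes> gam T)"
  proof (rule prod_eqI[OF A gT cat_comp[OF E k l] cat_Id[OF E prod_obj[OF A gT]]])
    show "Pr1 E A (gam T) \<cdot> (l \<cdot> k) = Pr1 E A (gam T) \<cdot> Id E (A \<otimes> gam T)"
      unfolding cat_assoc[OF E k l aT1, symmetric] l1 k1 cat_id_right[OF E aT1] ..
    have "j \<cdot> uY \<cdot> k = uT"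
      unfolding cat_assoc[OF E k uY j] uYk cat_assoc[OF E uT i j, symmetric] ji[folded i_def] by (rule cat_id_left[OF E uT])
    then show "Pr2 E A (gam T) \<cdot> (l \<cdot> k) = Pr2 E A (gam T) \<cdot> Id E (A \<otimes> gam T)"
      unfolding cat_assoc[OF E k l aT2, symmetric] l2 b_def cat_assoc[OF E k juY bT2] cat_id_right[OF E aT2]
      by (simp add: uT2)
  qed
  have kl: "k \<cdot> l = Id E (A \<otimes> Y)"
  proof (rule prod_eqI[OF A Y cat_comp[OF E l k] cat_Id[OF E prod_obj[OF A Y]]])
    show "Pr1 E A Y \<cdot> (k \<cdot> l) = Pr1 E A Y \<cdot> Id E (A \<otimes> Y)"
      unfolding cat_assoc[OF E l k aY1, symmetric] k1 l1 cat_id_right[OF E aY1] ..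
    show "Pr2 E A Y \<cdot> (k \<cdot> l) = Pr2 E A Y \<cdot> Id E (A \<otimes> Y)"
      unfolding cat_assoc[OF E l k aY2, symmetric] k2 \<zeta>_def cat_assoc[OF E l uT \<xi>] uTl
        cat_assoc[OF E uY j \<xi>, symmetric] j2 uY2 cat_id_right[OF E aY2] ..
  qed
  have "is_iso E (pair E (Pr1 E A (gam T)) \<zeta>)"
    unfolding k_def[symmetric] is_iso_hom[OF k] using l lk kl by blast
  then show ?thesis
    unfolding dd ustar_obj_eq uT_def[symmetric] \<zeta>_def[symmetric]
    using DA_connected[OF d] T DA_nonempty[OF d] \<zeta> by (simp add: DA_obj_def)
qed

lemma ustar_simps [simp]: "FObj (ustar E u) d = ustar_obj E u d"
  "FArr (ustar E u) w = (ustar_obj E u (fst w), fst (snd w), fst (snd (snd w)), ustar_obj E u (snd (snd (snd w))))"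
  by (simp_all add: ustar_def case_prod_beta)

lemma ustar_arr_hom:
  assumes u: "u \<in> hom E A B" and w: "w \<in> hom (DA E B) d d'"
  shows "FArr (ustar E u) w \<in> hom (DA E A) (ustar_obj E u d) (ustar_obj E u d')"
proof -
  note A = cat_dom[OF E u] and B = cat_cod[OF E u]
  obtain X S \<sigma> Y T \<xi> f \<eta> where d: "d = (X, S, \<sigma>)" "d' = (Y, T, \<xi>)" "w = (d, f, \<eta>, d')"
    and dO: "(X, S, \<sigma>) \<in> DA_obj E B" and dO': "(Y, T, \<xi>) \<in> DA_obj E B" and f: "f \<in> hom E X Y"
    and \<eta>: "\<eta> \<in> hom SetC S T"
    by (rule DA_arrE[OF B w]) (rule that)
  have "f \<cdot> pnt E A (ustar_obj E u d) s = pnt E A (ustar_obj E u d') (set_app \<eta> s)" if s: "s \<in> S" for s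
  proof -
    have "f \<cdot> (pnt E B d s \<cdot> u) = pnt E B d' (set_app \<eta> s) \<cdot> u"
      using cat_assoc[OF E u pnt_hom[OF B dO s] f] pnt_natural[OF B w, of s] s by (simp add: d)
    then show ?thesis
      using pnt_ustar[OF u, of d s] pnt_ustar[OF u, of d' "set_app \<eta> s"] s set_app_in[OF \<eta> s] dO dO'
      by (simp add: d)
  qed
  then show ?thesis
    using ustar_obj_DA[OF u dO] ustar_obj_DA[OF u dO'] f \<eta>
    unfolding ustar_simps d fst_conv snd_conv ustar_obj_eq hom_DA[OF A] by simp
qed

lemma ustar_functor:
  assumes A: "connected_object E A" and B: "connected_object E B" and u: "u \<in> hom E A B"
  shows "is_functor (DA E B) (DA E A) (ustar E u)"
proof (rule is_functorI[OF category_DA[OF B] category_DA[OF A]])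
  show "FObj (ustar E u) d \<in> Obj (DA E A)" if "d \<in> Obj (DA E B)" for d
    using ustar_obj_DA[OF u] that by simp
  show "FArr (ustar E u) w \<in> hom (DA E A) (FObj (ustar E u) d) (FObj (ustar E u) d')"
    if "w \<in> hom (DA E B) d d'" for d d' w
    using ustar_arr_hom[OF u that] by simp
  show "FArr (ustar E u) (g \<cdot>\<^bsub>DA E B\<^esub> f) = FArr (ustar E u) g \<cdot>\<^bsub>DA E A\<^esub> FArr (ustar E u) f"
    if "f \<in> hom (DA E B) x y" "g \<in> hom (DA E B) y z" for x y z f g
    by (simp add: DA_def case_prod_beta)
qed (simp add: DA_Id)

text \<open>Products with \<open>u\<close> and with \<open>r\<close> compose strictly. Equality on
  the nose, not just isomorphism, is what lets a horizontal composite be compared with a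
  transformation belonging to composite arrows.\<close>

lemma ustar_comp_obj:
  assumes u: "u \<in> hom E A B" and r: "r \<in> hom E B B'" and d: "d \<in> DA_obj E B'"
  shows "ustar_obj E u (ustar_obj E r d) = ustar_obj E (r \<cdot> u) d"
proof -
  obtain Y T \<xi> where dd: "d = (Y, T, \<xi>)"
    by (cases d) auto
  note d = d[unfolded dd]
  note A = cat_dom[OF E u] and T = DA_small[OF d] and \<xi> = DA_hom[OF d]
  note gT = gam_obj[OF T] and idT = cat_Id[OF E gam_obj[OF T]]
  note aT1 = Pr1_hom[OF A gT] and aT2 = Pr2_hom[OF A gT]
  note R = prod_arr_hom[OF r idT] and U = prod_arr_hom[OF u idT]
  have "prod_arr E u (Id E (gam T)) = pair E (u \<cdot> Pr1 E A (gam T)) (Id E (gam T) \<cdot> Pr2 E A (gam T))"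
    by (simp add: prod_arr_def hom_src[OF u] hom_src[OF idT])
  then have "prod_arr E r (Id E (gam T)) \<cdot> prod_arr E u (Id E (gam T)) = prod_arr E (r \<cdot> u) (Id E (gam T))"
    using prod_arr_pair[OF r idT cat_comp[OF E aT1 u] cat_comp[OF E aT2 idT]] cat_assoc[OF E aT1 u r]
    by (simp add: prod_arr_def hom_src[OF cat_comp[OF E u r]] hom_src[OF idT] cat_id_left[OF E aT2])
  then show ?thesis
    unfolding dd ustar_obj_eq using cat_assoc[OF E U R \<xi>] by simp
qed

lemma ustar_comp:
  assumes B': "connected_object E B'" and u: "u \<in> hom E A B" and r: "r \<in> hom E B B'"
  shows "functor_eq (DA E B') (ustar E u \<odot> ustar E r) (ustar E (r \<cdot> u))"
  unfolding functor_eq_def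
proof (intro conjI ballI)
  show "FObj (ustar E u \<odot> ustar E r) d = FObj (ustar E (r \<cdot> u)) d" if "d \<in> Obj (DA E B')" for d
    using ustar_comp_obj[OF u r] that by simp
  fix w assume w: "w \<in> Arr (DA E B')"
  have "w \<in> hom (DA E B') (fst w) (snd (snd (snd w)))"
    using w by (simp add: in_hom DA_def case_prod_beta)
  from cat_dom[OF category_DA[OF B'] this] cat_cod[OF category_DA[OF B'] this]
  have "fst w \<in> DA_obj E B'" "snd (snd (snd w)) \<in> DA_obj E B'"
    by simp_all
  then show "FArr (ustar E u \<odot> ustar E r) w = FArr (ustar E (r \<cdot> u)) w"
    using ustar_comp_obj[OF u r] by simp
qed

section \<open>The natural transformations \<open>\<theta>\<close>\<close>

text \<open>The lift of an identity arrow of \<open>E\<close>, which exists by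
  \<open>DA_full\<close> and is unique by \<open>DA_eqI\<close>. The object \<open>A\<close> is read
  off as the source of \<open>u\<close>, so one function serves all pairs of Galois objects.\<close>

definition theta :: "'v \<Rightarrow> 'v \<Rightarrow> ('o, 'v) dobj \<Rightarrow> ('o, 'v) darr" where
  "theta v u d = (SOME w. w \<in> hom (DA E (Src E u)) (ustar_obj E u d) (ustar_obj E v d) \<and> fst (snd w) = Id E (fst d))"

lemma theta:
  assumes A: "connected_object E A" and u: "u \<in> hom E A B" and v: "v \<in> hom E A B" and d: "d \<in> DA_obj E B"
  shows theta_hom: "theta v u d \<in> hom (DA E A) (ustar_obj E u d) (ustar_obj E v d)"
    and theta_arr: "fst (snd (theta v u d)) = Id E (fst d)"
proof -
  have "fst d \<in> Obj E"
    using d connected_obj by (auto simp: DA_obj_def)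
  then have "Id E (fst d) \<in> hom E (fst (ustar_obj E u d)) (fst (ustar_obj E v d))"
    by (simp add: cat_Id[OF E])
  then obtain w where "w \<in> hom (DA E A) (ustar_obj E u d) (ustar_obj E v d)" "fst (snd w) = Id E (fst d)"
    by (rule DA_full[OF A ustar_obj_DA[OF u d] ustar_obj_DA[OF v d]])
  then have "\<exists>w. w \<in> hom (DA E A) (ustar_obj E u d) (ustar_obj E v d) \<and> fst (snd w) = Id E (fst d)"
    by blast
  from someI_ex[OF this]
  have "theta v u d \<in> hom (DA E A) (ustar_obj E u d) (ustar_obj E v d) \<and> fst (snd (theta v u d)) = Id E (fst d)"
    unfolding theta_def hom_src[OF u] .
  then show "theta v u d \<in> hom (DA E A) (ustar_obj E u d) (ustar_obj E v d)"
    "fst (snd (theta v u d)) = Id E (fst d)"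
    by simp_all
qed

text \<open>By faithfulness a component is recognized by lying over an identity. All the equations
  for \<open>theta\<close> are instances: the other side of each lies over an identity as
  well.\<close>

lemma theta_unique:
  assumes A: "connected_object E A" and u: "u \<in> hom E A B" and v: "v \<in> hom E A B" and d: "d \<in> DA_obj E B"
    and w: "w \<in> hom (DA E A) (ustar_obj E u d) (ustar_obj E v d)" "fst (snd w) = Id E (fst d)"
  shows "w = theta v u d"
  by (rule DA_eqI[OF A w(1) theta_hom[OF A u v d]]) (simp add: w(2) theta_arr[OF A u v d])

lemma theta_natural:
  assumes A: "connected_object E A" and B: "connected_object E B" and u: "u \<in> hom E A B" and v: "v \<in> hom E A B"
  shows "nat_trans (DA E B) (DA E A) (ustar E u) (ustar E v) (theta v u)"
proof (rule nat_transI[OF ustar_functor[OF A B u] ustar_functor[OF A B v]])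
  note AO = connected_obj[OF A]
  show "theta v u d \<in> hom (DA E A) (FObj (ustar E u) d) (FObj (ustar E v) d)" if "d \<in> Obj (DA E B)" for d
    using theta_hom[OF A u v] that by simp
  fix d d' w assume w: "w \<in> hom (DA E B) d d'"
  have d: "d \<in> DA_obj E B" and d': "d' \<in> DA_obj E B"
    using cat_dom[OF category_DA[OF B] w] cat_cod[OF category_DA[OF B] w] by simp_all
  note q = qA_hom[OF connected_obj[OF B] w]
  show "FArr (ustar E v) w \<cdot>\<^bsub>DA E A\<^esub> theta v u d = theta v u d' \<cdot>\<^bsub>DA E A\<^esub> FArr (ustar E u) w"
    by (rule DA_eqI[OF A DA_comp_hom[OF AO theta_hom[OF A u v d] ustar_arr_hom[OF v w]]
          DA_comp_hom[OF AO ustar_arr_hom[OF u w] theta_hom[OF A u v d']]])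
      (simp add: theta_arr[OF A u v d] theta_arr[OF A u v d'] cat_id_left[OF E q] cat_id_right[OF E q])
qed

lemma DA_Id_obj: "d \<in> DA_obj E B \<Longrightarrow> Id E (fst d) \<in> hom E (fst d) (fst d)"
  by (rule cat_Id[OF E connected_obj]) (auto simp: DA_obj_def)

lemma theta_refl:
  assumes A: "connected_object E A" and u: "u \<in> hom E A B" and d: "d \<in> DA_obj E B"
  shows "theta u u d = Id (DA E A) (ustar_obj E u d)"
  using theta_unique[OF A u u d DA_Id_hom[OF connected_obj[OF A] ustar_obj_DA[OF u d]]] by (simp add: DA_Id)

lemma theta_comp:
  assumes A: "connected_object E A" and u: "u \<in> hom E A B" and v: "v \<in> hom E A B" and w: "w \<in> hom E A B"
    and d: "d \<in> DA_obj E B"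
  shows "theta w v d \<cdot>\<^bsub>DA E A\<^esub> theta v u d = theta w u d"
  by (rule theta_unique[OF A u w d DA_comp_hom[OF connected_obj[OF A] theta_hom[OF A u v d] theta_hom[OF A v w d]]])
    (simp add: theta_arr[OF A u v d] theta_arr[OF A v w d] cat_id_left[OF E DA_Id_obj[OF d]])

lemma theta_horizontal:
  assumes A: "connected_object E A" and B: "connected_object E B"
    and u: "u \<in> hom E A B" and v: "v \<in> hom E A B" and r: "r \<in> hom E B B'" and s: "s \<in> hom E B B'"
    and d: "d \<in> DA_obj E B'"
  shows "horiz_comp (DA E A) (ustar E u) (ustar E s) (theta v u) (theta s r) d = theta (s \<cdot> v) (r \<cdot> u) d"
proof -
  note sd = ustar_obj_DA[OF s d] and rd = ustar_obj_DA[OF r d]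
  have "theta v u (ustar_obj E s d) \<cdot>\<^bsub>DA E A\<^esub> FArr (ustar E u) (theta s r d)
      \<in> hom (DA E A) (ustar_obj E u (ustar_obj E r d)) (ustar_obj E v (ustar_obj E s d))"
    by (rule DA_comp_hom[OF connected_obj[OF A] ustar_arr_hom[OF u theta_hom[OF B r s d]] theta_hom[OF A u v sd]])
  then have *: "theta v u (ustar_obj E s d) \<cdot>\<^bsub>DA E A\<^esub> FArr (ustar E u) (theta s r d)
      \<in> hom (DA E A) (ustar_obj E (r \<cdot> u) d) (ustar_obj E (s \<cdot> v) d)"
    unfolding ustar_comp_obj[OF u r d] ustar_comp_obj[OF v s d] .
  have "theta v u (ustar_obj E s d) \<cdot>\<^bsub>DA E A\<^esub> FArr (ustar E u) (theta s r d) = theta (s \<cdot> v) (r \<cdot> u) d"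
    by (rule theta_unique[OF A cat_comp[OF E u r] cat_comp[OF E v s] d *])
      (use theta_arr[OF A u v sd] theta_arr[OF B r s d] cat_id_left[OF E DA_Id_obj[OF d]] in simp)
  then show ?thesis
    by (simp add: horiz_comp_def)
qed

lemma CA_inclusion:
  assumes u: "u \<in> hom E A B"
  shows "is_functor (CA E B) (CA E A) id_functor"
proof (rule is_functorI[OF category_CA category_CA])
  show *: "FObj id_functor X \<in> Obj (CA E A)" if "X \<in> Obj (CA E B)" for X
    using that cat_comp[OF E u] by (auto simp: Obj_CA)
  show "FArr id_functor f \<in> hom (CA E A) (FObj id_functor X) (FObj id_functor Y)" if "f \<in> hom (CA E B) X Y" for X Y f
    using that * by (auto simp: hom_CA_iff)
qed simp_all

end

section \<open>Atomic sites with a torsor\<close>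

text \<open>Sheaves on such a site are the sets with an action of the automorphism group of \<open>a\<close>.\<close>

locale atomic_site =
  fixes D :: "('p, 'b, 'z) cat_scheme" (structure) and a :: 'p
  assumes D: "category D" and a: "a \<in> Obj D"
    and reach: "X \<in> Obj D \<Longrightarrow> hom D a X \<noteq> {}"
    and transitive: "x \<in> hom D a X \<Longrightarrow> y \<in> hom D a X \<Longrightarrow> \<exists>g\<in>hom D a a. y = x \<cdot> g"
    and invertible: "g \<in> hom D a a \<Longrightarrow> \<exists>h\<in>hom D a a. h \<cdot> g = Id D a \<and> g \<cdot> h = Id D a"
begin

abbreviation K :: "'p \<Rightarrow> 'b set set" where
  "K \<equiv> single_covers D"

lemma K_into: "covers_into D K"
  by (auto simp: covers_into_def single_covers_def)

lemma K_single: "f \<in> hom D X Y \<Longrightarrow> {f} \<in> K Y"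
  by (auto simp: single_covers_def in_hom)

lemma res_in: "is_sheaf D K P \<Longrightarrow> f \<in> hom D X Y \<Longrightarrow> p \<in> FObj P Y \<Longrightarrow> res P f p \<in> FObj P X"
  by (rule presheaf_in[OF sheaf_presheaf[OF sheaf_dataI[OF _ D]]])

lemma res_Id: "is_sheaf D K P \<Longrightarrow> X \<in> Obj D \<Longrightarrow> p \<in> FObj P X \<Longrightarrow> res P (Id D X) p = p"
  by (rule presheaf_Id[OF sheaf_presheaf[OF sheaf_dataI[OF _ D]]])

lemma res_comp: "is_sheaf D K P \<Longrightarrow> f \<in> hom D Y Z \<Longrightarrow> g \<in> hom D X Y \<Longrightarrow> p \<in> FObj P Z \<Longrightarrow>
    res P (f \<cdot> g) p = res P g (res P f p)"
  by (rule presheaf_comp[OF sheaf_presheaf[OF sheaf_dataI[OF _ D]]])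

lemma res_inj:
  assumes P: "is_sheaf D K P" and f: "f \<in> hom D X Y" and p: "p \<in> FObj P Y" "q \<in> FObj P Y"
    and eq: "res P f p = res P f q"
  shows "p = q"
  by (rule sheaf_separated[OF sheaf_dataI[OF P D] D K_into cat_cod[OF D f] K_single[OF f] p]) (simp add: eq)

text \<open>The matching condition concerns parallel arrows into \<open>a\<close> from any
  \<open>Z\<close>, the hypothesis only endomorphisms of \<open>a\<close>. An arrow from
  \<open>a\<close> to \<open>Z\<close> reduces the former to the latter, as restriction along it is
  injective.\<close>

lemma amalgamate:
  assumes P: "is_sheaf D K P" and x: "x \<in> hom D a X" and m: "m \<in> FObj P a"
    and inv: "\<And>g h. g \<in> hom D a a \<Longrightarrow> h \<in> hom D a a \<Longrightarrow> x \<cdot> g = x \<cdot> h \<Longrightarrow> res P g m = res P h m"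
  obtains q where "q \<in> FObj P X" "res P x q = m"
proof -
  have eq: "res P h m = res P k m" if h: "h \<in> hom D Z a" and k: "k \<in> hom D Z a" and xhk: "x \<cdot> h = x \<cdot> k" for h k Z
  proof -
    obtain z where z: "z \<in> hom D a Z"
      using reach[OF cat_dom[OF D h]] by blast
    have "x \<cdot> (h \<cdot> z) = x \<cdot> (k \<cdot> z)"
      using cat_assoc[OF D z h x] cat_assoc[OF D z k x] xhk by simp
    then have "res P z (res P h m) = res P z (res P k m)"
      using inv[OF cat_comp[OF D z h] cat_comp[OF D z k]] res_comp[OF P h z m] res_comp[OF P k z m] by simp
    then show ?thesis
      by (rule res_inj[OF P z res_in[OF P h m] res_in[OF P k m]])
  qed
  have "matching D (FObj P) (res P) {x} (\<lambda>_. m)"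
    unfolding matching_def
  proof (intro conjI ballI impI)
    fix f g h k
    assume fg: "f \<in> {x}" "g \<in> {x}" and "h \<in> Arr D" "k \<in> Arr D" "Tgt D h = Src D f" "Tgt D k = Src D g"
      "Src D h = Src D k" "f \<cdot> h = g \<cdot> k"
    then show "res P h m = res P k m"
      using x by (intro eq[of h "Src D h" k]) (auto simp: in_hom)
  qed (use m hom_src[OF x] in simp)
  from sheaf_glue[OF sheaf_dataI[OF P D] cat_cod[OF D x] K_single[OF x] this] show thesis
    using that by blast
qed

text \<open>Each object is reached from \<open>a\<close>, and restricting to \<open>a\<close> is
  injective and compatible with the morphisms.\<close>

lemma Sh_determined:
  assumes \<sigma>: "\<sigma> \<in> hom (Sh D K) P Q" and \<tau>: "\<tau> \<in> hom (Sh D K) P Q"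
    and eq: "\<And>p. p \<in> FObj P a \<Longrightarrow> app \<sigma> a p = app \<tau> a p"
  shows "\<sigma> = \<tau>"
proof (rule Sh_eqI[OF \<sigma> \<tau>])
  fix X p assume X: "X \<in> Obj D" and p: "p \<in> FObj P X"
  obtain x where x: "x \<in> hom D a X"
    using reach[OF X] by blast
  have "res Q x (app \<sigma> X p) = res Q x (app \<tau> X p)"
    using app_natural[OF \<sigma> x p] app_natural[OF \<tau> x p] eq[OF res_in[OF Sh_dom[OF \<sigma>] x p]] by simp
  then show "app \<sigma> X p = app \<tau> X p"
    by (rule res_inj[OF Sh_cod[OF \<sigma>] x app_in[OF \<sigma> X p] app_in[OF \<tau> X p]])
qed

text \<open>The value at \<open>X\<close> is amalgamated along one arrow from \<open>a\<close>.
  Transitivity and equivariance show that it is then correct along all arrows from \<open>a\<close>,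
  which makes it independent of the choice and natural.\<close>

lemma Sh_extend:
  assumes P: "is_sheaf D K P" and Q: "is_sheaf D K Q"
    and \<beta>: "\<And>p. p \<in> FObj P a \<Longrightarrow> \<beta> p \<in> FObj Q a"
    and equi: "\<And>g p. g \<in> hom D a a \<Longrightarrow> p \<in> FObj P a \<Longrightarrow> \<beta> (res P g p) = res Q g (\<beta> p)"
  obtains \<tau> where "\<tau> \<in> hom (Sh D K) P Q" "\<And>p. p \<in> FObj P a \<Longrightarrow> app \<tau> a p = \<beta> p"
proof -
  have ex: "\<exists>q. q \<in> FObj Q X \<and> (\<forall>x\<in>hom D a X. res Q x q = \<beta> (res P x p))" if X: "X \<in> Obj D" and p: "p \<in> FObj P X" for X p
  proof -
    obtain x where x: "x \<in> hom D a X"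
      using reach[OF X] by blast
    note xp = res_in[OF P x p]
    obtain q where q: "q \<in> FObj Q X" "res Q x q = \<beta> (res P x p)"
    proof (rule amalgamate[OF Q x \<beta>[OF xp]])
      fix g h assume g: "g \<in> hom D a a" and h: "h \<in> hom D a a" and "x \<cdot> g = x \<cdot> h"
      then show "res Q g (\<beta> (res P x p)) = res Q h (\<beta> (res P x p))"
        using equi[OF g xp] equi[OF h xp] res_comp[OF P x g p] res_comp[OF P x h p] by simp
    qed (rule that)
    have "res Q y q = \<beta> (res P y p)" if y: "y \<in> hom D a X" for y
    proof -
      obtain g where g: "g \<in> hom D a a" "y = x \<cdot> g"
        using transitive[OF x y] by blast
      show ?thesis
        unfolding g(2) res_comp[OF Q x g(1) q(1)] res_comp[OF P x g(1) p] q(2) equi[OF g(1) xp] ..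
    qed
    then show ?thesis
      using q(1) by blast
  qed
  define t where "t X p = (SOME q. q \<in> FObj Q X \<and> (\<forall>x\<in>hom D a X. res Q x q = \<beta> (res P x p)))" for X p
  have t_all: "t X p \<in> FObj Q X \<and> (\<forall>x\<in>hom D a X. res Q x (t X p) = \<beta> (res P x p))"
    if "X \<in> Obj D" "p \<in> FObj P X" for X p
    using someI_ex[OF ex[OF that]] unfolding t_def .
  have t: "t X p \<in> FObj Q X" if "X \<in> Obj D" "p \<in> FObj P X" for X p
    using t_all[OF that] by blast
  have tx: "res Q x (t X p) = \<beta> (res P x p)" if "x \<in> hom D a X" "p \<in> FObj P X" for x X p
    using t_all[OF cat_cod[OF D that(1)] that(2)] that(1) by blast
  have "mk_trans D P t Q \<in> hom (Sh D K) P Q"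
  proof (rule mk_trans_hom[OF D P Q t])
    fix X Y f p assume f: "f \<in> hom D X Y" and p: "p \<in> FObj P Y"
    note X = cat_dom[OF D f] and Y = cat_cod[OF D f] and fp = res_in[OF P f p]
    obtain x where x: "x \<in> hom D a X"
      using reach[OF X] by blast
    have "res Q x (t X (res P f p)) = res Q x (res Q f (t Y p))"
      unfolding tx[OF x fp] res_comp[OF Q f x t[OF Y p], symmetric] tx[OF cat_comp[OF D x f] p]
        res_comp[OF P f x p] ..
    then show "t X (res P f p) = res Q f (t Y p)"
      by (rule res_inj[OF Q x t[OF X fp] res_in[OF Q f t[OF Y p]]])
  qed
  moreover have "app (mk_trans D P t Q) a p = \<beta> p" if p: "p \<in> FObj P a" for p
    using tx[OF cat_Id[OF D a] p] res_Id[OF Q a t[OF a p]] res_Id[OF P a p] a p by simp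
  ultimately show thesis
    by (rule that)
qed

text \<open>With base points \<open>bp X : a \<rightarrow> X\<close>, the value at \<open>X\<close> of the sheaf given by \<open>M\<close> consists of the elements
  fixed by the stabilizer of \<open>bp X\<close>.\<close>

lemma sheaf_of_action:
  fixes M :: "'v::universe set"
  assumes small: "small M"
    and act: "\<And>g m. g \<in> hom D a a \<Longrightarrow> m \<in> M \<Longrightarrow> act g m \<in> M"
    and act_Id: "\<And>m. m \<in> M \<Longrightarrow> act (Id D a) m = m"
    and act_comp: "\<And>g h m. g \<in> hom D a a \<Longrightarrow> h \<in> hom D a a \<Longrightarrow> m \<in> M \<Longrightarrow> act (g \<cdot> h) m = act h (act g m)"
  obtains P where "is_sheaf D K P" "FObj P a = M" "\<And>g m. g \<in> hom D a a \<Longrightarrow> m \<in> M \<Longrightarrow> res P g m = act g m"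
proof -
  note Ida = cat_Id[OF D a]
  \<comment> \<open>The base point of \<open>a\<close> itself is the identity, so that the value of
    the sheaf at \<open>a\<close> is exactly \<open>M\<close>.\<close>
  define bp where "bp X = (if X = a then Id D a else (SOME x. x \<in> hom D a X))" for X
  have bp: "bp X \<in> hom D a X" if "X \<in> Obj D" for X
    using Ida some_in_eq[of "hom D a X"] reach[OF that] by (auto simp: bp_def)
  have bpa: "bp a = Id D a"
    by (simp add: bp_def)
  define ob where "ob X = {m \<in> M. \<forall>g\<in>hom D a a. \<forall>h\<in>hom D a a. bp X \<cdot> g = bp X \<cdot> h \<longrightarrow> act g m = act h m}" for X
  \<comment> \<open>Transitivity moves \<open>f\<close> to an endomorphism between base points, and
    restriction along \<open>f\<close> acts by it. The choice does not matter on elements fixed by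
    the stabilizer (\<open>r_eq\<close>).\<close>
  define lift where "lift f = (SOME g. g \<in> hom D a a \<and> f \<cdot> bp (Src D f) = bp (Tgt D f) \<cdot> g)" for f
  define r where "r f m = act (lift f) m" for f m
  have lift: "lift f \<in> hom D a a" "f \<cdot> bp X = bp Y \<cdot> lift f" if f: "f \<in> hom D X Y" for f X Y
  proof -
    have "\<exists>g. g \<in> hom D a a \<and> f \<cdot> bp (Src D f) = bp (Tgt D f) \<cdot> g"
      using transitive[OF bp[OF cat_cod[OF D f]] cat_comp[OF D bp[OF cat_dom[OF D f]] f]]
      unfolding hom_src[OF f] hom_tgt[OF f] by blast
    from someI_ex[OF this]
    have "lift f \<in> hom D a a \<and> f \<cdot> bp (Src D f) = bp (Tgt D f) \<cdot> lift f"
      unfolding lift_def .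
    then show "lift f \<in> hom D a a" "f \<cdot> bp X = bp Y \<cdot> lift f"
      by (simp_all add: hom_src[OF f] hom_tgt[OF f])
  qed
  have ob_M: "m \<in> M" if "m \<in> ob X" for m X
    using that by (simp add: ob_def)
  have ob_eq: "act g m = act h m" if "m \<in> ob X" "g \<in> hom D a a" "h \<in> hom D a a" "bp X \<cdot> g = bp X \<cdot> h" for m X g h
    using that unfolding ob_def by blast
  have r_eq: "r f m = act g m" if f: "f \<in> hom D X Y" and m: "m \<in> ob Y" and g: "g \<in> hom D a a"
    and eq: "f \<cdot> bp X = bp Y \<cdot> g" for f X Y m g
    unfolding r_def by (rule ob_eq[OF m lift(1)[OF f] g]) (use lift(2)[OF f] eq in simp)
  have r_in: "r f m \<in> ob X" if f: "f \<in> hom D X Y" and m: "m \<in> ob Y" for f X Y m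
  proof -
    note l = lift[OF f] and X = bp[OF cat_dom[OF D f]] and Y = bp[OF cat_cod[OF D f]]
    have "act h (act (lift f) m) = act k (act (lift f) m)"
      if h: "h \<in> hom D a a" and k: "k \<in> hom D a a" and hk: "bp X \<cdot> h = bp X \<cdot> k" for h k
    proof -
      have "bp Y \<cdot> (lift f \<cdot> h) = bp Y \<cdot> (lift f \<cdot> k)"
        unfolding cat_assoc[OF D h l(1) Y, symmetric] cat_assoc[OF D k l(1) Y, symmetric] l(2)[symmetric]
          cat_assoc[OF D h X f] cat_assoc[OF D k X f] hk ..
      from ob_eq[OF m cat_comp[OF D h l(1)] cat_comp[OF D k l(1)] this] show ?thesis
        unfolding act_comp[OF l(1) h ob_M[OF m]] act_comp[OF l(1) k ob_M[OF m]] .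
    qed
    then show ?thesis
      using act[OF l(1) ob_M[OF m]] unfolding r_def ob_def by blast
  qed
  have sh: "sheaf_data D K ob r"
    unfolding sheaf_data_def
  proof (intro conjI ballI allI impI)
    show "presheaf_data D ob r"
      unfolding presheaf_data_def
    proof (intro conjI ballI allI impI)
      fix X assume X: "X \<in> Obj D"
      show "small (ob X)"
        by (rule small_subset[OF small]) (auto simp: ob_def)
      fix m assume m: "m \<in> ob X"
      have "r (Id D X) m = act (Id D a) m"
        by (rule r_eq[OF cat_Id[OF D X] m Ida]) (simp add: cat_id_left[OF D bp[OF X]] cat_id_right[OF D bp[OF X]])
      then show "r (Id D X) m = m"
        by (simp add: act_Id[OF ob_M[OF m]])
    next
      fix X Y Z f g m assume f: "f \<in> hom D Y Z" and g: "g \<in> hom D X Y" and m: "m \<in> ob Z"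
      note l = lift[OF f] and k = lift[OF g]
      have "r (f \<cdot> g) m = act (lift f \<cdot> lift g) m"
      proof (rule r_eq[OF cat_comp[OF D g f] m cat_comp[OF D k(1) l(1)]])
        show "f \<cdot> g \<cdot> bp X = bp Z \<cdot> (lift f \<cdot> lift g)"
          unfolding cat_assoc[OF D bp[OF cat_dom[OF D g]] g f] k(2)
            cat_assoc[OF D k(1) bp[OF cat_cod[OF D g]] f, symmetric] l(2)
          by (rule cat_assoc[OF D k(1) l(1) bp[OF cat_cod[OF D f]]])
      qed
      then show "r (f \<cdot> g) m = r g (r f m)"
        by (simp add: act_comp[OF l(1) k(1) ob_M[OF m]] r_def)
    qed (rule r_in)
  next
    fix Y R x assume Y: "Y \<in> Obj D" and R: "R \<in> K Y" and mt: "matching D ob r R x"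
    obtain f where Rf: "R = {f}" and f: "f \<in> hom D (Src D f) Y"
      using R by (auto simp: single_covers_def in_hom)
    define X where "X = Src D f"
    note f = f[folded X_def]
    define m where "m = x f"
    have m: "m \<in> ob X"
      using mt unfolding matching_def Rf m_def X_def by blast
    have mm: "r h m = r k m" if h: "h \<in> hom D Z X" and k: "k \<in> hom D Z X" and "f \<cdot> h = f \<cdot> k" for h k Z
    proof -
      note * = conjunct2[OF mt[unfolded matching_def Rf], THEN bspec, OF singletonI, THEN bspec, OF singletonI]
      show ?thesis
        unfolding m_def
        by (rule *[rule_format]) (use that hom_src[OF f] in \<open>simp_all add: in_hom\<close>)
    qed
    note l = lift[OF f] and bX = bp[OF cat_dom[OF D f]] and bY = bp[OF Y]
    obtain i where i: "i \<in> hom D a a" "i \<cdot> lift f = Id D a" "lift f \<cdot> i = Id D a"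
      using invertible[OF l(1)] by blast
    \<comment> \<open>An endomorphism \<open>h\<close> at the base point of \<open>Y\<close> is
      \<open>f\<close> after the base point of \<open>X\<close> composed with \<open>i\<close> and
      \<open>h\<close>. The matching condition along \<open>f\<close> therefore yields exactly the
      required invariance.\<close>
    have mi: "act i m \<in> ob Y"
    proof -
      have r_bp: "r (bp X \<cdot> (i \<cdot> h)) m = act h (act i m)" if h: "h \<in> hom D a a" for h
      proof -
        note ih = cat_comp[OF D h i(1)]
        have "r (bp X \<cdot> (i \<cdot> h)) m = act (i \<cdot> h) m"
          by (rule r_eq[OF cat_comp[OF D ih bX] m ih]) (simp add: bpa cat_id_right[OF D cat_comp[OF D ih bX]])
        then show ?thesis
          by (simp add: act_comp[OF i(1) h ob_M[OF m]])
      qed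
      have f_bp: "f \<cdot> (bp X \<cdot> (i \<cdot> h)) = bp Y \<cdot> h" if h: "h \<in> hom D a a" for h
      proof -
        note ih = cat_comp[OF D h i(1)]
        show ?thesis
          unfolding cat_assoc[OF D ih bX f, symmetric] l(2) cat_assoc[OF D ih l(1) bY]
            cat_assoc[OF D h i(1) l(1), symmetric] i(3) cat_id_left[OF D h] ..
      qed
      have "act h (act i m) = act k (act i m)"
        if h: "h \<in> hom D a a" and k: "k \<in> hom D a a" and "bp Y \<cdot> h = bp Y \<cdot> k" for h k
        using mm[OF cat_comp[OF D cat_comp[OF D h i(1)] bX] cat_comp[OF D cat_comp[OF D k i(1)] bX]]
          that(3) f_bp[OF h] f_bp[OF k] r_bp[OF h] r_bp[OF k] by simp
      then show ?thesis
        using act[OF i(1) ob_M[OF m]] unfolding ob_def by blast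
    qed
    show "\<exists>!y. y \<in> ob Y \<and> (\<forall>f\<in>R. r f y = x f)"
    proof (rule ex1I[of _ "act i m"])
      have "r f (act i m) = m"
        unfolding r_def act_comp[OF i(1) l(1) ob_M[OF m], symmetric] i(2) by (rule act_Id[OF ob_M[OF m]])
      then show "act i m \<in> ob Y \<and> (\<forall>f\<in>R. r f (act i m) = x f)"
        using mi by (simp add: Rf m_def)
      fix y assume y: "y \<in> ob Y \<and> (\<forall>f\<in>R. r f y = x f)"
      then have yM: "y \<in> M" and ry: "act (lift f) y = m"
        using ob_M by (auto simp: Rf m_def r_def)
      show "y = act i m"
        unfolding ry[symmetric] act_comp[OF l(1) i(1) yM, symmetric] i(3) act_Id[OF yM] ..
    qed
  qed
  have oba: "ob a = M"
    unfolding ob_def bpa using cat_id_left[OF D] by auto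
  show thesis
  proof (rule that[OF is_sheaf_mk_presheaf[OF D K_into sh]])
    show "FObj (mk_presheaf D ob r) a = M"
      by (simp add: oba)
    fix g m assume g: "g \<in> hom D a a" and m: "m \<in> M"
    have "r g m = act g m"
      by (rule r_eq[OF g _ g]) (simp_all add: oba m bpa cat_id_left[OF D g] cat_id_right[OF D g])
    then show "res (mk_presheaf D ob r) g m = act g m"
      using mk_presheaf_simps(2)[OF g, of m ob r] m by (simp add: oba)
  qed
qed

text \<open>The free orbit represents evaluation at \<open>a\<close>, which therefore preserves limits.\<close>

lemma limit_at_torsor:
  fixes G :: "('i, 'j, ('p, 'b, 'v::universe) presheaf, _) fctr" and e :: "'b \<Rightarrow> 'v"
  assumes e: "inj_on e (hom D a a)" "small (e ` hom D a a)"
    and lim: "is_limit J (Sh D K) G n \<kappa>"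
    and p: "\<And>i. i \<in> Obj J \<Longrightarrow> p i \<in> FObj (FObj G i) a"
    and compat: "\<And>i j f. f \<in> hom J i j \<Longrightarrow> app (FArr G f) a (p i) = p j"
  shows "\<exists>!q. q \<in> FObj n a \<and> (\<forall>i\<in>Obj J. app (\<kappa> i) a q = p i)"
proof -
  have G: "is_functor J (Sh D K) G" and cone: "is_cone J (Sh D K) G n \<kappa>"
    and univ: "\<And>m \<mu>. is_cone J (Sh D K) G m \<mu> \<Longrightarrow> \<exists>!h. h \<in> hom (Sh D K) m n \<and> (\<forall>i\<in>Obj J. \<kappa> i \<cdot>\<^bsub>Sh D K\<^esub> h = \<mu> i)"
    using lim by (simp_all add: is_limit_def)
  have n: "is_sheaf D K n" and \<kappa>: "\<And>i. i \<in> Obj J \<Longrightarrow> \<kappa> i \<in> hom (Sh D K) n (FObj G i)"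
    and \<kappa>_nat: "\<And>f. f \<in> Arr J \<Longrightarrow> FArr G f \<cdot>\<^bsub>Sh D K\<^esub> \<kappa> (Src J f) = \<kappa> (Tgt J f)"
    using cone by (simp_all add: is_cone_def)
  have GO: "is_sheaf D K (FObj G i)" if "i \<in> Obj J" for i
    using functor_obj[OF G that] by simp
  note Ida = cat_Id[OF D a]
  \<comment> \<open>The set of endomorphisms of \<open>a\<close>, coded in \<open>'v\<close> so that
    it can be a value of a sheaf, with composition on the right as action.\<close>
  define M where "M = e ` hom D a a"
  define dec where "dec = inv_into (hom D a a) e"
  have dec: "dec (e g) = g" if "g \<in> hom D a a" for g
    unfolding dec_def by (rule inv_into_f_f[OF e(1) that])
  have dec_hom: "dec m \<in> hom D a a" "e (dec m) = m" if "m \<in> M" for m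
    using that dec by (auto simp: M_def)
  have e_M: "e g \<in> M" if "g \<in> hom D a a" for g
    using that by (simp add: M_def)
  obtain T where T: "is_sheaf D K T" "FObj T a = M"
    and T_res: "\<And>g m. g \<in> hom D a a \<Longrightarrow> m \<in> M \<Longrightarrow> res T g m = e (dec m \<cdot> g)"
  proof (rule sheaf_of_action[where M = M and act = "\<lambda>g m. e (dec m \<cdot> g)"])
    show "small M"
      using e(2) by (simp add: M_def)
    show "e (dec m \<cdot> g) \<in> M" if "g \<in> hom D a a" "m \<in> M" for g m
      by (rule e_M[OF cat_comp[OF D that(1) dec_hom(1)[OF that(2)]]])
    show "e (dec m \<cdot> Id D a) = m" if "m \<in> M" for m
      using dec_hom[OF that] cat_id_right[OF D dec_hom(1)[OF that]] by simp
    show "e (dec m \<cdot> (g \<cdot> h)) = e (dec (e (dec m \<cdot> g)) \<cdot> h)"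
      if "g \<in> hom D a a" "h \<in> hom D a a" "m \<in> M" for g h m
      unfolding dec[OF cat_comp[OF D that(1) dec_hom(1)[OF that(3)]]]
      using cat_assoc[OF D that(2,1) dec_hom(1)[OF that(3)]] by simp
  qed (rule that)
  \<comment> \<open>The code of the identity generates the orbit freely: morphisms from
    \<open>T\<close> to \<open>Q\<close> correspond to elements of \<open>Q\<close> at
    \<open>a\<close> by evaluation at \<open>t\<close> (\<open>T_eqI\<close>,
    \<open>T_ex\<close>).\<close>
  define t where "t = e (Id D a)"
  have t: "t \<in> FObj T a" "dec t = Id D a"
    using e_M[OF Ida] dec[OF Ida] by (simp_all add: t_def T)
  have tm: "m = res T (dec m) t" if "m \<in> M" for m
    using T_res[OF dec_hom(1)[OF that], of t] t T(2) dec_hom[OF that] cat_id_left[OF D dec_hom(1)[OF that]] by simp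
  have T_eqI: "\<sigma> = \<tau>" if \<sigma>: "\<sigma> \<in> hom (Sh D K) T Q" and \<tau>: "\<tau> \<in> hom (Sh D K) T Q" and eq: "app \<sigma> a t = app \<tau> a t" for \<sigma> \<tau> Q
  proof (rule Sh_determined[OF \<sigma> \<tau>])
    fix m assume "m \<in> FObj T a"
    then have m: "m \<in> M"
      by (simp add: T)
    have "app \<sigma> a (res T (dec m) t) = app \<tau> a (res T (dec m) t)"
      using app_natural[OF \<sigma> dec_hom(1)[OF m] t(1)] app_natural[OF \<tau> dec_hom(1)[OF m] t(1)] eq by simp
    then show "app \<sigma> a m = app \<tau> a m"
      using tm[OF m] by simp
  qed
  have T_ex: "\<exists>\<tau>\<in>hom (Sh D K) T Q. app \<tau> a t = q" if Q: "is_sheaf D K Q" and q: "q \<in> FObj Q a" for Q q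
  proof (rule Sh_extend[OF T(1) Q, where \<beta> = "\<lambda>m. res Q (dec m) q"])
    show "res Q (dec m) q \<in> FObj Q a" if "m \<in> FObj T a" for m
      using res_in[OF Q dec_hom(1) q] that by (simp add: T)
    show "res Q (dec (res T g m)) q = res Q g (res Q (dec m) q)" if g: "g \<in> hom D a a" and m: "m \<in> FObj T a" for g m
    proof -
      have m: "m \<in> M"
        using m by (simp add: T)
      show ?thesis
        unfolding T_res[OF g m] dec[OF cat_comp[OF D g dec_hom(1)[OF m]]] by (rule res_comp[OF Q dec_hom(1)[OF m] g q])
    qed
    fix \<tau> assume \<tau>: "\<tau> \<in> hom (Sh D K) T Q" "\<And>m. m \<in> FObj T a \<Longrightarrow> app \<tau> a m = res Q (dec m) q"
    have "app \<tau> a t = q"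
      using \<tau>(2)[OF t(1)] res_Id[OF Q a q] by (simp add: t(2))
    then show "\<exists>\<tau>\<in>hom (Sh D K) T Q. app \<tau> a t = q"
      using \<tau>(1) by blast
  qed
  \<comment> \<open>The compatible family \<open>p\<close> becomes a cone with vertex
    \<open>T\<close>, and the mediating arrow evaluated at \<open>t\<close> is the wanted
    element.\<close>
  define \<mu> where "\<mu> i = (SOME \<tau>. \<tau> \<in> hom (Sh D K) T (FObj G i) \<and> app \<tau> a t = p i)" for i
  have \<mu>: "\<mu> i \<in> hom (Sh D K) T (FObj G i)" "app (\<mu> i) a t = p i" if i: "i \<in> Obj J" for i
  proof -
    have "\<exists>\<tau>. \<tau> \<in> hom (Sh D K) T (FObj G i) \<and> app \<tau> a t = p i"
      using T_ex[OF GO[OF i] p[OF i]] by blast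
    from someI_ex[OF this] show "\<mu> i \<in> hom (Sh D K) T (FObj G i)" "app (\<mu> i) a t = p i"
      unfolding \<mu>_def by simp_all
  qed
  have "is_cone J (Sh D K) G T \<mu>"
    unfolding is_cone_def
  proof (intro conjI ballI)
    show "T \<in> Obj (Sh D K)"
      using T(1) by simp
    fix f assume "f \<in> Arr J"
    then have f: "f \<in> hom J (Src J f) (Tgt J f)"
      by (rule arr_hom)
    note i = cat_dom[OF functor_dom[OF G] f] and j = cat_cod[OF functor_dom[OF G] f] and Gf = functor_hom[OF G f]
    show "FArr G f \<cdot>\<^bsub>Sh D K\<^esub> \<mu> (Src J f) = \<mu> (Tgt J f)"
      by (rule T_eqI[OF Sh_comp_hom[OF D \<mu>(1)[OF i] Gf] \<mu>(1)[OF j]])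
        (simp add: app_comp[OF \<mu>(1)[OF i] Gf a t(1)] \<mu>(2)[OF i] \<mu>(2)[OF j] compat[OF f])
  qed (rule \<mu>)
  from univ[OF this] obtain h where h: "h \<in> hom (Sh D K) T n" "\<And>i. i \<in> Obj J \<Longrightarrow> \<kappa> i \<cdot>\<^bsub>Sh D K\<^esub> h = \<mu> i"
    and h_uniq: "\<And>h'. h' \<in> hom (Sh D K) T n \<Longrightarrow> \<forall>i\<in>Obj J. \<kappa> i \<cdot>\<^bsub>Sh D K\<^esub> h' = \<mu> i \<Longrightarrow> h' = h"
    by blast
  show ?thesis
  proof (rule ex1I[of _ "app h a t"])
    show "app h a t \<in> FObj n a \<and> (\<forall>i\<in>Obj J. app (\<kappa> i) a (app h a t) = p i)"
      using app_in[OF h(1) a t(1)] app_comp[OF h(1) \<kappa> a t(1)] h(2) \<mu>(2) by fastforce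
    fix q assume q: "q \<in> FObj n a \<and> (\<forall>i\<in>Obj J. app (\<kappa> i) a q = p i)"
    obtain \<tau> where \<tau>: "\<tau> \<in> hom (Sh D K) T n" "app \<tau> a t = q"
      using T_ex[OF n] q by blast
    have "\<kappa> i \<cdot>\<^bsub>Sh D K\<^esub> \<tau> = \<mu> i" if i: "i \<in> Obj J" for i
      by (rule T_eqI[OF Sh_comp_hom[OF D \<tau>(1) \<kappa>[OF i]] \<mu>(1)[OF i]])
        (use app_comp[OF \<tau>(1) \<kappa>[OF i] a t(1)] \<tau>(2) q i \<mu>(2)[OF i] in simp)
    then have "\<tau> = h"
      by (intro h_uniq[OF \<tau>(1)]) blast
    then show "q = app h a t"
      using \<tau>(2) by simp
  qed
qed

end

section \<open>Morphisms of atomic sites\<close>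

text \<open>The assumption \<open>bij\<close> says that the functor represented by \<open>a\<close>,
  composed with \<open>U\<close>, is represented by \<open>b\<close> with universal element
  \<open>w\<close>; this is how compatibility with the points enters. The function \<open>e\<close>
  codes the endomorphisms of \<open>b\<close>, as the free orbit requires.\<close>

locale atomic_morphism = src: atomic_site D' b + tgt: atomic_site D a
  for D' :: "('q, 'c, 'y) cat_scheme" and b :: 'q and D :: "('p, 'b, 'z) cat_scheme" and a :: 'p +
  fixes U :: "('q, 'c, 'p, 'b) fctr" and w :: 'b and e :: "'c \<Rightarrow> 'v::universe"
  assumes U: "is_functor D' D U" and w: "w \<in> hom D a (FObj U b)"
    and bij: "Y \<in> Obj D' \<Longrightarrow> bij_betw (\<lambda>y. FArr U y \<cdot>\<^bsub>D\<^esub> w) (hom D' b Y) (hom D a (FObj U Y))"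
    and e: "inj_on e (hom D' b b)" "small (e ` hom D' b b)"
begin

abbreviation SD' :: "(('q, 'c, 'v) presheaf, ('q, 'c, 'v) presheaf \<times> ('q \<Rightarrow> 'v set_arr) \<times> ('q, 'c, 'v) presheaf) cat" where
  "SD' \<equiv> Sh D' src.K"

abbreviation SD :: "(('p, 'b, 'v) presheaf, ('p, 'b, 'v) presheaf \<times> ('p \<Rightarrow> 'v set_arr) \<times> ('p, 'b, 'v) presheaf) cat" where
  "SD \<equiv> Sh D tgt.K"

abbreviation R where
  "R \<equiv> precomposition D' U"

text \<open>The homomorphism of groups induced by \<open>w\<close>: the composite of
  \<open>w\<close> and \<open>g\<close> factors through \<open>w\<close> by a unique endomorphism of
  \<open>b\<close>.\<close>

definition bar :: "'b \<Rightarrow> 'c" where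
  "bar g = the_inv_into (hom D' b b) (\<lambda>y. FArr U y \<cdot>\<^bsub>D\<^esub> w) (w \<cdot>\<^bsub>D\<^esub> g)"

lemma w_inj: "y \<in> hom D' b Y \<Longrightarrow> z \<in> hom D' b Y \<Longrightarrow> FArr U y \<cdot>\<^bsub>D\<^esub> w = FArr U z \<cdot>\<^bsub>D\<^esub> w \<Longrightarrow> y = z"
  using inj_onD[OF bij_betw_imp_inj_on[OF bij[OF cat_cod[OF src.D]]]] by blast

lemma w_surj:
  assumes "Y \<in> Obj D'" "x \<in> hom D a (FObj U Y)"
  obtains y where "y \<in> hom D' b Y" "FArr U y \<cdot>\<^bsub>D\<^esub> w = x"
proof -
  have "x \<in> (\<lambda>y. FArr U y \<cdot>\<^bsub>D\<^esub> w) ` hom D' b Y"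
    using bij_betw_imp_surj_on[OF bij[OF assms(1)]] assms(2) by simp
  then show thesis
    using that by blast
qed

lemma bar: assumes g: "g \<in> hom D a a" shows bar_hom: "bar g \<in> hom D' b b" and bar_eq: "FArr U (bar g) \<cdot>\<^bsub>D\<^esub> w = w \<cdot>\<^bsub>D\<^esub> g"
proof -
  note wg = cat_comp[OF tgt.D g w]
  show "bar g \<in> hom D' b b"
    using the_inv_into_into[OF bij_betw_imp_inj_on[OF bij[OF src.a]], of "w \<cdot>\<^bsub>D\<^esub> g"]
      bij_betw_imp_surj_on[OF bij[OF src.a]] wg by (simp add: bar_def)
  show "FArr U (bar g) \<cdot>\<^bsub>D\<^esub> w = w \<cdot>\<^bsub>D\<^esub> g"
    using f_the_inv_into_f_bij_betw[OF bij[OF src.a], of "w \<cdot>\<^bsub>D\<^esub> g"] wg by (simp add: bar_def)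
qed

lemma bar_unique: "g \<in> hom D a a \<Longrightarrow> y \<in> hom D' b b \<Longrightarrow> FArr U y \<cdot>\<^bsub>D\<^esub> w = w \<cdot>\<^bsub>D\<^esub> g \<Longrightarrow> y = bar g"
  using w_inj[OF _ bar_hom] bar_eq by simp

text \<open>Transitivity at \<open>a\<close> expresses the image of \<open>y\<close> after
  \<open>w\<close> as \<open>w\<close> composed with some \<open>g\<close>.\<close>

lemma bar_surj:
  assumes y: "y \<in> hom D' b b"
  obtains g where "g \<in> hom D a a" "y = bar g"
proof -
  obtain g where g: "g \<in> hom D a a" "FArr U y \<cdot>\<^bsub>D\<^esub> w = w \<cdot>\<^bsub>D\<^esub> g"
    using tgt.transitive[OF w cat_comp[OF tgt.D w functor_hom[OF U y]]] by blast
  show thesis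
    by (rule that[OF g(1) bar_unique[OF g(1) y g(2)]])
qed

lemma bar_Id: "bar (Id D a) = Id D' b"
proof -
  have "FArr U (Id D' b) \<cdot>\<^bsub>D\<^esub> w = w \<cdot>\<^bsub>D\<^esub> Id D a"
    by (simp add: functor_id[OF U src.a] cat_id_left[OF tgt.D w] cat_id_right[OF tgt.D w])
  from bar_unique[OF cat_Id[OF tgt.D tgt.a] cat_Id[OF src.D src.a] this] show ?thesis
    by (rule sym)
qed

lemma bar_comp:
  assumes g: "g \<in> hom D a a" and h: "h \<in> hom D a a"
  shows "bar (g \<cdot>\<^bsub>D\<^esub> h) = bar g \<cdot>\<^bsub>D'\<^esub> bar h"
proof -
  note bg = bar_hom[OF g] and bh = bar_hom[OF h]
  note Ug = functor_hom[OF U bg] and Uh = functor_hom[OF U bh]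
  have "FArr U (bar g \<cdot>\<^bsub>D'\<^esub> bar h) \<cdot>\<^bsub>D\<^esub> w = w \<cdot>\<^bsub>D\<^esub> (g \<cdot>\<^bsub>D\<^esub> h)"
    unfolding functor_comp[OF U bh bg] cat_assoc[OF tgt.D w Uh Ug] bar_eq[OF h]
      cat_assoc[OF tgt.D h w Ug, symmetric] bar_eq[OF g] by (rule cat_assoc[OF tgt.D h g w])
  from bar_unique[OF cat_comp[OF tgt.D h g] cat_comp[OF src.D bh bg] this] show ?thesis
    by (rule sym)
qed

lemma bar_collapse: "g \<in> hom D a a \<Longrightarrow> h \<in> hom D a a \<Longrightarrow> w \<cdot>\<^bsub>D\<^esub> g = w \<cdot>\<^bsub>D\<^esub> h \<Longrightarrow> bar g = bar h"
  by (simp add: bar_def)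

lemma U_op: "is_functor (op D') (op D) U"
  by (rule is_functorI[OF category_op[OF src.D] category_op[OF tgt.D]])
    (simp_all add: functor_obj[OF U] functor_id[OF U] functor_hom[OF U] functor_comp[OF U])

text \<open>A family matching along \<open>f\<close> must match along its image under
  \<open>U\<close>. Arrows equalized by that image are precomposed with an arrow from
  \<open>a\<close>; through \<open>w\<close> they then come from arrows out of \<open>b\<close>,
  which \<open>f\<close> equalizes because composition with \<open>w\<close> is injective.\<close>

lemma precomp_sheaf:
  assumes P: "is_sheaf D tgt.K P"
  shows "is_sheaf D' src.K (P \<odot> U)"
proof -
  have PF: "is_functor (op D) SetC P"
    using P by (simp add: is_sheaf_def)
  have uniq: "\<exists>!y. y \<in> FObj (P \<odot> U) c \<and> (\<forall>f\<in>S. set_app (FArr (P \<odot> U) f) y = x f)"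
    if c: "c \<in> Obj D'" and S: "S \<in> src.K c" and m: "matching_family D' (P \<odot> U) S x" for c S x
  proof -
    obtain f where Sf: "S = {f}" and f: "f \<in> hom D' (Src D' f) c"
      using S by (auto simp: single_covers_def in_hom)
    note Uf = functor_hom[OF U f]
    have xf: "x f \<in> FObj P (FObj U (Src D' f))"
      using m unfolding matching_family_def Sf by simp
    have mm: "res P (FArr U h) (x f) = res P (FArr U k) (x f)"
      if "h \<in> hom D' Z (Src D' f)" "k \<in> hom D' Z (Src D' f)" "f \<cdot>\<^bsub>D'\<^esub> h = f \<cdot>\<^bsub>D'\<^esub> k" for h k Z
    proof -
      note * = conjunct2[OF m[unfolded matching_family_def Sf], THEN bspec, OF singletonI, THEN bspec, OF singletonI]
      show ?thesis
        by (rule *[unfolded comp_functor_simps, rule_format]) (use that in \<open>simp_all add: in_hom\<close>)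
    qed
    have eq: "res P h (x f) = res P k (x f)"
      if h: "h \<in> hom D Z (FObj U (Src D' f))" and k: "k \<in> hom D Z (FObj U (Src D' f))"
        and hk: "FArr U f \<cdot>\<^bsub>D\<^esub> h = FArr U f \<cdot>\<^bsub>D\<^esub> k" for h k Z
    proof -
      obtain z where z: "z \<in> hom D a Z"
        using tgt.reach[OF cat_dom[OF tgt.D h]] by blast
      note sf = cat_dom[OF src.D f] and hz = cat_comp[OF tgt.D z h] and kz = cat_comp[OF tgt.D z k]
      obtain y where y: "y \<in> hom D' b (Src D' f)" "FArr U y \<cdot>\<^bsub>D\<^esub> w = h \<cdot>\<^bsub>D\<^esub> z"
        by (rule w_surj[OF sf hz])
      obtain y' where y': "y' \<in> hom D' b (Src D' f)" "FArr U y' \<cdot>\<^bsub>D\<^esub> w = k \<cdot>\<^bsub>D\<^esub> z"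
        by (rule w_surj[OF sf kz])
      note Uy = functor_hom[OF U y(1)] and Uy' = functor_hom[OF U y'(1)]
      have "f \<cdot>\<^bsub>D'\<^esub> y = f \<cdot>\<^bsub>D'\<^esub> y'"
      proof (rule w_inj[OF cat_comp[OF src.D y(1) f] cat_comp[OF src.D y'(1) f]])
        show "FArr U (f \<cdot>\<^bsub>D'\<^esub> y) \<cdot>\<^bsub>D\<^esub> w = FArr U (f \<cdot>\<^bsub>D'\<^esub> y') \<cdot>\<^bsub>D\<^esub> w"
          unfolding functor_comp[OF U y(1) f] functor_comp[OF U y'(1) f] cat_assoc[OF tgt.D w Uy Uf]
            cat_assoc[OF tgt.D w Uy' Uf] y(2) y'(2) cat_assoc[OF tgt.D z h Uf, symmetric]
            cat_assoc[OF tgt.D z k Uf, symmetric] hk ..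
      qed
      then have "res P (FArr U y) (x f) = res P (FArr U y') (x f)"
        by (rule mm[OF y(1) y'(1)])
      then have "res P (h \<cdot>\<^bsub>D\<^esub> z) (x f) = res P (k \<cdot>\<^bsub>D\<^esub> z) (x f)"
        unfolding y(2)[symmetric] y'(2)[symmetric] by (simp add: tgt.res_comp[OF P Uy w xf] tgt.res_comp[OF P Uy' w xf])
      then show ?thesis
        unfolding tgt.res_comp[OF P h z xf] tgt.res_comp[OF P k z xf]
        by (rule tgt.res_inj[OF P z tgt.res_in[OF P h xf] tgt.res_in[OF P k xf]])
    qed
    have "matching D (FObj P) (res P) {FArr U f} (\<lambda>_. x f)"
      unfolding matching_def
    proof (intro conjI ballI impI)
      fix f' g h k
      assume "f' \<in> {FArr U f}" "g \<in> {FArr U f}" "h \<in> Arr D" "k \<in> Arr D" "Tgt D h = Src D f'" "Tgt D k = Src D g"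
        "Src D h = Src D k" "f' \<cdot>\<^bsub>D\<^esub> h = g \<cdot>\<^bsub>D\<^esub> k"
      then show "res P h (x f) = res P k (x f)"
        using hom_src[OF Uf] by (intro eq[of h "Src D h" k]) (auto simp: in_hom)
    qed (use xf hom_src[OF Uf] in simp)
    from sheaf_glue[OF sheaf_dataI[OF P tgt.D] cat_cod[OF tgt.D Uf] tgt.K_single[OF Uf] this]
    show ?thesis
      by (simp add: Sf)
  qed
  show ?thesis
    unfolding is_sheaf_def by (intro conjI ballI allI impI is_functor_comp[OF U_op PF] uniq)
qed

section \<open>Precomposition as a functor between sheaf categories\<close>

lemma R_obj: "FObj R P = P \<odot> U"
  by (simp add: precomposition_def)

lemma R_arr:
  assumes \<tau>: "\<tau> \<in> hom SD P Q"
  shows "FArr R \<tau> = mk_trans D' (P \<odot> U) (\<lambda>c. app \<tau> (FObj U c)) (Q \<odot> U)"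
proof -
  obtain t where t: "\<tau> = (P, t, Q)"
    using \<tau> unfolding hom_Sh by blast
  have "t (FObj U c) = set_arr (FObj (P \<odot> U) c) (app \<tau> (FObj U c)) (FObj (Q \<odot> U) c)" if c: "c \<in> Obj D'" for c
    using SetC_arr_eq[OF app_arr[OF \<tau> functor_obj[OF U c]]] by (simp add: t app_def[abs_def])
  then show ?thesis
    by (auto simp: precomposition_def mk_trans_def t restrict_def)
qed

lemma R_hom:
  assumes \<tau>: "\<tau> \<in> hom SD P Q"
  shows "FArr R \<tau> \<in> hom SD' (P \<odot> U) (Q \<odot> U)"
  unfolding R_arr[OF \<tau>]
  by (rule mk_trans_hom[OF src.D precomp_sheaf[OF Sh_dom[OF \<tau>]] precomp_sheaf[OF Sh_cod[OF \<tau>]]])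
    (simp_all add: app_in[OF \<tau> functor_obj[OF U]] app_natural[OF \<tau> functor_hom[OF U]])

lemma R_app:
  "\<tau> \<in> hom SD P Q \<Longrightarrow> c \<in> Obj D' \<Longrightarrow> p \<in> FObj P (FObj U c) \<Longrightarrow> app (FArr R \<tau>) c p = app \<tau> (FObj U c) p"
  by (simp add: R_arr)

lemma R_functor: "is_functor SD SD' R"
proof (rule is_functorI[OF category_Sh[OF tgt.D] category_Sh[OF src.D]])
  show "FObj R P \<in> Obj SD'" if "P \<in> Obj SD" for P
    using precomp_sheaf that by (simp add: R_obj)
  show "FArr R \<tau> \<in> hom SD' (FObj R P) (FObj R Q)" if "\<tau> \<in> hom SD P Q" for \<tau> P Q
    using R_hom[OF that] by (simp add: R_obj)
  show "FArr R (Id SD P) = Id SD' (FObj R P)" if "P \<in> Obj SD" for P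
  proof -
    have P: "is_sheaf D tgt.K P"
      using that by simp
    note I = Sh_Id_hom[OF tgt.D P]
    show ?thesis
      unfolding R_obj
      by (rule Sh_eqI[OF R_hom[OF I] Sh_Id_hom[OF src.D precomp_sheaf[OF P]]])
        (simp add: R_app[OF I] app_Id functor_obj[OF U])
  qed
  fix P Q S \<tau> \<sigma> assume \<tau>: "\<tau> \<in> hom SD P Q" and \<sigma>: "\<sigma> \<in> hom SD Q S"
  note c = Sh_comp_hom[OF tgt.D \<tau> \<sigma>]
  show "FArr R (\<sigma> \<cdot>\<^bsub>SD\<^esub> \<tau>) = FArr R \<sigma> \<cdot>\<^bsub>SD'\<^esub> FArr R \<tau>"
  proof (rule Sh_eqI[OF R_hom[OF c] Sh_comp_hom[OF src.D R_hom[OF \<tau>] R_hom[OF \<sigma>]]])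
    fix x p assume x: "x \<in> Obj D'" and p: "p \<in> FObj (P \<odot> U) x"
    note Ux = functor_obj[OF U x]
    have p': "p \<in> FObj P (FObj U x)"
      using p by simp
    show "app (FArr R (\<sigma> \<cdot>\<^bsub>SD\<^esub> \<tau>)) x p = app (FArr R \<sigma> \<cdot>\<^bsub>SD'\<^esub> FArr R \<tau>) x p"
      unfolding app_comp[OF R_hom[OF \<tau>] R_hom[OF \<sigma>] x p] R_app[OF c x p'] R_app[OF \<tau> x p']
        R_app[OF \<sigma> x app_in[OF \<tau> Ux p']] by (rule app_comp[OF \<tau> \<sigma> Ux p'])
  qed
qed

text \<open>The inverse image is inflation of actions along \<open>g \<mapsto> bar g\<close>.\<close>

definition infl :: "('q, 'c, 'v) presheaf \<Rightarrow> ('p, 'b, 'v) presheaf" where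
  "infl P = (SOME Q. is_sheaf D tgt.K Q \<and> FObj Q a = FObj P b \<and>
     (\<forall>g\<in>hom D a a. \<forall>m\<in>FObj P b. res Q g m = res P (bar g) m))"

lemma infl:
  assumes P: "is_sheaf D' src.K P"
  shows infl_sheaf: "is_sheaf D tgt.K (infl P)" and infl_obj: "FObj (infl P) a = FObj P b"
    and infl_res: "g \<in> hom D a a \<Longrightarrow> m \<in> FObj P b \<Longrightarrow> res (infl P) g m = res P (bar g) m"
proof -
  have "\<exists>Q. is_sheaf D tgt.K Q \<and> FObj Q a = FObj P b \<and> (\<forall>g\<in>hom D a a. \<forall>m\<in>FObj P b. res Q g m = res P (bar g) m)"
  proof (rule tgt.sheaf_of_action[where M = "FObj P b" and act = "\<lambda>g m. res P (bar g) m"])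
    show "small (FObj P b)"
      by (rule presheaf_small[OF sheaf_presheaf[OF sheaf_dataI[OF P src.D]] src.a])
    show "res P (bar g) m \<in> FObj P b" if "g \<in> hom D a a" "m \<in> FObj P b" for g m
      by (rule src.res_in[OF P bar_hom[OF that(1)] that(2)])
    show "res P (bar (Id D a)) m = m" if "m \<in> FObj P b" for m
      unfolding bar_Id by (rule src.res_Id[OF P src.a that])
    show "res P (bar (g \<cdot>\<^bsub>D\<^esub> h)) m = res P (bar h) (res P (bar g) m)"
      if "g \<in> hom D a a" "h \<in> hom D a a" "m \<in> FObj P b" for g h m
      unfolding bar_comp[OF that(1,2)] by (rule src.res_comp[OF P bar_hom[OF that(1)] bar_hom[OF that(2)] that(3)])
  qed blast
  from someI_ex[OF this, folded infl_def]
  show "is_sheaf D tgt.K (infl P)" "FObj (infl P) a = FObj P b"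
    "g \<in> hom D a a \<Longrightarrow> m \<in> FObj P b \<Longrightarrow> res (infl P) g m = res P (bar g) m"
    by simp_all
qed

text \<open>Endomorphisms identified by \<open>w\<close> have the same image under
  \<open>bar\<close>, so in the inflated sheaf every element over \<open>a\<close> descends along
  \<open>w\<close>. Since \<open>bar\<close> is surjective, these descended elements depend
  equivariantly on the given one.\<close>

lemma unit_exists:
  assumes P: "is_sheaf D' src.K P"
  shows "\<exists>\<eta>. \<eta> \<in> hom SD' P (infl P \<odot> U) \<and> (\<forall>p\<in>FObj P b. res (infl P) w (app \<eta> b p) = p)"
proof -
  note Q = infl_sheaf[OF P]
  have "\<exists>y. y \<in> FObj (infl P) (FObj U b) \<and> res (infl P) w y = p" if p: "p \<in> FObj P b" for p
  proof (rule tgt.amalgamate[OF Q w])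
    show p': "p \<in> FObj (infl P) a"
      using p by (simp add: infl_obj[OF P])
    show "res (infl P) g p = res (infl P) h p" if "g \<in> hom D a a" "h \<in> hom D a a" "w \<cdot>\<^bsub>D\<^esub> g = w \<cdot>\<^bsub>D\<^esub> h" for g h
      using infl_res[OF P that(1) p] infl_res[OF P that(2) p] bar_collapse[OF that] by simp
  qed blast
  then obtain y where y: "\<And>p. p \<in> FObj P b \<Longrightarrow> y p \<in> FObj (infl P) (FObj U b)"
    "\<And>p. p \<in> FObj P b \<Longrightarrow> res (infl P) w (y p) = p"
    by metis
  show ?thesis
  proof (rule src.Sh_extend[OF P precomp_sheaf[OF Q], where \<beta> = y])
    show "y p \<in> FObj (infl P \<odot> U) b" if "p \<in> FObj P b" for p
      using y(1)[OF that] by simp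
    show "y (res P l p) = res (infl P \<odot> U) l (y p)" if l: "l \<in> hom D' b b" and p: "p \<in> FObj P b" for l p
    proof -
      obtain g where g: "g \<in> hom D a a" "l = bar g"
        by (rule bar_surj[OF l])
      note lp = src.res_in[OF P l p] and Ul = functor_hom[OF U l]
      have lw: "FArr U l \<cdot>\<^bsub>D\<^esub> w = w \<cdot>\<^bsub>D\<^esub> g" and gp: "res (infl P) g p = res P l p"
        using bar_eq[OF g(1)] infl_res[OF P g(1) p] by (simp_all add: g(2))
      have "res (infl P) w (res (infl P) (FArr U l) (y p)) = res (infl P) w (y (res P l p))"
        unfolding tgt.res_comp[OF Q Ul w y(1)[OF p], symmetric] lw tgt.res_comp[OF Q w g(1) y(1)[OF p]]
          y(2)[OF p] gp y(2)[OF lp] ..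
      then have "res (infl P) (FArr U l) (y p) = y (res P l p)"
        by (rule tgt.res_inj[OF Q w tgt.res_in[OF Q Ul y(1)[OF p]] y(1)[OF lp]])
      then show ?thesis
        by simp
    qed
    show ?thesis if "\<tau> \<in> hom SD' P (infl P \<odot> U)" "\<And>p. p \<in> FObj P b \<Longrightarrow> app \<tau> b p = y p" for \<tau>
      using that y(2) by (intro exI[of _ \<tau>]) simp
  qed
qed

definition eta :: "('q, 'c, 'v) presheaf \<Rightarrow> ('q, 'c, 'v) presheaf \<times> ('q \<Rightarrow> 'v set_arr) \<times> ('q, 'c, 'v) presheaf" where
  "eta P = (SOME \<eta>. \<eta> \<in> hom SD' P (infl P \<odot> U) \<and> (\<forall>p\<in>FObj P b. res (infl P) w (app \<eta> b p) = p))"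

lemma eta:
  assumes P: "is_sheaf D' src.K P"
  shows eta_hom: "eta P \<in> hom SD' P (infl P \<odot> U)"
    and eta_res: "p \<in> FObj P b \<Longrightarrow> res (infl P) w (app (eta P) b p) = p"
  using someI_ex[OF unit_exists[OF P], folded eta_def] by simp_all

text \<open>Evaluated at \<open>b\<close> and restricted along the injective \<open>w\<close>, the
  transposition equation becomes a formula for \<open>g\<close> on the value at \<open>a\<close>,
  which determines \<open>g\<close>.\<close>

lemma transpose_iff:
  assumes P: "is_sheaf D' src.K P" and g: "g \<in> hom SD (infl P) Q" and f: "f \<in> hom SD' P (Q \<odot> U)"
  shows "FArr R g \<cdot>\<^bsub>SD'\<^esub> eta P = f \<longleftrightarrow> (\<forall>p\<in>FObj P b. app g a p = res Q w (app f b p))"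
proof -
  note Q = Sh_cod[OF g] and \<eta> = eta_hom[OF P] and Ub = functor_obj[OF U src.a]
  note Rg = R_hom[OF g]
  note c = Sh_comp_hom[OF src.D \<eta> Rg]
  have step: "app (FArr R g \<cdot>\<^bsub>SD'\<^esub> eta P) b p = app f b p \<longleftrightarrow> app g a p = res Q w (app f b p)"
    if p: "p \<in> FObj P b" for p
  proof -
    have y: "app (eta P) b p \<in> FObj (infl P) (FObj U b)"
      using app_in[OF \<eta> src.a p] by simp
    have fp: "app f b p \<in> FObj Q (FObj U b)"
      using app_in[OF f src.a p] by simp
    have "app (FArr R g \<cdot>\<^bsub>SD'\<^esub> eta P) b p = app g (FObj U b) (app (eta P) b p)"
      unfolding app_comp[OF \<eta> Rg src.a p] by (rule R_app[OF g src.a y])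
    moreover have "res Q w (app g (FObj U b) (app (eta P) b p)) = app g a p"
      unfolding app_natural[OF g w y, symmetric] eta_res[OF P p] ..
    ultimately show ?thesis
      using tgt.res_inj[OF Q w app_in[OF g Ub y] fp] by auto
  qed
  show ?thesis
  proof
    assume "FArr R g \<cdot>\<^bsub>SD'\<^esub> eta P = f"
    then show "\<forall>p\<in>FObj P b. app g a p = res Q w (app f b p)"
      using step by simp
  next
    assume *: "\<forall>p\<in>FObj P b. app g a p = res Q w (app f b p)"
    show "FArr R g \<cdot>\<^bsub>SD'\<^esub> eta P = f"
      by (rule src.Sh_determined[OF c f]) (use step * in simp)
  qed
qed

text \<open>The formula of \<open>transpose_iff\<close> is equivariant by the defining equation of
  \<open>bar\<close>, so it extends to a morphism of sheaves, and only to one.\<close>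

lemma unit_universal:
  assumes P: "is_sheaf D' src.K P" and Q: "is_sheaf D tgt.K Q" and f: "f \<in> hom SD' P (Q \<odot> U)"
  shows "\<exists>!g. g \<in> hom SD (infl P) Q \<and> FArr R g \<cdot>\<^bsub>SD'\<^esub> eta P = f"
proof -
  note I = infl_sheaf[OF P]
  have fp: "app f b p \<in> FObj Q (FObj U b)" if "p \<in> FObj P b" for p
    using app_in[OF f src.a that] by simp
  obtain g where g: "g \<in> hom SD (infl P) Q" "\<And>p. p \<in> FObj (infl P) a \<Longrightarrow> app g a p = res Q w (app f b p)"
  proof (rule tgt.Sh_extend[OF I Q, where \<beta> = "\<lambda>p. res Q w (app f b p)"])
    show "res Q w (app f b p) \<in> FObj Q a" if "p \<in> FObj (infl P) a" for p
      using tgt.res_in[OF Q w fp] that by (simp add: infl_obj[OF P])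
    show "res Q w (app f b (res (infl P) g p)) = res Q g (res Q w (app f b p))"
      if g: "g \<in> hom D a a" and "p \<in> FObj (infl P) a" for g p
    proof -
      have p: "p \<in> FObj P b"
        using that(2) by (simp add: infl_obj[OF P])
      have "app f b (res P (bar g) p) = res Q (FArr U (bar g)) (app f b p)"
        using app_natural[OF f bar_hom[OF g] p] by simp
      then show ?thesis
        unfolding infl_res[OF P g p]
        by (simp add: tgt.res_comp[OF Q functor_hom[OF U bar_hom[OF g]] w fp[OF p], symmetric] bar_eq[OF g]
            tgt.res_comp[OF Q w g fp[OF p]])
    qed
  qed (rule that)
  show ?thesis
  proof (rule ex1I[of _ g])
    show "g \<in> hom SD (infl P) Q \<and> FArr R g \<cdot>\<^bsub>SD'\<^esub> eta P = f"
      using g transpose_iff[OF P g(1) f] by (simp add: infl_obj[OF P])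
    fix h assume h: "h \<in> hom SD (infl P) Q \<and> FArr R h \<cdot>\<^bsub>SD'\<^esub> eta P = f"
    then have h1: "h \<in> hom SD (infl P) Q"
      by simp
    show "h = g"
      by (rule tgt.Sh_determined[OF h1 g(1)])
        (use h transpose_iff[OF P h1 f] g(2) in \<open>simp add: infl_obj[OF P]\<close>)
  qed
qed

text \<open>The universal units assemble into a left adjoint \<open>L\<close> of precomposition. By
  \<open>L_app\<close> it acts on values at \<open>a\<close> as the given morphism does at
  \<open>b\<close>, so limits are compared on these values.\<close>

lemma is_morphism_of_sites: "morphism_of_sites TYPE('v) D' src.K D tgt.K U"
proof -
  obtain L where adj: "adjunction SD' SD L R" and LO: "\<And>P. FObj L P = infl P"
    and LA: "\<And>f P P'. f \<in> hom SD' P P' \<Longrightarrow> FArr R (FArr L f) \<cdot>\<^bsub>SD'\<^esub> eta P = eta P' \<cdot>\<^bsub>SD'\<^esub> f"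
  proof (rule adjunction_universal[OF R_functor, of infl eta])
    show "infl P \<in> Obj SD" if "P \<in> Obj SD'" for P
      using infl_sheaf that by simp
    show "eta P \<in> hom SD' P (FObj R (infl P))" if "P \<in> Obj SD'" for P
      using eta_hom that by (simp add: R_obj)
    show "\<exists>!g. g \<in> hom SD (infl P) Q \<and> FArr R g \<cdot>\<^bsub>SD'\<^esub> eta P = f"
      if "P \<in> Obj SD'" "Q \<in> Obj SD" "f \<in> hom SD' P (FObj R Q)" for P Q f
      using unit_universal[of P Q f] that by (simp add: R_obj)
  qed (rule that)
  have L: "is_functor SD' SD L"
    using adj by (simp add: adjunction_def)
  have L_app: "app (FArr L f) a p = app f b p" if f: "f \<in> hom SD' P P'" and p: "p \<in> FObj P b" for f P P' p
  proof -
    note P = Sh_dom[OF f] and P' = Sh_cod[OF f] and \<eta>' = eta_hom[OF Sh_cod[OF f]]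
    have Lf: "FArr L f \<in> hom SD (infl P) (infl P')"
      using functor_hom[OF L f] by (simp add: LO)
    have "app (FArr L f) a p = res (infl P') w (app (eta P' \<cdot>\<^bsub>SD'\<^esub> f) b p)"
      using transpose_iff[OF P Lf Sh_comp_hom[OF src.D f \<eta>']] LA[OF f] p by simp
    also have "\<dots> = app f b p"
      unfolding app_comp[OF f \<eta>' src.a p] by (rule eta_res[OF P' app_in[OF f src.a p]])
    finally show ?thesis .
  qed
  have "preserves_finite_limits SD' SD L"
    unfolding preserves_finite_limits_def
  proof (intro allI impI)
    fix J :: "(nat, nat) cat" and G n \<kappa>
    assume lim: "is_limit J SD' G n \<kappa>"
    have G: "is_functor J SD' G" and n: "is_sheaf D' src.K n" and \<kappa>: "\<And>i. i \<in> Obj J \<Longrightarrow> \<kappa> i \<in> hom SD' n (FObj G i)"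
      and \<kappa>_nat: "\<And>f. f \<in> Arr J \<Longrightarrow> FArr G f \<cdot>\<^bsub>SD'\<^esub> \<kappa> (Src J f) = \<kappa> (Tgt J f)"
      using lim by (simp_all add: is_limit_def is_cone_def)
    have GO: "is_sheaf D' src.K (FObj G i)" if "i \<in> Obj J" for i
      using functor_obj[OF G that] by simp
    have L\<kappa>: "FArr L (\<kappa> i) \<in> hom SD (infl n) (infl (FObj G i))" if "i \<in> Obj J" for i
      using functor_hom[OF L \<kappa>[OF that]] by (simp add: LO)
    show "is_limit J SD (L \<odot> G) (FObj L n) (\<lambda>i. FArr L (\<kappa> i))"
      unfolding is_limit_def
    proof (intro conjI allI impI is_functor_comp[OF G L])
      show "is_cone J SD (L \<odot> G) (FObj L n) (\<lambda>i. FArr L (\<kappa> i))"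
        unfolding is_cone_def
      proof (intro conjI ballI)
        show "FObj L n \<in> Obj SD"
          using infl_sheaf[OF n] by (simp add: LO)
        show "FArr L (\<kappa> i) \<in> hom SD (FObj L n) (FObj (L \<odot> G) i)" if "i \<in> Obj J" for i
          using L\<kappa>[OF that] by (simp add: LO)
        fix f assume f: "f \<in> Arr J"
        note f' = arr_hom[OF f]
        show "FArr (L \<odot> G) f \<cdot>\<^bsub>SD\<^esub> FArr L (\<kappa> (Src J f)) = FArr L (\<kappa> (Tgt J f))"
          using functor_comp[OF L \<kappa>[OF cat_dom[OF functor_dom[OF G] f']] functor_hom[OF G f']] \<kappa>_nat[OF f] by simp
      qed
      fix m \<mu> assume cone: "is_cone J SD (L \<odot> G) m \<mu>"
      have m: "is_sheaf D tgt.K m" and \<mu>: "\<And>i. i \<in> Obj J \<Longrightarrow> \<mu> i \<in> hom SD m (infl (FObj G i))"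
        and \<mu>_nat: "\<And>f. f \<in> Arr J \<Longrightarrow> FArr L (FArr G f) \<cdot>\<^bsub>SD\<^esub> \<mu> (Src J f) = \<mu> (Tgt J f)"
        using cone by (simp_all add: is_cone_def LO)
      have \<mu>_in: "app (\<mu> i) a x \<in> FObj (FObj G i) b" if "i \<in> Obj J" "x \<in> FObj m a" for i x
        using app_in[OF \<mu>[OF that(1)] tgt.a that(2)] by (simp add: infl_obj[OF GO[OF that(1)]])
      \<comment> \<open>An element of the vertex over \<open>a\<close> yields a compatible family at
        \<open>b\<close>, and the free orbit over \<open>b\<close> turns it into a unique element of
        the given limit. Uniqueness also makes the resulting map equivariant.\<close>
      have point: "\<exists>!q. q \<in> FObj n b \<and> (\<forall>i\<in>Obj J. app (\<kappa> i) b q = app (\<mu> i) a x)" if x: "x \<in> FObj m a" for x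
      proof (rule src.limit_at_torsor[OF e lim \<mu>_in[OF _ x]])
        fix i j f assume f: "f \<in> hom J i j"
        note i = cat_dom[OF functor_dom[OF G] f] and Gf = functor_hom[OF G f]
        have LGf: "FArr L (FArr G f) \<in> hom SD (infl (FObj G i)) (infl (FObj G j))"
          using functor_hom[OF L Gf] by (simp add: LO)
        have "app (FArr G f) b (app (\<mu> i) a x) = app (FArr L (FArr G f)) a (app (\<mu> i) a x)"
          by (rule L_app[OF Gf \<mu>_in[OF i x], symmetric])
        also have "\<dots> = app (FArr L (FArr G f) \<cdot>\<^bsub>SD\<^esub> \<mu> i) a x"
          by (rule app_comp[OF \<mu>[OF i] LGf tgt.a x, symmetric])
        also have "FArr L (FArr G f) \<cdot>\<^bsub>SD\<^esub> \<mu> i = \<mu> j"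
          using \<mu>_nat[OF hom_arr[OF f]] by (simp add: hom_src[OF f] hom_tgt[OF f])
        finally show "app (FArr G f) b (app (\<mu> i) a x) = app (\<mu> j) a x" .
      qed
      define \<beta> where "\<beta> x = (THE q. q \<in> FObj n b \<and> (\<forall>i\<in>Obj J. app (\<kappa> i) b q = app (\<mu> i) a x))" for x
      have \<beta>: "\<beta> x \<in> FObj n b" "\<And>i. i \<in> Obj J \<Longrightarrow> app (\<kappa> i) b (\<beta> x) = app (\<mu> i) a x" if "x \<in> FObj m a" for x
        using theI'[OF point[OF that]] unfolding \<beta>_def by simp_all
      have \<beta>_unique: "q = \<beta> x" if "x \<in> FObj m a" "q \<in> FObj n b" "\<And>i. i \<in> Obj J \<Longrightarrow> app (\<kappa> i) b q = app (\<mu> i) a x" for x q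
        unfolding \<beta>_def by (rule the1_equality[OF point[OF that(1)], symmetric]) (use that in simp)
      obtain h where h: "h \<in> hom SD m (infl n)" "\<And>x. x \<in> FObj m a \<Longrightarrow> app h a x = \<beta> x"
      proof (rule tgt.Sh_extend[OF m infl_sheaf[OF n], where \<beta> = \<beta>])
        show "\<beta> x \<in> FObj (infl n) a" if "x \<in> FObj m a" for x
          using \<beta>(1)[OF that] by (simp add: infl_obj[OF n])
        show "\<beta> (res m g x) = res (infl n) g (\<beta> x)" if g: "g \<in> hom D a a" and x: "x \<in> FObj m a" for g x
        proof -
          note bx = \<beta>(1)[OF x] and bg = bar_hom[OF g]
          have "res n (bar g) (\<beta> x) = \<beta> (res m g x)"
          proof (rule \<beta>_unique[OF tgt.res_in[OF m g x] src.res_in[OF n bg bx]])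
            fix i assume i: "i \<in> Obj J"
            show "app (\<kappa> i) b (res n (bar g) (\<beta> x)) = app (\<mu> i) a (res m g x)"
              unfolding app_natural[OF \<kappa>[OF i] bg bx] \<beta>(2)[OF x i] app_natural[OF \<mu>[OF i] g x]
              by (rule infl_res[OF GO[OF i] g \<mu>_in[OF i x], symmetric])
          qed
          then show ?thesis
            by (simp add: infl_res[OF n g bx])
        qed
      qed (rule that)
      have iff: "(\<forall>i\<in>Obj J. FArr L (\<kappa> i) \<cdot>\<^bsub>SD\<^esub> k = \<mu> i) \<longleftrightarrow> (\<forall>x\<in>FObj m a. app k a x = \<beta> x)"
        if k: "k \<in> hom SD m (infl n)" for k
      proof -
        have kx: "app k a x \<in> FObj n b" if "x \<in> FObj m a" for x
          using app_in[OF k tgt.a that] by (simp add: infl_obj[OF n])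
        have Lk: "app (FArr L (\<kappa> i) \<cdot>\<^bsub>SD\<^esub> k) a x = app (\<kappa> i) b (app k a x)" if "i \<in> Obj J" "x \<in> FObj m a" for i x
          unfolding app_comp[OF k L\<kappa>[OF that(1)] tgt.a that(2)] by (rule L_app[OF \<kappa>[OF that(1)] kx[OF that(2)]])
        show ?thesis
        proof
          assume "\<forall>i\<in>Obj J. FArr L (\<kappa> i) \<cdot>\<^bsub>SD\<^esub> k = \<mu> i"
          then show "\<forall>x\<in>FObj m a. app k a x = \<beta> x"
            using \<beta>_unique[OF _ kx] Lk by simp
        next
          assume *: "\<forall>x\<in>FObj m a. app k a x = \<beta> x"
          show "\<forall>i\<in>Obj J. FArr L (\<kappa> i) \<cdot>\<^bsub>SD\<^esub> k = \<mu> i"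
          proof
            fix i assume i: "i \<in> Obj J"
            show "FArr L (\<kappa> i) \<cdot>\<^bsub>SD\<^esub> k = \<mu> i"
              by (rule tgt.Sh_determined[OF Sh_comp_hom[OF tgt.D k L\<kappa>[OF i]] \<mu>[OF i]])
                (use Lk[OF i] * \<beta>(2) i in simp)
          qed
        qed
      qed
      show "\<exists>!h. h \<in> hom SD m (FObj L n) \<and> (\<forall>i\<in>Obj J. FArr L (\<kappa> i) \<cdot>\<^bsub>SD\<^esub> h = \<mu> i)"
        unfolding LO
      proof (rule ex1I[of _ h])
        show "h \<in> hom SD m (infl n) \<and> (\<forall>i\<in>Obj J. FArr L (\<kappa> i) \<cdot>\<^bsub>SD\<^esub> h = \<mu> i)"
          using h iff[OF h(1)] by simp
        fix k assume k: "k \<in> hom SD m (infl n) \<and> (\<forall>i\<in>Obj J. FArr L (\<kappa> i) \<cdot>\<^bsub>SD\<^esub> k = \<mu> i)"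
        then have k1: "k \<in> hom SD m (infl n)"
          by simp
        show "k = h"
          by (rule tgt.Sh_determined[OF k1 h(1)]) (use k iff[OF k1] h(2) in simp)
      qed
    qed
  qed
  then show ?thesis
    unfolding morphism_of_sites_def geometric_morphism_def using U adj by blast
qed

end

section \<open>The sites \<open>\<D>\<^sub>A\<close> are atomic\<close>

context topos_representation
begin

lemma DA_pnt:
  assumes "A \<in> Obj E" "d \<in> DA_obj E A" "s \<in> fst (snd d)"
  shows "pnt E A d s \<in> hom E A (fst d)"
  using pnt_hom[of A "fst d" "fst (snd d)" "snd (snd d)" s] assms by simp

text \<open>Both group-theoretic conditions hold for \<open>A\<close> in \<open>E\<close> and are
  lifted to the torsor by full faithfulness.\<close>

lemma DA_atomic_site:
  assumes G: "galois_object E A" and a: "(A, S, \<sigma>) \<in> DA_obj E A"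
  shows "atomic_site (DA E A) (A, S, \<sigma>)"
proof
  note A = galois_connected[OF G] and AO = galois_obj[OF G]
  show "category (DA E A)"
    by (rule category_DA[OF A])
  show "(A, S, \<sigma>) \<in> Obj (DA E A)"
    using a by simp
  show "hom (DA E A) (A, S, \<sigma>) d \<noteq> {}" if "d \<in> Obj (DA E A)" for d
  proof -
    have d: "d \<in> DA_obj E A"
      using that by simp
    then obtain s where "s \<in> fst (snd d)"
      by (auto simp: DA_obj_def)
    from DA_pnt[OF AO d this] have "pnt E A d s \<in> hom E (fst (A, S, \<sigma>)) (fst d)"
      by simp
    then show ?thesis
      by (rule DA_full[OF A a d]) blast
  qed
  show "\<exists>g\<in>hom (DA E A) (A, S, \<sigma>) (A, S, \<sigma>). y = x \<cdot>\<^bsub>DA E A\<^esub> g"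
    if x: "x \<in> hom (DA E A) (A, S, \<sigma>) d" and y: "y \<in> hom (DA E A) (A, S, \<sigma>) d" for d x y
  proof -
    have d: "(fst d, fst (snd d), snd (snd d)) \<in> DA_obj E A"
      using cat_cod[OF category_DA[OF A] x] by simp
    have "\<exists>g\<in>hom E A A. fst (snd y) = fst (snd x) \<cdot> g"
      using galois_transitive[OF G d] qA_hom[OF AO x] qA_hom[OF AO y] by simp
    then obtain g where g: "g \<in> hom E (fst (A, S, \<sigma>)) (fst (A, S, \<sigma>))" "fst (snd y) = fst (snd x) \<cdot> g"
      by auto
    obtain k where k: "k \<in> hom (DA E A) (A, S, \<sigma>) (A, S, \<sigma>)" "fst (snd k) = g"
      by (rule DA_full[OF A a a g(1)])
    have "y = x \<cdot>\<^bsub>DA E A\<^esub> k"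
      by (rule DA_eqI[OF A y DA_comp_hom[OF AO k(1) x]]) (simp add: g(2) k(2))
    then show ?thesis
      using k(1) by blast
  qed
  show "\<exists>h\<in>hom (DA E A) (A, S, \<sigma>) (A, S, \<sigma>). h \<cdot>\<^bsub>DA E A\<^esub> g = Id (DA E A) (A, S, \<sigma>) \<and>
      g \<cdot>\<^bsub>DA E A\<^esub> h = Id (DA E A) (A, S, \<sigma>)"
    if g: "g \<in> hom (DA E A) (A, S, \<sigma>) (A, S, \<sigma>)" for g
  proof -
    have "fst (snd g) \<in> hom E A A"
      using qA_hom[OF AO g] by simp
    then obtain k where k: "k \<in> hom E A A" "k \<cdot> fst (snd g) = Id E A" "fst (snd g) \<cdot> k = Id E A"
      by (rule galois_endo_inverse[OF G])
    obtain h where h: "h \<in> hom (DA E A) (A, S, \<sigma>) (A, S, \<sigma>)" "fst (snd h) = k"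
      by (rule DA_full[OF A a a, of k]) (use k(1) in \<open>auto intro: that\<close>)
    note I = DA_Id_hom[OF AO a]
    have "h \<cdot>\<^bsub>DA E A\<^esub> g = Id (DA E A) (A, S, \<sigma>)"
      by (rule DA_eqI[OF A DA_comp_hom[OF AO g h(1)] I]) (simp add: h(2) k(2) DA_Id)
    moreover have "g \<cdot>\<^bsub>DA E A\<^esub> h = Id (DA E A) (A, S, \<sigma>)"
      by (rule DA_eqI[OF A DA_comp_hom[OF AO h(1) g] I]) (simp add: h(2) k(3) DA_Id)
    ultimately show ?thesis
      using h(1) by blast
  qed
qed

lemma ustar_morphism_of_sites:
  assumes GA: "galois_object E A" and GB: "galois_object E B" and u: "u \<in> hom E A B"
  shows "morphism_of_sites TYPE('v) (DA E B) (single_covers (DA E B)) (DA E A) (single_covers (DA E A)) (ustar E u)"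
proof -
  note A = galois_connected[OF GA] and AO = galois_obj[OF GA]
  note B = galois_connected[OF GB] and BO = galois_obj[OF GB]
  obtain \<sigma> where a: "(A, Aut E A, \<sigma>) \<in> DA_obj E A"
    by (rule galois_torsor[OF GA]) (rule that)
  obtain \<tau> where b: "(B, Aut E B, \<tau>) \<in> DA_obj E B"
    by (rule galois_torsor[OF GB]) (rule that)
  define dA where "dA = (A, Aut E A, \<sigma>)"
  define dB where "dB = (B, Aut E B, \<tau>)"
  note a = a[folded dA_def] and b = b[folded dB_def]
  have fst_d: "fst dA = A" "fst dB = B"
    by (simp_all add: dA_def dB_def)
  have "u \<in> hom E (fst dA) (fst (ustar_obj E u dB))"
    using u by (simp add: fst_d)
  then obtain w where w: "w \<in> hom (DA E A) dA (ustar_obj E u dB)" "fst (snd w) = u"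
    by (rule DA_full[OF A a ustar_obj_DA[OF u b]])
  \<comment> \<open>Both hom-sets are named by the same set of elements, and passing from one naming
    to the other is precomposition with \<open>u\<close> by \<open>pnt_ustar\<close>.\<close>
  have bij_u: "bij_betw (\<lambda>y. y \<cdot> u) (hom E B (fst d)) (hom E A (fst d))" if d: "d \<in> DA_obj E B" for d
  proof -
    note ud = ustar_obj_DA[OF u d]
    have d': "(fst d, fst (snd d), snd (snd d)) \<in> DA_obj E B"
      and ud': "(fst d, fst (snd d), snd (snd (ustar_obj E u d))) \<in> DA_obj E A"
      using d ud by (simp_all add: ustar_obj_def case_prod_beta)
    have pB: "bij_betw (pnt E B d) (fst (snd d)) (hom E B (fst d))"
      using pnt_bij[OF B d'] by simp
    have "(fst d, fst (snd d), snd (snd (ustar_obj E u d))) = ustar_obj E u d"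
      by (simp add: ustar_obj_def case_prod_beta)
    then have "bij_betw (pnt E A (ustar_obj E u d)) (fst (snd d)) (hom E A (fst d))"
      using pnt_bij[OF A ud'] by simp
    then have "bij_betw ((\<lambda>y. y \<cdot> u) \<circ> pnt E B d) (fst (snd d)) (hom E A (fst d))"
      by (subst bij_betw_cong[of _ _ "pnt E A (ustar_obj E u d)"]) (simp_all add: pnt_ustar[OF u d])
    then show ?thesis
      using bij_betw_comp_iff[OF pB] by blast
  qed
  \<comment> \<open>Arrows of D_B are tuples, not elements of \<open>'v\<close>; their component in
    \<open>E\<close> is an injective code with values in the small set
    \<open>hom E B B\<close>.\<close>
  interpret atomic_morphism "DA E B" dB "DA E A" dA "ustar E u" w "\<lambda>x. fst (snd x)"
  proof (intro atomic_morphism.intro atomic_morphism_axioms.intro)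
    show "atomic_site (DA E B) dB" "atomic_site (DA E A) dA"
      using DA_atomic_site[OF GB] DA_atomic_site[OF GA] a b by (simp_all add: dA_def dB_def)
    show "is_functor (DA E B) (DA E A) (ustar E u)"
      by (rule ustar_functor[OF A B u])
    show "w \<in> hom (DA E A) dA (FObj (ustar E u) dB)"
      using w(1) by simp
    show "bij_betw (\<lambda>y. FArr (ustar E u) y \<cdot>\<^bsub>DA E A\<^esub> w) (hom (DA E B) dB d) (hom (DA E A) dA (FObj (ustar E u) d))"
      if "d \<in> Obj (DA E B)" for d
    proof -
      have d: "d \<in> DA_obj E B"
        using that by simp
      note ud = ustar_obj_DA[OF u d]
      have q: "fst (snd (FArr (ustar E u) y \<cdot>\<^bsub>DA E A\<^esub> w)) = fst (snd y) \<cdot> u" for y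
        by (simp add: w(2))
      have h: "FArr (ustar E u) y \<cdot>\<^bsub>DA E A\<^esub> w \<in> hom (DA E A) dA (ustar_obj E u d)" if "y \<in> hom (DA E B) dB d" for y
        by (rule DA_comp_hom[OF AO w(1) ustar_arr_hom[OF u that]])
      have qB: "fst (snd y) \<in> hom E B (fst d)" if "y \<in> hom (DA E B) dB d" for y
        using qA_hom[OF BO that] by (simp add: fst_d)
      show ?thesis
        unfolding bij_betw_def ustar_simps(1)
      proof
        show "inj_on (\<lambda>y. FArr (ustar E u) y \<cdot>\<^bsub>DA E A\<^esub> w) (hom (DA E B) dB d)"
        proof (rule inj_onI)
          fix y z assume y: "y \<in> hom (DA E B) dB d" and z: "z \<in> hom (DA E B) dB d"
            and eq: "FArr (ustar E u) y \<cdot>\<^bsub>DA E A\<^esub> w = FArr (ustar E u) z \<cdot>\<^bsub>DA E A\<^esub> w"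
          have "fst (snd y) \<cdot> u = fst (snd z) \<cdot> u"
            using q[of y] q[of z] eq by metis
          then have "fst (snd y) = fst (snd z)"
            using inj_onD[OF bij_betw_imp_inj_on[OF bij_u[OF d]] _ qB[OF y] qB[OF z]] by simp
          then show "y = z"
            by (rule DA_eqI[OF B y z])
        qed
        show "(\<lambda>y. FArr (ustar E u) y \<cdot>\<^bsub>DA E A\<^esub> w) ` hom (DA E B) dB d = hom (DA E A) dA (ustar_obj E u d)"
        proof
          show "(\<lambda>y. FArr (ustar E u) y \<cdot>\<^bsub>DA E A\<^esub> w) ` hom (DA E B) dB d \<subseteq> hom (DA E A) dA (ustar_obj E u d)"
            using h by blast
          show "hom (DA E A) dA (ustar_obj E u d) \<subseteq> (\<lambda>y. FArr (ustar E u) y \<cdot>\<^bsub>DA E A\<^esub> w) ` hom (DA E B) dB d"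
          proof
            fix x assume x: "x \<in> hom (DA E A) dA (ustar_obj E u d)"
            have "fst (snd x) \<in> (\<lambda>y. y \<cdot> u) ` hom E B (fst d)"
              using bij_betw_imp_surj_on[OF bij_u[OF d]] qA_hom[OF AO x] by (simp add: fst_d)
            then obtain f where f: "f \<in> hom E B (fst d)" "fst (snd x) = f \<cdot> u"
              by blast
            have "f \<in> hom E (fst dB) (fst d)"
              using f(1) by (simp add: fst_d)
            then obtain y where y: "y \<in> hom (DA E B) dB d" "fst (snd y) = f"
              by (rule DA_full[OF B b d])
            have "x = FArr (ustar E u) y \<cdot>\<^bsub>DA E A\<^esub> w"
              by (rule DA_eqI[OF A x h[OF y(1)]]) (simp only: q y(2) f(2))
            then show "x \<in> (\<lambda>y. FArr (ustar E u) y \<cdot>\<^bsub>DA E A\<^esub> w) ` hom (DA E B) dB d"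
              using y(1) by blast
          qed
        qed
      qed
    qed
    show "inj_on (\<lambda>x. fst (snd x)) (hom (DA E B) dB dB)"
      by (rule inj_onI) (rule DA_eqI[OF B])
    show "small ((\<lambda>x. fst (snd x)) ` hom (DA E B) dB dB)"
    proof (rule small_subset[OF small_hom[OF BO BO]])
      show "(\<lambda>x. fst (snd x)) ` hom (DA E B) dB dB \<subseteq> hom E B B"
        using qA_hom[OF BO, of _ dB dB] by (auto simp: fst_d)
    qed
  qed
  show ?thesis
    by (rule is_morphism_of_sites)
qed

end

theorem proposition3p4:
  fixes E :: "('o, 'v::universe) topos"
  assumes "set_topos E" "connected_topos E" "locally_connected_topos E"
  shows
    "(\<forall>A. galois_object E A \<longrightarrow>
        point_of_site (DA E A) (single_covers (DA E A)) pA \<and>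
        is_functor (DA E A) (CA E A) qA \<and>
        is_functor (CA E A) SetC (hom_functor (CA E A) A) \<and>
        naturally_isomorphic (DA E A) SetC pA (hom_functor (CA E A) A \<odot> qA))
     \<and>
     (\<forall>A B. galois_object E A \<longrightarrow> galois_object E B \<longrightarrow> (\<forall>u\<in>hom E A B.
        morphism_of_sites TYPE('v) (DA E B) (single_covers (DA E B)) (DA E A) (single_covers (DA E A))
          (ustar E u) \<and>
        functor_eq (DA E B) (pA \<odot> ustar E u) pA))
     \<and>
     (\<exists>\<theta> :: 'v \<Rightarrow> 'v \<Rightarrow> ('o, 'v) dobj \<Rightarrow> ('o, 'v) darr.
        (\<forall>A B. galois_object E A \<longrightarrow> galois_object E B \<longrightarrow>
          (\<forall>u\<in>hom E A B. \<forall>v\<in>hom E A B.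
             nat_trans (DA E B) (DA E A) (ustar E u) (ustar E v) (\<theta> v u)) \<and>
          (\<forall>u\<in>hom E A B. \<forall>d\<in>Obj (DA E B).
             \<theta> u u d = Id (DA E A) (FObj (ustar E u) d)) \<and>
          (\<forall>u\<in>hom E A B. \<forall>v\<in>hom E A B. \<forall>w\<in>hom E A B. \<forall>d\<in>Obj (DA E B).
             vert_comp (DA E A) (\<theta> w v) (\<theta> v u) d = \<theta> w u d) \<and>
          (\<forall>u\<in>hom E A B. \<forall>v\<in>hom E A B. \<forall>d\<in>Obj (DA E B).
             vert_comp (DA E A) (\<theta> u v) (\<theta> v u) d = Id (DA E A) (FObj (ustar E u) d) \<and>
             vert_comp (DA E A) (\<theta> v u) (\<theta> u v) d = Id (DA E A) (FObj (ustar E v) d))) \<and>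
        (\<forall>A B C. galois_object E A \<longrightarrow> galois_object E B \<longrightarrow> galois_object E C \<longrightarrow>
          (\<forall>u\<in>hom E A B. \<forall>v\<in>hom E A B. \<forall>r\<in>hom E B C. \<forall>s\<in>hom E B C.
             functor_eq (DA E C) (ustar E u \<odot> ustar E r) (ustar E (r \<cdot>\<^bsub>E\<^esub> u)) \<and>
             functor_eq (DA E C) (ustar E v \<odot> ustar E s) (ustar E (s \<cdot>\<^bsub>E\<^esub> v)) \<and>
             (\<forall>d\<in>Obj (DA E C).
                horiz_comp (DA E A) (ustar E u) (ustar E s) (\<theta> v u) (\<theta> s r) d
                  = \<theta> (s \<cdot>\<^bsub>E\<^esub> v) (r \<cdot>\<^bsub>E\<^esub> u) d))) \<and>
        (\<forall>A B. galois_object E A \<longrightarrow> galois_object E B \<longrightarrow>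
          (\<forall>u\<in>hom E A B. \<forall>v\<in>hom E A B.
             is_functor (CA E B) (CA E A) id_functor \<and>
             functor_eq (DA E B) (qA \<odot> ustar E u) (id_functor \<odot> qA) \<and>
             functor_eq (DA E B) (qA \<odot> ustar E v) (id_functor \<odot> qA) \<and>
             (\<forall>d\<in>Obj (DA E B). FArr qA (\<theta> v u d) = Id (CA E A) (FObj qA (FObj (ustar E u) d))) \<and>
             (\<forall>\<tau>. nat_trans (DA E B) (DA E A) (ustar E u) (ustar E v) \<tau> \<longrightarrow>
                (\<forall>d\<in>Obj (DA E B). FArr qA (\<tau> d) = Id (CA E A) (FObj qA (FObj (ustar E u) d))) \<longrightarrow>
                (\<forall>d\<in>Obj (DA E B). \<tau> d = \<theta> v u d)))))"
proof -
  have "grothendieck_topos E"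
    using assms(1) by (simp add: set_topos_def)
  then obtain S K F where rep: "sheaf_representation E S K F"
    by (rule sheaf_representation_exists)
  interpret topos_representation E S K F
    by (intro topos_representation.intro topos_representation_axioms.intro rep assms(1))
  note con = galois_connected
  show ?thesis
  proof (intro conjI exI[of _ theta] allI impI ballI)
    fix A assume G: "galois_object E A"
    show "point_of_site (DA E A) (single_covers (DA E A)) pA"
      by (rule pA_point[OF G])
    show "is_functor (DA E A) (CA E A) qA"
      by (rule qA_functor[OF con[OF G]])
    show "is_functor (CA E A) SetC (hom_functor (CA E A) A)"
      by (rule hom_functor_functor[OF category_CA locally_small_CA CA_self[OF con[OF G]]])
    show "naturally_isomorphic (DA E A) SetC pA (hom_functor (CA E A) A \<odot> qA)"
      by (rule pA_representable[OF con[OF G]])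
  next
    fix A B u v assume G: "galois_object E A" "galois_object E B" and u: "u \<in> hom E A B"
    show "morphism_of_sites TYPE('v) (DA E B) (single_covers (DA E B)) (DA E A) (single_covers (DA E A)) (ustar E u)"
      by (rule ustar_morphism_of_sites[OF G u])
    show "functor_eq (DA E B) (pA \<odot> ustar E u) pA"
      by (simp add: functor_eq_def)
    show "theta u u d = Id (DA E A) (FObj (ustar E u) d)" if "d \<in> Obj (DA E B)" for d
      using theta_refl[OF con[OF G(1)] u] that by simp
    show "is_functor (CA E B) (CA E A) id_functor"
      by (rule CA_inclusion[OF u])
    show "functor_eq (DA E B) (qA \<odot> ustar E u) (id_functor \<odot> qA)"
      by (simp add: functor_eq_def)
    assume v: "v \<in> hom E A B"
    show "nat_trans (DA E B) (DA E A) (ustar E u) (ustar E v) (theta v u)"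
      by (rule theta_natural[OF con[OF G(1)] con[OF G(2)] u v])
    show "vert_comp (DA E A) (theta w v) (theta v u) d = theta w u d"
      if "w \<in> hom E A B" "d \<in> Obj (DA E B)" for w d
      using theta_comp[OF con[OF G(1)] u v that(1)] that(2) by (simp add: vert_comp_def)
    show "vert_comp (DA E A) (theta u v) (theta v u) d = Id (DA E A) (FObj (ustar E u) d)"
      if "d \<in> Obj (DA E B)" for d
      using theta_comp[OF con[OF G(1)] u v u] theta_refl[OF con[OF G(1)] u] that by (simp add: vert_comp_def)
    show "vert_comp (DA E A) (theta v u) (theta u v) d = Id (DA E A) (FObj (ustar E v) d)"
      if "d \<in> Obj (DA E B)" for d
      using theta_comp[OF con[OF G(1)] v u v] theta_refl[OF con[OF G(1)] v] that by (simp add: vert_comp_def)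
    show "functor_eq (DA E B) (qA \<odot> ustar E v) (id_functor \<odot> qA)"
      by (simp add: functor_eq_def)
    show "FArr qA (theta v u d) = Id (CA E A) (FObj qA (FObj (ustar E u) d))" if "d \<in> Obj (DA E B)" for d
      using theta_arr[OF con[OF G(1)] u v] that by simp
    show "\<tau> d = theta v u d"
      if \<tau>: "nat_trans (DA E B) (DA E A) (ustar E u) (ustar E v) \<tau>"
        "\<forall>d\<in>Obj (DA E B). FArr qA (\<tau> d) = Id (CA E A) (FObj qA (FObj (ustar E u) d))"
        and d: "d \<in> Obj (DA E B)" for \<tau> d
      by (rule theta_unique[OF con[OF G(1)] u v]) (use d \<tau>(2) nat_trans_hom[OF \<tau>(1) d] in simp_all)
  next
    fix A B C u v r s
    assume G: "galois_object E A" "galois_object E B" "galois_object E C"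
      and uv: "u \<in> hom E A B" "v \<in> hom E A B" and rs: "r \<in> hom E B C" "s \<in> hom E B C"
    show "functor_eq (DA E C) (ustar E u \<odot> ustar E r) (ustar E (r \<cdot>\<^bsub>E\<^esub> u))"
      by (rule ustar_comp[OF con[OF G(3)] uv(1) rs(1)])
    show "functor_eq (DA E C) (ustar E v \<odot> ustar E s) (ustar E (s \<cdot>\<^bsub>E\<^esub> v))"
      by (rule ustar_comp[OF con[OF G(3)] uv(2) rs(2)])
    show "horiz_comp (DA E A) (ustar E u) (ustar E s) (theta v u) (theta s r) d = theta (s \<cdot>\<^bsub>E\<^esub> v) (r \<cdot>\<^bsub>E\<^esub> u) d"
      if "d \<in> Obj (DA E C)" for d
      using theta_horizontal[OF con[OF G(1)] con[OF G(2)] uv rs] that by simp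
  qed
qed

end
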